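(* Let $\mathbb{F}$ be an algebraically closed field of characteristic zero and let $\Gamma_4$ be the fine grading, with universal group $G_4=\mathbb{Z}_3^2\times\mathbb{Z}^2$, on the Lie algebra $\mathcal{T}(\mathcal{C},\mathcal{J})$ of type $E_6$ described in the context. Identify the Weyl group $\mathcal{W}(\Gamma_4)$ with a subgroup of $\mathrm{Aut}(G_4)$, and elements of $\mathrm{Aut}(G_4)$ with their matrices (by columns, in $2+2$ blocks) relative to the canonical basis of $G_4$. Then $\mathcal{W}(\Gamma_4)$ coincides with $$\left\{\begin{pmatrix} A & \begin{matrix} a & a \\ b & b \end{matrix} \\ 0 & B \end{pmatrix}\;\middle|\; A\in\mathrm{GL}_2(\mathbb{Z}_3),\ B\in\langle\sigma,\tau\rangle,\ a,b\in\mathbb{Z}_3\right\},$$ where $$\sigma=\begin{pmatrix} 1 & -1 \\ 1 & 0 \end{pmatrix}\quad\text{and}\quad\tau=\begin{pmatrix} 1 & -1 \\ 0 & -1 \end{pmatrix}$$ generate the dihedral group $D_6$ (of order $12$). Thus $\mathcal{W}(\Gamma_4)\cong\mathbb{Z}_3^2\rtimes(\mathrm{GL}_2(\mathbb{Z}_3)\times D_6)$.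
   Context: **Gradings.** For an abelian group $G$, a $G$-grading on an algebra $A$ is a decomposition $\Gamma: A=\bigoplus_{g\in G}A_g$ with $A_gA_h\subseteq A_{g+h}$; $\mathrm{Supp}\,\Gamma=\{g:A_g\ne0\}$. It is fine if it has no proper refinement (a decomposition graded by some abelian group whose components are contained in components of $\Gamma$, some properly). The universal group of $\Gamma$ is the abelian group $G$ realizing $\Gamma$ such that for any other realization over a group $H$ there is a unique homomorphism $G\to H$ restricting to the identity on the support. $\mathrm{Aut}(\Gamma)$ is the group of algebra automorphisms permuting the components, $\mathrm{Stab}(\Gamma)$ the subgroup fixing every component, and $\mathcal{W}(\Gamma)=\mathrm{Aut}(\Gamma)/\mathrm{Stab}(\Gamma)$. Each $f\in\mathrm{Aut}(\Gamma)$ induces $\alpha_f\in\mathrm{Aut}(G)$ ($G$ universal) with $f(A_s)=A_{\alpha_f(s)}$ for $s\in\mathrm{Supp}\,\Gamma$, which identifies $\mathcal{W}(\Gamma)$ with a subgroup of $\mathrm{Aut}(G)$. For $G=\mathbb{Z}_p^m\times\mathbb{Z}^n$, the matrix of $\alpha\in\mathrm{Aut}(G)$ has as $j$-th column the coordinates of the image of the $j$-th canonical basis element; its first $m$ rows have entries in $\mathbb{Z}_p$ and the last $n$ rows in $\mathbb{Z}$. **Algebras.** $\mathcal{C}$ is the split octonion algebra over $\mathbb{F}$, with multiplicative norm $n$, polar form $n(x,y)=n(x+y)-n(x)-n(y)$, trace $t_{\mathcal{C}}(x)=n(x,1)$, trace zero part $\mathcal{C}_0$, and $d_{a,b}=[l_a,l_b]+[l_a,r_b]+[r_a,r_b]\in\mathrm{Der}(\mathcal{C})$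 ($l_a,r_a$ left and right multiplications). It has a canonical basis $\{e_1,e_2,u_1,u_2,u_3,v_1,v_2,v_3\}$ with $e_i^2=e_i$, $e_1e_2=e_2e_1=0$, $e_1+e_2=1$, $e_1u_i=u_i=u_ie_2$, $e_2v_i=v_i=v_ie_1$, $u_iv_i=-e_1$, $v_iu_i=-e_2$, $u_iu_{i+1}=-u_{i+1}u_i=v_{i+2}$, $v_iv_{i+1}=-v_{i+1}v_i=u_{i+2}$ (indices mod 3), all other products of basis elements being zero. $\mathcal{J}=\mathrm{Mat}_{3\times3}(\mathbb{F})^+$ with product $xy=\frac12(x\cdot y+y\cdot x)$, $t_{\mathcal{J}}=\frac13\mathrm{tr}$, $\mathcal{J}_0=\ker t_{\mathcal{J}}$, $x\ast y=xy-t_{\mathcal{J}}(xy)1$, $D_{x,y}(z)=x(yz)-y(xz)$. The Lie algebra $\mathcal{T}(\mathcal{C},\mathcal{J})=\mathrm{Der}(\mathcal{C})\oplus(\mathcal{C}_0\otimes\mathcal{J}_0)\oplus\mathrm{Der}(\mathcal{J})$ of type $E_6$ has bracket: $\mathrm{Der}(\mathcal{C})\oplus\mathrm{Der}(\mathcal{J})$ is a subalgebra, $[d,a\otimes x]=d(a)\otimes x$, $[D,a\otimes x]=a\otimes D(x)$, $[a\otimes x,b\otimes y]=t_{\mathcal{J}}(xy)d_{a,b}+[a,b]\otimes(x\ast y)+2t_{\mathcal{C}}(ab)D_{x,y}$. **The grading $\Gamma_4$.** $\mathcal{J}$ is $\mathbb{Z}_3^2$-graded by $\deg b=(\bar1,\bar0)$,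 $\deg c=(\bar0,\bar1)$, where $b=\mathrm{diag}(1,\omega,\omega^2)$ with $\omega$ a primitive cube root of $1$ and $c=E_{13}+E_{21}+E_{32}$ ($E_{ij}$ the matrix units), i.e. the matrix product $b^ic^j$ has degree $(\bar i,\bar j)$. $\mathcal{C}$ is $\mathbb{Z}^2$-graded by $\deg e_i=(0,0)$, $\deg u_1=(1,0)=-\deg v_1$, $\deg u_2=(0,1)=-\deg v_2$, $\deg u_3=(-1,-1)=-\deg v_3$. $\Gamma_4$ is the induced $\mathbb{Z}_3^2\times\mathbb{Z}^2$-grading on $\mathcal{T}(\mathcal{C},\mathcal{J})$, where $\mathrm{Der}(\mathcal{C})$ and $\mathrm{Der}(\mathcal{J})$ have the gradings induced from $\mathrm{End}(\mathcal{C})$ and $\mathrm{End}(\mathcal{J})$. *)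

theory Defs
  imports
    "HOL-Analysis.Analysis"
    "HOL-Library.Function_Algebras"
    "HOL-Library.Numeral_Type"
    "HOL-Algebra.Bij"
    "HOL-Algebra.Elementary_Groups"
begin

section \<open>Algebras and gradings\<close>

text \<open>An algebra is given by a carrier inside an ambient additive group, a scalar multiplication
  and a product; no identities are imposed on the product.\<close>

record ('k, 'v) algebra =
  vecs :: "'v set"
  scl :: "'k \<Rightarrow> 'v \<Rightarrow> 'v"
  mul :: "'v \<Rightarrow> 'v \<Rightarrow> 'v"

definition direct_sum_decomposition ::
    "('k::field, 'v::ab_group_add) algebra \<Rightarrow> 'g set \<Rightarrow> ('g \<Rightarrow> 'v set) \<Rightarrow> bool" where
  "direct_sum_decomposition A I \<Gamma> \<longleftrightarrow>
     (\<forall>g\<in>I. module.subspace (scl A) (\<Gamma> g) \<and> \<Gamma> g \<subseteq> vecs A) \<and>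
     (\<forall>x\<in>vecs A. \<exists>!c :: 'g \<Rightarrow> 'v.
        (\<forall>g\<in>I. c g \<in> \<Gamma> g) \<and> (\<forall>g. g \<notin> I \<longrightarrow> c g = 0) \<and>
        finite {g. c g \<noteq> 0} \<and> x = (\<Sum>g | c g \<noteq> 0. c g))"

definition is_grading ::
    "('k::field, 'v::ab_group_add) algebra \<Rightarrow> 'g monoid \<Rightarrow> ('g \<Rightarrow> 'v set) \<Rightarrow> bool" where
  "is_grading A G \<Gamma> \<longleftrightarrow>
     comm_group G \<and> direct_sum_decomposition A (carrier G) \<Gamma> \<and>
     (\<forall>g\<in>carrier G. \<forall>h\<in>carrier G. \<forall>x\<in>\<Gamma> g. \<forall>y\<in>\<Gamma> h. mul A x y \<in> \<Gamma> (g \<otimes>\<^bsub>G\<^esub> h))"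

definition support :: "'g monoid \<Rightarrow> ('g \<Rightarrow> 'v::zero set) \<Rightarrow> 'g set" where
  "support G \<Gamma> = {g \<in> carrier G. \<Gamma> g \<noteq> {0}}"

text \<open>HOL cannot quantify over types inside a formula, so the element type \<open>'h\<close> of the competing
  groups is a parameter; in a theorem it is a free, hence universally quantified, type variable.\<close>

definition fine_grading ::
    "'h itself \<Rightarrow> ('k::field, 'v::ab_group_add) algebra \<Rightarrow> 'g monoid \<Rightarrow> ('g \<Rightarrow> 'v set) \<Rightarrow> bool" where
  "fine_grading _ A G \<Gamma> \<longleftrightarrow> is_grading A G \<Gamma> \<and>
     \<not> (\<exists>(H :: 'h monoid) \<Delta>. is_grading A H \<Delta> \<and>
          (\<forall>h\<in>support H \<Delta>. \<exists>g\<in>support G \<Gamma>. \<Delta> h \<subseteq> \<Gamma> g) \<and>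
          (\<exists>h\<in>support H \<Delta>. \<exists>g\<in>support G \<Gamma>. \<Delta> h \<subset> \<Gamma> g))"

text \<open>A realization of \<open>\<Gamma>\<close> over \<open>H\<close> is an \<open>H\<close>-grading \<open>\<Delta>\<close> with the same nonzero components;
  a homomorphism is the identity on the support if it respects the labels of the components.\<close>

definition universal_group ::
    "'h itself \<Rightarrow> ('k::field, 'v::ab_group_add) algebra \<Rightarrow> 'g monoid \<Rightarrow> ('g \<Rightarrow> 'v set) \<Rightarrow> bool" where
  "universal_group _ A G \<Gamma> \<longleftrightarrow> is_grading A G \<Gamma> \<and>
     (\<forall>(H :: 'h monoid) \<Delta>.
        is_grading A H \<Delta> \<and> \<Delta> ` support H \<Delta> = \<Gamma> ` support G \<Gamma> \<longrightarrow>
        (\<exists>!\<phi>. \<phi> \<in> hom G H \<inter> extensional (carrier G) \<and> (\<forall>s\<in>support G \<Gamma>. \<Delta> (\<phi> s) = \<Gamma> s)))"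

definition algebra_automorphisms :: "('k, 'v::ab_group_add) algebra \<Rightarrow> ('v \<Rightarrow> 'v) set" where
  "algebra_automorphisms A = {f \<in> Bij (vecs A).
     (\<forall>x\<in>vecs A. \<forall>y\<in>vecs A. f (x + y) = f x + f y) \<and>
     (\<forall>k. \<forall>x\<in>vecs A. f (scl A k x) = scl A k (f x)) \<and>
     (\<forall>x\<in>vecs A. \<forall>y\<in>vecs A. f (mul A x y) = mul A (f x) (f y))}"

definition Aut_grading ::
    "('k, 'v::ab_group_add) algebra \<Rightarrow> 'g monoid \<Rightarrow> ('g \<Rightarrow> 'v set) \<Rightarrow> ('v \<Rightarrow> 'v) monoid" where
  "Aut_grading A G \<Gamma> = BijGroup (vecs A) \<lparr>carrier :=
     {f \<in> algebra_automorphisms A.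
        bij_betw (\<lambda>V. f ` V) (\<Gamma> ` support G \<Gamma>) (\<Gamma> ` support G \<Gamma>)}\<rparr>"

definition Stab_grading ::
    "('k, 'v::ab_group_add) algebra \<Rightarrow> 'g monoid \<Rightarrow> ('g \<Rightarrow> 'v set) \<Rightarrow> ('v \<Rightarrow> 'v) set" where
  "Stab_grading A G \<Gamma> = {f \<in> carrier (Aut_grading A G \<Gamma>). \<forall>s\<in>support G \<Gamma>. f ` \<Gamma> s = \<Gamma> s}"

definition Weyl_group ::
    "('k, 'v::ab_group_add) algebra \<Rightarrow> 'g monoid \<Rightarrow> ('g \<Rightarrow> 'v set) \<Rightarrow> ('v \<Rightarrow> 'v) set monoid" where
  "Weyl_group A G \<Gamma> = Aut_grading A G \<Gamma> Mod Stab_grading A G \<Gamma>"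

text \<open>The identification of the Weyl group with a group of automorphisms of \<open>G\<close>: a coset \<open>X\<close> of
  the stabilizer is sent to the common \<open>\<alpha>\<^sub>f\<close> of all \<open>f \<in> X\<close>. It is meaningful when \<open>G\<close> is the
  universal group.\<close>

definition Weyl_embedding ::
    "'g monoid \<Rightarrow> ('g \<Rightarrow> 'v::ab_group_add set) \<Rightarrow> ('v \<Rightarrow> 'v) set \<Rightarrow> 'g \<Rightarrow> 'g" where
  "Weyl_embedding G \<Gamma> X =
     (THE \<alpha>. \<alpha> \<in> auto G \<and> (\<forall>f\<in>X. \<forall>s\<in>support G \<Gamma>. f ` \<Gamma> s = \<Gamma> (\<alpha> s)))"


section \<open>The split octonions\<close>

text \<open>The indices of the \<open>u\<^sub>i\<close> and \<open>v\<^sub>i\<close> live in the type \<open>3\<close> of integers modulo 3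
  (so the index 3 is the element 0), and index arithmetic is modulo 3 by construction.\<close>

datatype octix = E1 | E2 | U "3" | V "3"

lemma UNIV_octix: "UNIV = {E1, E2} \<union> range U \<union> range V"
proof -
  have "x \<in> {E1, E2} \<union> range U \<union> range V" for x by (cases x) auto
  then show ?thesis by blast
qed

instance octix :: finite
  by standard (simp add: UNIV_octix)

type_synonym 'a oct = "'a ^ octix"

abbreviation oct_basis :: "octix \<Rightarrow> 'a::comm_ring_1 oct" where
  "oct_basis i \<equiv> axis i 1"

fun oct_table :: "octix \<Rightarrow> octix \<Rightarrow> 'a::comm_ring_1 oct" where
  "oct_table E1 E1 = oct_basis E1"
| "oct_table E2 E2 = oct_basis E2"
| "oct_table E1 E2 = 0"
| "oct_table E2 E1 = 0"
| "oct_table E1 (U i) = oct_basis (U i)"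
| "oct_table (U i) E2 = oct_basis (U i)"
| "oct_table E2 (U i) = 0"
| "oct_table (U i) E1 = 0"
| "oct_table E2 (V i) = oct_basis (V i)"
| "oct_table (V i) E1 = oct_basis (V i)"
| "oct_table E1 (V i) = 0"
| "oct_table (V i) E2 = 0"
| "oct_table (U i) (V j) = (if i = j then - oct_basis E1 else 0)"
| "oct_table (V i) (U j) = (if i = j then - oct_basis E2 else 0)"
| "oct_table (U i) (U j) =
     (if j = i + 1 then oct_basis (V (i + 2))
      else if i = j + 1 then - oct_basis (V (j + 2)) else 0)"
| "oct_table (V i) (V j) =
     (if j = i + 1 then oct_basis (U (i + 2))
      else if i = j + 1 then - oct_basis (U (j + 2)) else 0)"

definition oct_mult :: "'a::comm_ring_1 oct \<Rightarrow> 'a oct \<Rightarrow> 'a oct" where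
  "oct_mult x y = (\<Sum>i\<in>UNIV. \<Sum>j\<in>UNIV. (x $ i * y $ j) *s oct_table i j)"

text \<open>The multiplicative norm: \<open>e\<^sub>1, e\<^sub>2\<close> and \<open>u\<^sub>i, v\<^sub>i\<close> are hyperbolic pairs, the unit is \<open>e\<^sub>1 + e\<^sub>2\<close>.\<close>

definition oct_norm :: "'a::comm_ring_1 oct \<Rightarrow> 'a" where
  "oct_norm x = x $ E1 * x $ E2 + (\<Sum>i\<in>UNIV. x $ U i * x $ V i)"

definition oct_polar :: "'a::comm_ring_1 oct \<Rightarrow> 'a oct \<Rightarrow> 'a" where
  "oct_polar x y = oct_norm (x + y) - oct_norm x - oct_norm y"

definition oct_one :: "'a::comm_ring_1 oct" where
  "oct_one = oct_basis E1 + oct_basis E2"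

definition oct_trace :: "'a::comm_ring_1 oct \<Rightarrow> 'a" where
  "oct_trace x = oct_polar x oct_one"

definition oct_traceless :: "'a::comm_ring_1 oct set" where
  "oct_traceless = {x. oct_trace x = 0}"

definition oct_commutator :: "'a::comm_ring_1 oct \<Rightarrow> 'a oct \<Rightarrow> 'a oct" where
  "oct_commutator a b = oct_mult a b - oct_mult b a"

definition map_commutator :: "('v::ab_group_add \<Rightarrow> 'v) \<Rightarrow> ('v \<Rightarrow> 'v) \<Rightarrow> 'v \<Rightarrow> 'v" where
  "map_commutator f g = (f \<circ> g) - (g \<circ> f)"

definition oct_d :: "'a::comm_ring_1 oct \<Rightarrow> 'a oct \<Rightarrow> 'a oct \<Rightarrow> 'a oct" where
  "oct_d a b =
     (let l = oct_mult; r = (\<lambda>c x. oct_mult x c)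
      in map_commutator (l a) (l b) + map_commutator (l a) (r b) + map_commutator (r a) (r b))"

definition Der_oct :: "('a::field oct \<Rightarrow> 'a oct) set" where
  "Der_oct = {d. Vector_Spaces.linear (*s) (*s) d \<and>
     (\<forall>x y. d (oct_mult x y) = oct_mult (d x) y + oct_mult x (d y))}"


section \<open>The Jordan algebra of \<open>3 \<times> 3\<close> matrices\<close>

type_synonym 'a jor = "'a ^ 3 ^ 3"

definition mscale :: "'a::times \<Rightarrow> 'a ^ 'n ^ 'm \<Rightarrow> 'a ^ 'n ^ 'm" where
  "mscale k x = (\<chi> i j. k * x $ i $ j)"

definition jor_mult :: "'a::field jor \<Rightarrow> 'a jor \<Rightarrow> 'a jor" where
  "jor_mult x y = mscale (1 / 2) (x ** y + y ** x)"

definition jor_trace :: "'a::field jor \<Rightarrow> 'a" where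
  "jor_trace x = 1 / 3 * trace x"

definition jor_traceless :: "'a::field jor set" where
  "jor_traceless = {x. jor_trace x = 0}"

definition jor_star :: "'a::field jor \<Rightarrow> 'a jor \<Rightarrow> 'a jor" where
  "jor_star x y = jor_mult x y - mscale (jor_trace (jor_mult x y)) (mat 1)"

definition jor_D :: "'a::field jor \<Rightarrow> 'a jor \<Rightarrow> 'a jor \<Rightarrow> 'a jor" where
  "jor_D x y = (\<lambda>z. jor_mult x (jor_mult y z) - jor_mult y (jor_mult x z))"

definition Der_jor :: "('a::field jor \<Rightarrow> 'a jor) set" where
  "Der_jor = {D. Vector_Spaces.linear mscale mscale D \<and>
     (\<forall>x y. D (jor_mult x y) = jor_mult (D x) y + jor_mult x (D y))}"


section \<open>The Lie algebra \<open>\<T>(\<C>, \<J>)\<close>\<close>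

text \<open>The tensor product of the octonions and \<open>\<J>\<close> is realized as the space of octonion
  coordinates with values in \<open>\<J>\<close>: the family \<open>S\<close> stands for the sum of the
  \<open>oct_basis i \<otimes> S $ i\<close>.\<close>

type_synonym 'a octjor = "'a jor ^ octix"

definition tens :: "'a::comm_ring_1 oct \<Rightarrow> 'a jor \<Rightarrow> 'a octjor" where
  "tens a x = (\<chi> i. mscale (a $ i) x)"

definition octjor_scale :: "'a::times \<Rightarrow> 'a octjor \<Rightarrow> 'a octjor" where
  "octjor_scale k S = (\<chi> i. mscale k (S $ i))"

definition tensor_span :: "'a::field oct set \<Rightarrow> 'a jor set \<Rightarrow> 'a octjor set" where
  "tensor_span A X = module.span octjor_scale {tens a x | a x. a \<in> A \<and> x \<in> X}"

type_synonym 'a tits = "('a oct \<Rightarrow> 'a oct) \<times> 'a octjor \<times> ('a jor \<Rightarrow> 'a jor)"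

text \<open>The actions \<open>d(a) \<otimes> x\<close> and \<open>a \<otimes> D(x)\<close>, and the three components of \<open>[a \<otimes> x, b \<otimes> y]\<close>,
  extended (bi)linearly from elementary tensors; \<open>tits_bracket_elementary\<close> below recovers
  the defining formulas of the bracket.\<close>

definition act_oct :: "('a::field oct \<Rightarrow> 'a oct) \<Rightarrow> 'a octjor \<Rightarrow> 'a octjor" where
  "act_oct d S = (\<Sum>i\<in>UNIV. tens (d (oct_basis i)) (S $ i))"

definition act_jor :: "('a::field jor \<Rightarrow> 'a jor) \<Rightarrow> 'a octjor \<Rightarrow> 'a octjor" where
  "act_jor D S = (\<Sum>i\<in>UNIV. tens (oct_basis i) (D (S $ i)))"

definition tensor_d :: "'a::field octjor \<Rightarrow> 'a octjor \<Rightarrow> 'a oct \<Rightarrow> 'a oct" where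
  "tensor_d S T = (\<lambda>z. \<Sum>i\<in>UNIV. \<Sum>j\<in>UNIV.
     jor_trace (jor_mult (S $ i) (T $ j)) *s oct_d (oct_basis i) (oct_basis j) z)"

definition tensor_mid :: "'a::field octjor \<Rightarrow> 'a octjor \<Rightarrow> 'a octjor" where
  "tensor_mid S T = (\<Sum>i\<in>UNIV. \<Sum>j\<in>UNIV.
     tens (oct_commutator (oct_basis i) (oct_basis j)) (jor_star (S $ i) (T $ j)))"

definition tensor_D :: "'a::field octjor \<Rightarrow> 'a octjor \<Rightarrow> 'a jor \<Rightarrow> 'a jor" where
  "tensor_D S T = (\<lambda>z. \<Sum>i\<in>UNIV. \<Sum>j\<in>UNIV.
     mscale (2 * oct_trace (oct_mult (oct_basis i) (oct_basis j))) (jor_D (S $ i) (T $ j) z))"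

definition tits_scale :: "'a::field \<Rightarrow> 'a tits \<Rightarrow> 'a tits" where
  "tits_scale k = (\<lambda>(d, S, D). ((\<lambda>z. k *s d z), octjor_scale k S, (\<lambda>z. mscale k (D z))))"

definition tits_bracket :: "'a::field tits \<Rightarrow> 'a tits \<Rightarrow> 'a tits" where
  "tits_bracket = (\<lambda>(d, S, D) (d', S', D').
     (map_commutator d d' + tensor_d S S',
      act_oct d S' - act_oct d' S + act_jor D S' - act_jor D' S + tensor_mid S S',
      map_commutator D D' + tensor_D S S'))"

lemma oct_mult_basis: "oct_mult (oct_basis i) (oct_basis j) = oct_table i j"
proof -
  have "oct_mult (oct_basis i) (oct_basis j) =
      (\<Sum>i'\<in>UNIV. \<Sum>j'\<in>UNIV. if j' = j then (if i' = i then oct_table i j else 0) else 0)"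
    unfolding oct_mult_def by (intro sum.cong) (auto simp: axis_def)
  also have "\<dots> = oct_table i j" by simp
  finally show ?thesis .
qed

lemma oct_trace_eq: "oct_trace x = x $ E1 + x $ E2"
  by (simp add: oct_trace_def oct_polar_def oct_norm_def oct_one_def axis_def algebra_simps)

lemma oct_mult_left_linear:
  "oct_mult (x + x') y = oct_mult x y + oct_mult x' y" "oct_mult (k *s x) y = k *s oct_mult x y"
  by (simp_all add: oct_mult_def vec_eq_iff algebra_simps sum.distrib sum_distrib_left)

lemma oct_mult_right_linear:
  "oct_mult x (y + y') = oct_mult x y + oct_mult x y'" "oct_mult x (k *s y) = k *s oct_mult x y"
  by (simp_all add: oct_mult_def vec_eq_iff algebra_simps sum.distrib sum_distrib_left)

lemma oct_linear_expand:
  fixes f :: "'a::field oct \<Rightarrow> 'v::ab_group_add"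
  assumes "Vector_Spaces.linear (*s) s f"
  shows "f a = (\<Sum>i\<in>UNIV. s (a $ i) (f (oct_basis i)))"
proof -
  interpret Vector_Spaces.linear "(*s)" s f by fact
  show ?thesis
    by (subst (1) basis_expansion[symmetric, of a]) (simp add: sum scale)
qed

lemma vec_linearI:
  assumes "\<And>x y. f (x + y) = f x + f y" "\<And>k x. f (k *s x) = k *s f x"
  shows "Vector_Spaces.linear (*s) (*s) (f :: 'a::field ^ 'n \<Rightarrow> 'a ^ 'm)"
  by (simp add: assms Vector_Spaces.linear_iff vec.vector_space_axioms)

lemma oct_bilinear_expand:
  fixes f :: "'a::field oct \<Rightarrow> 'a oct \<Rightarrow> 'a ^ 'm"
  assumes "\<And>x y z. f (x + y) z = f x z + f y z" "\<And>k x z. f (k *s x) z = k *s f x z"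
    and "\<And>x y z. f z (x + y) = f z x + f z y" "\<And>k x z. f z (k *s x) = k *s f z x"
  shows "(\<Sum>i\<in>UNIV. \<Sum>j\<in>UNIV. (a $ i * b $ j) *s f (oct_basis i) (oct_basis j)) = f a b"
proof -
  have "f a b = (\<Sum>i\<in>UNIV. a $ i *s f (oct_basis i) b)"
    using oct_linear_expand[OF vec_linearI, of "\<lambda>x. f x b" a] assms by simp
  also have "\<dots> = (\<Sum>i\<in>UNIV. a $ i *s (\<Sum>j\<in>UNIV. b $ j *s f (oct_basis i) (oct_basis j)))"
    using oct_linear_expand[OF vec_linearI, of "f (oct_basis i)" b for i] assms by simp
  finally show ?thesis
    by (simp add: vec.scale_sum_right vec.scale_scale)
qed

lemma oct_d_expand:
  "(\<Sum>i\<in>UNIV. \<Sum>j\<in>UNIV. (a $ i * b $ j) *s oct_d (oct_basis i) (oct_basis j) z) =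
     oct_d a b (z :: 'a::field oct)"
  by (rule oct_bilinear_expand)
    (simp_all add: oct_d_def map_commutator_def oct_mult_left_linear oct_mult_right_linear
      vec.scale_right_diff_distrib vec.scale_right_distrib)

lemma oct_commutator_expand:
  "(\<Sum>i\<in>UNIV. \<Sum>j\<in>UNIV. (a $ i * b $ j) *s oct_commutator (oct_basis i) (oct_basis j)) =
     oct_commutator a (b :: 'a::field oct)"
  by (rule oct_bilinear_expand)
    (simp_all add: oct_commutator_def oct_mult_left_linear oct_mult_right_linear
      vec.scale_right_diff_distrib)

lemma oct_trace_mult_expand:
  "(\<Sum>i\<in>UNIV. \<Sum>j\<in>UNIV. a $ i * b $ j * oct_trace (oct_mult (oct_basis i) (oct_basis j))) =
     oct_trace (oct_mult a (b :: 'a::field oct))"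
  unfolding oct_mult_basis
  by (simp add: oct_trace_eq oct_mult_def sum.distrib[symmetric] distrib_left)

lemma jor_mult_mscale:
  "jor_mult (mscale k x) y = mscale k (jor_mult x y)"
  "jor_mult x (mscale k y) = mscale k (jor_mult x y)"
  by (simp_all add: jor_mult_def mscale_def matrix_matrix_mult_def vec_eq_iff
      sum_distrib_left algebra_simps)

lemma jor_trace_mscale: "jor_trace (mscale k x) = k * jor_trace x"
  by (simp add: jor_trace_def mscale_def trace_def sum_distrib_left algebra_simps)

lemma mscale_mscale: "mscale k (mscale l x) = mscale (k * l :: 'a::semigroup_mult) x"
  by (simp add: mscale_def vec_eq_iff mult.assoc)

lemma mscale_diff: "mscale k (x - y) = mscale k x - mscale k (y :: 'a::ring ^ 'n ^ 'm)"
  by (simp add: mscale_def vec_eq_iff algebra_simps)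

lemma mscale_sum: "(\<Sum>i\<in>I. mscale (f i) x) = mscale (\<Sum>i\<in>I. f i) (x :: 'a::ring ^ 'n ^ 'm)"
  by (simp add: mscale_def vec_eq_iff sum_distrib_right)

lemma tens_mscale: "tens a (mscale k x) = tens (k *s a) x"
  by (simp add: tens_def vec_eq_iff mscale_mscale mult.commute)

lemma tens_sum: "(\<Sum>i\<in>I. tens (f i) x) = tens (\<Sum>i\<in>I. f i) x"
  by (simp add: tens_def vec_eq_iff mscale_sum)

lemma act_oct_tens:
  assumes "Vector_Spaces.linear (*s) (*s) d"
  shows "act_oct d (tens a x) = tens (d a) x"
proof -
  have "act_oct d (tens a x) = (\<Sum>i\<in>UNIV. tens (a $ i *s d (oct_basis i)) x)"
    by (simp add: act_oct_def tens_mscale[symmetric]) (simp add: tens_def)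
  then show ?thesis
    using oct_linear_expand[OF assms, of a] by (simp add: tens_sum)
qed

lemma act_jor_tens:
  assumes "Vector_Spaces.linear mscale mscale D"
  shows "act_jor D (tens a x) = tens a (D x)"
proof -
  interpret Vector_Spaces.linear mscale mscale D by fact
  have "act_jor D (tens a x) = (\<Sum>i\<in>UNIV. tens (a $ i *s oct_basis i) (D x))"
    by (simp add: act_jor_def tens_mscale[symmetric] scale[symmetric]) (simp add: tens_def)
  then show ?thesis by (simp add: tens_sum basis_expansion)
qed

lemma tensor_d_tens:
  "tensor_d (tens a x) (tens b y) = (\<lambda>z. jor_trace (jor_mult x y) *s oct_d a b z)"
proof
  fix z
  have "tensor_d (tens a x) (tens b y) z = jor_trace (jor_mult x y) *s
      (\<Sum>i\<in>UNIV. \<Sum>j\<in>UNIV. (a $ i * b $ j) *s oct_d (oct_basis i) (oct_basis j) z)"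
    by (simp add: tensor_d_def tens_def jor_mult_mscale jor_trace_mscale vec.scale_sum_right
        mult_ac)
  then show "tensor_d (tens a x) (tens b y) z = jor_trace (jor_mult x y) *s oct_d a b z"
    by (simp only: oct_d_expand)
qed

lemma tensor_mid_tens:
  "tensor_mid (tens a x) (tens b y) = tens (oct_commutator a b) (jor_star x y)"
proof -
  have *: "jor_star (mscale k x) (mscale l y) = mscale (k * l) (jor_star x y)" for k l
    by (simp add: jor_star_def jor_mult_mscale jor_trace_mscale mscale_diff mscale_mscale mult_ac)
  have "tensor_mid (tens a x) (tens b y) = (\<Sum>i\<in>UNIV. \<Sum>j\<in>UNIV.
      tens ((a $ i * b $ j) *s oct_commutator (oct_basis i) (oct_basis j)) (jor_star x y))"
    by (simp add: tensor_mid_def tens_mscale[symmetric] *[symmetric]) (simp add: tens_def)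
  then show ?thesis by (simp only: tens_sum oct_commutator_expand)
qed

lemma tensor_D_tens:
  "tensor_D (tens a x) (tens b y) = (\<lambda>z. mscale (2 * oct_trace (oct_mult a b)) (jor_D x y z))"
proof
  fix z
  have *: "jor_D (mscale k x) (mscale l y) z = mscale (k * l) (jor_D x y z)" for k l
    by (simp add: jor_D_def jor_mult_mscale mscale_diff mscale_mscale mult_ac)
  have "tensor_D (tens a x) (tens b y) z = mscale (\<Sum>i\<in>UNIV. \<Sum>j\<in>UNIV.
      2 * (a $ i * b $ j * oct_trace (oct_mult (oct_basis i) (oct_basis j)))) (jor_D x y z)"
    by (simp add: tensor_D_def tens_def * mscale_mscale mscale_sum[symmetric] mult_ac)
  then show "tensor_D (tens a x) (tens b y) z =
      mscale (2 * oct_trace (oct_mult a b)) (jor_D x y z)"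
    by (simp only: sum_distrib_left[symmetric] oct_trace_mult_expand)
qed

lemma tits_bracket_elementary:
  fixes a b :: "'a::field oct"
  shows "D \<in> Der_jor \<Longrightarrow> D' \<in> Der_jor \<Longrightarrow>
      tits_bracket (d, 0, D) (d', 0, D') = (map_commutator d d', 0, map_commutator D D')"
    and "d \<in> Der_oct \<Longrightarrow> tits_bracket (d, 0, 0) (0, tens a x, 0) = (0, tens (d a) x, 0)"
    and "D \<in> Der_jor \<Longrightarrow> tits_bracket (0, 0, D) (0, tens a x, 0) = (0, tens a (D x), 0)"
    and "tits_bracket (0, tens a x, 0) (0, tens b y, 0) =
      ((\<lambda>z. jor_trace (jor_mult x y) *s oct_d a b z),
       tens (oct_commutator a b) (jor_star x y),
       (\<lambda>z. mscale (2 * oct_trace (oct_mult a b)) (jor_D x y z)))"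
proof -
  have z: "tens a 0 = 0" "tens 0 x = 0" for a :: "'a oct" and x
    by (simp_all add: tens_def mscale_def vec_eq_iff)
  have m: "jor_mult 0 x = 0" "jor_mult x 0 = 0" "jor_trace (0 :: 'a jor) = 0"
      "mscale k (0 :: 'a jor) = 0" "mscale 0 x = 0" for k and x :: "'a jor"
    by (simp_all add: jor_mult_def jor_trace_def trace_def mscale_def vec_eq_iff
        matrix_matrix_mult_def)
  have a: "act_oct 0 S = 0" "act_jor 0 S = 0" "act_oct d 0 = 0" for S :: "'a octjor" and d :: "'a oct \<Rightarrow> 'a oct"
    by (simp_all add: act_oct_def act_jor_def z)
  have t: "tensor_d 0 S = 0" "tensor_d S 0 = 0" "tensor_mid 0 S = 0" "tensor_mid S 0 = 0"
      "tensor_D 0 S = 0" "tensor_D S 0 = 0" for S :: "'a octjor"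
    by (simp_all add: tensor_d_def tensor_mid_def tensor_D_def jor_star_def jor_D_def m z
        fun_eq_iff)
  have D0: "act_jor D 0 = 0" if "D \<in> Der_jor" for D :: "'a jor \<Rightarrow> 'a jor"
  proof -
    interpret Vector_Spaces.linear mscale mscale D using that by (simp add: Der_jor_def)
    show ?thesis by (simp add: act_jor_def zero z)
  qed
  have c: "map_commutator f 0 = 0" "map_commutator 0 f = 0" if "f 0 = 0"
    for f :: "'v::ab_group_add \<Rightarrow> 'v"
    using that by (simp_all add: map_commutator_def fun_eq_iff)
  have d0: "d 0 = 0" if "d \<in> Der_oct" for d :: "'a oct \<Rightarrow> 'a oct"
  proof -
    interpret Vector_Spaces.linear "(*s)" "(*s)" d using that by (simp add: Der_oct_def)
    show ?thesis by (rule zero)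
  qed
  have D0': "D 0 = 0" if "D \<in> Der_jor" for D :: "'a jor \<Rightarrow> 'a jor"
  proof -
    interpret Vector_Spaces.linear mscale mscale D using that by (simp add: Der_jor_def)
    show ?thesis by (rule zero)
  qed
  show "tits_bracket (d, 0, D) (d', 0, D') = (map_commutator d d', 0, map_commutator D D')"
    if "D \<in> Der_jor" "D' \<in> Der_jor"
    using that by (simp add: tits_bracket_def a t D0)
  show "tits_bracket (d, 0, 0) (0, tens a x, 0) = (0, tens (d a) x, 0)" if "d \<in> Der_oct"
    using that act_oct_tens[of d a x]
    by (simp add: tits_bracket_def a t c d0 Der_oct_def)
  show "tits_bracket (0, 0, D) (0, tens a x, 0) = (0, tens a (D x), 0)" if "D \<in> Der_jor"
    using that act_jor_tens[of D a x]
    by (simp add: tits_bracket_def a t c D0' Der_jor_def)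
  show "tits_bracket (0, tens a x, 0) (0, tens b y, 0) =
      ((\<lambda>z. jor_trace (jor_mult x y) *s oct_d a b z),
       tens (oct_commutator a b) (jor_star x y),
       (\<lambda>z. mscale (2 * oct_trace (oct_mult a b)) (jor_D x y z)))"
    by (simp add: tits_bracket_def a c tensor_d_tens tensor_mid_tens tensor_D_tens)
qed

definition tits_algebra :: "('a::field, 'a tits) algebra" where
  "tits_algebra =
     \<lparr>vecs = Der_oct \<times> tensor_span oct_traceless jor_traceless \<times> Der_jor,
      scl = tits_scale, mul = tits_bracket\<rparr>"


section \<open>The grading \<open>\<Gamma>\<^sub>4\<close>\<close>

definition additive_group :: "'g::ab_group_add monoid" where
  "additive_group = \<lparr>carrier = UNIV, mult = (+), one = 0\<rparr>"

text \<open>The entries of \<open>3 ^ 2\<close> are in the ring \<open>3\<close> of integers modulo 3.\<close>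

type_synonym g4 = "(3 ^ 2) \<times> (int ^ 2)"

definition G4 :: "g4 monoid" where
  "G4 = additive_group"

definition matrix_unit :: "'n \<Rightarrow> 'm \<Rightarrow> 'a::zero_neq_one ^ 'm ^ 'n" where
  "matrix_unit i j = (\<chi> r s. if r = i \<and> s = j then 1 else 0)"

definition jor_b :: "'a::field \<Rightarrow> 'a jor" where
  "jor_b \<omega> = matrix_unit 1 1 + mscale \<omega> (matrix_unit 2 2) + mscale (\<omega>\<^sup>2) (matrix_unit 3 3)"

definition jor_c :: "'a::field jor" where
  "jor_c = matrix_unit 1 3 + matrix_unit 2 1 + matrix_unit 3 2"

definition matrix_power :: "'a::semiring_1 ^ 'n ^ 'n \<Rightarrow> nat \<Rightarrow> 'a ^ 'n ^ 'n" where
  "matrix_power x n = (((**) x) ^^ n) (mat 1)"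

definition jor_component :: "'a::field \<Rightarrow> 3 ^ 2 \<Rightarrow> 'a jor set" where
  "jor_component \<omega> g = module.span mscale
     {matrix_power (jor_b \<omega>) i ** matrix_power jor_c j | i j. vector [of_nat i, of_nat j] = g}"

definition u_degree :: "3 \<Rightarrow> int ^ 2" where
  "u_degree i = (if i = 1 then vector [1, 0] else if i = 2 then vector [0, 1] else vector [-1, -1])"

fun oct_degree :: "octix \<Rightarrow> int ^ 2" where
  "oct_degree E1 = 0"
| "oct_degree E2 = 0"
| "oct_degree (U i) = u_degree i"
| "oct_degree (V i) = - u_degree i"

definition oct_component :: "int ^ 2 \<Rightarrow> 'a::field oct set" where
  "oct_component h = module.span (*s) {oct_basis k | k. oct_degree k = h}"

definition Der_oct_component :: "int ^ 2 \<Rightarrow> ('a::field oct \<Rightarrow> 'a oct) set" where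
  "Der_oct_component h = {d \<in> Der_oct. \<forall>h'. d ` oct_component h' \<subseteq> oct_component (h + h')}"

definition Der_jor_component :: "'a::field \<Rightarrow> 3 ^ 2 \<Rightarrow> ('a jor \<Rightarrow> 'a jor) set" where
  "Der_jor_component \<omega> g =
     {D \<in> Der_jor. \<forall>g'. D ` jor_component \<omega> g' \<subseteq> jor_component \<omega> (g + g')}"

definition \<Gamma>4 :: "'a::field \<Rightarrow> g4 \<Rightarrow> 'a tits set" where
  "\<Gamma>4 \<omega> = (\<lambda>(g, h).
     (if g = 0 then Der_oct_component h else {0}) \<times>
     tensor_span (oct_traceless \<inter> oct_component h) (jor_traceless \<inter> jor_component \<omega> g) \<times>
     (if h = 0 then Der_jor_component \<omega> g else {0}))"


section \<open>Matrices and groups\<close>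

text \<open>The four blocks (upper left, upper right, lower left, lower right) of the matrix of a
  self-map of \<open>G\<^sub>4\<close>; columns are images of canonical basis elements.\<close>

type_synonym block_matrix = "(3 ^ 2 ^ 2) \<times> (3 ^ 2 ^ 2) \<times> (int ^ 2 ^ 2) \<times> (int ^ 2 ^ 2)"

definition g4_matrix :: "(g4 \<Rightarrow> g4) \<Rightarrow> block_matrix" where
  "g4_matrix \<alpha> =
     (\<chi> i j. fst (\<alpha> (axis j 1, 0)) $ i, \<chi> i j. fst (\<alpha> (0, axis j 1)) $ i,
      \<chi> i j. snd (\<alpha> (axis j 1, 0)) $ i, \<chi> i j. snd (\<alpha> (0, axis j 1)) $ i)"

definition GL :: "('r::comm_ring_1 ^ 'n ^ 'n) monoid" where
  "GL = \<lparr>carrier = {A. invertible A}, mult = (**), one = mat 1\<rparr>"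

definition sigma_mat :: "int ^ 2 ^ 2" where
  "sigma_mat = vector [vector [1, -1], vector [1, 0]]"

definition tau_mat :: "int ^ 2 ^ 2" where
  "tau_mat = vector [vector [1, -1], vector [0, -1]]"

definition D_sigma_tau :: "(int ^ 2 ^ 2) monoid" where
  "D_sigma_tau = subgroup_generated GL {sigma_mat, tau_mat}"

definition semidirect :: "'n monoid \<Rightarrow> 'k monoid \<Rightarrow> ('k \<Rightarrow> 'n \<Rightarrow> 'n) \<Rightarrow> ('n \<times> 'k) monoid" where
  "semidirect N K \<phi> =
     \<lparr>carrier = carrier N \<times> carrier K,
      mult = (\<lambda>(n, k) (n', k'). (n \<otimes>\<^bsub>N\<^esub> \<phi> k n', k \<otimes>\<^bsub>K\<^esub> k')),
      one = (\<one>\<^bsub>N\<^esub>, \<one>\<^bsub>K\<^esub>)\<rparr>"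

definition dihedral_group :: "nat \<Rightarrow> (int \<times> int) monoid" where
  "dihedral_group n = semidirect (integer_mod_group n) (integer_mod_group 2)
     (\<lambda>s r. if s = 0 then r else inv\<^bsub>integer_mod_group n\<^esub> r)"

text \<open>Conjugation of the block matrix with diagonal blocks \<open>1, 1\<close> and upper right block \<open>v (1 1)\<close>,
  where \<open>(1 1)\<close> is a row, by the block diagonal matrix \<open>(A, B)\<close> replaces the upper right block by
  \<open>A v (1 1) B\<^sup>-\<^sup>1\<close>. Modulo 3 one has \<open>(1 1) B = \<chi> (1 1)\<close> with \<open>\<chi> = \<plusminus>1\<close> the first entry of the row
  \<open>(1 1) B\<close>, so the new block is \<open>(\<chi> A v) (1 1)\<close>.\<close>

definition Weyl_action :: "(3 ^ 2 ^ 2) \<times> (int ^ 2 ^ 2) \<Rightarrow> 3 ^ 2 \<Rightarrow> 3 ^ 2" where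
  "Weyl_action = (\<lambda>(A, B) v. of_int (B $ 1 $ 1 + B $ 2 $ 1) *s (A *v v))"

end

theory Submission
  imports Defs
begin

text \<open>
  The proof replaces \<open>\<T>(\<C>, \<J>)\<close> by the model \<open>sl\<^sub>3 \<oplus> sl\<^sub>3 \<oplus> sl\<^sub>3 \<oplus> (V \<otimes> M) \<oplus> (V\<^sup>* \<otimes> M)\<close>,
  where \<open>V\<close> is three-dimensional, \<open>M\<close> is the space of \<open>3 \<times> 3\<close> matrices, and the second and third
  summands act on \<open>M\<close> from the left and from the right. There \<open>\<Gamma>\<^sub>4\<close> combines the weight
  decomposition of \<open>V\<close> with the Pauli basis \<open>b\<^sup>i c\<^sup>j\<close> of \<open>M\<close>: the degree-zero part of the
  \<open>\<int>\<^sup>2\<close>-grading contributes all of \<open>\<int>\<^sub>3\<^sup>2\<close>, the six short roots carry a full copy of \<open>M\<close>, and the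
  six long roots occur only with \<open>\<int>\<^sub>3\<^sup>2\<close>-component 0.

  Fineness and universality hold because enough products of homogeneous elements are nonzero to
  force any relabelling of the components to be additive. An induced automorphism of the universal
  group preserves the support. It therefore preserves the torsion \<open>\<int>\<^sub>3\<^sup>2\<close>, permutes the short
  roots by an element \<open>B\<close> of the dihedral group, and, since long roots have trivial
  \<open>\<int>\<^sub>3\<^sup>2\<close>-component, shifts \<open>u\<^sub>1\<close> and \<open>u\<^sub>2\<close> by the same element. Conversely the matrices
  \<open>A\<close>, the shifts, \<open>\<sigma>\<close> and \<open>\<tau>\<close> are induced by explicit automorphisms of the model: relabelling
  of the Pauli basis (an automorphism of \<open>M\<close> if \<open>det A = 1\<close>, an anti-automorphism if
  \<open>det A = -1\<close>), left multiplication of \<open>M\<close> by a Pauli matrix, the duality exchanging \<open>V\<close> and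
  \<open>V\<^sup>*\<close>, and a transposition of the basis of \<open>V\<close>.
\<close>

text \<open>The model exists because of the shifts. The matrices \<open>A\<close>, \<sigma> and
  \<tau> could be realized by automorphisms of the octonions and of the Jordan algebra, which
  preserve the three summands of the Tits construction. A shift cannot: it changes the Z_3^2-degree
  of short root vectors, so it carries a short root vector of Der(C), which has Z_3^2-degree 0, into
  C_0 tensor J_0. Only when the scalar matrices contributed by Der(C) are glued to the traceless
  ones from C_0 tensor J_0 does M appear as a whole, and with it left multiplication by a Pauli
  matrix. The model is E6 seen from its subalgebra of type A2 + A2 + A2, with 78 = 3 * 8 + 27 + 27.
  The second copy of M is really its dual, matrices in the opposite direction; this is why X and Y
  change sides between \<open>P\<close> and \<open>Q\<close> in \<open>mdl_bracket\<close>. The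
  other choice is that of phases: normalized symmetrically, the Pauli matrices can be relabelled by
  any matrix of determinant 1 or -1 without correcting scalars.\<close>

lemma exhaust_mod3: "x = 0 \<or> x = 1 \<or> x = 2" for x :: 3
  using exhaust_3[of x] by auto

lemma mod3_simps: "(3 :: 3) = 0" "(4 :: 3) = 1"
  by simp_all

lemma mod3_triple: "x + x + x = 0" "x + (x + x) = 0" "- x = x + x" for x :: 3
  using exhaust_mod3[of x] by (elim disjE; simp)+

lemma forall_mod3: "(\<forall>x::3. R x) \<longleftrightarrow> R 0 \<and> R 1 \<and> R 2"
  by (metis exhaust_mod3)

lemma sum_mod3: "sum f (UNIV :: 3 set) = f 0 + f 1 + f 2"
proof -
  \<comment> \<open>The enumeration \<open>sum_3\<close> runs over 1, 2, 3; as elements of the type,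
    3 and 0 coincide.\<close>
  have "f 3 = f 0" by (simp only: mod3_simps)
  then show ?thesis by (simp only: sum_3 add_ac)
qed

lemma sum_mod3_shift:
  "(\<Sum>x\<in>UNIV. f (x + c)) = sum f (UNIV :: 3 set)" "(\<Sum>x\<in>UNIV. f (c + x)) = sum f UNIV"
  "(\<Sum>x\<in>UNIV. f (c - x)) = sum f UNIV" "(\<Sum>x\<in>UNIV. f (x - c)) = sum f UNIV"
  by (rule sum.reindex_bij_witness[of _ "\<lambda>y. y - c" "\<lambda>x. x + c"]
        sum.reindex_bij_witness[of _ "\<lambda>y. y - c" "\<lambda>x. c + x"]
        sum.reindex_bij_witness[of _ "\<lambda>y. c - y" "\<lambda>x. c - x"]
        sum.reindex_bij_witness[of _ "\<lambda>y. y + c" "\<lambda>x. x - c"]; simp)+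

section \<open>Coordinates of vectors of length two and linearity of matrix operations\<close>

lemma vec2_eq_iff: "(x :: 'b ^ 2) = y \<longleftrightarrow> x $ 1 = y $ 1 \<and> x $ 2 = y $ 2"
  by (simp add: vec_eq_iff forall_2)

lemma vector_eta2: "vector [v $ 1, v $ 2] = (v :: 'b::zero ^ 2)"
  by (simp add: vec2_eq_iff)

lemma sum_vec2: "sum f (UNIV :: ('b::{finite,zero} ^ 2) set) = (\<Sum>x\<in>UNIV. \<Sum>y\<in>UNIV. f (vector [x, y]))"
proof -
  have "sum f UNIV = (\<Sum>p\<in>UNIV. f (vector [fst p, snd p]))"
    by (rule sum.reindex_bij_witness[of _ "\<lambda>p. vector [fst p, snd p]" "\<lambda>v. (v $ 1, v $ 2)"])
      (auto simp: vector_eta2)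
  also have "\<dots> = (\<Sum>x\<in>UNIV. \<Sum>y\<in>UNIV. f (vector [x, y]))"
    by (simp add: sum.cartesian_product case_prod_beta)
  finally show ?thesis .
qed

lemma mscale_nth [simp]: "mscale k x $ i $ j = k * x $ i $ j"
  by (simp add: mscale_def)

lemma mscale_one [simp]: "mscale (1 :: 'b::monoid_mult) x = x"
  by (simp add: vec_eq_iff)

lemma mscale_zero [simp]: "mscale (0 :: 'b::mult_zero) x = 0" "mscale k (0 :: 'b ^ 'n ^ 'm) = 0"
  by (simp_all add: vec_eq_iff)

lemma mscale_add: "mscale k (x + y) = mscale k x + mscale k (y :: 'b::semiring ^ 'n ^ 'm)"
  by (simp add: vec_eq_iff algebra_simps)

lemma mscale_minus [simp]: "mscale k (- x) = - mscale k (x :: 'b::ring ^ 'n ^ 'm)"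
  by (simp add: vec_eq_iff algebra_simps)

lemma mscale_eq_0_iff [simp]: "mscale k x = 0 \<longleftrightarrow> k = 0 \<or> x = 0"
  for k :: "'b::semiring_no_zero_divisors"
  by (auto simp: vec_eq_iff)

lemma mscale_matrix_mult:
  "mscale k x ** y = mscale k (x ** y)" "x ** mscale k y = mscale (k :: 'b::comm_semiring_1) (x ** y)"
  by (simp_all add: vec_eq_iff matrix_matrix_mult_def sum_distrib_left mult_ac)

lemma matrix_mult_nth: "(x ** y) $ i $ j = (\<Sum>k\<in>UNIV. x $ i $ k * y $ k $ j)"
  by (simp add: matrix_matrix_mult_def)

lemma matrix_mult_zero [simp]:
  "0 ** (x :: 'b::semiring_1 ^ 'n ^ 'm) = 0" "x ** (0 :: 'b ^ 'k ^ 'n) = 0"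
  by (simp_all add: vec_eq_iff matrix_matrix_mult_def)

lemma matrix_mult_minus:
  "(- x) ** y = - (x ** y :: 'b::ring_1 ^ 'n ^ 'm)" "u ** (- v) = - (u ** v :: 'b::ring_1 ^ 'n ^ 'm)"
  by (simp_all add: vec_eq_iff matrix_matrix_mult_def sum_negf)

lemma matrix_mult_add:
  "(x + x') ** y = x ** y + (x' ** y :: 'b::semiring_1 ^ 'n ^ 'm)"
  "u ** (z + z') = u ** z + u ** (z' :: 'b::semiring_1 ^ 'n ^ 'm)"
  by (simp_all add: vec_eq_iff matrix_matrix_mult_def sum.distrib algebra_simps)

lemma matrix_mult_diff:
  "(x - x') ** y = x ** y - (x' ** y :: 'b::ring_1 ^ 'n ^ 'm)"
  "u ** (z - z') = u ** z - u ** (z' :: 'b::ring_1 ^ 'n ^ 'm)"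
  by (simp_all add: vec_eq_iff matrix_matrix_mult_def sum_subtractf algebra_simps)

lemma matrix_mult_sum_distrib:
  "sum f I ** y = (\<Sum>i\<in>I. f i ** (y :: 'b::semiring_1 ^ 'n ^ 'm))"
  "u ** sum h I = (\<Sum>i\<in>I. u ** (h i :: 'b ^ 'n ^ 'm))"
  by (induction I rule: infinite_finite_induct) (simp_all add: matrix_mult_add)

lemma trace_linear:
  "trace (x + y) = trace x + trace y" "trace (x - y) = trace x - trace y"
  "trace (- x) = - trace (x :: 'b::ring_1 ^ 'n ^ 'n)" "trace (0 :: 'b ^ 'n ^ 'n) = 0"
  "trace (mscale k x) = k * trace x"
  by (simp_all add: trace_def sum.distrib sum_subtractf sum_negf sum_distrib_left)

lemma trace_sum: "trace (sum f I) = (\<Sum>i\<in>I. trace (f i :: 'b::ring_1 ^ 'n ^ 'n))"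
  by (induction I rule: infinite_finite_induct) (simp_all add: trace_linear)

lemma trace_mat_1: "trace (mat 1 :: 'b::ring_1 ^ 3 ^ 3) = 3"
  by (simp add: trace_def mat_def)

lemma module_mscale: "module (mscale :: 'b::comm_ring_1 \<Rightarrow> _ \<Rightarrow> 'b ^ 'n ^ 'm)"
  by unfold_locales (simp_all add: mscale_mscale vec_eq_iff algebra_simps)


section \<open>The generalized Pauli matrices\<close>

text \<open>The determinant form on Z_3^2. It is the exponent of \<omega> by which
  \<open>pauli g ** pauli h\<close> differs from \<open>pauli h ** pauli g\<close>, because -2 = 1
  modulo 3.\<close>

definition sympl :: "3 ^ 2 \<Rightarrow> 3 ^ 2 \<Rightarrow> 3" where
  "sympl g h = g $ 1 * h $ 2 - g $ 2 * h $ 1"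

lemma sympl_simps [simp]:
  "sympl 0 g = 0" "sympl g 0 = 0" "sympl g g = 0" "sympl (- g) h = - sympl g h" "sympl g (- h) = - sympl g h"
  by (simp_all add: sympl_def)

lemma sympl_add: "sympl (g + g') h = sympl g h + sympl g' h" "sympl h (g + g') = sympl h g + sympl h g'"
  by (simp_all add: sympl_def algebra_simps)

lemma sympl_sym: "sympl h g = - sympl g h"
  by (simp add: sympl_def)

locale cube_root =
  fixes \<omega> :: "'a::field_char_0"
  assumes cube: "\<omega> ^ 3 = 1" and nontriv: "\<omega> \<noteq> 1"
begin

text \<open>The character of Z_3 with value \<omega> at 1. It stands for a power of \<omega> whose
  exponent lives in the type \<open>3\<close>, so that exponents can be computed in that
  ring.\<close>

definition root_char :: "3 \<Rightarrow> 'a" where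
  "root_char x = (if x = 0 then 1 else if x = 1 then \<omega> else \<omega>\<^sup>2)"

lemma sum_roots: "1 + \<omega> + \<omega>\<^sup>2 = 0"
proof -
  have "(\<omega> - 1) * (1 + \<omega> + \<omega>\<^sup>2) = 0"
    using cube by (simp add: algebra_simps power2_eq_square power3_eq_cube)
  then show ?thesis using nontriv by simp
qed

lemma root_nonzero: "\<omega> \<noteq> 0"
  using cube by auto

lemma root_char_simps [simp]: "root_char 0 = 1" "root_char 1 = \<omega>" "root_char 2 = \<omega>\<^sup>2"
    "root_char 3 = 1" "root_char 4 = \<omega>" "root_char (- 1) = \<omega>\<^sup>2" "root_char (- 2) = \<omega>"
  by (simp_all add: root_char_def)

lemma root_char_add: "root_char (x + y) = root_char x * root_char y"
proof -
  have "\<omega> ^ 4 = \<omega> * \<omega> ^ 3"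
    by (simp flip: power_Suc)
  then have c: "\<omega> * \<omega>\<^sup>2 = 1" "\<omega>\<^sup>2 * \<omega> = 1" "\<omega> ^ 4 = \<omega>" "\<omega> * \<omega> = \<omega>\<^sup>2"
    using cube by (simp_all add: power2_eq_square power3_eq_cube mult.assoc)
  show ?thesis
    using exhaust_mod3[of x] exhaust_mod3[of y] by (elim disjE) (simp_all add: c)
qed

lemma root_char_nonzero [simp]: "root_char x \<noteq> 0"
  using root_nonzero by (simp add: root_char_def)

lemma root_char_minus: "root_char (- x) = inverse (root_char x)"
  using root_char_add[of x "- x"] by (simp add: field_simps)

lemma root_char_inj: "root_char x = root_char y \<longleftrightarrow> x = y"
proof -
  have p: "\<omega> ^ 3 = \<omega>\<^sup>2 * \<omega>" "\<omega>\<^sup>2 = \<omega> * \<omega>"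
    by (simp_all add: power2_eq_square power3_eq_cube)
  have a: "\<omega>\<^sup>2 \<noteq> 1"
  proof
    assume "\<omega>\<^sup>2 = 1"
    then show False using p(1) cube nontriv by simp
  qed
  have b: "\<omega>\<^sup>2 \<noteq> \<omega>"
  proof
    assume "\<omega>\<^sup>2 = \<omega>"
    then have "\<omega> * \<omega> = \<omega> * 1" using p(2) by simp
    then show False using root_nonzero nontriv by simp
  qed
  show ?thesis
    using exhaust_mod3[of x] exhaust_mod3[of y] a b not_sym[OF a] not_sym[OF b] nontriv not_sym[OF nontriv]
    by (elim disjE) simp_all
qed

lemma sum_root_char: "(\<Sum>x\<in>UNIV. root_char (x * y)) = (if y = 0 then 3 else 0)"
  using exhaust_mod3[of y] sum_roots by (elim disjE) (simp_all add: sum_mod3 add_ac)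

text \<open>For g = (i, j) this is b^i c^j times \<omega>^(ij). Modulo 3 the extra exponent is
  -ij/2, the symmetric ordering of b and c; it makes the multiplication cocycle a function of
  \<open>sympl\<close> alone.\<close>

definition pauli :: "3 ^ 2 \<Rightarrow> 'a jor" where
  "pauli g = (\<chi> r s. if r = s + g $ 2 then root_char (g $ 1 * (g $ 2 + r - 1)) else 0)"

lemma pauli_nth:
  "pauli g $ r $ s = (if r = s + g $ 2 then root_char (g $ 1 * (g $ 2 + r - 1)) else 0)"
  by (simp add: pauli_def)

text \<open>Over the integers the two exponents differ by 3bc. The defect is written as a threefold
  sum so that \<open>mod3_triple\<close> removes it once the identity is specialized to Z_3.\<close>

lemma pauli_exponent:
  "a * (b + r - 1) + c * (d + (r - b) - 1) =
    - (a * d - b * c) + (a + c) * ((b + d) + r - 1) - (b * c + b * c + b * c)"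
  for a :: "'b::comm_ring_1"
  by (simp add: algebra_simps)

lemma pauli_mult: "pauli g ** pauli h = mscale (root_char (- sympl g h)) (pauli (g + h))"
proof -
  have "(pauli g ** pauli h) $ r $ s = mscale (root_char (- sympl g h)) (pauli (g + h)) $ r $ s" for r s
  proof -
    have "(pauli g ** pauli h) $ r $ s =
        (\<Sum>t\<in>UNIV. if t = r - g $ 2 then pauli g $ r $ t * pauli h $ t $ s else 0)"
      unfolding matrix_mult_nth by (rule sum.cong) (auto simp: pauli_nth)
    also have "\<dots> = pauli g $ r $ (r - g $ 2) * pauli h $ (r - g $ 2) $ s" by simp
    also have "\<dots> = mscale (root_char (- sympl g h)) (pauli (g + h)) $ r $ s"
    proof (cases "r = s + (g + h) $ 2")
      case True
      have "g $ 1 * (g $ 2 + r - 1) + h $ 1 * (h $ 2 + (r - g $ 2) - 1) =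
          - sympl g h + (g + h) $ 1 * ((g + h) $ 2 + r - 1)"
        using pauli_exponent[of "g $ 1" "g $ 2" r "h $ 1" "h $ 2"]
        by (simp only: sympl_def vector_add_component mod3_triple(1) diff_0_right)
      then show ?thesis using True
        by (simp add: pauli_nth root_char_add[symmetric])
    next
      case False
      then have "r - g $ 2 \<noteq> s + h $ 2" by (auto simp: diff_eq_eq add_ac)
      with False show ?thesis by (simp add: pauli_nth)
    qed
    finally show ?thesis .
  qed
  then show ?thesis by (simp add: vec_eq_iff)
qed

lemma pauli_0: "pauli 0 = mat 1"
  by (simp add: vec_eq_iff pauli_nth mat_def)

lemma trace_pauli: "trace (pauli g) = (if g = 0 then 3 else 0)"
proof -
  have "trace (pauli g) = (\<Sum>r\<in>UNIV. if g $ 2 = 0 then root_char ((r - 1) * g $ 1) else 0)"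
    unfolding trace_def by (rule sum.cong) (auto simp: pauli_nth mult.commute)
  also have "\<dots> = (if g $ 2 = 0 then \<Sum>r\<in>UNIV. root_char (r * g $ 1) else 0)"
    using sum_mod3_shift(4)[of "\<lambda>r. root_char (r * g $ 1)" 1] by auto
  finally show ?thesis by (auto simp: sum_root_char vec2_eq_iff)
qed

lemma pauli_nonzero [simp]: "pauli g \<noteq> 0"
proof
  assume "pauli g = 0"
  then have "pauli g $ (0 + g $ 2) $ 0 = 0" by simp
  then show False by (simp add: pauli_nth)
qed

text \<open>Since \<open>pauli (- g)\<close> is inverse to \<open>pauli g\<close> and only the label
  0 has a nonzero trace, namely 3, this trace reads off the coefficient of
  \<open>pauli g\<close>.\<close>

definition coord :: "3 ^ 2 \<Rightarrow> 'a jor \<Rightarrow> 'a" where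
  "coord g M = trace (pauli (- g) ** M) / 3"

lemma coord_linear:
  "coord g (M + N) = coord g M + coord g N" "coord g (M - N) = coord g M - coord g N"
  "coord g (- M) = - coord g M" "coord g 0 = 0" "coord g (mscale k M) = k * coord g M"
  by (simp_all add: coord_def matrix_mult_add matrix_mult_diff matrix_mult_minus trace_linear
      mscale_matrix_mult add_divide_distrib diff_divide_distrib)

lemma coord_pauli: "coord g (pauli h) = (if g = h then 1 else 0)"
  by (auto simp: coord_def pauli_mult trace_linear trace_pauli)

lemma coord_nth: "coord g M = (\<Sum>r\<in>UNIV. root_char (- (g $ 1 * (g $ 2 + r - 1))) * M $ r $ (r - g $ 2)) / 3"
proof -
  have "(pauli (- g) ** M) $ s $ s = pauli (- g) $ s $ (s + g $ 2) * M $ (s + g $ 2) $ s" for s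
  proof -
    have "(pauli (- g) ** M) $ s $ s =
        (\<Sum>t\<in>UNIV. if t = s + g $ 2 then pauli (- g) $ s $ t * M $ t $ s else 0)"
      unfolding matrix_mult_nth by (rule sum.cong) (auto simp: pauli_nth)
    then show ?thesis by simp
  qed
  moreover have "pauli (- g) $ s $ (s + g $ 2) = root_char (- (g $ 1 * (g $ 2 + (s + g $ 2) - 1)))" for s
  proof -
    have "- a * (- b + s - 1) = - (a * (b + (s + b) - 1)) + a * (b + b + b)" for a b :: 3
      by (simp add: distrib_left right_diff_distrib)
    then have "- g $ 1 * (- g $ 2 + s - 1) = - (g $ 1 * (g $ 2 + (s + g $ 2) - 1))"
      by (simp only: mod3_triple mult_zero_right add_0_right)
    then show ?thesis by (simp add: pauli_nth del: mult_minus_left)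
  qed
  ultimately have "trace (pauli (- g) ** M) =
      (\<Sum>s\<in>UNIV. root_char (- (g $ 1 * (g $ 2 + (s + g $ 2) - 1))) * M $ (s + g $ 2) $ ((s + g $ 2) - g $ 2))"
    unfolding trace_def by simp
  also have "\<dots> = (\<Sum>r\<in>UNIV. root_char (- (g $ 1 * (g $ 2 + r - 1))) * M $ r $ (r - g $ 2))"
    by (rule sum_mod3_shift(1)[of "\<lambda>r. root_char (- (g $ 1 * (g $ 2 + r - 1))) * M $ r $ (r - g $ 2)" "g $ 2"])
  finally show ?thesis by (simp add: coord_def)
qed

text \<open>Fourier inversion instead of a dimension count: to the entry (r, s) only labels with
  second coordinate r - s contribute, and the sum of \<omega>^(x(r - t)) over x isolates t =
  r.\<close>

lemma pauli_expand: "(\<Sum>g\<in>UNIV. mscale (coord g M) (pauli g)) = M"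
proof -
  have "(\<Sum>g\<in>UNIV. mscale (coord g M) (pauli g)) $ r $ s = M $ r $ s" for r s
  proof -
    have "(\<Sum>g\<in>UNIV. mscale (coord g M) (pauli g)) $ r $ s =
        (\<Sum>x\<in>UNIV. \<Sum>y\<in>UNIV. if y = r - s then coord (vector [x, y]) M * pauli (vector [x, y]) $ r $ s else 0)"
      unfolding sum_vec2 sum_component
      by (intro sum.cong refl) (auto simp: pauli_nth)
    also have "\<dots> = (\<Sum>x\<in>UNIV. coord (vector [x, r - s]) M * pauli (vector [x, r - s]) $ r $ s)"
      by simp
    also have "\<dots> = (\<Sum>x\<in>UNIV. \<Sum>t\<in>UNIV. root_char (x * (r - t)) * (M $ t $ (t - (r - s)) / 3))"
    proof (rule sum.cong)
      fix x :: 3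
      have *: "root_char (- (x * (r - s + t - 1))) * root_char (x * (r - s + r - 1)) = root_char (x * (r - t))" for t
        unfolding root_char_add[symmetric] right_diff_distrib distrib_left by (simp add: mult.commute)
      show "coord (vector [x, r - s]) M * pauli (vector [x, r - s]) $ r $ s =
          (\<Sum>t\<in>UNIV. root_char (x * (r - t)) * (M $ t $ (t - (r - s)) / 3))"
        unfolding *[symmetric] coord_nth pauli_nth sum_distrib_right sum_divide_distrib
        by (rule sum.cong) (simp_all add: mult_ac)
    qed simp
    also have "\<dots> = (\<Sum>t\<in>UNIV. \<Sum>x\<in>UNIV. root_char (x * (r - t)) * (M $ t $ (t - (r - s)) / 3))"
      by (rule sum.swap)
    also have "\<dots> = (\<Sum>t\<in>UNIV. if t = r then M $ r $ s else 0)"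
      unfolding sum_distrib_right[symmetric] sum_root_char by (intro sum.cong) auto
    finally show ?thesis by simp
  qed
  then show ?thesis by (simp add: vec_eq_iff)
qed

lemma matrix_power_Suc: "matrix_power x (Suc n) = x ** matrix_power x n"
  by (simp add: matrix_power_def)

end

section \<open>Linear maps of matrices, the cross product and tracefree parts\<close>

definition mlin :: "('b::field ^ 3 ^ 3 \<Rightarrow> 'b ^ 3 ^ 3) \<Rightarrow> bool" where
  "mlin f \<longleftrightarrow> (\<forall>x y. f (x + y) = f x + f y) \<and> (\<forall>k x. f (mscale k x) = mscale k (f x))"

lemma mlin_simps:
  assumes "mlin f"
  shows "f (x + y) = f x + f y" "f (mscale k x) = mscale k (f x)" "f (- x) = - f x"
    "f (x - y) = f x - f y" "f 0 = 0"
proof -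
  show a: "f (x + y) = f x + f y" "f (mscale k x) = mscale k (f x)" for x y k
    using assms by (auto simp: mlin_def)
  have m: "mscale (-1) z = - z" for z :: "'a jor" by (simp add: vec_eq_iff)
  show n: "f (- x) = - f x" for x using a(2)[of "-1" x] by (simp add: m)
  show "f (x - y) = f x - f y" using a(1)[of x "- y"] by (simp add: n)
  show "f 0 = 0" using a(2)[of 0 0] by simp
qed

lemma mlin_sum: "mlin f \<Longrightarrow> f (sum h I) = (\<Sum>i\<in>I. f (h i))"
  by (induction I rule: infinite_finite_induct) (simp_all add: mlin_simps)

text \<open>The polarized adjugate, also known as the Freudenthal cross product: by Cayley-Hamilton
  \<open>mcross M M\<close> is twice the adjugate of M. If A and B have determinant 1, replacing M,
  N by A M B, A N B turns the value C into B^-1 C A^-1, so the values belong to the dual of the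
  space of arguments.\<close>

definition mcross :: "'b::field jor \<Rightarrow> 'b jor \<Rightarrow> 'b jor" where
  "mcross M N = M ** N + N ** M - mscale (trace M) N - mscale (trace N) M
     + mscale (trace M * trace N - trace (M ** N)) (mat 1)"

lemma mcross_linear:
  "mcross (M + M') N = mcross M N + mcross M' N" "mcross M (N + N') = mcross M N + mcross M N'"
  "mcross (M - M') N = mcross M N - mcross M' N" "mcross M (N - N') = mcross M N - mcross M N'"
  "mcross (mscale k M) N = mscale k (mcross M N)" "mcross M (mscale k N) = mscale k (mcross M N)"
  "mcross 0 N = 0" "mcross M 0 = 0" "mcross (- M) N = - mcross M N" "mcross M (- N) = - mcross M N"
  by (simp_all add: mcross_def matrix_mult_add matrix_mult_diff matrix_mult_minus mscale_matrix_mult trace_linear vec_eq_iff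
      algebra_simps)

lemma mlin_intros:
  "mlin (\<lambda>x. x)" "mlin (\<lambda>x. x ** y)" "mlin (\<lambda>x. y ** x)" "mlin (mcross y)" "mlin (\<lambda>x. mcross x y)"
  by (auto simp: mlin_def matrix_mult_add mscale_matrix_mult mcross_linear)

lemma mlin_comp: "mlin f \<Longrightarrow> mlin h \<Longrightarrow> mlin (\<lambda>x. f (h x))"
  by (auto simp: mlin_def)

definition tracefree :: "'b::field jor \<Rightarrow> 'b jor" where
  "tracefree M = M - mscale (trace M / 3) (mat 1)"

lemma tracefree_linear:
  "tracefree (x + y) = tracefree x + tracefree y" "tracefree (x - y) = tracefree x - tracefree y"
  "tracefree (- x) = - tracefree x" "tracefree (mscale k x) = mscale k (tracefree x)" "tracefree 0 = 0"
  by (simp_all add: tracefree_def trace_linear mscale_diff mscale_mscale vec_eq_iff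
      add_divide_distrib diff_divide_distrib algebra_simps)

lemma trace_tracefree [simp]: "trace (tracefree M) = (0 :: 'b::field_char_0)"
  by (simp add: tracefree_def trace_linear trace_mat_1)

lemma tracefree_eq: "trace M = 0 \<Longrightarrow> tracefree M = M"
  by (simp add: tracefree_def)

text \<open>The form is nondegenerate on a plane, so the orthogonal space of h is the line through
  h, and over Z_3 a line has just the points 0, h and -h.\<close>

lemma sympl_eq_0_cases:
  assumes "sympl h k = 0" "h \<noteq> 0"
  shows "k = 0 \<or> k = h \<or> k = - h"
proof -
  have a: "a * d - b * c = 0 \<Longrightarrow> \<not> (a = 0 \<and> b = 0) \<Longrightarrow>
      (c = 0 \<and> d = 0) \<or> (c = a \<and> d = b) \<or> (c = - a \<and> d = - b)" for a b c d :: 3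
    using exhaust_mod3[of a] exhaust_mod3[of b] exhaust_mod3[of c] exhaust_mod3[of d]
    by (elim disjE; simp)
  show ?thesis
    using a[of "h $ 1" "k $ 2" "h $ 2" "k $ 1"] assms by (auto simp: vec2_eq_iff sympl_def)
qed

lemma vec3_double_eq_0: "h + h = 0 \<longleftrightarrow> h = 0" for h :: "3 ^ 2"
proof -
  have "x + x = 0 \<longleftrightarrow> x = 0" for x :: 3
    using exhaust_mod3[of x] by (elim disjE; simp)
  then show ?thesis by (simp add: vec2_eq_iff)
qed

context cube_root
begin

lemma mlin_expand: "mlin f \<Longrightarrow> f M = (\<Sum>g\<in>UNIV. mscale (coord g M) (f (pauli g)))"
  by (subst pauli_expand[of M, symmetric]) (simp add: mlin_sum mlin_simps)

lemma mlin_eqI: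
  assumes "mlin f" "mlin h" "\<And>g. f (pauli g) = h (pauli g)"
  shows "f M = h M"
  by (subst (1 2) mlin_expand) (simp_all add: assms)

text \<open>Reduces bilinear identities between matrices to pairs of Pauli matrices, where they
  become identities between exponents of \<omega>.\<close>

lemma mlin2_eqI:
  assumes "\<And>y. mlin (\<lambda>x. f x y)" "\<And>y. mlin (\<lambda>x. h x y)" "\<And>x. mlin (f x)" "\<And>x. mlin (h x)"
    and "\<And>g k. f (pauli g) (pauli k) = h (pauli g) (pauli k)"
  shows "f M N = h M N"
proof (rule mlin_eqI[where f = "\<lambda>x. f x N" and h = "\<lambda>x. h x N"])
  show "f (pauli g) N = h (pauli g) N" for g
    by (rule mlin_eqI) (use assms in auto)
qed (use assms in auto)

lemma root_char_pm: "s \<noteq> 0 \<Longrightarrow> root_char s + root_char (- s) = -1"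
  using exhaust_mod3[of s] sum_roots eq_neg_iff_add_eq_0[of "\<omega> + \<omega>\<^sup>2" 1]
  by (elim disjE) (simp_all add: add_ac)

text \<open>For h nonzero and k off the line through h, the two matrix products contribute
  \<omega>^s + \<omega>^(-s) = -1 with s nonzero. For k = 0 and k = -h the products contribute 2 and
  the trace terms subtract 3. That the coefficient depends only on whether h = k makes it invariant
  under translation of both labels.\<close>

lemma mcross_pauli: "mcross (pauli h) (pauli k) = mscale (if h = k then 2 else -1) (pauli (h + k))"
proof -
  have p: "mcross (pauli h) (pauli k) = mscale (root_char (- sympl h k) + root_char (sympl h k)) (pauli (h + k))
      - mscale (trace (pauli h)) (pauli k) - mscale (trace (pauli k)) (pauli h)
      + mscale (trace (pauli h) * trace (pauli k) - root_char (- sympl h k) * trace (pauli (h + k))) (pauli 0)"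
    by (simp add: mcross_def pauli_mult sympl_sym[of k h] add.commute[of k h] pauli_0 trace_linear)
      (simp add: vec_eq_iff algebra_simps)
  consider "h = 0" "k = 0" | "h = 0" "k \<noteq> 0" | "h \<noteq> 0" "k = 0" | "h \<noteq> 0" "k = h" | "h \<noteq> 0" "k = - h" "k \<noteq> h"
    | "h \<noteq> 0" "k \<noteq> 0" "k \<noteq> h" "k \<noteq> - h"
    by blast
  then show ?thesis
  proof cases
    case 4
    then show ?thesis using vec3_double_eq_0[of h] unfolding p by (simp add: trace_pauli)
  next
    case 5
    then show ?thesis unfolding p by (simp add: trace_pauli) (simp add: vec_eq_iff algebra_simps)
  next
    case 6
    then have "sympl h k \<noteq> 0" "h + k \<noteq> 0"
      using sympl_eq_0_cases[of h k] by (auto simp: add_eq_0_iff)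
    then show ?thesis using 6 root_char_pm[of "sympl h k"] unfolding p by (simp add: trace_pauli add.commute)
  qed (unfold p, (simp_all add: trace_pauli)?, (simp_all add: vec_eq_iff algebra_simps)?)
qed

lemma jor_b_pauli: "jor_b \<omega> = pauli (vector [1, 0])"
  by (simp add: vec_eq_iff forall_mod3 pauli_nth jor_b_def matrix_unit_def)

lemma jor_c_pauli: "jor_c = pauli (vector [0, 1])"
  by (simp add: vec_eq_iff forall_mod3 pauli_nth jor_c_def matrix_unit_def)

lemma matrix_power_b: "matrix_power (jor_b \<omega>) n = pauli (vector [of_nat n, 0])"
proof (induction n)
  case (Suc n)
  then show ?case
    by (simp add: matrix_power_Suc jor_b_pauli pauli_mult sympl_def)
      (simp add: vec_eq_iff pauli_nth forall_2)
qed (simp add: matrix_power_def pauli_0[symmetric] vec_eq_iff pauli_nth)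

lemma matrix_power_c: "matrix_power jor_c n = pauli (vector [0, of_nat n])"
proof (induction n)
  case (Suc n)
  then show ?case
    by (simp add: matrix_power_Suc jor_c_pauli pauli_mult sympl_def)
      (simp add: vec_eq_iff pauli_nth forall_2)
qed (simp add: matrix_power_def pauli_0[symmetric] vec_eq_iff pauli_nth)

lemma jor_component_eq: "jor_component \<omega> g = range (\<lambda>k. mscale k (pauli g))"
proof -
  interpret module "mscale :: 'a \<Rightarrow> _ \<Rightarrow> 'a jor" by (rule module_mscale)
  let ?S = "{matrix_power (jor_b \<omega>) i ** matrix_power jor_c j | i j. vector [of_nat i, of_nat j] = g}"
  have eq: "matrix_power (jor_b \<omega>) i ** matrix_power jor_c j =
      mscale (root_char (- (of_nat i * of_nat j))) (pauli (vector [of_nat i, of_nat j]))" for i j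
  proof -
    have "vector [of_nat i, 0] + vector [0, of_nat j] = (vector [of_nat i, of_nat j] :: 3 ^ 2)"
      by (simp add: vec2_eq_iff)
    then show ?thesis
      by (simp add: matrix_power_b matrix_power_c pauli_mult sympl_def)
  qed
  \<comment> \<open>The spanning set runs over natural exponents, infinitely many for each degree;
    one pair of representatives of g is enough for the lower inclusion.\<close>
  have ex: "\<exists>i. of_nat i = x" for x :: 3
    using exhaust_mod3[of x] by (metis of_nat_0 of_nat_1 of_nat_numeral)
  obtain i j where ij: "of_nat i = g $ 1" "of_nat j = g $ 2" using ex by metis
  then have g: "vector [of_nat i, of_nat j] = g" by (simp add: vector_eta2)
  show ?thesis
  proof
    have "?S \<subseteq> range (\<lambda>k. mscale k (pauli g))" using eq by auto
    moreover have "subspace (range (\<lambda>k. mscale k (pauli g)))"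
      by (auto simp: subspace_def image_iff mscale_mscale scale_left_distrib[symmetric] intro: exI[of _ 0])
    ultimately show "jor_component \<omega> g \<subseteq> range (\<lambda>k. mscale k (pauli g))"
      unfolding jor_component_def by (rule span_minimal)
  next
    have "matrix_power (jor_b \<omega>) i ** matrix_power jor_c j \<in> span ?S"
      using g by (intro span_base) blast
    then have "mscale (root_char (- (of_nat i * of_nat j))) (pauli g) \<in> span ?S"
      using eq[of i j] g by simp
    then have "mscale k (mscale (root_char (- (of_nat i * of_nat j))) (pauli g)) \<in> span ?S" for k
      by (rule span_scale)
    from this[of "k / root_char (- (of_nat i * of_nat j))" for k]
    show "range (\<lambda>k. mscale k (pauli g)) \<subseteq> jor_component \<omega> g"
      unfolding jor_component_def by (auto simp: mscale_mscale)
  qed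
qed

lemma jor_component_iff: "M \<in> jor_component \<omega> g \<longleftrightarrow> M = mscale (coord g M) (pauli g)"
  by (auto simp: jor_component_eq coord_linear coord_pauli)

lemma jor_component_linear:
  "0 \<in> jor_component \<omega> g"
  "M \<in> jor_component \<omega> g \<Longrightarrow> N \<in> jor_component \<omega> g \<Longrightarrow> M + N \<in> jor_component \<omega> g"
  "M \<in> jor_component \<omega> g \<Longrightarrow> N \<in> jor_component \<omega> g \<Longrightarrow> M - N \<in> jor_component \<omega> g"
  "M \<in> jor_component \<omega> g \<Longrightarrow> mscale k M \<in> jor_component \<omega> g"
  "M \<in> jor_component \<omega> g \<Longrightarrow> - M \<in> jor_component \<omega> g"
proof -
  show "0 \<in> jor_component \<omega> g" by (simp add: jor_component_iff coord_linear)
  assume M: "M \<in> jor_component \<omega> g"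
  then obtain k where k: "M = mscale k (pauli g)" by (auto simp: jor_component_eq)
  show "mscale l M \<in> jor_component \<omega> g" for l
    unfolding jor_component_eq k mscale_mscale by blast
  have "- M = mscale (- k) (pauli g)" by (simp add: k vec_eq_iff)
  then show "- M \<in> jor_component \<omega> g" unfolding jor_component_eq by blast
  assume "N \<in> jor_component \<omega> g"
  then obtain l where l: "N = mscale l (pauli g)" by (auto simp: jor_component_eq)
  have "M + N = mscale (k + l) (pauli g)" "M - N = mscale (k - l) (pauli g)"
    by (simp_all add: k l vec_eq_iff algebra_simps)
  then show "M + N \<in> jor_component \<omega> g" "M - N \<in> jor_component \<omega> g"
    unfolding jor_component_eq by blast+
qed

lemma jor_component_mult:
  assumes "M \<in> jor_component \<omega> g" "N \<in> jor_component \<omega> h"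
  shows "M ** N \<in> jor_component \<omega> (g + h)" "mcross M N \<in> jor_component \<omega> (g + h)"
proof -
  obtain k l where "M = mscale k (pauli g)" "N = mscale l (pauli h)"
    using assms by (auto simp: jor_component_eq)
  then show "M ** N \<in> jor_component \<omega> (g + h)" "mcross M N \<in> jor_component \<omega> (g + h)"
    by (simp_all add: mscale_matrix_mult pauli_mult mcross_linear mcross_pauli mscale_mscale jor_component_eq)
qed

lemma trace_jor_component: "M \<in> jor_component \<omega> g \<Longrightarrow> g \<noteq> 0 \<Longrightarrow> trace M = 0"
  by (auto simp: jor_component_eq trace_linear trace_pauli)

lemma trace_eq_coord: "trace M = 3 * coord 0 M"
  by (simp add: coord_def pauli_0)

lemma tracefree_jor_component:
  "M \<in> jor_component \<omega> g \<Longrightarrow> tracefree M = (if g = 0 then 0 else M)"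
  using trace_jor_component[of M g]
  by (auto simp: tracefree_eq) (auto simp: jor_component_eq tracefree_def trace_linear trace_pauli pauli_0 trace_mat_1)

end

section \<open>Derivations of the octonions\<close>

lemma forall_octix: "(\<forall>i. R i) \<longleftrightarrow> R E1 \<and> R E2 \<and> (\<forall>k. R (U k)) \<and> (\<forall>k. R (V k))"
  by (metis octix.exhaust)

lemma sum_octix: "sum f UNIV = f E1 + f E2 + (\<Sum>k\<in>UNIV. f (U k)) + (\<Sum>k\<in>UNIV. f (V k))"
proof -
  have "sum f UNIV = sum f {E1, E2} + sum f (range U \<union> range V)"
    unfolding UNIV_octix Un_assoc by (rule sum.union_disjoint) auto
  also have "sum f (range U \<union> range V) = sum f (range U) + sum f (range V)"
    by (rule sum.union_disjoint) auto
  finally show ?thesis by (simp add: sum.reindex inj_def add.assoc)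
qed

lemma axis_nth_if: "axis i x $ j = (if j = i then x else 0)"
  by (simp add: axis_def)

lemma oct_mult_nth:
  "oct_mult x y $ E1 = x $ E1 * y $ E1 - (\<Sum>k\<in>UNIV. x $ U k * y $ V k)"
  "oct_mult x y $ E2 = x $ E2 * y $ E2 - (\<Sum>k\<in>UNIV. x $ V k * y $ U k)"
  "oct_mult x y $ U k = x $ E1 * y $ U k + x $ U k * y $ E2
     + (x $ V (k + 1) * y $ V (k + 2) - x $ V (k + 2) * y $ V (k + 1))"
  "oct_mult x y $ V k = x $ E2 * y $ V k + x $ V k * y $ E1
     + (x $ U (k + 1) * y $ U (k + 2) - x $ U (k + 2) * y $ U (k + 1))"
proof -
  show "oct_mult x y $ E1 = x $ E1 * y $ E1 - (\<Sum>k\<in>UNIV. x $ U k * y $ V k)"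
    and "oct_mult x y $ E2 = x $ E2 * y $ E2 - (\<Sum>k\<in>UNIV. x $ V k * y $ U k)"
    by (simp_all add: oct_mult_def sum_octix sum_mod3 axis_nth_if)
  show "oct_mult x y $ U k = x $ E1 * y $ U k + x $ U k * y $ E2
     + (x $ V (k + 1) * y $ V (k + 2) - x $ V (k + 2) * y $ V (k + 1))"
    and "oct_mult x y $ V k = x $ E2 * y $ V k + x $ V k * y $ E1
     + (x $ U (k + 1) * y $ U (k + 2) - x $ U (k + 2) * y $ U (k + 1))"
    using exhaust_mod3[of k]
    by (elim disjE; simp add: oct_mult_def sum_octix sum_mod3 axis_nth_if mod3_simps)+
qed

text \<open>The decomposition of G2 under its subalgebra sl_3. K acts on the span of the u_i and
  minus its transpose on the span of the v_i; p and q record the image of e_1, which has coordinates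
  p at the u_k and -q at the v_k.\<close>

definition oct_der :: "'b::field ^ 3 ^ 3 \<Rightarrow> 'b ^ 3 \<Rightarrow> 'b ^ 3 \<Rightarrow> 'b oct \<Rightarrow> 'b oct" where
  "oct_der K p q z = (\<chi> i. case i of
      E1 \<Rightarrow> (\<Sum>k\<in>UNIV. p $ k * z $ V k) - (\<Sum>k\<in>UNIV. q $ k * z $ U k)
    | E2 \<Rightarrow> (\<Sum>k\<in>UNIV. q $ k * z $ U k) - (\<Sum>k\<in>UNIV. p $ k * z $ V k)
    | U k \<Rightarrow> (z $ E1 - z $ E2) * p $ k + (\<Sum>l\<in>UNIV. K $ k $ l * z $ U l)
        + (q $ (k + 1) * z $ V (k + 2) - q $ (k + 2) * z $ V (k + 1))
    | V k \<Rightarrow> (z $ E2 - z $ E1) * q $ k - (\<Sum>l\<in>UNIV. K $ l $ k * z $ V l)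
        + (p $ (k + 1) * z $ U (k + 2) - p $ (k + 2) * z $ U (k + 1)))"

lemma oct_der_nth:
  "oct_der K p q z $ E1 = (\<Sum>k\<in>UNIV. p $ k * z $ V k) - (\<Sum>k\<in>UNIV. q $ k * z $ U k)"
  "oct_der K p q z $ E2 = (\<Sum>k\<in>UNIV. q $ k * z $ U k) - (\<Sum>k\<in>UNIV. p $ k * z $ V k)"
  "oct_der K p q z $ U k = (z $ E1 - z $ E2) * p $ k + (\<Sum>l\<in>UNIV. K $ k $ l * z $ U l)
        + (q $ (k + 1) * z $ V (k + 2) - q $ (k + 2) * z $ V (k + 1))"
  "oct_der K p q z $ V k = (z $ E2 - z $ E1) * q $ k - (\<Sum>l\<in>UNIV. K $ l $ k * z $ V l)
        + (p $ (k + 1) * z $ U (k + 2) - p $ (k + 2) * z $ U (k + 1))"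
  by (simp_all add: oct_der_def)

lemma trace_3: "trace M = M $ 0 $ 0 + M $ 1 $ 1 + M $ 2 $ 2" for M :: "'b::semiring_1 ^ 3 ^ 3"
  by (simp add: trace_def sum_mod3)

lemma oct_der_linear: "Vector_Spaces.linear (*s) (*s) (oct_der K p q)"
  by (rule vec_linearI)
    (simp_all add: vec_eq_iff forall_octix oct_der_nth sum.distrib sum_distrib_left algebra_simps)

lemma oct_der_split: "oct_der K p q z = oct_der K 0 0 z + oct_der 0 p 0 z + oct_der 0 0 q z"
  by (simp add: vec_eq_iff forall_octix oct_der_nth)

lemma mod3_index [simp]:
  "(1 + 1 :: 3) = 2" "(2 + 1 :: 3) = 0" "(1 + 2 :: 3) = 0" "(2 + 2 :: 3) = 1"
  by simp_all

lemma oct_der_in_Der: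
  assumes "trace K = 0"
  shows "oct_der K p q \<in> Der_oct"
proof -
  have K: "K $ 2 $ 2 = - K $ 0 $ 0 - K $ 1 $ 1"
    using assms by (simp add: trace_3 algebra_simps eq_neg_iff_add_eq_0)
  note s = oct_der_nth oct_mult_nth sum_mod3 mod3_index zero_index add_0 mult_zero_left mult_zero_right
    sum.neutral_const diff_0_right add_0_right diff_0 diff_self minus_zero vector_add_component
  \<comment> \<open>The Leibniz rule is additive in the derivation, so the three blocks are treated
    separately, which keeps the polynomial identities small.\<close>
  have 1: "oct_der K 0 0 (oct_mult x y) = oct_mult (oct_der K 0 0 x) y + oct_mult x (oct_der K 0 0 y)" for x y
    unfolding vec_eq_iff forall_octix forall_mod3
    by (intro conjI; simp only: s K; simp add: algebra_simps)
  have 2: "oct_der 0 p 0 (oct_mult x y) = oct_mult (oct_der 0 p 0 x) y + oct_mult x (oct_der 0 p 0 y)" for x y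
    unfolding vec_eq_iff forall_octix forall_mod3
    by (intro conjI; simp only: s; simp add: algebra_simps)
  have 3: "oct_der 0 0 q (oct_mult x y) = oct_mult (oct_der 0 0 q x) y + oct_mult x (oct_der 0 0 q y)" for x y
    unfolding vec_eq_iff forall_octix forall_mod3
    by (intro conjI; simp only: s; simp add: algebra_simps)
  have "oct_der K p q (oct_mult x y) = oct_mult (oct_der K p q x) y + oct_mult x (oct_der K p q y)" for x y
    unfolding oct_der_split[of K p q] 1 2 3 oct_mult_left_linear oct_mult_right_linear by (simp add: algebra_simps)
  then show ?thesis by (simp add: Der_oct_def oct_der_linear)
qed

lemma oct_der_basis:
  "oct_der K p q (oct_basis E1) $ E1 = 0" "oct_der K p q (oct_basis E1) $ E2 = 0"
  "oct_der K p q (oct_basis E1) $ U k = p $ k" "oct_der K p q (oct_basis E1) $ V k = - q $ k"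
  "oct_der K p q (oct_basis E2) $ E1 = 0" "oct_der K p q (oct_basis E2) $ E2 = 0"
  "oct_der K p q (oct_basis E2) $ U k = - p $ k" "oct_der K p q (oct_basis E2) $ V k = q $ k"
  "oct_der K p q (oct_basis (U l)) $ E1 = - q $ l" "oct_der K p q (oct_basis (U l)) $ E2 = q $ l"
  "oct_der K p q (oct_basis (U l)) $ U k = K $ k $ l"
  "oct_der K p q (oct_basis (U l)) $ V k =
     (if l = k + 2 then p $ (k + 1) else if l = k + 1 then - p $ (k + 2) else 0)"
  "oct_der K p q (oct_basis (V l)) $ E1 = p $ l" "oct_der K p q (oct_basis (V l)) $ E2 = - p $ l"
  "oct_der K p q (oct_basis (V l)) $ U k =
     (if l = k + 2 then q $ (k + 1) else if l = k + 1 then - q $ (k + 2) else 0)"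
  "oct_der K p q (oct_basis (V l)) $ V k = - K $ l $ k"
  by (auto simp: oct_der_nth axis_nth_if if_distrib[of "(*) _"] cong: if_cong)

lemma oct_der_inject: "oct_der K p q = oct_der K' p' q' \<longleftrightarrow> K = K' \<and> p = p' \<and> q = q'"
proof
  assume eq: "oct_der K p q = oct_der K' p' q'"
  show "K = K' \<and> p = p' \<and> q = q'"
    using oct_der_basis[of K p q] oct_der_basis[of K' p' q'] unfolding eq by (simp add: vec_eq_iff)
qed simp

lemma oct_linear_eqI:
  assumes "Vector_Spaces.linear (*s) (*s) f" "Vector_Spaces.linear (*s) (*s) h"
    and "\<And>i. f (oct_basis i) = h (oct_basis i)"
  shows "f = (h :: 'b::field oct \<Rightarrow> 'b oct)"
proof
  fix a
  have "f a = (\<Sum>i\<in>UNIV. a $ i *s h (oct_basis i))"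
    unfolding assms(3)[symmetric] by (rule oct_linear_expand[OF assms(1)])
  then show "f a = h a"
    using oct_linear_expand[OF assms(2), of a] by simp
qed

text \<open>The multiplication table forces everything. Idempotence kills the e-coordinates of
  d(e_1) and d(e_2), and e_1 e_2 = e_2 e_1 = 0 gives d(e_2) = -d(e_1). Products of an idempotent
  with u_j or v_j then fix all coordinates outside the matrix K and its dual; the products u_i v_j
  make the dual equal to minus the transpose, and u_1 u_2 = v_3 forces trace zero.\<close>

lemma Der_oct_cases:
  fixes d :: "'b::field_char_0 oct \<Rightarrow> 'b oct"
  assumes "d \<in> Der_oct"
  obtains K p q where "trace K = 0" "d = oct_der K p q"
proof -
  let ?e = "oct_basis :: octix \<Rightarrow> 'b oct"
  interpret Vector_Spaces.linear "(*s)" "(*s)" d using assms by (simp add: Der_oct_def)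
  have D: "d (oct_table i j) $ k = oct_mult (d (?e i)) (?e j) $ k + oct_mult (?e i) (d (?e j)) $ k" for i j k
    using assms unfolding oct_mult_basis[symmetric] by (simp add: Der_oct_def)
  define K where "K = (\<chi> i j. d (?e (U j)) $ U i)"
  define p where "p = (\<chi> i. d (?e E1) $ U i)"
  define q where "q = (\<chi> i. - d (?e E1) $ V i)"
  note s = oct_mult_nth sum_mod3 axis_nth_if mod3_simps zero neg
  have e1: "d (?e E1) $ E1 = 0" "d (?e E1) $ E2 = 0"
    using D[of E1 E1 E1] D[of E1 E1 E2] by (simp_all add: s)
  have e2: "d (?e E2) $ E1 = 0" "d (?e E2) $ E2 = 0"
    using D[of E2 E2 E1] D[of E2 E2 E2] by (simp_all add: s)
  have e3: "d (?e E2) $ U k = - d (?e E1) $ U k" "d (?e E2) $ V k = - d (?e E1) $ V k" for k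
    using D[of E1 E2 "U k"] D[of E2 E1 "V k"] by (simp_all add: s eq_neg_iff_add_eq_0 add.commute)
  have u: "d (?e (U j)) $ E2 = q $ j" "d (?e (U j)) $ E1 = - q $ j" for j
    using D[of E1 "U j" E2] D[of "U j" E2 E1] exhaust_mod3[of j]
    by (elim disjE; simp add: s e1 e2 e3 q_def)+
  have uV: "d (?e (U j)) $ V k = oct_der K p q (?e (U j)) $ V k" for j k
    using D[of E1 "U j" "V k"] exhaust_mod3[of j] exhaust_mod3[of k]
    by (elim disjE; simp add: s e1 e2 e3 oct_der_nth p_def)
  have v: "d (?e (V j)) $ E1 = p $ j" "d (?e (V j)) $ E2 = - p $ j" for j
    using D[of E2 "V j" E1] D[of "V j" E1 E2] exhaust_mod3[of j]
    by (elim disjE; simp add: s e1 e2 e3 p_def)+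
  have vU: "d (?e (V j)) $ U k = oct_der K p q (?e (V j)) $ U k" for j k
    using D[of E2 "V j" "U k"] exhaust_mod3[of j] exhaust_mod3[of k]
    by (elim disjE; simp add: s e1 e2 e3 oct_der_nth q_def)
  have vV: "d (?e (V j)) $ V i = - K $ j $ i" for i j
    using D[of "U i" "V j" E1] exhaust_mod3[of j] exhaust_mod3[of i]
    by (elim disjE; simp add: s e1 K_def; simp add: minus_equation_iff)
  have "- K $ 0 $ 0 = K $ 1 $ 1 + K $ 2 $ 2"
    using D[of "U 1" "U 2" "V 0"] vV[of 0 0] by (simp add: s K_def add_ac)
  then have tr: "trace K = 0" by (simp add: trace_3 algebra_simps neg_eq_iff_add_eq_0)
  have "d (?e i) $ k = oct_der K p q (?e i) $ k" for i k
  proof (cases i)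
    case E1
    then show ?thesis
      by (cases k) (simp_all add: e1 oct_der_nth axis_nth_if p_def q_def)
  next
    case E2
    then show ?thesis
      by (cases k) (simp_all add: e2 e3 oct_der_nth axis_nth_if p_def q_def)
  next
    case (U j)
    then show ?thesis
      using exhaust_mod3[of j] by (cases k) (auto simp: u uV oct_der_basis K_def oct_der_nth axis_nth_if sum_mod3)
  next
    case (V j)
    then show ?thesis
      using exhaust_mod3[of j] by (cases k) (auto simp: v vU vV oct_der_nth axis_nth_if sum_mod3)
  qed
  then have "d (?e i) = oct_der K p q (?e i)" for i by (simp add: vec_eq_iff)
  then have "d = oct_der K p q"
    by (intro oct_linear_eqI oct_der_linear linear_axioms)
  with tr that show thesis by blast
qed

lemma oct_component_iff: "a \<in> oct_component h \<longleftrightarrow> (\<forall>i. a $ i \<noteq> 0 \<longrightarrow> oct_degree i = h)"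
  for a :: "'b::field oct"
proof
  let ?S = "{oct_basis k | k. oct_degree k = h}"
  have "vec.span ?S \<subseteq> {a. \<forall>i. a $ i \<noteq> 0 \<longrightarrow> oct_degree i = h}"
    by (rule vec.span_minimal)
      (auto simp: vec.subspace_def axis_nth_if split: if_splits, metis add_0 add_cancel_right_right)
  then show "a \<in> oct_component h \<Longrightarrow> \<forall>i. a $ i \<noteq> 0 \<longrightarrow> oct_degree i = h"
    by (auto simp: oct_component_def)
next
  let ?S = "{oct_basis k | k. oct_degree k = h} :: 'b oct set"
  assume a: "\<forall>i. a $ i \<noteq> 0 \<longrightarrow> oct_degree i = h"
  have "a $ i *s oct_basis i \<in> vec.span ?S" for i
  proof (cases "a $ i = 0")
    case False
    then show ?thesis using a by (intro vec.span_scale vec.span_base) auto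
  qed (simp add: vec.span_zero)
  then have "(\<Sum>i\<in>UNIV. a $ i *s oct_basis i) \<in> vec.span ?S"
    by (intro vec.span_sum) auto
  then show "a \<in> oct_component h"
    by (simp add: oct_component_def basis_expansion)
qed

lemma u_degree_sum: "u_degree k + u_degree (k + 1) + u_degree (k + 2) = 0"
  using exhaust_mod3[of k] by (elim disjE) (simp_all add: u_degree_def vec2_eq_iff mod3_simps)

lemma u_degree_sums:
  "u_degree (k + 1) + u_degree (k + 2) = - u_degree k" "u_degree (k + 2) + u_degree (k + 1) = - u_degree k"
  "- u_degree (k + 1) - u_degree (k + 2) = u_degree k" "- u_degree (k + 2) - u_degree (k + 1) = u_degree k"
proof -
  have "a + b + c = 0 \<Longrightarrow> b + c = - a \<and> c + b = - a \<and> - b - c = a \<and> - c - b = a" for a b c :: "int ^ 2"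
    by (simp add: vec_eq_iff forall_2)
  from this[OF u_degree_sum[of k]]
  show "u_degree (k + 1) + u_degree (k + 2) = - u_degree k" "u_degree (k + 2) + u_degree (k + 1) = - u_degree k"
    "- u_degree (k + 1) - u_degree (k + 2) = u_degree k" "- u_degree (k + 2) - u_degree (k + 1) = u_degree k"
    by blast+
qed

lemma u_degree_inject: "u_degree i = u_degree j \<longleftrightarrow> i = j"
  using exhaust_mod3[of i] exhaust_mod3[of j]
  by (elim disjE) (simp_all add: u_degree_def vec2_eq_iff)

definition g2_component :: "int ^ 2 \<Rightarrow> 'b::field ^ 3 ^ 3 \<Rightarrow> 'b ^ 3 \<Rightarrow> 'b ^ 3 \<Rightarrow> bool" where
  "g2_component h K p q \<longleftrightarrow> (\<forall>i j. K $ i $ j \<noteq> 0 \<longrightarrow> u_degree i - u_degree j = h) \<and>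
     (\<forall>i. p $ i \<noteq> 0 \<longrightarrow> u_degree i = h) \<and> (\<forall>i. q $ i \<noteq> 0 \<longrightarrow> - u_degree i = h)"

text \<open>The images of e_1 and of the u_j display p, q and K, which gives one direction. In the
  other, the cross terms of \<open>oct_der\<close> are homogeneous because the degrees at k + 1 and
  k + 2 sum to minus the degree at k.\<close>

lemma oct_der_component_iff:
  fixes K :: "'b::field_char_0 ^ 3 ^ 3"
  assumes "trace K = 0"
  shows "oct_der K p q \<in> Der_oct_component h \<longleftrightarrow> g2_component h K p q"
proof
  assume d: "oct_der K p q \<in> Der_oct_component h"
  have b: "(oct_basis j :: 'b oct) \<in> oct_component (oct_degree j)" for j
    by (auto simp: oct_component_iff axis_nth_if)
  have *: "oct_der K p q (oct_basis j) $ i \<noteq> 0 \<Longrightarrow> oct_degree i = h + oct_degree j" for i j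
  proof -
    have "oct_der K p q (oct_basis j) \<in> oct_component (h + oct_degree j)"
      using d b[of j] unfolding Der_oct_component_def image_subset_iff by simp
    then show "oct_der K p q (oct_basis j) $ i \<noteq> 0 \<Longrightarrow> oct_degree i = h + oct_degree j"
      by (simp add: oct_component_iff)
  qed
  show "g2_component h K p q"
    unfolding g2_component_def using *[of E1 "U k" for k] *[of E1 "V k" for k] *[of "U j" "U i" for i j]
    by (simp add: oct_der_basis diff_eq_eq)
next
  assume g: "g2_component h K p q"
  have K: "h = u_degree i - u_degree j" if "K $ i $ j \<noteq> 0" for i j
    using g that by (auto simp: g2_component_def)
  have p: "p $ i \<noteq> 0 \<Longrightarrow> h = u_degree i" and q: "q $ i \<noteq> 0 \<Longrightarrow> h = - u_degree i" for i
    using g by (auto simp: g2_component_def)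
  have b: "oct_degree i = h + oct_degree j" if "oct_der K p q (oct_basis j) $ i \<noteq> 0" for i j
    using that by (cases i; cases j)
      (auto simp: oct_der_basis u_degree_sums split: if_splits dest!: K p q)
  have "oct_der K p q ` oct_component h' \<subseteq> oct_component (h + h')" for h'
  proof safe
    fix a :: "'b oct" assume a: "a \<in> oct_component h'"
    have "oct_der K p q a $ i = (\<Sum>j\<in>UNIV. a $ j * oct_der K p q (oct_basis j) $ i)" for i
      by (subst oct_linear_expand[OF oct_der_linear]) simp
    moreover have "a $ j * oct_der K p q (oct_basis j) $ i = 0" if "oct_degree i \<noteq> h + h'" for i j
      using a b[of j i] that by (metis mult_eq_0_iff oct_component_iff)
    ultimately show "oct_der K p q a \<in> oct_component (h + h')"
      unfolding oct_component_iff by (metis (no_types, lifting) sum.neutral)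
  qed
  then show "oct_der K p q \<in> Der_oct_component h"
    using oct_der_in_Der[OF assms] by (simp add: Der_oct_component_def)
qed

section \<open>Derivations of the Jordan algebra\<close>

definition jor_ad :: "'b::field jor \<Rightarrow> 'b jor \<Rightarrow> 'b jor" where
  "jor_ad y M = y ** M - M ** y"

lemma jor_ad_linear:
  "jor_ad (y + y') M = jor_ad y M + jor_ad y' M" "jor_ad (y - y') M = jor_ad y M - jor_ad y' M"
  "jor_ad (mscale k y) M = mscale k (jor_ad y M)" "jor_ad 0 M = 0"
  "jor_ad y (M + N) = jor_ad y M + jor_ad y N" "jor_ad y (mscale k M) = mscale k (jor_ad y M)"
  "jor_ad (mat 1) M = 0"
  by (simp_all add: jor_ad_def matrix_mult_add matrix_mult_diff mscale_matrix_mult mscale_diff)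

lemma jor_ad_in_Der: "jor_ad (y :: 'b::field jor) \<in> Der_jor"
proof -
  interpret m: module "mscale :: 'b \<Rightarrow> _ \<Rightarrow> 'b jor" by (rule module_mscale)
  have "Vector_Spaces.linear mscale mscale (jor_ad y)"
    unfolding Vector_Spaces.linear_def module_hom_def module_hom_axioms_def vector_space_def
    using module_mscale
    by (auto simp: jor_ad_linear m.scale_left_distrib m.scale_right_distrib)
  moreover have "jor_ad y (jor_mult M N) = jor_mult (jor_ad y M) N + jor_mult M (jor_ad y N)" for M N
    unfolding jor_mult_def jor_ad_linear mscale_add[symmetric]
    by (simp add: jor_ad_def matrix_mult_add matrix_mult_diff matrix_mul_assoc algebra_simps)
  ultimately show ?thesis by (simp add: Der_jor_def)
qed

lemma matrix_unit_nth: "matrix_unit i j $ r $ s = (if r = i \<and> s = j then 1 else 0)"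
  by (simp add: matrix_unit_def)

lemma matrix_unit_mult:
  "(matrix_unit i j ** M) $ r $ s = (if r = i then M $ j $ s else 0)"
  "(M ** matrix_unit i j) $ r $ s = (if s = j then M $ r $ i else 0 :: 'b::semiring_1)"
proof -
  show "(matrix_unit i j ** M) $ r $ s = (if r = i then M $ j $ s else 0)"
    by (simp add: matrix_mult_nth matrix_unit_nth if_distrib[of "\<lambda>x. x * _"] cong: if_cong)
  show "(M ** matrix_unit i j) $ r $ s = (if s = j then M $ r $ i else 0)"
    by (simp add: matrix_mult_nth matrix_unit_nth if_distrib[of "(*) _"] cong: if_cong)
qed

lemma matrix_unit_expand: "M = (\<Sum>i\<in>UNIV. \<Sum>j\<in>UNIV. mscale (M $ i $ j) (matrix_unit i j))"
  for M :: "'b::semiring_1 ^ 3 ^ 3"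
  by (simp add: vec_eq_iff forall_mod3 sum_mod3 matrix_unit_nth)

lemma Der_jor_linear:
  assumes "D \<in> Der_jor"
  shows "mlin D"
proof -
  interpret Vector_Spaces.linear mscale mscale D using assms by (simp add: Der_jor_def)
  show ?thesis by (simp add: mlin_def add scale)
qed

lemma Der_jor_anticommutator:
  fixes D :: "'b::field_char_0 jor \<Rightarrow> 'b jor"
  assumes "D \<in> Der_jor"
  shows "D (M ** N) + D (N ** M) = D M ** N + N ** D M + (M ** D N + D N ** M)"
proof -
  have "D (jor_mult M N) = jor_mult (D M) N + jor_mult M (D N)"
    using assms by (simp add: Der_jor_def)
  then have "mscale 2 (D (jor_mult M N)) = mscale 2 (jor_mult (D M) N + jor_mult M (D N))"
    by simp
  then show ?thesis
    by (simp add: jor_mult_def mlin_simps[OF Der_jor_linear[OF assms]] mscale_mscale mscale_add[symmetric])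
qed

text \<open>The derivation rule for the product of two matrix units, read off at one entry. The
  Jordan product only gives access to the sum over both orders, so later uses choose the units and
  the entry in such a way that most of the terms vanish.\<close>

lemma Der_jor_units:
  fixes D :: "'b::field_char_0 jor \<Rightarrow> 'b jor"
  assumes "D \<in> Der_jor"
  shows "(if j = k then D (matrix_unit i l) $ r $ s else 0) + (if l = i then D (matrix_unit k j) $ r $ s else 0) =
    (if s = l then D (matrix_unit i j) $ r $ k else 0) + (if r = k then D (matrix_unit i j) $ l $ s else 0) +
    ((if r = i then D (matrix_unit k l) $ j $ s else 0) + (if s = j then D (matrix_unit k l) $ r $ i else 0))"
proof -
  have u: "matrix_unit i j ** matrix_unit k l = (if j = k then matrix_unit i l else 0 :: 'b jor)" for i j k l :: 3
    by (auto simp: vec_eq_iff matrix_unit_mult matrix_unit_nth)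
  have "(D (matrix_unit i j ** matrix_unit k l) + D (matrix_unit k l ** matrix_unit i j)) $ r $ s =
      (D (matrix_unit i j) ** matrix_unit k l + matrix_unit k l ** D (matrix_unit i j) +
      (matrix_unit i j ** D (matrix_unit k l) + D (matrix_unit k l) ** matrix_unit i j)) $ r $ s"
    by (simp only: Der_jor_anticommutator[OF assms])
  then show ?thesis
    unfolding u by (simp add: matrix_unit_mult mlin_simps[OF Der_jor_linear[OF assms]] if_distrib[of D]
        if_distrib[of "\<lambda>x. x $ r $ s"] cong: if_cong)
qed

text \<open>A Peirce argument. A derivation that kills the diagonal idempotents preserves the Peirce
  spaces, here the spans of E_ij and E_ji, and E_ij^2 = 0 excludes a component along E_ji. The
  remaining scalars are additive along i, j, k and antisymmetric, hence differences a i - a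
  j.\<close>

lemma Der_jor_diagonal:
  fixes D :: "'b::field_char_0 jor \<Rightarrow> 'b jor"
  assumes D: "D \<in> Der_jor" and 0: "\<And>i. D (matrix_unit i i) = 0"
  obtains a where "D = jor_ad (\<chi> i j. if i = j then a i else 0)"
proof -
  define w where "w i j = D (matrix_unit i j)" for i j
  have Q: "(if j = k then w i l $ r $ s else 0) + (if l = i then w k j $ r $ s else 0) =
    (if s = l then w i j $ r $ k else 0) + (if r = k then w i j $ l $ s else 0) +
    ((if r = i then w k l $ j $ s else 0) + (if s = j then w k l $ r $ i else 0))" for i j k l r s
    unfolding w_def by (rule Der_jor_units[OF D])
  have w0: "w i i = 0" for i by (simp add: w_def 0)
  have off: "w i j $ r $ s = 0" if "i \<noteq> j" "\<not> (r = i \<and> s = j)" for i j r s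
  proof -
    have 1: "w i j $ r $ s = (if r = i then w i j $ i $ s else 0) + (if s = i then w i j $ r $ i else 0)"
      using Q[of i i i j r s] that(1) by (simp add: w0 split: if_splits)
    have 2: "w i j $ r $ s = (if s = j then w i j $ r $ j else 0) + (if r = j then w i j $ j $ s else 0)"
      using Q[of j j i j r s] that(1) by (simp add: w0 split: if_splits)
    \<comment> \<open>From E_ij^2 = 0, which says that twice this entry is zero.\<close>
    have 3: "w i j $ j $ i = 0"
      using Q[of j i i j j j] that(1) by (simp split: if_splits)
    show ?thesis using 1 2 3 that by (auto split: if_splits)
  qed
  \<comment> \<open>The additive cocycle is trivialized by measuring every index against the base
    index 0.\<close>
  define a where "a i = w i 0 $ i $ 0" for i
  have trans: "w i k $ i $ k = w i j $ i $ j + w j k $ j $ k" if "i \<noteq> j" "j \<noteq> k" "i \<noteq> k" for i j k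
    using Q[of j j i k i k] that by simp
  have anti: "w j i $ j $ i = - w i j $ i $ j" if "i \<noteq> j" for i j
    using Q[of j j i i i i] that by (simp add: w0 eq_neg_iff_add_eq_0 add.commute)
  have diag: "w i j $ i $ j = a i - a j" if "i \<noteq> j" for i j
  proof -
    consider "j = 0" | "i = 0" | "i \<noteq> 0" "j \<noteq> 0" by blast
    then show ?thesis
    proof cases
      case 1
      then show ?thesis by (simp add: a_def w0)
    next
      case 2
      then show ?thesis using anti[of j 0] that by (simp add: a_def w0)
    next
      case 3
      then show ?thesis using trans[of i j 0] that by (simp add: a_def)
    qed
  qed
  have eq: "w i j = jor_ad (\<chi> i j. if i = j then a i else 0) (matrix_unit i j)" for i j
  proof (cases "i = j")
    case True
    then show ?thesis
      by (auto simp: w0 vec_eq_iff jor_ad_def matrix_unit_mult)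
  next
    case False
    then show ?thesis
      using off[OF False] diag[OF False] by (auto simp: vec_eq_iff jor_ad_def matrix_unit_mult)
  qed
  have "D M = jor_ad (\<chi> i j. if i = j then a i else 0) M" for M
    by (subst (1 2) matrix_unit_expand)
      (simp add: mlin_sum[OF Der_jor_linear[OF D]] mlin_sum[OF Der_jor_linear[OF jor_ad_in_Der]]
        mlin_simps[OF Der_jor_linear[OF D]] jor_ad_linear eq[unfolded w_def])
  with that show thesis by blast
qed

lemma Der_jor_diff:
  fixes y :: "'b::field jor"
  assumes "D \<in> Der_jor"
  shows "(\<lambda>M. D M - jor_ad y M) \<in> Der_jor"
proof -
  interpret m: module "mscale :: 'b \<Rightarrow> _ \<Rightarrow> 'b jor" by (rule module_mscale)
  have j: "jor_mult (M - M') N = jor_mult M N - jor_mult M' N" "jor_mult N (M - M') = jor_mult N M - jor_mult N M'"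
    for M M' N :: "'b jor"
    by (simp_all add: jor_mult_def matrix_mult_diff mscale_diff[symmetric] algebra_simps)
  have "Vector_Spaces.linear mscale mscale (\<lambda>M. D M - jor_ad y M)"
    unfolding Vector_Spaces.linear_def module_hom_def module_hom_axioms_def vector_space_def
    using module_mscale mlin_simps[OF Der_jor_linear[OF assms]]
    by (auto simp: jor_ad_linear m.scale_left_distrib m.scale_right_distrib mscale_diff)
  then show ?thesis
    using assms jor_ad_in_Der[of y] by (simp add: Der_jor_def j)
qed

text \<open>Derivations are inner. Off the diagonal, [y, E_ii] has column i of y as its column i, so
  y0 can be read off from the images of the idempotents; subtracting \<open>jor_ad y0\<close> leads
  to the diagonal case. Taking the tracefree part removes the freedom of adding a scalar
  matrix.\<close>

lemma Der_jor_cases: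
  fixes D :: "'b::field_char_0 jor \<Rightarrow> 'b jor"
  assumes D: "D \<in> Der_jor"
  obtains y where "trace y = 0" "D = jor_ad y"
proof -
  define w where "w i j = D (matrix_unit i j)" for i j
  have Q: "(if j = k then w i l $ r $ s else 0) + (if l = i then w k j $ r $ s else 0) =
    (if s = l then w i j $ r $ k else 0) + (if r = k then w i j $ l $ s else 0) +
    ((if r = i then w k l $ j $ s else 0) + (if s = j then w k l $ r $ i else 0))" for i j k l r s
    unfolding w_def by (rule Der_jor_units[OF D])
  define y0 where "y0 = (\<chi> r i. if r = i then 0 else w i i $ r $ i)"
  have "w i i $ r $ s = jor_ad y0 (matrix_unit i i) $ r $ s" for i r s
  proof -
    have 1: "w i i $ r $ s = 0" if "r \<noteq> i" "s \<noteq> i"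
      using Q[of i i i i r s] that by simp
    have 2: "w i i $ i $ i = 0"
      using Q[of i i i i i i] by simp
    \<comment> \<open>E_ii and E_ss are orthogonal, so the two prescriptions for the entry (i, s),
      from column s and from row i, are compatible.\<close>
    have 3: "w i i $ i $ s = - w s s $ i $ s" if "s \<noteq> i"
      using Q[of i s i s i s] that by (simp add: eq_neg_iff_add_eq_0)
    show ?thesis
      using 1 2 3 by (auto simp: jor_ad_def matrix_unit_mult y0_def)
  qed
  then have "D (matrix_unit i i) - jor_ad y0 (matrix_unit i i) = 0" for i
    by (simp add: w_def vec_eq_iff)
  from Der_jor_diagonal[OF Der_jor_diff[OF D] this]
  obtain a where a: "(\<lambda>M. D M - jor_ad y0 M) = jor_ad (\<chi> i j. if i = j then a i else 0)" by blast
  let ?y = "y0 + (\<chi> i j. if i = j then a i else 0)"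
  have "D M = jor_ad (tracefree ?y) M" for M
    using fun_cong[OF a, of M] by (simp add: tracefree_def jor_ad_linear algebra_simps)
  then have "D = jor_ad (tracefree ?y)" by blast
  with that[of "tracefree ?y"] show thesis by simp
qed

lemma jor_D_eq: "jor_D x y = jor_ad (mscale (1 / 4) (x ** y - y ** x))"
  for x :: "'b::field_char_0 jor"
  by (simp add: fun_eq_iff jor_D_def jor_mult_def jor_ad_def matrix_mult_add matrix_mult_diff
      mscale_matrix_mult matrix_mul_assoc mscale_mscale)
    (simp add: vec_eq_iff algebra_simps)

lemma jor_ad_inject:
  fixes y :: "'b::field_char_0 jor"
  assumes "jor_ad y = jor_ad z" "trace y = 0" "trace z = 0"
  shows "y = z"
proof -
  have 0: "jor_ad (y - z) M = 0" for M using assms(1) by (simp add: jor_ad_linear)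
  have 1: "(if s = j then (y - z) $ r $ i else 0) = (if r = i then (y - z) $ j $ s else 0)" for i j r s
  proof -
    have "((y - z) ** matrix_unit i j) $ r $ s = (matrix_unit i j ** (y - z)) $ r $ s"
      using 0[of "matrix_unit i j"] by (simp add: jor_ad_def)
    then show ?thesis unfolding matrix_unit_mult .
  qed
  define c where "c = (y - z) $ 0 $ 0"
  have d: "(y - z) $ r $ i = (if r = i then c else 0)" for r i
    unfolding c_def using 1[of 0 0 r i] by simp
  have "trace (y - z) = 0" using assms by (simp add: trace_linear)
  then have "c = 0" unfolding trace_3 d by simp
  then have "y - z = 0" unfolding vec_eq_iff d by simp
  then show ?thesis by simp
qed

section \<open>Tensor spans and homogeneous derivations in Pauli coordinates\<close>

lemma module_octjor_scale: "module (octjor_scale :: 'b::field \<Rightarrow> _)"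
  by unfold_locales (simp_all add: octjor_scale_def vec_eq_iff algebra_simps)

text \<open>A traceless octonion has opposite coordinates at e_1 and e_2, so the index set must
  contain both or neither. Then e_1 - e_2 and the admissible u_k and v_k span the space, and a
  tensor is recovered from its coordinates at E1, U k and V k.\<close>

lemma tensor_span_eq:
  fixes X :: "'b::field jor set"
  assumes I: "E1 \<in> I \<longleftrightarrow> E2 \<in> I" and X: "module.subspace mscale X"
  shows "tensor_span (oct_traceless \<inter> {a. \<forall>i. a $ i \<noteq> 0 \<longrightarrow> i \<in> I}) X =
    {S. (\<forall>i. S $ i \<in> X) \<and> (\<forall>i. S $ i \<noteq> 0 \<longrightarrow> i \<in> I) \<and> S $ E2 = - S $ E1}"
    (is "tensor_span ?A X = ?R")
proof -
  interpret m: module "mscale :: 'b \<Rightarrow> _ \<Rightarrow> 'b jor" by (rule module_mscale)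
  interpret o: module "octjor_scale :: 'b \<Rightarrow> _" by (rule module_octjor_scale)
  note Xs = m.subspace_0[OF X] m.subspace_add[OF X] m.subspace_scale[OF X]
  let ?T = "{tens a x | a x. a \<in> ?A \<and> x \<in> X}"
  show ?thesis
  proof
    have "?T \<subseteq> ?R"
      by (auto simp: tens_def Xs oct_traceless_def oct_trace_eq, (auto simp: vec_eq_iff add_eq_0_iff)?)
    moreover have "o.subspace ?R"
      by (auto simp: o.subspace_def Xs octjor_scale_def, (metis add_0)?)
    ultimately show "tensor_span ?A X \<subseteq> ?R"
      unfolding tensor_span_def by (rule o.span_minimal)
  next
    show "?R \<subseteq> tensor_span ?A X"
    proof
      fix S assume S: "S \<in> ?R"
      \<comment> \<open>The octonion has to be admissible only if x is nonzero: the coordinates of S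
        outside I vanish, and the corresponding basis vectors are not admissible.\<close>
      have t: "tens a x \<in> o.span ?T" if "x \<noteq> 0 \<Longrightarrow> a \<in> ?A" "x \<in> X" for a x
      proof (cases "x = 0")
        case True
        then have "tens a x = 0" by (simp add: tens_def vec_eq_iff)
        then show ?thesis by (simp add: o.span_zero)
      next
        case False
        then show ?thesis using that by (intro o.span_base) blast
      qed
      have b: "oct_basis (U k) \<in> ?A" if "S $ U k \<noteq> 0" for k
        using S that by (auto simp: oct_traceless_def oct_trace_eq axis_nth_if)
      have c: "oct_basis (V k) \<in> ?A" if "S $ V k \<noteq> 0" for k
        using S that by (auto simp: oct_traceless_def oct_trace_eq axis_nth_if)
      have d: "oct_basis E1 - oct_basis E2 \<in> ?A" if "S $ E1 \<noteq> 0"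
        using S that I by (auto simp: oct_traceless_def oct_trace_eq axis_nth_if split: if_splits)
      have "S = tens (oct_basis E1 - oct_basis E2) (S $ E1) +
          ((\<Sum>k\<in>UNIV. tens (oct_basis (U k)) (S $ U k)) + (\<Sum>k\<in>UNIV. tens (oct_basis (V k)) (S $ V k)))"
        using S unfolding vec_eq_iff[of S] forall_octix forall_mod3
        by (simp add: tens_def sum_mod3 axis_nth_if)
      also have "\<dots> \<in> o.span ?T"
        using S b c d by (intro o.span_add o.span_sum t) auto
      finally show "S \<in> tensor_span ?A X" by (simp add: tensor_span_def)
    qed
  qed
qed

lemma jor_traceless_iff: "x \<in> jor_traceless \<longleftrightarrow> trace x = (0 :: 'b::field_char_0)"
  by (simp add: jor_traceless_def jor_trace_def)

lemma tensor_span_traceless: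
  "tensor_span oct_traceless (jor_traceless :: 'b::field_char_0 jor set) =
    {S. (\<forall>i. trace (S $ i) = 0) \<and> S $ E2 = - S $ E1}"
proof -
  interpret m: module "mscale :: 'b \<Rightarrow> _ \<Rightarrow> 'b jor" by (rule module_mscale)
  have "m.subspace jor_traceless" by (simp add: m.subspace_def jor_traceless_iff trace_linear)
  from tensor_span_eq[of UNIV, OF _ this] show ?thesis by (simp add: jor_traceless_iff)
qed

context cube_root
begin

lemma tensor_span_component:
  "tensor_span (oct_traceless \<inter> oct_component h) (jor_traceless \<inter> jor_component \<omega> g) =
    {S. (\<forall>i. trace (S $ i) = 0 \<and> S $ i \<in> jor_component \<omega> g) \<and> (\<forall>i. S $ i \<noteq> 0 \<longrightarrow> oct_degree i = h) \<and> S $ E2 = - S $ E1}"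
proof -
  interpret m: module "mscale :: 'a \<Rightarrow> _ \<Rightarrow> 'a jor" by (rule module_mscale)
  have "m.subspace (jor_traceless \<inter> jor_component \<omega> g)"
    by (auto simp: m.subspace_def jor_traceless_iff trace_linear jor_component_linear)
  from tensor_span_eq[of "{i. oct_degree i = h}", OF _ this]
  have "tensor_span (oct_traceless \<inter> {a. \<forall>i. a $ i \<noteq> 0 \<longrightarrow> i \<in> {i. oct_degree i = h}}) (jor_traceless \<inter> jor_component \<omega> g) =
    {S. (\<forall>i. S $ i \<in> jor_traceless \<inter> jor_component \<omega> g) \<and> (\<forall>i. S $ i \<noteq> 0 \<longrightarrow> i \<in> {i. oct_degree i = h}) \<and> S $ E2 = - S $ E1}"
    by simp
  moreover have "oct_component h = {a :: 'a oct. \<forall>i. a $ i \<noteq> 0 \<longrightarrow> i \<in> {i. oct_degree i = h}}"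
    by (auto simp: oct_component_iff)
  ultimately show ?thesis by (simp add: jor_traceless_iff)
qed

lemma jor_ad_pauli:
  "jor_ad (pauli g) (pauli h) = mscale (root_char (- sympl g h) - root_char (sympl g h)) (pauli (g + h))"
  by (simp add: jor_ad_def pauli_mult sympl_sym[of h g] add.commute[of h g]) (simp add: vec_eq_iff algebra_simps)

lemma coord_sum: "coord g (sum f I) = (\<Sum>i\<in>I. coord g (f i))"
  by (induction I rule: infinite_finite_induct) (simp_all add: coord_linear)

lemma sympl_nondegenerate:
  assumes "k \<noteq> 0" obtains g where "sympl k g = 1"
proof -
  have "\<exists>c d. a * d - b * c = 1" if "\<not> (a = 0 \<and> b = 0)" for a b :: 3
  proof -
    have "a * a = 1 \<or> b * b = 1"
      using that exhaust_mod3[of a] exhaust_mod3[of b] by (elim disjE; simp)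
    then show ?thesis
    proof
      assume "a * a = 1"
      then have "a * a - b * 0 = 1" by simp
      then show ?thesis by blast
    next
      assume "b * b = 1"
      then have "a * 0 - b * (- b) = 1" by simp
      then show ?thesis by blast
    qed
  qed
  from this[of "k $ 1" "k $ 2"] obtain c d where "k $ 1 * d - k $ 2 * c = 1"
    using assms by (auto simp: vec2_eq_iff)
  then have "sympl k (vector [c, d]) = 1" by (simp add: sympl_def)
  with that show thesis by blast
qed

lemma root_char_neq: "s \<noteq> 0 \<Longrightarrow> root_char (- s) - root_char s \<noteq> 0"
proof -
  assume "s \<noteq> 0"
  then have "- s \<noteq> s" using exhaust_mod3[of s] by (elim disjE; simp)
  then show ?thesis by (simp add: root_char_inj)
qed

text \<open>To see that the coefficient of y at k vanishes, bracket with a Pauli matrix whose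
  symplectic product with k is 1: the coefficient reappears, times \<omega>^2 - \<omega>, at a
  degree where the bracket has no component. The label 0 commutes with everything and is covered by
  the trace condition.\<close>

lemma jor_ad_component_iff:
  assumes tr: "trace y = 0"
  shows "jor_ad y \<in> Der_jor_component \<omega> g \<longleftrightarrow> y \<in> jor_component \<omega> g"
proof
  assume "y \<in> jor_component \<omega> g"
  then show "jor_ad y \<in> Der_jor_component \<omega> g"
    using jor_component_mult(1)[of y g] jor_component_mult(1)[of _ _ y g]
    by (auto simp: Der_jor_component_def jor_ad_in_Der jor_ad_def intro!: jor_component_linear(3))
      (metis add.commute)
next
  assume D: "jor_ad y \<in> Der_jor_component \<omega> g"
  have "coord k y = 0" if "k \<noteq> g" for k
  proof (cases "k = 0")
    case True
    then show ?thesis using tr by (simp add: trace_eq_coord)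
  next
    case False
    then obtain g' where g': "sympl k g' = 1" by (rule sympl_nondegenerate)
    have "pauli g' \<in> jor_component \<omega> g'" by (simp add: jor_component_iff coord_pauli)
    then have "jor_ad y (pauli g') \<in> jor_component \<omega> (g + g')"
      using D by (auto simp: Der_jor_component_def)
    then have "jor_ad y (pauli g') = mscale (coord (g + g') (jor_ad y (pauli g'))) (pauli (g + g'))"
      by (simp only: jor_component_iff)
    then have "coord (k + g') (jor_ad y (pauli g')) = coord (g + g') (jor_ad y (pauli g')) * coord (k + g') (pauli (g + g'))"
      by (metis coord_linear(5))
    then have 0: "coord (k + g') (jor_ad y (pauli g')) = 0"
      using that by (simp add: coord_pauli)
    have "mlin (\<lambda>y. jor_ad y (pauli g'))" by (simp add: mlin_def jor_ad_linear)
    from mlin_expand[OF this, of y]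
    have "coord (k + g') (jor_ad y (pauli g')) =
        (\<Sum>l\<in>UNIV. if l = k then coord k y * (root_char (- sympl k g') - root_char (sympl k g')) else 0)"
      by (simp add: coord_sum jor_ad_pauli coord_linear coord_pauli if_distrib[of "(*) _"] cong: if_cong)
    with 0 have "coord k y * (root_char (- sympl k g') - root_char (sympl k g')) = 0" by simp
    then show ?thesis using root_char_neq[of 1] by (simp add: g')
  qed
  note 0 = this
  have "y = (\<Sum>k\<in>UNIV. mscale (coord k y) (pauli k))" by (simp only: pauli_expand)
  also have "\<dots> = (\<Sum>k\<in>UNIV. if k = g then mscale (coord g y) (pauli g) else 0)"
    by (rule sum.cong) (auto simp: 0)
  finally show "y \<in> jor_component \<omega> g" by (simp add: jor_component_iff)
qed

end

section \<open>The bracket of the Tits construction in coordinates\<close>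

lemma mod3_numerals: "(3 :: 3) = 0" "(4 :: 3) = 1" "(5 :: 3) = 2" "(6 :: 3) = 0"
  by simp_all

lemma oct_der_add: "oct_der K p q z + oct_der K' p' q' z = oct_der (K + K') (p + p') (q + q') z"
  by (simp add: vec_eq_iff forall_octix oct_der_nth sum.distrib algebra_simps)

lemma oct_der_scale: "k *s oct_der K p q z = oct_der (mscale k K) (k *s p) (k *s q) z"
  by (simp add: vec_eq_iff forall_octix oct_der_nth sum_distrib_left algebra_simps)

lemma oct_der_sum:
  "(\<Sum>i\<in>I. oct_der (K i) (p i) (q i) z) = oct_der (\<Sum>i\<in>I. K i) (\<Sum>i\<in>I. p i) (\<Sum>i\<in>I. q i) z"
proof (induction I rule: infinite_finite_induct)
  case empty
  show ?case by (simp add: vec_eq_iff forall_octix oct_der_nth)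
next
  case (infinite A)
  then show ?case by (simp add: vec_eq_iff forall_octix oct_der_nth)
qed (simp add: oct_der_add)

lemma tracefree_nth: "tracefree M $ i $ j = M $ i $ j - (if i = j then trace M / 3 else 0)"
  by (simp add: tracefree_def mat_def)

definition cross3 :: "'b::comm_ring_1 ^ 3 \<Rightarrow> 'b ^ 3 \<Rightarrow> 'b ^ 3" where
  "cross3 x y = (\<chi> i. x $ (i + 1) * y $ (i + 2) - x $ (i + 2) * y $ (i + 1))"

lemma cross3_nth: "cross3 x y $ i = x $ (i + 1) * y $ (i + 2) - x $ (i + 2) * y $ (i + 1)"
  by (simp add: cross3_def)

lemma oct_der_commutator:
  fixes K :: "'b::field_char_0 ^ 3 ^ 3"
  assumes "trace K = 0" "trace K' = 0"
  shows "oct_der K p q (oct_der K' p' q' z) - oct_der K' p' q' (oct_der K p q z) =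
    oct_der (K ** K' - K' ** K - mscale 3 (tracefree (\<chi> i j. p $ i * q' $ j - p' $ i * q $ j)))
      (K *v p' - K' *v p - 2 *s cross3 q q') (q v* K' - q' v* K - 2 *s cross3 p p') z"
proof -
  have K: "K $ 2 $ 2 = - K $ 0 $ 0 - K $ 1 $ 1" "K' $ 2 $ 2 = - K' $ 0 $ 0 - K' $ 1 $ 1"
    using assms by (simp_all add: trace_3 algebra_simps eq_neg_iff_add_eq_0)
  note s = oct_der_nth sum_mod3 cross3_nth tracefree_nth matrix_mult_nth matrix_vector_mult_def vector_matrix_mult_def trace_3 mod3_numerals
  show ?thesis
    unfolding vec_eq_iff forall_octix forall_mod3
    by (intro conjI; simp add: s K; simp add: field_simps)
qed

lemma oct_d_eq:
  fixes a b :: "'b::field_char_0 oct"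
  shows "oct_d a b z = oct_der (mscale (-3) (tracefree (\<chi> i j. a $ U i * b $ V j - b $ U i * a $ V j)))
    ((b $ E1 - b $ E2) *s (\<chi> i. a $ U i) - (a $ E1 - a $ E2) *s (\<chi> i. b $ U i) + cross3 (\<chi> i. a $ V i) (\<chi> i. b $ V i))
    ((a $ E1 - a $ E2) *s (\<chi> i. b $ V i) - (b $ E1 - b $ E2) *s (\<chi> i. a $ V i) + cross3 (\<chi> i. a $ U i) (\<chi> i. b $ U i)) z"
proof -
  note s = oct_der_nth sum_mod3 cross3_nth tracefree_nth trace_3 oct_mult_nth oct_d_def map_commutator_def Let_def mod3_numerals
  show ?thesis
    unfolding vec_eq_iff forall_octix forall_mod3
    by (intro conjI; simp add: s; simp add: field_simps)
qed

definition trace_form :: "'b::field jor \<Rightarrow> 'b jor \<Rightarrow> 'b" where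
  "trace_form x y = jor_trace (jor_mult x y)"

lemma trace_form_eq: "trace_form x y = trace (x ** y) / 3" for x :: "'b::field_char_0 jor"
  by (simp add: trace_form_def jor_trace_def jor_mult_def trace_linear trace_mul_sym[of y x])

lemma tensor_d_eq:
  fixes S :: "'b::field_char_0 octjor"
  shows "tensor_d S T z = oct_der (mscale (-3) (tracefree (\<chi> i j. trace_form (S $ U i) (T $ V j) - trace_form (S $ V j) (T $ U i))))
    (\<chi> i. trace_form (S $ U i) (T $ E1) - trace_form (S $ U i) (T $ E2) - trace_form (S $ E1) (T $ U i) + trace_form (S $ E2) (T $ U i)
      + trace_form (S $ V (i + 1)) (T $ V (i + 2)) - trace_form (S $ V (i + 2)) (T $ V (i + 1)))
    (\<chi> i. trace_form (S $ E1) (T $ V i) - trace_form (S $ E2) (T $ V i) - trace_form (S $ V i) (T $ E1) + trace_form (S $ V i) (T $ E2)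
      + trace_form (S $ U (i + 1)) (T $ U (i + 2)) - trace_form (S $ U (i + 2)) (T $ U (i + 1))) z"
  unfolding tensor_d_def trace_form_def[symmetric] oct_d_eq oct_der_scale oct_der_sum
proof (rule arg_cong[where f = "\<lambda>(K, p, q). oct_der K p q z" and x = "(_, _, _)" and y = "(_, _, _)", simplified],
    intro conjI)
qed (unfold vec_eq_iff forall_mod3, (intro conjI; simp add: sum_octix sum_mod3 axis_nth_if tracefree_nth trace_3 cross3_nth mod3_numerals; simp add: field_simps)+)

lemma act_oct_nth: "act_oct d S $ k = (\<Sum>i\<in>UNIV. mscale (d (oct_basis i) $ k) (S $ i))"
  by (simp add: act_oct_def tens_def)

lemma act_jor_nth:
  assumes "D 0 = (0 :: 'b::field jor)"
  shows "act_jor D S $ k = D (S $ k)"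
  by (simp add: act_jor_def tens_def axis_nth_if if_distrib[of "\<lambda>c. mscale c _"] cong: if_cong)

lemma tensor_mid_nth:
  fixes S :: "'b::field_char_0 octjor"
  shows "tensor_mid S T $ E1 = (\<Sum>i\<in>UNIV. jor_star (S $ V i) (T $ U i) - jor_star (S $ U i) (T $ V i))"
    "tensor_mid S T $ E2 = (\<Sum>i\<in>UNIV. jor_star (S $ U i) (T $ V i) - jor_star (S $ V i) (T $ U i))"
    "tensor_mid S T $ U k = jor_star (S $ E1) (T $ U k) - jor_star (S $ E2) (T $ U k)
      - jor_star (S $ U k) (T $ E1) + jor_star (S $ U k) (T $ E2)
      + mscale 2 (jor_star (S $ V (k + 1)) (T $ V (k + 2)) - jor_star (S $ V (k + 2)) (T $ V (k + 1)))"
    "tensor_mid S T $ V k = jor_star (S $ E2) (T $ V k) - jor_star (S $ E1) (T $ V k)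
      - jor_star (S $ V k) (T $ E2) + jor_star (S $ V k) (T $ E1)
      + mscale 2 (jor_star (S $ U (k + 1)) (T $ U (k + 2)) - jor_star (S $ U (k + 2)) (T $ U (k + 1)))"
proof -
  have n: "tensor_mid S T $ k =
      (\<Sum>i\<in>UNIV. \<Sum>j\<in>UNIV. mscale (oct_table i j $ k - oct_table j i $ k) (jor_star (S $ i) (T $ j)))" for k
    by (simp add: tensor_mid_def tens_def oct_commutator_def oct_mult_basis)
  have m: "mscale (-1) x = - x" "mscale (-2) x = - mscale 2 x" for x :: "'b jor"
    by (simp_all add: vec_eq_iff)
  show "tensor_mid S T $ E1 = (\<Sum>i\<in>UNIV. jor_star (S $ V i) (T $ U i) - jor_star (S $ U i) (T $ V i))"
    and "tensor_mid S T $ E2 = (\<Sum>i\<in>UNIV. jor_star (S $ U i) (T $ V i) - jor_star (S $ V i) (T $ U i))"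
    unfolding n by (simp_all add: sum_octix sum_mod3 axis_nth_if m mod3_numerals)
  show "tensor_mid S T $ U k = jor_star (S $ E1) (T $ U k) - jor_star (S $ E2) (T $ U k)
      - jor_star (S $ U k) (T $ E1) + jor_star (S $ U k) (T $ E2)
      + mscale 2 (jor_star (S $ V (k + 1)) (T $ V (k + 2)) - jor_star (S $ V (k + 2)) (T $ V (k + 1)))"
    and "tensor_mid S T $ V k = jor_star (S $ E2) (T $ V k) - jor_star (S $ E1) (T $ V k)
      - jor_star (S $ V k) (T $ E2) + jor_star (S $ V k) (T $ E1)
      + mscale 2 (jor_star (S $ U (k + 1)) (T $ U (k + 2)) - jor_star (S $ U (k + 2)) (T $ U (k + 1)))"
    unfolding n using exhaust_mod3[of k]
    by (elim disjE; simp add: sum_octix sum_mod3 axis_nth_if m mod3_numerals mscale_diff)+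
qed

text \<open>The octonion trace is 1 on e_1 e_1 and e_2 e_2, -1 on u_i v_i and v_i u_i, and 0 on the
  other products of basis elements. The factor 1/2 is the 2 of the bracket times the 1/4 of
  \<open>jor_D_eq\<close>.\<close>

lemma tensor_D_eq:
  fixes S :: "'b::field_char_0 octjor"
  shows "tensor_D S T = jor_ad (mscale (1 / 2)
    ((S $ E1 ** T $ E1 - T $ E1 ** S $ E1) + (S $ E2 ** T $ E2 - T $ E2 ** S $ E2)
     - (\<Sum>i\<in>UNIV. S $ U i ** T $ V i - T $ V i ** S $ U i) - (\<Sum>i\<in>UNIV. S $ V i ** T $ U i - T $ U i ** S $ V i)))"
proof
  fix z
  show "tensor_D S T z = jor_ad (mscale (1 / 2)
    ((S $ E1 ** T $ E1 - T $ E1 ** S $ E1) + (S $ E2 ** T $ E2 - T $ E2 ** S $ E2)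
     - (\<Sum>i\<in>UNIV. S $ U i ** T $ V i - T $ V i ** S $ U i) - (\<Sum>i\<in>UNIV. S $ V i ** T $ U i - T $ U i ** S $ V i))) z"
    unfolding tensor_D_def oct_mult_basis jor_D_eq
    by (simp add: sum_octix sum_mod3 oct_trace_eq axis_nth_if mod3_numerals jor_ad_linear mscale_mscale)
      (simp add: vec_eq_iff jor_ad_linear algebra_simps)
qed

section \<open>The model of three copies of \<open>sl\<^sub>3\<close>\<close>

type_synonym 'b mdl = "'b jor \<times> 'b jor \<times> 'b jor \<times> ('b jor ^ 3) \<times> ('b jor ^ 3)"

definition mdl_vecs :: "'b::field mdl set" where
  "mdl_vecs = {(K, X, Y, P, Q). trace K = 0 \<and> trace X = 0 \<and> trace Y = 0}"

definition mdl_scale :: "'b::field \<Rightarrow> 'b mdl \<Rightarrow> 'b mdl" where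
  "mdl_scale k = (\<lambda>(K, X, Y, P, Q).
     (mscale k K, mscale k X, mscale k Y, \<chi> i. mscale k (P $ i), \<chi> i. mscale k (Q $ i)))"

text \<open>The first factor acts on the index of \<open>P\<close> and \<open>Q\<close>, the second and third by left and right
  multiplication on the matrices \<open>P $ i\<close> and \<open>Q $ i\<close>.\<close>

definition mdl_bracket :: "'b::field mdl \<Rightarrow> 'b mdl \<Rightarrow> 'b mdl" where
  "mdl_bracket = (\<lambda>(K, X, Y, P, Q) (K', X', Y', P', Q').
     (K ** K' - K' ** K - tracefree (\<chi> i j. trace (P $ i ** Q' $ j) - trace (P' $ i ** Q $ j)),
      X ** X' - X' ** X - tracefree (\<Sum>i\<in>UNIV. P $ i ** Q' $ i - P' $ i ** Q $ i),
      Y ** Y' - Y' ** Y + tracefree (\<Sum>i\<in>UNIV. Q' $ i ** P $ i - Q $ i ** P' $ i),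
      \<chi> i. (\<Sum>l\<in>UNIV. mscale (K $ i $ l) (P' $ l) - mscale (K' $ i $ l) (P $ l))
        + (X ** P' $ i - X' ** P $ i) - (P' $ i ** Y - P $ i ** Y')
        + (mcross (Q $ (i + 1)) (Q' $ (i + 2)) - mcross (Q $ (i + 2)) (Q' $ (i + 1))),
      \<chi> i. (\<Sum>l\<in>UNIV. mscale (K' $ l $ i) (Q $ l) - mscale (K $ l $ i) (Q' $ l))
        - (Q' $ i ** X - Q $ i ** X') + (Y ** Q' $ i - Y' ** Q $ i)
        + (mcross (P $ (i + 1)) (P' $ (i + 2)) - mcross (P $ (i + 2)) (P' $ (i + 1)))))"

text \<open>\<open>P $ i\<close> is its tracefree part minus \<open>trace_vec P $ i\<close> times
  the identity. These scalars become the vectors p and q of an octonion derivation.\<close>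

definition trace_vec :: "'b::field jor ^ 3 \<Rightarrow> 'b ^ 3" where
  "trace_vec P = (\<chi> i. - trace (P $ i) / 3)"

definition tits_mid :: "'b::field jor \<Rightarrow> 'b jor \<Rightarrow> 'b jor ^ 3 \<Rightarrow> 'b jor ^ 3 \<Rightarrow> 'b octjor" where
  "tits_mid X Y P Q = (\<chi> i. case i of E1 \<Rightarrow> mscale (1 / 2) (X - Y) | E2 \<Rightarrow> mscale (1 / 2) (Y - X)
     | U k \<Rightarrow> tracefree (P $ k) | V k \<Rightarrow> tracefree (Q $ k))"

text \<open>The tracefree parts of P and Q are the u- and v-coordinates of C_0 tensor J_0, the
  scalar parts belong to Der(C). On u tensor x, ad y together with (e_1 - e_2) tensor z acts by (y +
  z) x - x (y - z), up to scalar matrices. Since X acts from the left and Y from the right with a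
  minus sign, X = y + z and Y = y - z, whence the halves.\<close>

definition to_tits :: "'b::field mdl \<Rightarrow> 'b tits" where
  "to_tits = (\<lambda>(K, X, Y, P, Q).
     (oct_der K (trace_vec P) (trace_vec Q), tits_mid X Y P Q, jor_ad (mscale (1 / 2) (X + Y))))"

lemma tits_mid_nth:
  "tits_mid X Y P Q $ E1 = mscale (1 / 2) (X - Y)" "tits_mid X Y P Q $ E2 = mscale (1 / 2) (Y - X)"
  "tits_mid X Y P Q $ U k = tracefree (P $ k)" "tits_mid X Y P Q $ V k = tracefree (Q $ k)"
  by (simp_all add: tits_mid_def)

lemma trace_mcross: "trace (mcross M N) = trace M * trace N - trace (M ** N)"
  for M :: "'b::field_char_0 jor"
  by (simp add: mcross_def trace_linear trace_mat_1 trace_mul_sym[of N M] algebra_simps)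

lemma matrix_mult_one [simp]: "mat 1 ** x = x" "y ** mat 1 = (y :: 'b::semiring_1 ^ 'n ^ 'm)"
  by (simp_all add: matrix_mul_lid matrix_mul_rid)

lemmas matrix_expand = matrix_mult_add matrix_mult_diff matrix_mult_minus mscale_matrix_mult trace_linear
  mscale_add mscale_diff mscale_mscale

lemma trace_form_tracefree:
  fixes A :: "'b::field_char_0 jor"
  shows "trace_form (tracefree A) (tracefree B) = trace (A ** B) / 3 - trace A * trace B / 9"
    "trace_form (tracefree A) (mscale k B) = k * (trace (A ** B) / 3 - trace A * trace B / 9)"
    "trace_form (mscale k A) (tracefree B) = k * (trace (A ** B) / 3 - trace A * trace B / 9)"
  by (simp_all add: trace_form_eq tracefree_def matrix_expand trace_mat_1 field_simps)

lemma to_tits_bracket_1: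
  fixes K :: "'b::field_char_0 jor"
  assumes "trace K = 0" "trace K' = 0" and X: "trace X = 0" "trace Y = 0" "trace X' = 0" "trace Y' = 0"
  shows "fst (tits_bracket (to_tits (K, X, Y, P, Q)) (to_tits (K', X', Y', P', Q'))) =
    fst (to_tits (mdl_bracket (K, X, Y, P, Q) (K', X', Y', P', Q')))"
proof
  fix z
  let ?M1 = "\<chi> i j. trace_vec P $ i * trace_vec Q' $ j - trace_vec P' $ i * trace_vec Q $ j"
  let ?S = "tits_mid X Y P Q" and ?T = "tits_mid X' Y' P' Q'"
  let ?M2 = "\<chi> i j. trace_form (?S $ U i) (?T $ V j) - trace_form (?S $ V j) (?T $ U i)"
  let ?M3 = "\<chi> i j. trace (P $ i ** Q' $ j) - trace (P' $ i ** Q $ j)"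
  \<comment> \<open>tr(AB) splits into tr A tr B / 3 and three times the trace form of the tracefree
    parts. The first summand comes from the commutator of octonion derivations, the second from the
    bracket on C_0 tensor J_0.\<close>
  have "?M3 = mscale 3 ?M1 + mscale 3 ?M2"
    by (simp add: vec_eq_iff tits_mid_nth trace_form_tracefree trace_vec_def trace_mul_sym[of "Q $ _" "P' $ _"] field_simps)
  then have 1: "tracefree ?M3 = mscale 3 (tracefree ?M1) + mscale 3 (tracefree ?M2)"
    by (simp only: tracefree_linear)
  have m: "mscale (-3) x = - mscale 3 x" for x :: "'b jor" by (simp add: vec_eq_iff)
  have ty: "trace (Q' $ i ** Q $ j) = trace (Q $ j ** Q' $ i)" "trace (P' $ i ** P $ j) = trace (P $ j ** P' $ i)"
    "trace (X ** R) = trace (R ** X)" "trace (X' ** R) = trace (R ** X')" "trace (Y ** R) = trace (R ** Y)"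
    "trace (Y' ** R) = trace (R ** Y')" for R i j
    by (rule trace_mul_sym)+
  note s = vec_eq_iff trace_vec_def matrix_vector_mult_def vector_matrix_mult_def cross3_nth
    trace_sum trace_linear matrix_mult_diff trace_mcross sum_mod3 trace_form_tracefree
  let ?P = "\<chi> i. (\<Sum>l\<in>UNIV. mscale (K $ i $ l) (P' $ l) - mscale (K' $ i $ l) (P $ l))
        + (X ** P' $ i - X' ** P $ i) - (P' $ i ** Y - P $ i ** Y')
        + (mcross (Q $ (i + 1)) (Q' $ (i + 2)) - mcross (Q $ (i + 2)) (Q' $ (i + 1)))"
  let ?Q = "\<chi> i. (\<Sum>l\<in>UNIV. mscale (K' $ l $ i) (Q $ l) - mscale (K $ l $ i) (Q' $ l))
        - (Q' $ i ** X - Q $ i ** X') + (Y ** Q' $ i - Y' ** Q $ i)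
        + (mcross (P $ (i + 1)) (P' $ (i + 2)) - mcross (P $ (i + 2)) (P' $ (i + 1)))"
  have 2: "K *v trace_vec P' - K' *v trace_vec P - 2 *s cross3 (trace_vec Q) (trace_vec Q') +
      (\<chi> i. trace_form (?S $ U i) (?T $ E1) - trace_form (?S $ U i) (?T $ E2) - trace_form (?S $ E1) (?T $ U i)
        + trace_form (?S $ E2) (?T $ U i)
        + trace_form (?S $ V (i + 1)) (?T $ V (i + 2)) - trace_form (?S $ V (i + 2)) (?T $ V (i + 1))) = trace_vec ?P"
    unfolding s tits_mid_nth vec_lambda_beta vector_add_component vector_minus_component vector_smult_component X ty
    by (intro allI) (simp add: field_simps)
  have 3: "trace_vec Q v* K' - trace_vec Q' v* K - 2 *s cross3 (trace_vec P) (trace_vec P') +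
      (\<chi> i. trace_form (?S $ E1) (?T $ V i) - trace_form (?S $ E2) (?T $ V i) - trace_form (?S $ V i) (?T $ E1)
        + trace_form (?S $ V i) (?T $ E2)
        + trace_form (?S $ U (i + 1)) (?T $ U (i + 2)) - trace_form (?S $ U (i + 2)) (?T $ U (i + 1))) = trace_vec ?Q"
    unfolding s tits_mid_nth vec_lambda_beta vector_add_component vector_minus_component vector_smult_component X ty
    by (intro allI) (simp add: field_simps)
  show "fst (tits_bracket (to_tits (K, X, Y, P, Q)) (to_tits (K', X', Y', P', Q'))) z =
    fst (to_tits (mdl_bracket (K, X, Y, P, Q) (K', X', Y', P', Q'))) z"
    unfolding tits_bracket_def to_tits_def mdl_bracket_def prod.case fst_conv plus_fun_apply map_commutator_def
      fun_diff_def comp_def oct_der_commutator[OF assms(1,2)] tensor_d_eq oct_der_add 2 3 1 m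
    by (simp add: algebra_simps)
qed

lemma act_oct_der_nth:
  fixes S :: "'b::field octjor"
  shows "act_oct (oct_der K p q) S $ E1 = (\<Sum>l\<in>UNIV. mscale (p $ l) (S $ V l) - mscale (q $ l) (S $ U l))"
    "act_oct (oct_der K p q) S $ E2 = (\<Sum>l\<in>UNIV. mscale (q $ l) (S $ U l) - mscale (p $ l) (S $ V l))"
    "act_oct (oct_der K p q) S $ U k = mscale (p $ k) (S $ E1 - S $ E2) + (\<Sum>l\<in>UNIV. mscale (K $ k $ l) (S $ U l))
      + (mscale (q $ (k + 1)) (S $ V (k + 2)) - mscale (q $ (k + 2)) (S $ V (k + 1)))"
    "act_oct (oct_der K p q) S $ V k = mscale (q $ k) (S $ E2 - S $ E1) - (\<Sum>l\<in>UNIV. mscale (K $ l $ k) (S $ V l))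
      + (mscale (p $ (k + 1)) (S $ U (k + 2)) - mscale (p $ (k + 2)) (S $ U (k + 1)))"
proof -
  have m: "mscale (- c) x = - mscale c x" for x :: "'b jor" and c by (simp add: vec_eq_iff)
  show "act_oct (oct_der K p q) S $ E1 = (\<Sum>l\<in>UNIV. mscale (p $ l) (S $ V l) - mscale (q $ l) (S $ U l))"
    and "act_oct (oct_der K p q) S $ E2 = (\<Sum>l\<in>UNIV. mscale (q $ l) (S $ U l) - mscale (p $ l) (S $ V l))"
    by (simp_all add: act_oct_nth sum_octix oct_der_basis m sum_subtractf sum_negf)
  show "act_oct (oct_der K p q) S $ U k = mscale (p $ k) (S $ E1 - S $ E2) + (\<Sum>l\<in>UNIV. mscale (K $ k $ l) (S $ U l))
      + (mscale (q $ (k + 1)) (S $ V (k + 2)) - mscale (q $ (k + 2)) (S $ V (k + 1)))"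
    and "act_oct (oct_der K p q) S $ V k = mscale (q $ k) (S $ E2 - S $ E1) - (\<Sum>l\<in>UNIV. mscale (K $ l $ k) (S $ V l))
      + (mscale (p $ (k + 1)) (S $ U (k + 2)) - mscale (p $ (k + 2)) (S $ U (k + 1)))"
    using exhaust_mod3[of k]
    by (elim disjE; simp add: act_oct_nth sum_octix sum_mod3 oct_der_basis m mscale_diff mod3_numerals)+
qed

lemma jor_star_eq:
  "jor_star x y = mscale (1 / 2) (x ** y + y ** x) - mscale (trace (x ** y) / 3) (mat 1)"
  for x :: "'b::field_char_0 jor"
  by (simp add: jor_star_def jor_trace_def jor_mult_def trace_linear trace_mul_sym[of y x])

lemma to_tits_bracket_2:
  fixes K :: "'b::field_char_0 jor"
  assumes X: "trace X = 0" "trace Y = 0" "trace X' = 0" "trace Y' = 0"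
  shows "fst (snd (tits_bracket (to_tits (K, X, Y, P, Q)) (to_tits (K', X', Y', P', Q')))) =
    fst (snd (to_tits (mdl_bracket (K, X, Y, P, Q) (K', X', Y', P', Q'))))"
proof -
  have z: "jor_ad y 0 = 0" for y :: "'b jor" by (simp add: jor_ad_def)
  have ty: "trace (Q' $ i ** Q $ j) = trace (Q $ j ** Q' $ i)" "trace (P' $ i ** P $ j) = trace (P $ j ** P' $ i)"
    "trace (P' $ i ** Q $ j) = trace (Q $ j ** P' $ i)" "trace (P $ i ** Q' $ j) = trace (Q' $ j ** P $ i)"
    "trace (X ** R) = trace (R ** X)" "trace (X' ** R) = trace (R ** X')" "trace (Y ** R) = trace (R ** Y)"
    "trace (Y' ** R) = trace (R ** Y')" for R i j
    by (rule trace_mul_sym)+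
  note s = act_oct_der_nth act_jor_nth[of "jor_ad y" for y, OF z] tensor_mid_nth tits_mid_nth
  note t = jor_star_eq tracefree_def jor_ad_def trace_vec_def vec_lambda_beta matrix_expand trace_mat_1 X mcross_def matrix_mult_one sum_mod3
    ty mult_zero_left mult_zero_right mscale_zero diff_0_right add_0_right add_0_left diff_self
  note n = vec_eq_iff vector_add_component vector_minus_component mscale_nth vector_uminus_component
  show ?thesis
    unfolding tits_bracket_def to_tits_def mdl_bracket_def prod.case fst_conv snd_conv vec_eq_iff[where 'b = octix]
      forall_octix vector_add_component vector_minus_component s
    by (intro conjI allI; unfold t n; intro allI; simp add: field_simps)
qed

lemma to_tits_bracket_3:
  fixes K :: "'b::field_char_0 jor"
  shows "snd (snd (tits_bracket (to_tits (K, X, Y, P, Q)) (to_tits (K', X', Y', P', Q')))) =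
    snd (snd (to_tits (mdl_bracket (K, X, Y, P, Q) (K', X', Y', P', Q'))))"
proof -
  have c: "map_commutator (jor_ad x) (jor_ad y) = jor_ad (x ** y - y ** x)" for x y :: "'b jor"
    by (simp add: map_commutator_def fun_eq_iff jor_ad_def matrix_expand matrix_mul_assoc)
  have ty: "trace (Q' $ i ** P $ i) = trace (P $ i ** Q' $ i)" "trace (Q $ i ** P' $ i) = trace (P' $ i ** Q $ i)" for i
    by (rule trace_mul_sym)+
  note t = tracefree_def matrix_expand trace_mat_1 matrix_mult_one sum_mod3 ty
  note n = vec_eq_iff vector_add_component vector_minus_component mscale_nth vector_uminus_component
  have p: "jor_ad x + jor_ad y = jor_ad (x + y)" for x y :: "'b jor"
    by (simp add: fun_eq_iff jor_ad_linear)
  show ?thesis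
    unfolding tits_bracket_def to_tits_def mdl_bracket_def prod.case snd_conv tensor_D_eq tits_mid_nth c p
    unfolding t
    by (rule arg_cong[where f = jor_ad], unfold n, intro allI, simp add: field_simps)
qed

lemma to_tits_bracket:
  fixes m n :: "'b::field_char_0 mdl"
  assumes "m \<in> mdl_vecs" "n \<in> mdl_vecs"
  shows "to_tits (mdl_bracket m n) = tits_bracket (to_tits m) (to_tits n)"
proof -
  obtain K X Y P Q where m: "m = (K, X, Y, P, Q)" by (cases m) auto
  obtain K' X' Y' P' Q' where n: "n = (K', X', Y', P', Q')" by (cases n) auto
  show ?thesis
    using assms unfolding m n mdl_vecs_def
    by (intro prod_eqI) (simp_all add: to_tits_bracket_1 to_tits_bracket_2 to_tits_bracket_3)
qed

lemma to_tits_linear: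
  fixes m :: "'b::field_char_0 mdl"
  shows "to_tits (m + n) = to_tits m + to_tits n" "to_tits (mdl_scale k m) = tits_scale k (to_tits m)"
proof -
  obtain K X Y P Q where m: "m = (K, X, Y, P, Q)" by (cases m) auto
  obtain K' X' Y' P' Q' where n: "n = (K', X', Y', P', Q')" by (cases n) auto
  have tv: "trace_vec (P + P') = trace_vec P + trace_vec P'" "trace_vec (\<chi> i. mscale k (P $ i)) = k *s trace_vec P"
    for P P' :: "'b jor ^ 3"
    by (simp_all add: vec_eq_iff trace_vec_def trace_linear add_divide_distrib)
  show "to_tits (m + n) = to_tits m + to_tits n"
    unfolding m n to_tits_def
    by (simp add: fun_eq_iff oct_der_add tv vec_eq_iff[where 'b = octix] forall_octix tits_mid_nth tracefree_linear)
      (simp add: vec_eq_iff jor_ad_linear algebra_simps)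
  show "to_tits (mdl_scale k m) = tits_scale k (to_tits m)"
    unfolding m to_tits_def mdl_scale_def tits_scale_def
    by (simp add: fun_eq_iff oct_der_scale tv vec_eq_iff[where 'b = octix] forall_octix tits_mid_nth tracefree_linear
        octjor_scale_def jor_ad_linear mscale_mscale mscale_add mscale_diff mult.commute)
qed

lemma to_tits_inj: "inj_on to_tits (mdl_vecs :: 'b::field_char_0 mdl set)"
proof
  fix m n :: "'b mdl" assume mn: "m \<in> mdl_vecs" "n \<in> mdl_vecs" and eq: "to_tits m = to_tits n"
  obtain K X Y P Q where m: "m = (K, X, Y, P, Q)" by (cases m) auto
  obtain K' X' Y' P' Q' where n: "n = (K', X', Y', P', Q')" by (cases n) auto
  have tr: "trace K = 0" "trace X = 0" "trace Y = 0" "trace K' = 0" "trace X' = 0" "trace Y' = 0"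
    using mn by (auto simp: m n mdl_vecs_def)
  have 1: "K = K'" "trace_vec P = trace_vec P'" "trace_vec Q = trace_vec Q'"
    using eq by (auto simp: m n to_tits_def oct_der_inject)
  have mid: "tits_mid X Y P Q $ i = tits_mid X' Y' P' Q' $ i" for i
    using eq by (simp add: m n to_tits_def)
  have "jor_ad (mscale (1 / 2) (X + Y)) = jor_ad (mscale (1 / 2) (X' + Y'))"
    using eq by (simp add: m n to_tits_def)
  then have "mscale (1 / 2) (X + Y) = mscale (1 / 2) (X' + Y')"
    by (rule jor_ad_inject) (simp_all add: trace_linear tr)
  from arg_cong[OF this, of "mscale 2"] have "X + Y = X' + Y'" by (simp add: mscale_mscale)
  then have a: "X $ r $ s + Y $ r $ s = X' $ r $ s + Y' $ r $ s" for r s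
    by (metis vector_add_component)
  have "X - Y = X' - Y'"
    using arg_cong[OF mid[of E1], of "mscale 2"] by (simp add: tits_mid_nth mscale_mscale)
  then have b: "X $ r $ s - Y $ r $ s = X' $ r $ s - Y' $ r $ s" for r s
    by (metis vector_minus_component)
  have c: "x = x'" "y = y'" if "x + y = x' + y'" "x - y = x' - y'" for x y x' y' :: 'b
  proof -
    have "2 * x = 2 * x'" using that by algebra
    then show "x = x'" by simp
    with that show "y = y'" by simp
  qed
  have X: "X = X'" "Y = Y'" using c[OF a b] by (simp_all add: vec_eq_iff)
  have P: "P $ k = P' $ k" "Q $ k = Q' $ k" for k
    using mid[of "U k"] mid[of "V k"] 1(2,3) by (auto simp: tits_mid_nth tracefree_def trace_vec_def vec_eq_iff)
  show "m = n" using 1 X P by (simp add: m n vec_eq_iff)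
qed

lemma to_tits_image: "to_tits ` (mdl_vecs :: 'b::field_char_0 mdl set) = vecs tits_algebra"
proof
  show "to_tits ` (mdl_vecs :: 'b mdl set) \<subseteq> vecs tits_algebra"
    by (auto simp: mdl_vecs_def to_tits_def tits_algebra_def oct_der_in_Der jor_ad_in_Der tensor_span_traceless
        forall_octix tits_mid_nth trace_linear)
      (simp add: vec_eq_iff field_simps)
  show "vecs tits_algebra \<subseteq> to_tits ` (mdl_vecs :: 'b mdl set)"
  proof
    fix v :: "'b tits" assume v: "v \<in> vecs tits_algebra"
    obtain d S D where dSD: "v = (d, S, D)" by (cases v) auto
    have "d \<in> Der_oct" "D \<in> Der_jor" and S: "\<And>i. trace (S $ i) = 0" "S $ E2 = - S $ E1"
      using v by (auto simp: dSD tits_algebra_def tensor_span_traceless)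
    then obtain K p q y where K: "trace K = 0" "d = oct_der K p q" and y: "trace y = 0" "D = jor_ad y"
      by (metis Der_oct_cases Der_jor_cases)
    \<comment> \<open>Inverts the change of coordinates: X and Y are the sum and the difference of
      the inner matrix and the e_1-coordinate, and the scalars -p and -q are put back into P and
      Q.\<close>
    let ?m = "(K, y + S $ E1, y - S $ E1, \<chi> k. S $ U k - mscale (p $ k) (mat 1), \<chi> k. S $ V k - mscale (q $ k) (mat 1))"
    have "?m \<in> mdl_vecs" using K y S by (simp add: mdl_vecs_def trace_linear)
    moreover have "to_tits ?m = v"
    proof -
      have tv: "trace_vec (\<chi> k. S $ U k - mscale (p $ k) (mat 1)) = p" "trace_vec (\<chi> k. S $ V k - mscale (q $ k) (mat 1)) = q"
        by (simp_all add: vec_eq_iff trace_vec_def trace_linear trace_mat_1 S)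
      have "mscale (1 / 2) (y + S $ E1 + (y - S $ E1)) = y" by (simp add: vec_eq_iff)
      moreover have "tits_mid (y + S $ E1) (y - S $ E1) (\<chi> k. S $ U k - mscale (p $ k) (mat 1)) (\<chi> k. S $ V k - mscale (q $ k) (mat 1)) = S"
        unfolding vec_eq_iff[where 'b = octix] forall_octix
        by (simp add: tits_mid_nth S tracefree_def trace_linear trace_mat_1) (simp add: vec_eq_iff)
      ultimately show ?thesis by (simp add: to_tits_def tv dSD K y)
    qed
    ultimately show "v \<in> to_tits ` mdl_vecs" by blast
  qed
qed

section \<open>Gradings with the support of \<open>\<Gamma>\<^sub>4\<close>\<close>

lemma additive_group_simps [simp]:
  "carrier additive_group = UNIV" "mult additive_group = (+)" "one additive_group = 0"
  by (simp_all add: additive_group_def)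

lemma comm_group_additive_group: "comm_group additive_group"
  by (rule comm_groupI) (auto simp: add_ac intro: exI[of _ "- x" for x])

lemma G4_simps [simp]: "carrier G4 = UNIV" "mult G4 = (+)" "one G4 = 0"
  by (simp_all add: G4_def)

lemma comm_group_G4: "comm_group G4"
  unfolding G4_def by (rule comm_group_additive_group)

lemma group_G4: "group G4"
  using comm_group_G4 by (rule comm_group.axioms)

lemma (in group) int_hom_pow:
  assumes add: "\<And>m n. F (m + n) = F m \<otimes> F n" and F: "\<And>n. F n \<in> carrier G"
  shows "F n = F 1 [^] (n :: int)"
proof (induction n rule: int_induct[where k = 0])
  case base
  have "F 0 \<otimes> F 0 = F 0" using add[of 0 0] by simp
  then show ?case using F[of 0] by (simp add: l_cancel_one)
next
  case (step1 i)
  then show ?case using add[of i 1] F by (simp add: int_pow_mult)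
next
  case (step2 i)
  have "F (i - 1) \<otimes> F 1 = F 1 [^] (i - 1) \<otimes> F 1"
    using add[of "i - 1" 1] int_pow_mult[of "F 1" "i - 1" 1] F step2 by simp
  then show ?case using F by simp
qed

lemma u_degree_simps:
  "u_degree 1 = vector [1, 0]" "u_degree 2 = vector [0, 1]" "u_degree 0 = vector [-1, -1]"
  by (simp_all add: u_degree_def)

lemma u_degree_nonzero: "u_degree i \<noteq> 0"
  using exhaust_mod3[of i] by (elim disjE) (simp_all add: u_degree_simps vec2_eq_iff)

text \<open>The degrees of u_1 and u_2 are the canonical basis of Z^2, so together with the torsion
  subgroup they generate the group.\<close>

lemma G4_hom_eqI:
  fixes H :: "'h monoid"
  assumes H: "group H" and \<phi>: "\<phi> \<in> hom G4 H" and \<psi>: "\<psi> \<in> hom G4 H"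
    and 0: "\<And>g. \<phi> (g, 0) = \<psi> (g, 0)" and 1: "\<phi> (0, u_degree 1) = \<psi> (0, u_degree 1)"
    and 2: "\<phi> (0, u_degree 2) = \<psi> (0, u_degree 2)"
  shows "\<phi> s = \<psi> s"
proof -
  interpret group H by fact
  have *: "\<theta> (g, h) = \<theta> (g, 0) \<otimes>\<^bsub>H\<^esub> (\<theta> (0, u_degree 1) [^]\<^bsub>H\<^esub> (h $ 1) \<otimes>\<^bsub>H\<^esub> \<theta> (0, u_degree 2) [^]\<^bsub>H\<^esub> (h $ 2))"
    if "\<theta> \<in> hom G4 H" for \<theta> g h
  proof -
    have add: "\<theta> (s + t) = \<theta> s \<otimes>\<^bsub>H\<^esub> \<theta> t" and cl: "\<theta> s \<in> carrier H" for s t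
      using hom_mult[OF that] hom_in_carrier[OF that] by simp_all
    have a: "\<theta> (0, vector [n, 0]) = \<theta> (0, u_degree 1) [^]\<^bsub>H\<^esub> n" for n
    proof -
      have "(0, vector [m + k, 0]) = (0, vector [m, 0]) + (0 :: 3 ^ 2, vector [k, 0] :: int ^ 2)" for m k
        by (simp add: vec2_eq_iff)
      then have "\<theta> (0, vector [m + k, 0]) = \<theta> (0, vector [m, 0]) \<otimes>\<^bsub>H\<^esub> \<theta> (0, vector [k, 0])" for m k
        by (simp only: add)
      from int_hom_pow[of "\<lambda>n. \<theta> (0, vector [n, 0])" n, OF this cl] show ?thesis
        by (simp only: u_degree_simps)
    qed
    have b: "\<theta> (0, vector [0, n]) = \<theta> (0, u_degree 2) [^]\<^bsub>H\<^esub> n" for n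
    proof -
      have "(0, vector [0, m + k]) = (0, vector [0, m]) + (0 :: 3 ^ 2, vector [0, k] :: int ^ 2)" for m k
        by (simp add: vec2_eq_iff)
      then have "\<theta> (0, vector [0, m + k]) = \<theta> (0, vector [0, m]) \<otimes>\<^bsub>H\<^esub> \<theta> (0, vector [0, k])" for m k
        by (simp only: add)
      from int_hom_pow[of "\<lambda>n. \<theta> (0, vector [0, n])" n, OF this cl] show ?thesis
        by (simp only: u_degree_simps)
    qed
    have "(g, h) = (g, 0) + ((0, vector [h $ 1, 0]) + (0, vector [0, h $ 2]))"
      by (simp add: vec2_eq_iff)
    then show ?thesis by (metis a b add)
  qed
  show ?thesis
    using *[OF \<phi>, of "fst s" "snd s"] *[OF \<psi>, of "fst s" "snd s"] 0 1 2 by simp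
qed

text \<open>There are 69 degrees: nine over 0, 54 over the six short roots and six over the long
  roots. In \<Gamma>4 the first nine components are planes and the others are lines, which accounts
  for 18 + 60 = 78 dimensions.\<close>

definition e6_support :: "g4 set" where
  "e6_support = {(g, h). h = 0 \<or> (\<exists>i. h = u_degree i \<or> h = - u_degree i) \<or> (g = 0 \<and> (\<exists>i j. h = u_degree i - u_degree j))}"

lemma e6_support_intros [simp]:
  "(g, 0) \<in> e6_support" "(g, u_degree i) \<in> e6_support" "(g, - u_degree i) \<in> e6_support"
  "(0, u_degree i - u_degree j) \<in> e6_support" "0 \<in> e6_support"
  by (auto simp: e6_support_def zero_prod_def)

lemma e6_support_cases:
  assumes "s \<in> e6_support"
  obtains g where "s = (g, 0)" | g i where "s = (g, u_degree i)" | g i where "s = (g, - u_degree i)"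
    | i j where "i \<noteq> j" "s = (0, u_degree i - u_degree j)"
  using assms that by (cases s) (auto simp: e6_support_def, metis cancel_comm_monoid_add_class.diff_cancel)

text \<open>The listed relations present G4 on its support. \<open>uv\<close>, taken for all g and
  h, does double duty: it makes opposite labels inverse to each other and it forces additivity on
  Z_3^2. \<open>uu\<close> makes the product of the three short labels trivial, and
  \<open>long\<close> expresses the labels that remain.\<close>

lemma support_hom_exists:
  fixes H :: "'h monoid"
  assumes H: "comm_group H" and \<delta>: "\<And>s. s \<in> e6_support \<Longrightarrow> \<delta> s \<in> carrier H"
    and one: "\<delta> 0 = \<one>\<^bsub>H\<^esub>"
    and uu: "\<delta> (0, u_degree 1) \<otimes>\<^bsub>H\<^esub> \<delta> (0, u_degree 2) = \<delta> (0, - u_degree 0)"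
    and uv: "\<And>g h i. \<delta> (g, u_degree i) \<otimes>\<^bsub>H\<^esub> \<delta> (h, - u_degree i) = \<delta> (g + h, 0)"
    and long: "\<And>i j. i \<noteq> j \<Longrightarrow> \<delta> (0, u_degree i) \<otimes>\<^bsub>H\<^esub> \<delta> (0, - u_degree j) = \<delta> (0, u_degree i - u_degree j)"
  obtains \<phi> where "\<phi> \<in> hom G4 H" "\<And>s. s \<in> e6_support \<Longrightarrow> \<phi> s = \<delta> s"
proof -
  interpret comm_group H by fact
  define c where "c g = \<delta> (g, 0)" for g
  define r where "r i = \<delta> (0, u_degree i)" for i
  have cl [simp]: "c g \<in> carrier H" "r i \<in> carrier H" "\<delta> (g, u_degree i) \<in> carrier H" "\<delta> (g, - u_degree i) \<in> carrier H" for g i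
    by (simp_all add: c_def r_def \<delta>)
  have c0: "c 0 = \<one>\<^bsub>H\<^esub>" using one by (simp add: c_def zero_prod_def)
  have neg: "\<delta> (g, - u_degree i) = inv\<^bsub>H\<^esub> \<delta> (- g, u_degree i)" for g i
    using uv[of "- g" i g] c0 by (metis add.left_inverse c_def cl(3,4) inv_equality m_comm)
  have short: "\<delta> (g, u_degree i) = c g \<otimes>\<^bsub>H\<^esub> r i" for g i
  proof -
    have "\<delta> (g, u_degree i) \<otimes>\<^bsub>H\<^esub> inv\<^bsub>H\<^esub> r i = c g"
      using uv[of g i 0] neg[of 0 i] by (simp add: c_def r_def)
    then show ?thesis by (metis cl inv_solve_right)
  qed
  \<comment> \<open>Cancelling the short label in the product of (g, u_1) and (h, -u_1) yields
    additivity only up to an inverse and a sign; the case g = 0 then shows that the two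
    cancel.\<close>
  have cadd': "c (g + h) = c g \<otimes>\<^bsub>H\<^esub> inv\<^bsub>H\<^esub> c (- h)" for g h
  proof -
    have "c (g + h) = \<delta> (g, u_degree 1) \<otimes>\<^bsub>H\<^esub> inv\<^bsub>H\<^esub> \<delta> (- h, u_degree 1)"
      using uv[of g 1 h] neg[of h 1] by (simp add: c_def)
    also have "\<dots> = c g \<otimes>\<^bsub>H\<^esub> (r 1 \<otimes>\<^bsub>H\<^esub> (inv\<^bsub>H\<^esub> r 1 \<otimes>\<^bsub>H\<^esub> inv\<^bsub>H\<^esub> c (- h)))"
      by (simp add: short inv_mult_group m_assoc)
    also have "r 1 \<otimes>\<^bsub>H\<^esub> (inv\<^bsub>H\<^esub> r 1 \<otimes>\<^bsub>H\<^esub> inv\<^bsub>H\<^esub> c (- h)) = inv\<^bsub>H\<^esub> c (- h)"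
      by (simp add: m_assoc[symmetric])
    finally show ?thesis .
  qed
  have cneg: "inv\<^bsub>H\<^esub> c (- h) = c h" for h
    using cadd'[of 0 h] by (simp add: c0)
  have cadd: "c (g + h) = c g \<otimes>\<^bsub>H\<^esub> c h" for g h
    using cadd'[of g h] by (simp add: cneg)
  have r0: "r 0 = inv\<^bsub>H\<^esub> (r 1 \<otimes>\<^bsub>H\<^esub> r 2)"
    using uu neg[of 0 0] by (simp add: r_def)
  define \<phi> :: "g4 \<Rightarrow> 'h" where "\<phi> s = c (fst s) \<otimes>\<^bsub>H\<^esub> (r 1 [^]\<^bsub>H\<^esub> (snd s $ 1) \<otimes>\<^bsub>H\<^esub> r 2 [^]\<^bsub>H\<^esub> (snd s $ 2))" for s
  have hom: "\<phi> \<in> hom G4 H"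
    by (auto simp: hom_def \<phi>_def cadd int_pow_mult m_ac)
  have add: "\<phi> (s + t) = \<phi> s \<otimes>\<^bsub>H\<^esub> \<phi> t" and cl' [simp]: "\<phi> s \<in> carrier H" for s t
    using hom_mult[OF hom] hom_in_carrier[OF hom] by simp_all
  have s1: "\<phi> (g, 0) = c g" for g by (simp add: \<phi>_def)
  have s2: "\<phi> (g, u_degree i) = c g \<otimes>\<^bsub>H\<^esub> r i" for g i
    using exhaust_mod3[of i] by (elim disjE) (simp_all add: \<phi>_def u_degree_simps r0 int_pow_neg inv_mult)
  have s3: "\<phi> (g, - u_degree i) = \<delta> (g, - u_degree i)" for g i
  proof -
    have "\<phi> (g, - u_degree i) \<otimes>\<^bsub>H\<^esub> \<phi> (- g, u_degree i) = \<one>\<^bsub>H\<^esub>"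
      using add[of "(g, - u_degree i)" "(- g, u_degree i)"] s1[of 0] c0 by simp
    then have "\<phi> (g, - u_degree i) = inv\<^bsub>H\<^esub> \<phi> (- g, u_degree i)"
      by (metis cl' inv_equality)
    then show ?thesis by (simp add: s2 neg short)
  qed
  have "\<phi> s = \<delta> s" if "s \<in> e6_support" for s
    using that
  proof (cases rule: e6_support_cases)
    case (4 i j)
    have "\<phi> s = \<phi> (0, u_degree i) \<otimes>\<^bsub>H\<^esub> \<phi> (0, - u_degree j)"
      using add[of "(0, u_degree i)" "(0, - u_degree j)"] 4 by simp
    then show ?thesis using long[OF 4(1)] 4 by (simp add: s2 s3 short)
  qed (simp_all add: s1 s2 s3 short c_def)
  with hom that show thesis by blast
qed

lemma G4_hom_eq_support:
  fixes H :: "'h monoid"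
  assumes "group H" "\<phi> \<in> hom G4 H" "\<psi> \<in> hom G4 H" "\<And>s. s \<in> e6_support \<Longrightarrow> \<phi> s = \<psi> s"
  shows "\<phi> s = \<psi> s"
  by (rule G4_hom_eqI[OF assms(1-3)]; rule assms(4); simp)

section \<open>Abstract gradings with this support: universality and fineness\<close>

lemma direct_sum_components_disjoint:
  assumes ds: "direct_sum_decomposition A I \<Gamma>" and I: "g \<in> I" "h \<in> I"
    and x: "x \<in> \<Gamma> g" "x \<in> \<Gamma> h" "x \<noteq> 0" and 0: "\<And>k. k \<in> I \<Longrightarrow> 0 \<in> \<Gamma> k"
  shows "g = h"
proof -
  let ?R = "\<lambda>c. (\<forall>g\<in>I. c g \<in> \<Gamma> g) \<and> (\<forall>g. g \<notin> I \<longrightarrow> c g = 0) \<and> finite {g. c g \<noteq> 0} \<and> x = (\<Sum>g | c g \<noteq> 0. c g)"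
  have "x \<in> vecs A" using ds I x by (auto simp: direct_sum_decomposition_def)
  then have u: "\<exists>!c. ?R c" using ds unfolding direct_sum_decomposition_def by blast
  have r: "?R (\<lambda>i. if i = k then x else 0)" if "k \<in> I" "x \<in> \<Gamma> k" for k
  proof -
    have "{g. (if g = k then x else 0) \<noteq> 0} = {k}" using x(3) by auto
    then show ?thesis using that 0 by auto
  qed
  have "(THE c. ?R c) = (\<lambda>i. if i = k then x else 0)" if "k \<in> I" "x \<in> \<Gamma> k" for k
    by (rule the1_equality[OF u]) (rule r[OF that])
  from this[OF I(1) x(1)] this[OF I(2) x(2)]
  have "(\<lambda>i. if i = g then x else 0) = (\<lambda>i. if i = h then x else 0)" by (rule trans[OF sym])
  from fun_cong[OF this, of g] show ?thesis using x(3) by (auto split: if_splits)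
qed

lemma direct_sum_decompositionI:
  fixes A :: "('k::field, 'v::ab_group_add) algebra"
  assumes sub: "\<And>g. g \<in> I \<Longrightarrow> module.subspace (scl A) (\<Gamma> g)" "\<And>g. g \<in> I \<Longrightarrow> \<Gamma> g \<subseteq> vecs A"
    and S: "finite S" "S \<subseteq> I" and triv: "\<And>g. g \<in> I - S \<Longrightarrow> \<Gamma> g = {0}"
    and proj: "\<And>g x. x \<in> vecs A \<Longrightarrow> g \<in> S \<Longrightarrow> \<pi> g x \<in> \<Gamma> g"
    and sum: "\<And>x. x \<in> vecs A \<Longrightarrow> (\<Sum>g\<in>S. \<pi> g x) = x"
    and uniq: "\<And>c h. (\<And>g. g \<in> S \<Longrightarrow> c g \<in> \<Gamma> g) \<Longrightarrow> h \<in> S \<Longrightarrow> \<pi> h (\<Sum>g\<in>S. c g) = c h"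
  shows "direct_sum_decomposition A I \<Gamma>"
  unfolding direct_sum_decomposition_def
proof (intro conjI ballI)
  fix x assume x: "x \<in> vecs A"
  have sumS: "(\<Sum>g | c g \<noteq> 0. c g) = (\<Sum>g\<in>S. c g)" if "\<And>g. g \<notin> S \<Longrightarrow> c g = 0" for c :: "_ \<Rightarrow> 'v"
    using that S by (intro sum.mono_neutral_left) auto
  show "\<exists>!c. (\<forall>g\<in>I. c g \<in> \<Gamma> g) \<and> (\<forall>g. g \<notin> I \<longrightarrow> c g = 0) \<and> finite {g. c g \<noteq> 0} \<and> x = (\<Sum>g | c g \<noteq> 0. c g)"
  proof (rule ex1I[of _ "\<lambda>g. if g \<in> S then \<pi> g x else 0"], goal_cases)
    case 1
    have "finite {g. (if g \<in> S then \<pi> g x else 0) \<noteq> 0}"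
      by (rule finite_subset[OF _ S(1)]) auto
    then show ?case
      using x S triv proj sum by (subst sumS) auto
  next
    case (2 c)
    then have 0: "c g = 0" if "g \<notin> S" for g using triv that by (cases "g \<in> I") auto
    then have "x = (\<Sum>g\<in>S. c g)" using 2 sumS[of c] by simp
    moreover have "c g \<in> \<Gamma> g" if "g \<in> S" for g using 2 S that by auto
    ultimately have "\<pi> h x = c h" if "h \<in> S" for h using uniq that by simp
    then show ?case using 0 by auto
  qed
qed (use sub in auto)

text \<open>The properties of \<Gamma>4 on which fineness, universality and the formalism of the
  Weyl group rest, separated from its construction. The \<open>bracket_\<close> assumptions provide
  nonzero products; \<open>line\<close> treats the components off the torsion, and
  \<open>bracket_plane\<close> the nonzero torsion degrees.\<close>

locale e6_grading =
  fixes A :: "('k::field, 'v::ab_group_add) algebra" and \<Gamma> :: "g4 \<Rightarrow> 'v set" and \<pi> :: "g4 \<Rightarrow> 'v \<Rightarrow> 'v"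
  assumes module_scl: "module (scl A)"
    and vecs_subspace: "module.subspace (scl A) (vecs A)"
    and subspace: "\<And>g. module.subspace (scl A) (\<Gamma> g)" and comp_vecs: "\<And>g. \<Gamma> g \<subseteq> vecs A"
    and mult_comp: "\<And>x y g h. x \<in> \<Gamma> g \<Longrightarrow> y \<in> \<Gamma> h \<Longrightarrow> mul A x y \<in> \<Gamma> (g + h)"
    and mult_vecs: "\<And>x y. x \<in> vecs A \<Longrightarrow> y \<in> vecs A \<Longrightarrow> mul A x y \<in> vecs A"
    and finite_support: "finite e6_support"
    and supp: "\<And>g. \<Gamma> g \<noteq> {0} \<longleftrightarrow> g \<in> e6_support"
    and proj_in: "\<And>x g. x \<in> vecs A \<Longrightarrow> \<pi> g x \<in> \<Gamma> g"
    and proj_add: "\<And>x y g. x \<in> vecs A \<Longrightarrow> y \<in> vecs A \<Longrightarrow> \<pi> g (x + y) = \<pi> g x + \<pi> g y"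
    and proj_comp: "\<And>x g h. x \<in> \<Gamma> h \<Longrightarrow> \<pi> g x = (if g = h then x else 0)"
    and proj_sum: "\<And>x. x \<in> vecs A \<Longrightarrow> (\<Sum>g\<in>e6_support. \<pi> g x) = x"
    and line: "\<And>g x y. snd g \<noteq> 0 \<Longrightarrow> x \<in> \<Gamma> g \<Longrightarrow> x \<noteq> 0 \<Longrightarrow> y \<in> \<Gamma> g \<Longrightarrow> \<exists>k. y = scl A k x"
    and bracket_uu: "\<exists>x\<in>\<Gamma> (0, u_degree 1). \<exists>y\<in>\<Gamma> (0, u_degree 2). mul A x y \<noteq> 0"
    and bracket_uv: "\<And>g h i. \<exists>x\<in>\<Gamma> (g, u_degree i). \<exists>y\<in>\<Gamma> (h, - u_degree i). mul A x y \<noteq> 0"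
    and bracket_long: "\<And>i j. i \<noteq> j \<Longrightarrow> \<exists>x\<in>\<Gamma> (0, u_degree i). \<exists>y\<in>\<Gamma> (0, - u_degree j). mul A x y \<noteq> 0"
    and bracket_zero: "\<And>z. z \<in> \<Gamma> 0 \<Longrightarrow> z \<noteq> 0 \<Longrightarrow> \<exists>i. \<exists>y\<in>\<Gamma> (0, u_degree i). mul A z y \<noteq> 0"
    and bracket_plane: "\<And>z z' g. z \<in> \<Gamma> (g, 0) \<Longrightarrow> z \<noteq> 0 \<Longrightarrow> z' \<in> \<Gamma> (g, 0) \<Longrightarrow> z' \<noteq> 0 \<Longrightarrow> g \<noteq> 0 \<Longrightarrow>
      \<exists>h. \<exists>y\<in>\<Gamma> (h, u_degree 1). mul A z y \<noteq> 0 \<and> mul A z' y \<noteq> 0"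
begin

sublocale scl: module "scl A" by (rule module_scl)

lemma comp_0 [simp]: "0 \<in> \<Gamma> g"
  by (rule scl.subspace_0[OF subspace])

lemma proj_0: "\<pi> g 0 = 0"
  using proj_comp[of 0 g g] by simp

lemma proj_sum_distrib:
  assumes "\<And>i. i \<in> I \<Longrightarrow> f i \<in> vecs A"
  shows "\<pi> g (\<Sum>i\<in>I. f i) = (\<Sum>i\<in>I. \<pi> g (f i))"
  using assms
proof (induction I rule: infinite_finite_induct)
  case (insert i I)
  have "(\<Sum>i\<in>I. f i) \<in> vecs A" using insert by (intro scl.subspace_sum[OF vecs_subspace]) auto
  then show ?case using insert by (simp add: proj_add)
qed (simp_all add: proj_0)

lemma grading: "is_grading A G4 \<Gamma>"
proof -
  have "direct_sum_decomposition A (carrier G4) \<Gamma>"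
  proof (rule direct_sum_decompositionI[where S = e6_support and \<pi> = \<pi>])
    show "\<Gamma> g = {0}" if "g \<in> carrier G4 - e6_support" for g using supp[of g] that by simp
  next
    fix c h assume c: "\<And>g. g \<in> e6_support \<Longrightarrow> c g \<in> \<Gamma> g" and h: "h \<in> e6_support"
    have "\<pi> h (\<Sum>g\<in>e6_support. c g) = (\<Sum>g\<in>e6_support. \<pi> h (c g))"
      using c comp_vecs by (intro proj_sum_distrib) blast
    also have "\<dots> = (\<Sum>g\<in>e6_support. if g = h then c h else 0)"
      by (rule sum.cong) (use proj_comp[OF c] in auto)
    finally show "\<pi> h (\<Sum>g\<in>e6_support. c g) = c h" using h finite_support by simp
  qed (use subspace comp_vecs finite_support proj_in proj_sum in auto)
  then show ?thesis using mult_comp by (auto simp: is_grading_def comm_group_G4)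
qed

lemma support_eq: "support G4 \<Gamma> = e6_support"
  using supp by (auto simp: support_def)

lemma component_unique:
  assumes "is_grading A H \<Delta>" "g \<in> carrier H" "h \<in> carrier H" "x \<in> \<Delta> g" "x \<in> \<Delta> h" "x \<noteq> 0"
  shows "g = h"
proof (rule direct_sum_components_disjoint[OF _ assms(2-6)])
  show ds: "direct_sum_decomposition A (carrier H) \<Delta>" using assms by (simp add: is_grading_def)
  show "0 \<in> \<Delta> k" if "k \<in> carrier H" for k
    using ds that scl.subspace_0 by (auto simp: direct_sum_decomposition_def)
qed

lemma degree_unique: "x \<in> \<Gamma> g \<Longrightarrow> x \<in> \<Gamma> h \<Longrightarrow> x \<noteq> 0 \<Longrightarrow> g = h"
  by (rule component_unique[OF grading]) auto

lemma nonzero_support: "x \<in> \<Gamma> g \<Longrightarrow> x \<noteq> 0 \<Longrightarrow> g \<in> e6_support"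
  using supp[of g] by auto

text \<open>A relabelling of the components which is multiplicative on nonzero products extends to a
  homomorphism, because the products assumed above present the group.\<close>

lemma relabelling_hom:
  fixes H :: "'h monoid"
  assumes H: "comm_group H" and \<delta>: "\<And>s. s \<in> e6_support \<Longrightarrow> \<delta> s \<in> carrier H"
    and mult: "\<And>s t x y. x \<in> \<Gamma> s \<Longrightarrow> y \<in> \<Gamma> t \<Longrightarrow> mul A x y \<noteq> 0 \<Longrightarrow> s \<in> e6_support \<Longrightarrow> t \<in> e6_support \<Longrightarrow>
      \<delta> (s + t) = \<delta> s \<otimes>\<^bsub>H\<^esub> \<delta> t"
  obtains \<phi> where "\<phi> \<in> hom G4 H" "\<And>s. s \<in> e6_support \<Longrightarrow> \<phi> s = \<delta> s"
proof -
  interpret comm_group H by fact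
  obtain z where z: "z \<in> \<Gamma> 0" "z \<noteq> 0"
    using supp[of 0] by (auto intro: comp_0)
  obtain i y where y: "y \<in> \<Gamma> (0, u_degree i)" "mul A z y \<noteq> 0"
    using bracket_zero[OF z] by blast
  have "\<delta> (0, u_degree i) = \<delta> 0 \<otimes>\<^bsub>H\<^esub> \<delta> (0, u_degree i)"
    using mult[OF z(1) y] by simp
  then have one: "\<delta> 0 = \<one>\<^bsub>H\<^esub>" using \<delta> by (metis e6_support_intros(2,5) r_cancel_one')
  show thesis
  proof (rule support_hom_exists[of H \<delta>, OF H \<delta> one])
    have e: "u_degree 1 + u_degree 2 = - u_degree 0"
      using u_degree_sums(1)[of 0] by simp
    show "\<delta> (0, u_degree 1) \<otimes>\<^bsub>H\<^esub> \<delta> (0, u_degree 2) = \<delta> (0, - u_degree 0)"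
      using bracket_uu mult[of _ "(0, u_degree 1)" _ "(0, u_degree 2)"] by (auto simp: e)
    show "\<delta> (g, u_degree i) \<otimes>\<^bsub>H\<^esub> \<delta> (h, - u_degree i) = \<delta> (g + h, 0)" for g h i
      using bracket_uv[of g i h] mult[of _ "(g, u_degree i)" _ "(h, - u_degree i)"] by auto
    show "\<delta> (0, u_degree i) \<otimes>\<^bsub>H\<^esub> \<delta> (0, - u_degree j) = \<delta> (0, u_degree i - u_degree j)" if "i \<noteq> j" for i j
      using bracket_long[OF that] mult[of _ "(0, u_degree i)" _ "(0, - u_degree j)"] by auto
  qed (use that in auto)
qed

text \<open>Label each component by its degree over H. A nonzero product lies in a single component,
  so the labels multiply whenever a product is nonzero, and by \<open>relabelling_hom\<close> they
  extend to a homomorphism. It is unique because the support generates G4.\<close>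

lemma universal: "universal_group TYPE('h) A G4 \<Gamma>"
  unfolding universal_group_def support_eq
proof (intro conjI allI impI grading)
  fix H :: "'h monoid" and \<Delta>
  assume "is_grading A H \<Delta> \<and> \<Delta> ` support H \<Delta> = \<Gamma> ` e6_support"
  then have gr: "is_grading A H \<Delta>" and im: "\<Delta> ` support H \<Delta> = \<Gamma> ` e6_support" by auto
  have H: "comm_group H" using gr by (simp add: is_grading_def)
  then have gH: "group H" by (rule comm_group.axioms)
  have "\<exists>h\<in>support H \<Delta>. \<Delta> h = \<Gamma> s" if "s \<in> e6_support" for s
  proof -
    have "\<Gamma> s \<in> \<Delta> ` support H \<Delta>" using that im by simp
    then show ?thesis by (metis imageE)
  qed
  then obtain \<delta> where \<delta>: "\<And>s. s \<in> e6_support \<Longrightarrow> \<delta> s \<in> support H \<Delta>" "\<And>s. s \<in> e6_support \<Longrightarrow> \<Delta> (\<delta> s) = \<Gamma> s"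
    by metis
  have \<delta>c: "\<delta> s \<in> carrier H" if "s \<in> e6_support" for s using \<delta>(1)[OF that] by (simp add: support_def)
  have mult: "\<delta> (s + t) = \<delta> s \<otimes>\<^bsub>H\<^esub> \<delta> t"
    if "x \<in> \<Gamma> s" "y \<in> \<Gamma> t" "mul A x y \<noteq> 0" "s \<in> e6_support" "t \<in> e6_support" for s t x y
  proof (rule component_unique[OF gr])
    have xy: "mul A x y \<in> \<Gamma> (s + t)" using mult_comp that by blast
    then have st: "s + t \<in> e6_support" using nonzero_support that by blast
    show "mul A x y \<in> \<Delta> (\<delta> (s + t))" "\<delta> (s + t) \<in> carrier H" using xy \<delta> \<delta>c st by auto
    have "x \<in> \<Delta> (\<delta> s)" "y \<in> \<Delta> (\<delta> t)" using that \<delta> by auto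
    then show "mul A x y \<in> \<Delta> (\<delta> s \<otimes>\<^bsub>H\<^esub> \<delta> t)" using gr \<delta>c that by (auto simp: is_grading_def)
    show "\<delta> s \<otimes>\<^bsub>H\<^esub> \<delta> t \<in> carrier H"
      using that by (intro monoid.m_closed[OF group.is_monoid[OF gH]] \<delta>c)
  qed (rule that)
  obtain \<phi> where \<phi>: "\<phi> \<in> hom G4 H" "\<And>s. s \<in> e6_support \<Longrightarrow> \<phi> s = \<delta> s"
  proof (rule relabelling_hom[of H \<delta>, OF H])
    show "\<delta> s \<in> carrier H" if "s \<in> e6_support" for s by (rule \<delta>c[OF that])
    show "\<delta> (s + t) = \<delta> s \<otimes>\<^bsub>H\<^esub> \<delta> t"
      if "x \<in> \<Gamma> s" "y \<in> \<Gamma> t" "mul A x y \<noteq> 0" "s \<in> e6_support" "t \<in> e6_support" for s t x y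
      by (rule mult[OF that])
  qed blast
  show "\<exists>!\<phi>. \<phi> \<in> hom G4 H \<inter> extensional (carrier G4) \<and> (\<forall>s\<in>e6_support. \<Delta> (\<phi> s) = \<Gamma> s)"
  proof (rule ex1I[of _ \<phi>])
    show "\<phi> \<in> hom G4 H \<inter> extensional (carrier G4) \<and> (\<forall>s\<in>e6_support. \<Delta> (\<phi> s) = \<Gamma> s)"
      using \<phi> \<delta> by simp
  next
    fix \<psi> assume \<psi>: "\<psi> \<in> hom G4 H \<inter> extensional (carrier G4) \<and> (\<forall>s\<in>e6_support. \<Delta> (\<psi> s) = \<Gamma> s)"
    have "\<psi> s = \<phi> s" if s: "s \<in> e6_support" for s
    proof -
      obtain x where x: "x \<in> \<Gamma> s" "x \<noteq> 0" using supp[of s] s by (auto intro: comp_0)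
      have "\<psi> s \<in> carrier H" using \<psi> by (auto intro: hom_in_carrier)
      moreover have "x \<in> \<Delta> (\<psi> s)" "x \<in> \<Delta> (\<delta> s)" using \<psi> s x \<delta> by auto
      ultimately have "\<psi> s = \<delta> s" using component_unique[OF gr] \<delta>c[OF s] x by blast
      then show ?thesis using \<phi> s by simp
    qed
    then show "\<psi> = \<phi>" using G4_hom_eq_support[OF gH] \<psi> \<phi>(1) by (intro ext) auto
  qed
qed

text \<open>Expand x over \<Delta> and project to \<Gamma> t. Each term is either kept or killed, as
  \<Delta> refines \<Gamma>, so some term inside \<Gamma> t lies outside X. Taking X = {0} finds a
  piece of a component, taking X = \<Delta> h finds a second piece.\<close>

lemma line_refined:
  assumes gr: "is_grading A H \<Delta>" and ref: "\<And>h. h \<in> support H \<Delta> \<Longrightarrow> \<exists>g\<in>e6_support. \<Delta> h \<subseteq> \<Gamma> g"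
    and x: "x \<in> \<Gamma> t" "x \<notin> X" and X: "module.subspace (scl A) X"
  obtains h z where "h \<in> support H \<Delta>" "\<Delta> h \<subseteq> \<Gamma> t" "z \<in> \<Delta> h" "z \<notin> X"
proof -
  have ds: "direct_sum_decomposition A (carrier H) \<Delta>" using gr by (simp add: is_grading_def)
  have "x \<in> vecs A" using x comp_vecs by blast
  then have "\<exists>!c. (\<forall>g\<in>carrier H. c g \<in> \<Delta> g) \<and> (\<forall>g. g \<notin> carrier H \<longrightarrow> c g = 0) \<and> finite {g. c g \<noteq> 0} \<and>
      x = (\<Sum>g | c g \<noteq> 0. c g)"
    using ds unfolding direct_sum_decomposition_def by blast
  from ex1_implies_ex[OF this] obtain c where c': "(\<forall>g\<in>carrier H. c g \<in> \<Delta> g) \<and> (\<forall>g. g \<notin> carrier H \<longrightarrow> c g = 0) \<and>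
      finite {g. c g \<noteq> 0} \<and> x = (\<Sum>g | c g \<noteq> 0. c g)"
    by (rule exE)
  then have c: "\<And>h. h \<in> carrier H \<Longrightarrow> c h \<in> \<Delta> h" "\<And>h. h \<notin> carrier H \<Longrightarrow> c h = 0"
    "finite {h. c h \<noteq> 0}" "x = (\<Sum>h | c h \<noteq> 0. c h)"
    by blast+
  have sup: "h \<in> support H \<Delta>" if "c h \<noteq> 0" for h
    using c(1)[of h] c(2)[of h] that by (auto simp: support_def)
  have "x = \<pi> t x" using x proj_comp by simp
  also have "\<dots> = (\<Sum>h | c h \<noteq> 0. \<pi> t (c h))"
    unfolding c(4)
  proof (rule proj_sum_distrib)
    fix h assume "h \<in> {h. c h \<noteq> 0}"
    then have "h \<in> carrier H" using c(2) by auto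
    then show "c h \<in> vecs A" using c(1) ds by (auto simp: direct_sum_decomposition_def)
  qed
  finally have "(\<Sum>h | c h \<noteq> 0. \<pi> t (c h)) \<notin> X" using x by simp
  then obtain h where h: "c h \<noteq> 0" "\<pi> t (c h) \<notin> X"
    using scl.subspace_sum[OF X, of "{h. c h \<noteq> 0}" "\<lambda>h. \<pi> t (c h)"] by blast
  obtain g where g: "g \<in> e6_support" "\<Delta> h \<subseteq> \<Gamma> g" using ref[OF sup[OF h(1)]] by blast
  have "c h \<in> \<Delta> h" using c h by auto
  moreover from this g have "\<pi> t (c h) = (if t = g then c h else 0)" using proj_comp by blast
  moreover have "0 \<in> X" by (rule scl.subspace_0[OF X])
  ultimately show thesis using that[OF sup[OF h(1)]] g h by (auto split: if_splits)
qed

text \<open>Lines cannot split, so they remain components of \<Delta>, and a proper refinement must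
  split a component of torsion degree. Multiply two of its pieces by vectors from short lines: the
  products lie in lines again, so their degrees in H are determined, and cancellation makes the
  degrees of the two pieces equal.\<close>

lemma fine: "fine_grading TYPE('h) A G4 \<Gamma>"
  unfolding fine_grading_def support_eq
proof (intro conjI grading notI)
  assume "\<exists>(H :: 'h monoid) \<Delta>. is_grading A H \<Delta> \<and>
          (\<forall>h\<in>support H \<Delta>. \<exists>g\<in>e6_support. \<Delta> h \<subseteq> \<Gamma> g) \<and>
          (\<exists>h\<in>support H \<Delta>. \<exists>g\<in>e6_support. \<Delta> h \<subset> \<Gamma> g)"
  then obtain H :: "'h monoid" and \<Delta> h g where gr: "is_grading A H \<Delta>"
    and ref: "\<And>h. h \<in> support H \<Delta> \<Longrightarrow> \<exists>g\<in>e6_support. \<Delta> h \<subseteq> \<Gamma> g"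
    and h: "h \<in> support H \<Delta>" and g: "\<Delta> h \<subset> \<Gamma> g" by blast
  have H: "comm_group H" using gr by (simp add: is_grading_def)
  interpret H: comm_group H by fact
  have sub: "module.subspace (scl A) (\<Delta> h)" if "h \<in> carrier H" for h
    using gr that by (auto simp: is_grading_def direct_sum_decomposition_def)
  have hc: "h \<in> carrier H" using h by (simp add: support_def)
  obtain x where x: "x \<in> \<Gamma> g" "x \<notin> \<Delta> h" using g by blast
  obtain k z' where k: "k \<in> support H \<Delta>" "\<Delta> k \<subseteq> \<Gamma> g" "z' \<in> \<Delta> k" "z' \<notin> \<Delta> h"
    using line_refined[OF gr ref x sub[OF hc]] by blast
  have kc: "k \<in> carrier H" using k by (simp add: support_def)
  have "0 \<in> \<Delta> h" using scl.subspace_0[OF sub[OF hc]] .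
  then obtain z where z: "z \<in> \<Delta> h" "z \<noteq> 0"
    using h by (auto simp: support_def)
  have z': "z' \<noteq> 0" using k \<open>0 \<in> \<Delta> h\<close> by auto
  have zg: "z \<in> \<Gamma> g" "z' \<in> \<Gamma> g" using z g k by auto
  have hk: "h \<noteq> k" using k by auto
  have full: "\<exists>l\<in>support H \<Delta>. \<Delta> l = \<Gamma> t" if t: "snd t \<noteq> 0" "t \<in> e6_support" for t
  proof -
    obtain y where y: "y \<in> \<Gamma> t" "y \<noteq> 0" using supp[of t] t by (auto intro: comp_0)
    obtain l w where l: "l \<in> support H \<Delta>" "\<Delta> l \<subseteq> \<Gamma> t" "w \<in> \<Delta> l" "w \<noteq> 0"
      using line_refined[OF gr ref y(1), of "{0}"] y(2) by (auto simp: scl.subspace_single_0)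
    have "\<Gamma> t \<subseteq> \<Delta> l"
    proof
      fix v assume "v \<in> \<Gamma> t"
      then obtain c where "v = scl A c w" using line[of t w v] t l by blast
      then show "v \<in> \<Delta> l" using scl.subspace_scale[OF sub] l by (auto simp: support_def)
    qed
    then show ?thesis using l by blast
  qed
  have lineE: "\<exists>l\<in>carrier H. \<exists>m\<in>carrier H. y \<in> \<Delta> l \<and> (\<forall>w. w \<in> \<Gamma> g \<longrightarrow> mul A w y \<noteq> 0 \<longrightarrow> mul A w y \<in> \<Delta> m)"
    if y: "y \<in> \<Gamma> t" and t: "snd t \<noteq> 0" "snd (g + t) \<noteq> 0" and w: "w \<in> \<Gamma> g" "mul A w y \<noteq> 0" for y t w
  proof -
    have gt: "mul A v y \<in> \<Gamma> (g + t)" if "v \<in> \<Gamma> g" for v using mult_comp y that by blast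
    \<comment> \<open>Seen from degrees alone: zero lies in every component, so a zero factor would
      put the nonzero product into two different components.\<close>
    have "y \<noteq> 0"
    proof
      assume "y = 0"
      then have "y \<in> \<Gamma> (t + t)" "y \<in> \<Gamma> t" by auto
      then have "mul A w y \<in> \<Gamma> (g + (t + t))" "mul A w y \<in> \<Gamma> (g + t)" using mult_comp w by blast+
      then have "g + (t + t) = g + t" using degree_unique w by blast
      then show False using t by simp
    qed
    then have "t \<in> e6_support" "g + t \<in> e6_support"
      using nonzero_support y gt w by blast+
    then obtain l m where "l \<in> support H \<Delta>" "\<Delta> l = \<Gamma> t" "m \<in> support H \<Delta>" "\<Delta> m = \<Gamma> (g + t)"
      using full t by meson
    then show ?thesis using y gt by (auto simp: support_def)
  qed
  have mulH: "mul A v y \<in> \<Delta> (a \<otimes>\<^bsub>H\<^esub> b)" if "v \<in> \<Delta> a" "y \<in> \<Delta> b" "a \<in> carrier H" "b \<in> carrier H" for v y a b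
    using gr that by (auto simp: is_grading_def)
  have "snd g = 0"
  proof (rule ccontr)
    assume "snd g \<noteq> 0"
    then obtain c where "z' = scl A c z" using line[of g z z'] zg z by blast
    then show False using k z scl.subspace_scale[OF sub[OF hc]] by auto
  qed
  then obtain g0 where g0: "g = (g0, 0)" by (cases g) auto
  show False
  proof (cases "g0 = 0")
    case True
    \<comment> \<open>In degree 0 the vectors that detect the two pieces may lie in different short
      lines. But each piece maps some line into itself, so its degree is the identity of H.\<close>
    have one: "a = \<one>\<^bsub>H\<^esub>" if v: "v \<in> \<Delta> a" "a \<in> carrier H" "v \<noteq> 0" "v \<in> \<Gamma> g" for v a
    proof -
      have gz: "g = 0" using g0 True by (simp add: zero_prod_def)
      obtain i y where y: "y \<in> \<Gamma> (0, u_degree i)" "mul A v y \<noteq> 0"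
        using bracket_zero[of v] v gz by blast
      have t: "(0, u_degree i) \<in> e6_support" "snd (0 :: 3 ^ 2, u_degree i) \<noteq> 0" by (simp_all add: u_degree_nonzero)
      obtain l where l: "l \<in> support H \<Delta>" "\<Delta> l = \<Gamma> (0, u_degree i)"
        using full[OF t(2,1)] by blast
      have lc: "l \<in> carrier H" using l by (simp add: support_def)
      have "mul A v y \<in> \<Delta> (a \<otimes>\<^bsub>H\<^esub> l)" using mulH v y l lc by auto
      moreover have "mul A v y \<in> \<Delta> l" using mult_comp[of v 0 y "(0, u_degree i)"] v y l gz by simp
      ultimately have "a \<otimes>\<^bsub>H\<^esub> l = l"
        using component_unique[OF gr] y v lc by blast
      then show ?thesis using v lc by simp
    qed
    show False using one[OF z(1) hc z(2) zg(1)] one[OF k(3) kc z' zg(2)] hk by simp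
  next
    case False
    obtain h' y where y: "y \<in> \<Gamma> (h', u_degree 1)" "mul A z y \<noteq> 0" "mul A z' y \<noteq> 0"
      using bracket_plane[of z g0 z'] zg z z' False g0 by blast
    obtain l m where lm: "l \<in> carrier H" "m \<in> carrier H" "y \<in> \<Delta> l"
      "\<And>w. w \<in> \<Gamma> g \<Longrightarrow> mul A w y \<noteq> 0 \<Longrightarrow> mul A w y \<in> \<Delta> m"
      using lineE[OF y(1) _ _ zg(1) y(2)] g0 by (auto simp: u_degree_nonzero)
    have "h \<otimes>\<^bsub>H\<^esub> l = m"
      using component_unique[OF gr _ lm(2) mulH[OF z(1) lm(3) hc lm(1)] lm(4)[OF zg(1) y(2)] y(2)] hc lm by simp
    moreover have "k \<otimes>\<^bsub>H\<^esub> l = m"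
      using component_unique[OF gr _ lm(2) mulH[OF k(3) lm(3) kc lm(1)] lm(4)[OF zg(2) y(3)] y(3)] kc lm by simp
    ultimately show False using hk H.right_cancel[OF lm(1) hc kc] by simp
  qed
qed

end

section \<open>Induced automorphisms and the Weyl group of an abstract grading\<close>

context e6_grading
begin

lemma vecs_0: "0 \<in> vecs A"
  by (rule scl.subspace_0[OF vecs_subspace])

lemma automorphismD:
  assumes "f \<in> algebra_automorphisms A"
  shows "bij_betw f (vecs A) (vecs A)" "f \<in> extensional (vecs A)" "f \<in> Bij (vecs A)"
    "x \<in> vecs A \<Longrightarrow> y \<in> vecs A \<Longrightarrow> f (x + y) = f x + f y"
    "x \<in> vecs A \<Longrightarrow> f (scl A k x) = scl A k (f x)"
    "x \<in> vecs A \<Longrightarrow> y \<in> vecs A \<Longrightarrow> f (mul A x y) = mul A (f x) (f y)"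
    "x \<in> vecs A \<Longrightarrow> f x \<in> vecs A" "inj_on f (vecs A)" "f ` vecs A = vecs A"
  using assms by (auto simp: algebra_automorphisms_def Bij_def bij_betw_def)

lemma automorphism_0: "f \<in> algebra_automorphisms A \<Longrightarrow> f 0 = 0"
  using automorphismD(4)[of f 0 0] vecs_0 by simp

lemma image_compose: "g ` \<Gamma> s \<subseteq> vecs A \<Longrightarrow> compose (vecs A) f g ` \<Gamma> s = f ` (g ` \<Gamma> s)"
  using comp_vecs[of s] by (force simp: compose_def image_iff)

lemma component_inj: "s \<in> e6_support \<Longrightarrow> \<Gamma> s = \<Gamma> t \<Longrightarrow> s = t"
proof -
  assume s: "s \<in> e6_support" "\<Gamma> s = \<Gamma> t"
  then obtain x where "x \<in> \<Gamma> s" "x \<noteq> 0" using supp[of s] by (auto intro: comp_0)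
  then show ?thesis using s degree_unique by auto
qed

text \<open>A relation at first, since existence needs the extension of a relabelling from the
  support and uniqueness the fact that the support generates G4. The function obtained in the end is
  \<open>induced\<close>.\<close>

definition induces :: "('v \<Rightarrow> 'v) \<Rightarrow> (g4 \<Rightarrow> g4) \<Rightarrow> bool" where
  "induces f \<alpha> \<longleftrightarrow> \<alpha> \<in> auto G4 \<and> (\<forall>s\<in>e6_support. f ` \<Gamma> s = \<Gamma> (\<alpha> s))"

lemma auto_G4_iff: "\<alpha> \<in> auto G4 \<longleftrightarrow> bij \<alpha> \<and> (\<forall>s t. \<alpha> (s + t) = \<alpha> s + \<alpha> t)"
  by (auto simp: auto_def hom_def Bij_def)

text \<open>f is injective, so nonzero components have nonzero images and \<alpha> maps the support
  into itself; finiteness gives equality.\<close>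

lemma induces_support:
  assumes f: "f \<in> algebra_automorphisms A" and ind: "induces f \<alpha>"
  shows "\<alpha> ` e6_support = e6_support"
proof (rule card_subset_eq[OF finite_support])
  show "\<alpha> ` e6_support \<subseteq> e6_support"
  proof
    fix t assume "t \<in> \<alpha> ` e6_support"
    then obtain s where s: "s \<in> e6_support" "t = \<alpha> s" by blast
    obtain x where x: "x \<in> \<Gamma> s" "x \<noteq> 0" using supp[of s] s by (auto intro: comp_0)
    have "f x \<noteq> f 0"
      using automorphismD(8)[OF f] x comp_vecs[of s] vecs_0 by (auto simp: inj_on_def)
    then have "f x \<noteq> 0" by (simp add: automorphism_0[OF f])
    moreover have "f x \<in> \<Gamma> t" using ind s x by (auto simp: induces_def)
    ultimately show "t \<in> e6_support" by (rule nonzero_support[rotated])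
  qed
  have "inj \<alpha>" using ind by (simp add: induces_def auto_G4_iff bij_is_inj)
  then show "card (\<alpha> ` e6_support) = card e6_support"
    by (simp add: card_image inj_on_subset)
qed

lemma induces_unique:
  assumes "f \<in> algebra_automorphisms A" "induces f \<alpha>" "induces f \<beta>"
  shows "\<alpha> = \<beta>"
proof
  fix s
  have h: "\<alpha> \<in> hom G4 G4" "\<beta> \<in> hom G4 G4" using assms by (auto simp: induces_def auto_def)
  show "\<alpha> s = \<beta> s"
  proof (rule G4_hom_eq_support[OF group_G4 h])
    fix s assume s: "s \<in> e6_support"
    then have "\<alpha> s \<in> e6_support" using induces_support[OF assms(1,2)] by auto
    then show "\<alpha> s = \<beta> s" using s assms by (intro component_inj) (auto simp: induces_def)
  qed
qed

definition graded_auts :: "('v \<Rightarrow> 'v) set" where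
  "graded_auts = {f \<in> algebra_automorphisms A. bij_betw (\<lambda>V. f ` V) (\<Gamma> ` e6_support) (\<Gamma> ` e6_support)}"

lemma inverse_automorphism:
  assumes f: "f \<in> algebra_automorphisms A"
  defines "f' \<equiv> restrict (inv_into (vecs A) f) (vecs A)"
  shows "f' \<in> algebra_automorphisms A" "x \<in> vecs A \<Longrightarrow> f (f' x) = x" "x \<in> vecs A \<Longrightarrow> f' (f x) = x"
proof -
  note D = automorphismD[OF f]
  show ff: "f (f' x) = x" if "x \<in> vecs A" for x
    using that D(9) by (simp add: f'_def f_inv_into_f)
  show f'f: "f' (f x) = x" if "x \<in> vecs A" for x
    using that D(7,8) by (simp add: f'_def inv_into_f_f)
  have b: "f' \<in> Bij (vecs A)" unfolding f'_def by (rule restrict_inv_into_Bij[OF D(3)])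
  then have cl: "f' x \<in> vecs A" if "x \<in> vecs A" for x using that by (auto simp: Bij_def bij_betw_def)
  have a: "f' (x + y) = f' x + f' y" if "x \<in> vecs A" "y \<in> vecs A" for x y
    using f'f[of "f' x + f' y"] D(4)[of "f' x" "f' y"] that ff cl scl.subspace_add[OF vecs_subspace] by simp
  have s: "f' (scl A k x) = scl A k (f' x)" if "x \<in> vecs A" for x k
    using f'f[of "scl A k (f' x)"] D(5)[of "f' x" k] that ff cl scl.subspace_scale[OF vecs_subspace] by simp
  have m: "f' (mul A x y) = mul A (f' x) (f' y)" if "x \<in> vecs A" "y \<in> vecs A" for x y
    using f'f[of "mul A (f' x) (f' y)"] D(6)[of "f' x" "f' y"] that ff cl mult_vecs by simp
  show "f' \<in> algebra_automorphisms A" using b a s m by (simp add: algebra_automorphisms_def)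
qed

lemma inverse_automorphism_image:
  assumes f: "f \<in> algebra_automorphisms A"
  defines "f' \<equiv> restrict (inv_into (vecs A) f) (vecs A)"
  shows "f' ` (f ` \<Gamma> s) = \<Gamma> s" "f ` (f' ` \<Gamma> s) = \<Gamma> s"
proof -
  have v: "x \<in> \<Gamma> s \<Longrightarrow> x \<in> vecs A" for x using comp_vecs by blast
  have "f' ` (f ` \<Gamma> s) = (\<lambda>x. x) ` \<Gamma> s"
    unfolding image_image f'_def by (rule image_cong[OF refl]) (rule inverse_automorphism(3)[OF f v])
  then show "f' ` (f ` \<Gamma> s) = \<Gamma> s" by simp
  have "f ` (f' ` \<Gamma> s) = (\<lambda>x. x) ` \<Gamma> s"
    unfolding image_image f'_def by (rule image_cong[OF refl]) (rule inverse_automorphism(2)[OF f v])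
  then show "f ` (f' ` \<Gamma> s) = \<Gamma> s" by simp
qed

lemma compose_automorphism:
  assumes f: "f \<in> algebra_automorphisms A" and g: "g \<in> algebra_automorphisms A"
  shows "compose (vecs A) f g \<in> algebra_automorphisms A"
  using compose_Bij[OF automorphismD(3)[OF f] automorphismD(3)[OF g]]
  by (simp add: algebra_automorphisms_def compose_def automorphismD[OF f] automorphismD[OF g] mult_vecs
      scl.subspace_add[OF vecs_subspace] scl.subspace_scale[OF vecs_subspace])

lemma id_automorphism: "(\<lambda>x\<in>vecs A. x) \<in> algebra_automorphisms A"
  using id_Bij[of "vecs A"]
  by (simp add: algebra_automorphisms_def mult_vecs scl.subspace_add[OF vecs_subspace] scl.subspace_scale[OF vecs_subspace])

lemma induces_id: "induces (\<lambda>x\<in>vecs A. x) (\<lambda>s. s)"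
proof -
  have "(\<lambda>x\<in>vecs A. x) ` \<Gamma> s = \<Gamma> s" for s using comp_vecs[of s] by (auto simp: image_iff subset_iff)
  then show ?thesis by (simp add: induces_def auto_G4_iff bij_id[unfolded id_def])
qed

lemma induces_compose:
  assumes f: "f \<in> algebra_automorphisms A" "induces f \<alpha>" and g: "g \<in> algebra_automorphisms A" "induces g \<beta>"
  shows "induces (compose (vecs A) f g) (\<alpha> \<circ> \<beta>)"
proof -
  have "compose (vecs A) f g ` \<Gamma> s = \<Gamma> (\<alpha> (\<beta> s))" if s: "s \<in> e6_support" for s
  proof -
    have "\<beta> s \<in> e6_support" using induces_support[OF g] s by blast
    then show ?thesis
      using s f g comp_vecs[of "\<beta> s"] by (subst image_compose) (auto simp: induces_def)
  qed
  moreover have "\<alpha> \<circ> \<beta> \<in> auto G4"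
  proof -
    have "bij \<alpha>" "\<And>s t. \<alpha> (s + t) = \<alpha> s + \<alpha> t" "bij \<beta>" "\<And>s t. \<beta> (s + t) = \<beta> s + \<beta> t"
      using f(2) g(2) unfolding induces_def auto_G4_iff by blast+
    then show ?thesis unfolding auto_G4_iff by (simp add: bij_comp del: split_paired_All)
  qed
  ultimately show ?thesis by (simp add: induces_def)
qed

lemma inverse_graded:
  assumes f: "f \<in> graded_auts"
  shows "restrict (inv_into (vecs A) f) (vecs A) \<in> graded_auts"
proof -
  let ?f = "restrict (inv_into (vecs A) f) (vecs A)"
  have fa: "f \<in> algebra_automorphisms A" and b: "bij_betw (\<lambda>V. f ` V) (\<Gamma> ` e6_support) (\<Gamma> ` e6_support)"
    using f by (auto simp: graded_auts_def)
  note I = inverse_automorphism[OF fa]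
  have 1: "?f ` (f ` \<Gamma> s) = \<Gamma> s" and 2: "f ` (?f ` \<Gamma> s) = \<Gamma> s" for s
    by (rule inverse_automorphism_image[OF fa])+
  have "bij_betw (\<lambda>V. ?f ` V) (\<Gamma> ` e6_support) (\<Gamma> ` e6_support)"
  proof (intro bij_betw_byWitness[where f' = "\<lambda>V. f ` V"])
    show "(\<lambda>V. f ` V) ` \<Gamma> ` e6_support \<subseteq> \<Gamma> ` e6_support" using b by (simp add: bij_betw_def)
    show "(\<lambda>V. ?f ` V) ` \<Gamma> ` e6_support \<subseteq> \<Gamma> ` e6_support"
    proof safe
      fix s t assume "(s, t) \<in> e6_support"
      then have "\<Gamma> (s, t) \<in> (\<lambda>V. f ` V) ` \<Gamma> ` e6_support" using b by (simp add: bij_betw_def)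
      then obtain u where "u \<in> e6_support" "\<Gamma> (s, t) = f ` \<Gamma> u" by blast
      then show "?f ` \<Gamma> (s, t) \<in> \<Gamma> ` e6_support" using 1 by simp
    qed
  qed (use 1 2 in simp_all)
  then show ?thesis using I(1) unfolding graded_auts_def by blast
qed

text \<open>f carries a nonzero product to a nonzero product, whose degree can be computed before or
  after applying f. So the permutation of degrees is multiplicative where
  \<open>relabelling_hom\<close> asks for it.\<close>

lemma induced_hom:
  assumes f: "f \<in> graded_auts"
  obtains \<alpha> where "\<alpha> \<in> hom G4 G4" "\<And>s. s \<in> e6_support \<Longrightarrow> \<alpha> s \<in> e6_support \<and> f ` \<Gamma> s = \<Gamma> (\<alpha> s)"
proof -
  have fa: "f \<in> algebra_automorphisms A" and b: "bij_betw (\<lambda>V. f ` V) (\<Gamma> ` e6_support) (\<Gamma> ` e6_support)"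
    using f by (auto simp: graded_auts_def)
  have "\<exists>t\<in>e6_support. f ` \<Gamma> s = \<Gamma> t" if "s \<in> e6_support" for s
  proof -
    have "f ` \<Gamma> s \<in> (\<lambda>V. f ` V) ` \<Gamma> ` e6_support" using that by blast
    also have "\<dots> = \<Gamma> ` e6_support" using b by (simp add: bij_betw_def)
    finally show ?thesis by blast
  qed
  then obtain \<delta> where \<delta>: "\<And>s. s \<in> e6_support \<Longrightarrow> \<delta> s \<in> e6_support" "\<And>s. s \<in> e6_support \<Longrightarrow> f ` \<Gamma> s = \<Gamma> (\<delta> s)"
    by metis
  obtain \<alpha> where \<alpha>: "\<alpha> \<in> hom G4 G4" "\<And>s. s \<in> e6_support \<Longrightarrow> \<alpha> s = \<delta> s"
  proof (rule relabelling_hom[of G4 \<delta>, OF comm_group_G4])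
    show "\<delta> (s + t) = \<delta> s \<otimes>\<^bsub>G4\<^esub> \<delta> t"
      if xy: "x \<in> \<Gamma> s" "y \<in> \<Gamma> t" "mul A x y \<noteq> 0" and s: "s \<in> e6_support" "t \<in> e6_support" for s t x y
    proof -
      have v: "x \<in> vecs A" "y \<in> vecs A" "mul A x y \<in> vecs A" using xy comp_vecs mult_vecs by blast+
      have st: "s + t \<in> e6_support" using nonzero_support[OF mult_comp[OF xy(1,2)] xy(3)] .
      have "f (mul A x y) \<noteq> f 0"
        using automorphismD(8)[OF fa] v vecs_0 xy by (auto simp: inj_on_def)
      then have "f (mul A x y) \<noteq> 0" by (simp add: automorphism_0[OF fa])
      moreover have "f (mul A x y) \<in> \<Gamma> (\<delta> (s + t))" using \<delta>(2)[OF st] mult_comp[OF xy(1,2)] by blast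
      moreover have "f x \<in> \<Gamma> (\<delta> s)" "f y \<in> \<Gamma> (\<delta> t)" using \<delta>(2)[OF s(1)] \<delta>(2)[OF s(2)] xy by blast+
      then have "f (mul A x y) \<in> \<Gamma> (\<delta> s + \<delta> t)" by (simp add: automorphismD(6)[OF fa] v mult_comp)
      ultimately show ?thesis using degree_unique by simp
    qed
  qed auto
  show thesis by (rule that[OF \<alpha>(1)]) (simp add: \<alpha>(2) \<delta>)
qed

text \<open>Bijectivity comes from the inverse of f, which induces a second homomorphism; both
  composites fix the support and are therefore the identity.\<close>

lemma graded_auts_induces:
  assumes f: "f \<in> graded_auts"
  obtains \<alpha> where "induces f \<alpha>"
proof -
  let ?f = "restrict (inv_into (vecs A) f) (vecs A)"
  have fa: "f \<in> algebra_automorphisms A" using f by (simp add: graded_auts_def)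
  note I = inverse_automorphism[OF fa]
  obtain \<alpha> where \<alpha>: "\<alpha> \<in> hom G4 G4" "\<And>s. s \<in> e6_support \<Longrightarrow> \<alpha> s \<in> e6_support \<and> f ` \<Gamma> s = \<Gamma> (\<alpha> s)"
    using induced_hom[OF f] by blast
  obtain \<beta> where \<beta>: "\<beta> \<in> hom G4 G4" "\<And>s. s \<in> e6_support \<Longrightarrow> \<beta> s \<in> e6_support \<and> ?f ` \<Gamma> s = \<Gamma> (\<beta> s)"
    using induced_hom[OF inverse_graded[OF f]] by blast
  have 1: "?f ` (f ` \<Gamma> s) = \<Gamma> s" and 2: "f ` (?f ` \<Gamma> s) = \<Gamma> s" for s
    by (rule inverse_automorphism_image[OF fa])+
  have id: "(\<lambda>s. s) \<in> hom G4 G4" by (simp add: hom_def)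
  have c: "(\<lambda>s. \<beta> (\<alpha> s)) \<in> hom G4 G4" "(\<lambda>s. \<alpha> (\<beta> s)) \<in> hom G4 G4"
    using Group.hom_compose[OF \<alpha>(1) \<beta>(1)] Group.hom_compose[OF \<beta>(1) \<alpha>(1)] by (simp_all add: comp_def)
  have "\<beta> (\<alpha> s) = s" for s
  proof (rule G4_hom_eq_support[OF group_G4 c(1) id])
    fix s assume s: "s \<in> e6_support"
    have "\<Gamma> (\<beta> (\<alpha> s)) = \<Gamma> s" using \<alpha>(2)[OF s] \<beta>(2)[of "\<alpha> s"] 1[of s] by simp
    then show "\<beta> (\<alpha> s) = s" using component_inj[OF s] by metis
  qed
  moreover have "\<alpha> (\<beta> s) = s" for s
  proof (rule G4_hom_eq_support[OF group_G4 c(2) id])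
    fix s assume s: "s \<in> e6_support"
    have "\<Gamma> (\<alpha> (\<beta> s)) = \<Gamma> s" using \<beta>(2)[OF s] \<alpha>(2)[of "\<beta> s"] 2[of s] by simp
    then show "\<alpha> (\<beta> s) = s" using component_inj[OF s] by metis
  qed
  ultimately have "bij \<alpha>" by (intro bij_betw_byWitness[of UNIV \<beta> \<alpha> UNIV]) simp_all
  then have "\<alpha> \<in> auto G4" using \<alpha>(1) by (simp add: auto_def Bij_def)
  then have "induces f \<alpha>" using \<alpha>(2) by (simp add: induces_def)
  then show thesis by (rule that)
qed

lemma induces_graded:
  assumes f: "f \<in> algebra_automorphisms A" and ind: "induces f \<alpha>"
  shows "f \<in> graded_auts"
proof -
  have "bij_betw (\<lambda>V. f ` V) (\<Gamma> ` e6_support) (\<Gamma> ` e6_support)"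
  proof (rule bij_betw_imageI)
    show "inj_on (\<lambda>V. f ` V) (\<Gamma> ` e6_support)"
      using automorphismD(8)[OF f] comp_vecs by (auto simp: inj_on_def inj_on_image_eq_iff[of f "vecs A"])
    have "(\<lambda>V. f ` V) ` \<Gamma> ` e6_support = \<Gamma> ` \<alpha> ` e6_support"
      using ind by (force simp: induces_def image_image)
    then show "(\<lambda>V. f ` V) ` \<Gamma> ` e6_support = \<Gamma> ` e6_support"
      by (simp add: induces_support[OF f ind])
  qed
  then show ?thesis using f by (simp add: graded_auts_def)
qed

lemma Aut_grading_eq: "Aut_grading A G4 \<Gamma> = BijGroup (vecs A) \<lparr>carrier := graded_auts\<rparr>"
  by (simp add: Aut_grading_def graded_auts_def support_eq)

lemma subgroup_graded_auts: "subgroup graded_auts (BijGroup (vecs A))"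
proof (rule subgroup.intro)
  show sub: "graded_auts \<subseteq> carrier (BijGroup (vecs A))"
    by (auto simp: graded_auts_def BijGroup_def automorphismD(3))
  show "f \<otimes>\<^bsub>BijGroup (vecs A)\<^esub> g \<in> graded_auts" if fg: "f \<in> graded_auts" "g \<in> graded_auts" for f g
  proof -
    obtain \<alpha> \<beta> where "induces f \<alpha>" "induces g \<beta>" using graded_auts_induces fg by metis
    moreover have a: "f \<in> algebra_automorphisms A" "g \<in> algebra_automorphisms A"
      using fg by (auto simp: graded_auts_def)
    ultimately have "compose (vecs A) f g \<in> graded_auts"
      by (intro induces_graded[OF compose_automorphism induces_compose])
    then show ?thesis using automorphismD(3)[OF a(1)] automorphismD(3)[OF a(2)] by (simp add: BijGroup_def)
  qed
  show "\<one>\<^bsub>BijGroup (vecs A)\<^esub> \<in> graded_auts"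
    using induces_graded[OF id_automorphism induces_id] by (simp add: BijGroup_def)
  show "inv\<^bsub>BijGroup (vecs A)\<^esub> f \<in> graded_auts" if "f \<in> graded_auts" for f
    using inverse_graded[OF that] that automorphismD(3)[of f] by (simp add: inv_BijGroup graded_auts_def)
qed

lemma group_Aut: "group (Aut_grading A G4 \<Gamma>)"
  unfolding Aut_grading_eq by (rule subgroup.subgroup_is_group[OF subgroup_graded_auts group_BijGroup])

definition induced :: "('v \<Rightarrow> 'v) \<Rightarrow> g4 \<Rightarrow> g4" where
  "induced f = (THE \<alpha>. induces f \<alpha>)"

lemma induced_eq: "f \<in> algebra_automorphisms A \<Longrightarrow> induces f \<alpha> \<Longrightarrow> induced f = \<alpha>"
  unfolding induced_def using induces_unique by blast

lemma induces_induced: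
  assumes "f \<in> graded_auts"
  shows "induces f (induced f)"
proof -
  obtain \<alpha> where "induces f \<alpha>" using graded_auts_induces[OF assms] .
  then show ?thesis using induced_eq[of f \<alpha>] assms by (simp add: graded_auts_def)
qed

lemma induced_group_hom: "group_hom (Aut_grading A G4 \<Gamma>) (AutoGroup G4) induced"
proof (rule group_hom.intro)
  show "group (AutoGroup G4)" by (rule group.AutoGroup[OF group_G4])
  have "induced \<in> hom (Aut_grading A G4 \<Gamma>) (AutoGroup G4)"
  proof (rule homI)
    fix f assume f: "f \<in> carrier (Aut_grading A G4 \<Gamma>)"
    then show "induced f \<in> carrier (AutoGroup G4)"
      using induces_induced[of f] by (simp add: Aut_grading_eq AutoGroup_def induces_def)
    fix g assume g: "g \<in> carrier (Aut_grading A G4 \<Gamma>)"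
    have fg: "f \<in> graded_auts" "g \<in> graded_auts" using f g by (auto simp: Aut_grading_eq)
    then have a: "f \<in> algebra_automorphisms A" "g \<in> algebra_automorphisms A" by (auto simp: graded_auts_def)
    have "f \<otimes>\<^bsub>Aut_grading A G4 \<Gamma>\<^esub> g = compose (vecs A) f g"
      using automorphismD(3)[OF a(1)] automorphismD(3)[OF a(2)] by (simp add: Aut_grading_eq BijGroup_def)
    moreover have "induced (compose (vecs A) f g) = induced f \<circ> induced g"
      by (rule induced_eq[OF compose_automorphism[OF a] induces_compose[OF a(1) _ a(2)]])
        (use fg induces_induced in auto)
    moreover have "induced f \<otimes>\<^bsub>AutoGroup G4\<^esub> induced g = induced f \<circ> induced g"
      using induces_induced[OF fg(1)] induces_induced[OF fg(2)]
      by (simp add: AutoGroup_def BijGroup_def induces_def auto_def compose_def comp_def restrict_def)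
    ultimately show "induced (f \<otimes>\<^bsub>Aut_grading A G4 \<Gamma>\<^esub> g) = induced f \<otimes>\<^bsub>AutoGroup G4\<^esub> induced g"
      by simp
  qed
  then show "group_hom_axioms (Aut_grading A G4 \<Gamma>) (AutoGroup G4) induced"
    by (rule group_hom_axioms.intro)
qed (rule group_Aut)

text \<open>Presents the Weyl group as a quotient by a kernel, so that the first isomorphism theorem
  embeds it into the automorphisms of G4.\<close>

lemma kernel_induced: "kernel (Aut_grading A G4 \<Gamma>) (AutoGroup G4) induced = Stab_grading A G4 \<Gamma>"
proof -
  have "induced f = (\<lambda>s. s) \<longleftrightarrow> (\<forall>s\<in>e6_support. f ` \<Gamma> s = \<Gamma> s)" if f: "f \<in> graded_auts" for f
  proof
    assume "induced f = (\<lambda>s. s)"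
    then show "\<forall>s\<in>e6_support. f ` \<Gamma> s = \<Gamma> s" using induces_induced[OF f] by (simp add: induces_def)
  next
    assume "\<forall>s\<in>e6_support. f ` \<Gamma> s = \<Gamma> s"
    then have "induces f (\<lambda>s. s)" by (simp add: induces_def auto_G4_iff bij_id[unfolded id_def])
    then show "induced f = (\<lambda>s. s)" using f by (intro induced_eq) (simp add: graded_auts_def)
  qed
  then show ?thesis
    by (auto simp: kernel_def Stab_grading_def support_eq Aut_grading_eq AutoGroup_def BijGroup_def restrict_def)
qed

lemma Weyl_group_eq: "Weyl_group A G4 \<Gamma> = Aut_grading A G4 \<Gamma> Mod kernel (Aut_grading A G4 \<Gamma>) (AutoGroup G4) induced"
  by (simp add: Weyl_group_def kernel_induced)

text \<open>All members of a coset induce the same automorphism, so the definite description in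
  \<open>Weyl_embedding\<close> agrees with the map of the first isomorphism theorem.\<close>

lemma Weyl_embedding_eq:
  assumes X: "X \<in> carrier (Weyl_group A G4 \<Gamma>)"
  shows "Weyl_embedding G4 \<Gamma> X = the_elem (induced ` X)" "\<exists>f\<in>graded_auts. the_elem (induced ` X) = induced f"
proof -
  interpret group_hom "Aut_grading A G4 \<Gamma>" "AutoGroup G4" induced by (rule induced_group_hom)
  obtain f where f: "f \<in> carrier (Aut_grading A G4 \<Gamma>)"
    and Xf: "X = kernel (Aut_grading A G4 \<Gamma>) (AutoGroup G4) induced #>\<^bsub>Aut_grading A G4 \<Gamma>\<^esub> f"
    using X unfolding Weyl_group_eq by (auto simp: carrier_FactGroup)
  have ne: "X \<noteq> {}" using X unfolding Weyl_group_eq by (rule FactGroup_nonempty)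
  have all: "g \<in> graded_auts \<and> induced g = induced f" if "g \<in> X" for g
  proof -
    have "g \<in> carrier (Aut_grading A G4 \<Gamma>)" "induced g = induced f"
      using that f unfolding Xf by (auto simp: r_coset_def kernel_def)
    then show ?thesis by (simp add: Aut_grading_eq)
  qed
  have el: "the_elem (induced ` X) = induced f"
    using ne all by (intro the_elem_image_unique) auto
  show "\<exists>f\<in>graded_auts. the_elem (induced ` X) = induced f" using el f by (auto simp: Aut_grading_eq)
  obtain g where g: "g \<in> X" using ne by blast
  show "Weyl_embedding G4 \<Gamma> X = the_elem (induced ` X)"
    unfolding Weyl_embedding_def support_eq el
  proof (rule the_equality)
    show "induced f \<in> auto G4 \<and> (\<forall>h\<in>X. \<forall>s\<in>e6_support. h ` \<Gamma> s = \<Gamma> (induced f s))"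
      using all induces_induced g by (metis induces_def)
    fix \<alpha> assume "\<alpha> \<in> auto G4 \<and> (\<forall>h\<in>X. \<forall>s\<in>e6_support. h ` \<Gamma> s = \<Gamma> (\<alpha> s))"
    then have "induces g \<alpha>" using g by (auto simp: induces_def)
    then show "\<alpha> = induced f" using all[OF g] induced_eq[of g \<alpha>] by (simp add: graded_auts_def)
  qed
qed

lemma Weyl_embedding_mon: "Weyl_embedding G4 \<Gamma> \<in> mon (Weyl_group A G4 \<Gamma>) (AutoGroup G4)"
proof -
  interpret group_hom "Aut_grading A G4 \<Gamma>" "AutoGroup G4" induced by (rule induced_group_hom)
  have h: "(\<lambda>X. the_elem (induced ` X)) \<in> hom (Weyl_group A G4 \<Gamma>) (AutoGroup G4)"
    unfolding Weyl_group_eq by (rule FactGroup_hom)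
  have i: "inj_on (\<lambda>X. the_elem (induced ` X)) (carrier (Weyl_group A G4 \<Gamma>))"
    unfolding Weyl_group_eq by (rule FactGroup_inj_on)
  have g: "group (Weyl_group A G4 \<Gamma>)"
    unfolding Weyl_group_eq by (rule normal.factorgroup_is_group[OF normal_kernel])
  have "Weyl_embedding G4 \<Gamma> \<in> hom (Weyl_group A G4 \<Gamma>) (AutoGroup G4)"
  proof (rule homI)
    fix X Y assume XY: "X \<in> carrier (Weyl_group A G4 \<Gamma>)" "Y \<in> carrier (Weyl_group A G4 \<Gamma>)"
    show "Weyl_embedding G4 \<Gamma> X \<in> carrier (AutoGroup G4)"
      using hom_in_carrier[OF h XY(1)] by (simp add: Weyl_embedding_eq(1)[OF XY(1)])
    have "X \<otimes>\<^bsub>Weyl_group A G4 \<Gamma>\<^esub> Y \<in> carrier (Weyl_group A G4 \<Gamma>)"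
      using monoid.m_closed[OF group.is_monoid[OF g]] XY by blast
    then show "Weyl_embedding G4 \<Gamma> (X \<otimes>\<^bsub>Weyl_group A G4 \<Gamma>\<^esub> Y) =
        Weyl_embedding G4 \<Gamma> X \<otimes>\<^bsub>AutoGroup G4\<^esub> Weyl_embedding G4 \<Gamma> Y"
      using Group.hom_mult[OF h XY] XY by (simp add: Weyl_embedding_eq(1))
  qed
  moreover have "inj_on (Weyl_embedding G4 \<Gamma>) (carrier (Weyl_group A G4 \<Gamma>))"
    using i by (simp add: inj_on_def Weyl_embedding_eq(1))
  ultimately show ?thesis by (simp add: mon_def)
qed

lemma Weyl_embedding_image:
  "Weyl_embedding G4 \<Gamma> ` carrier (Weyl_group A G4 \<Gamma>) = {\<alpha>. \<exists>f\<in>algebra_automorphisms A. induces f \<alpha>}"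
proof safe
  fix X assume X: "X \<in> carrier (Weyl_group A G4 \<Gamma>)"
  then obtain f where "f \<in> graded_auts" "Weyl_embedding G4 \<Gamma> X = induced f" using Weyl_embedding_eq[OF X] by auto
  then show "\<exists>f\<in>algebra_automorphisms A. induces f (Weyl_embedding G4 \<Gamma> X)"
    using induces_induced[of f] by (auto simp: graded_auts_def)
next
  fix \<alpha> f assume f: "f \<in> algebra_automorphisms A" "induces f \<alpha>"
  interpret group_hom "Aut_grading A G4 \<Gamma>" "AutoGroup G4" induced by (rule induced_group_hom)
  let ?K = "kernel (Aut_grading A G4 \<Gamma>) (AutoGroup G4) induced"
  have fc: "f \<in> carrier (Aut_grading A G4 \<Gamma>)" using induces_graded[OF f] by (simp add: Aut_grading_eq)
  let ?X = "?K #>\<^bsub>Aut_grading A G4 \<Gamma>\<^esub> f"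
  have X: "?X \<in> carrier (Weyl_group A G4 \<Gamma>)"
    unfolding Weyl_group_eq using fc by (auto simp: carrier_FactGroup)
  have "induced ` ?X = {induced f}"
  proof
    show "induced ` ?X \<subseteq> {induced f}" using fc by (auto simp: kernel_def r_coset_def)
    have "\<one>\<^bsub>Aut_grading A G4 \<Gamma>\<^esub> \<otimes>\<^bsub>Aut_grading A G4 \<Gamma>\<^esub> f \<in> ?X"
      unfolding r_coset_def by (auto simp: kernel_def)
    then show "{induced f} \<subseteq> induced ` ?X" using fc by (simp add: image_iff) (metis)
  qed
  then have "Weyl_embedding G4 \<Gamma> ?X = \<alpha>"
    using Weyl_embedding_eq(1)[OF X] induced_eq[OF f] by simp
  then show "\<alpha> \<in> Weyl_embedding G4 \<Gamma> ` carrier (Weyl_group A G4 \<Gamma>)" using X by (metis imageI)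
qed

lemma realized_compose:
  assumes "\<alpha> \<in> {\<alpha>. \<exists>f\<in>algebra_automorphisms A. induces f \<alpha>}" "\<beta> \<in> {\<alpha>. \<exists>f\<in>algebra_automorphisms A. induces f \<alpha>}"
  shows "\<alpha> \<circ> \<beta> \<in> {\<alpha>. \<exists>f\<in>algebra_automorphisms A. induces f \<alpha>}"
  using assms compose_automorphism induces_compose by blast

end

section \<open>The grading in the model\<close>

lemma u_degree_diff_short: "u_degree j - u_degree l \<noteq> u_degree i" "u_degree j - u_degree l \<noteq> - u_degree i"
    "u_degree i \<noteq> - u_degree j"
  using exhaust_mod3[of i] exhaust_mod3[of j] exhaust_mod3[of l]
  by (elim disjE; simp add: u_degree_simps vec2_eq_iff)+

lemma u_degree_diff_inject:
  assumes "i \<noteq> j" "u_degree i - u_degree j = u_degree k - u_degree l"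
  shows "k = i \<and> l = j"
  using exhaust_mod3[of i] exhaust_mod3[of j] exhaust_mod3[of k] exhaust_mod3[of l] assms
  by (elim disjE; simp add: u_degree_simps vec2_eq_iff)

lemma finite_e6_support: "finite e6_support"
proof (rule finite_subset)
  show "e6_support \<subseteq> UNIV \<times> ({0} \<union> range u_degree \<union> range (\<lambda>i. - u_degree i) \<union> range (\<lambda>(i, j). u_degree i - u_degree j))"
    by (auto simp: e6_support_def)
qed auto

lemma mdl_bracket_vecs:
  fixes m n :: "'b::field_char_0 mdl"
  assumes "m \<in> mdl_vecs" "n \<in> mdl_vecs"
  shows "mdl_bracket m n \<in> mdl_vecs"
proof -
  have t: "trace (x ** y - y ** x) = 0" for x y :: "'b jor" by (simp add: trace_linear trace_mul_sym[of y x])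
  show ?thesis
    by (cases m; cases n) (simp add: mdl_bracket_def mdl_vecs_def t trace_linear(1,2)[of "_ - _"] trace_linear(2)[of "_ - _"]
      trace_linear(1)[of "_ - _"])
qed

definition mdl_P :: "3 \<Rightarrow> 'b::field jor \<Rightarrow> 'b mdl" where
  "mdl_P i M = (0, 0, 0, axis i M, 0)"

definition mdl_Q :: "3 \<Rightarrow> 'b::field jor \<Rightarrow> 'b mdl" where
  "mdl_Q i M = (0, 0, 0, 0, axis i M)"

context cube_root
begin

abbreviation "J \<equiv> jor_component \<omega>"

lemma pauli_in_J [simp]: "pauli g \<in> J g"
  by (simp add: jor_component_iff coord_pauli)

text \<open>The matrix unit E_ij in the first sl_3 is a root vector of weight u_i - u_j and carries
  no torsion.\<close>

definition kcomp :: "g4 \<Rightarrow> 'a jor \<Rightarrow> bool" where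
  "kcomp s K \<longleftrightarrow> (\<forall>i j. K $ i $ j \<noteq> 0 \<longrightarrow> fst s = 0 \<and> u_degree i - u_degree j = snd s)"

text \<open>M sits in a slot of Z^2-weight c: it has to be a multiple of the Pauli matrix of the
  torsion part of s, and zero if s has another weight.\<close>

definition jcomp :: "g4 \<Rightarrow> int ^ 2 \<Rightarrow> 'a jor \<Rightarrow> bool" where
  "jcomp s c M \<longleftrightarrow> M \<in> J (fst s) \<and> (snd s \<noteq> c \<longrightarrow> M = 0)"

definition mdl_component :: "g4 \<Rightarrow> 'a mdl set" where
  "mdl_component s = {(K, X, Y, P, Q). trace K = 0 \<and> trace X = 0 \<and> trace Y = 0 \<and> kcomp s K \<and>
     jcomp s 0 X \<and> jcomp s 0 Y \<and> (\<forall>i. jcomp s (u_degree i) (P $ i)) \<and> (\<forall>i. jcomp s (- u_degree i) (Q $ i))}"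

lemma jcomp_linear:
  "jcomp s c 0" "jcomp s c M \<Longrightarrow> jcomp s c N \<Longrightarrow> jcomp s c (M + N)"
  "jcomp s c M \<Longrightarrow> jcomp s c N \<Longrightarrow> jcomp s c (M - N)" "jcomp s c M \<Longrightarrow> jcomp s c (- M)"
  "jcomp s c M \<Longrightarrow> jcomp s c (mscale k M)"
  by (auto simp: jcomp_def jor_component_linear)

lemma jcomp_sum: "(\<And>i. i \<in> I \<Longrightarrow> jcomp s c (f i)) \<Longrightarrow> jcomp s c (sum f I)"
  by (induction I rule: infinite_finite_induct) (simp_all add: jcomp_linear)

lemma jcomp_tracefree: "jcomp s c M \<Longrightarrow> jcomp s c (tracefree M)"
  using tracefree_jor_component[of M "fst s"] by (auto simp: jcomp_def tracefree_linear jor_component_linear)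

lemma jcomp_mult:
  assumes "jcomp s c M" "jcomp t d N" "e = c + d"
  shows "jcomp (s + t) e (M ** N)" "jcomp (t + s) e (M ** N)" "jcomp (s + t) e (mcross M N)"
  using assms jor_component_mult[of M "fst s" N "fst t"]
  by (auto simp: jcomp_def mcross_linear add_ac)

lemma kcomp_linear:
  "kcomp s 0" "kcomp s M \<Longrightarrow> kcomp s N \<Longrightarrow> kcomp s (M + N)"
  "kcomp s M \<Longrightarrow> kcomp s N \<Longrightarrow> kcomp s (M - N)" "kcomp s M \<Longrightarrow> kcomp s (mscale k M)"
proof -
  show "kcomp s 0" by (simp add: kcomp_def)
  show "kcomp s M \<Longrightarrow> kcomp s (mscale k M)" by (auto simp: kcomp_def)
  assume "kcomp s M" "kcomp s N"
  then have "M $ i $ j = 0 \<and> N $ i $ j = 0" if "\<not> (fst s = 0 \<and> u_degree i - u_degree j = snd s)" for i j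
    using that by (auto simp: kcomp_def)
  note z = this
  show "kcomp s (M + N)"
    unfolding kcomp_def by (intro allI impI, rule ccontr, drule z, simp)
  show "kcomp s (M - N)"
    unfolding kcomp_def by (intro allI impI, rule ccontr, drule z, simp)
qed

lemma kcomp_mult:
  assumes "kcomp s M" "kcomp t N"
  shows "kcomp (s + t) (M ** N)" "kcomp (t + s) (M ** N)"
proof -
  have "fst s + fst t = 0 \<and> u_degree i - u_degree j = snd s + snd t" if nz: "(M ** N) $ i $ j \<noteq> 0" for i j
  proof -
    obtain l where "M $ i $ l * N $ l $ j \<noteq> 0"
      using nz unfolding matrix_mult_nth by (meson sum.neutral)
    then have "fst s = 0" "u_degree i - u_degree l = snd s" "fst t = 0" "u_degree l - u_degree j = snd t"
      using assms by (auto simp: kcomp_def)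
    then show ?thesis by (simp add: algebra_simps)
  qed
  then show "kcomp (s + t) (M ** N)" "kcomp (t + s) (M ** N)" by (auto simp: kcomp_def add.commute)
qed

text \<open>Subtracting the scalar part is harmless: a nonzero trace requires a nonzero diagonal
  entry, which already forces degree 0.\<close>

lemma kcomp_tracefree:
  assumes "kcomp s M"
  shows "kcomp s (tracefree M)"
proof -
  have "fst s = 0 \<and> snd s = 0" if "trace M \<noteq> 0"
  proof -
    have "\<exists>i. M $ i $ i \<noteq> 0"
      by (rule ccontr) (use that in \<open>simp add: trace_def\<close>)
    then show ?thesis using assms unfolding kcomp_def by (metis cancel_comm_monoid_add_class.diff_cancel)
  qed
  then have "kcomp s (mscale (trace M / 3) (mat 1))"
    by (simp add: kcomp_def mat_def)
  then show ?thesis unfolding tracefree_def by (rule kcomp_linear(3)[OF assms])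
qed

text \<open>Homogeneous matrices of nonzero torsion degree have trace zero. This is the reason why
  the long roots carry no torsion.\<close>

lemma kcomp_trace:
  assumes "\<And>i j. jcomp s (u_degree i - u_degree j) (M i j)"
  shows "kcomp s (\<chi> i j. trace (M i j))"
proof -
  have "fst s = 0 \<and> u_degree i - u_degree j = snd s" if "trace (M i j) \<noteq> 0" for i j
  proof -
    have "M i j \<noteq> 0" using that by (auto simp: trace_linear)
    then show ?thesis using that assms[of i j] trace_jor_component[of "M i j" "fst s"] by (auto simp: jcomp_def)
  qed
  then show ?thesis by (simp add: kcomp_def)
qed

lemma jcomp_kcomp:
  assumes "kcomp s K" "jcomp t c M" "d = u_degree i - u_degree j + c"
  shows "jcomp (s + t) d (mscale (K $ i $ j) M)" "jcomp (t + s) d (mscale (K $ i $ j) M)"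
proof -
  have "jcomp (s + t) d (mscale (K $ i $ j) M)"
  proof (cases "K $ i $ j = 0")
    case False
    then show ?thesis using assms by (auto simp: kcomp_def jcomp_def jor_component_linear)
  qed (simp add: jcomp_linear)
  then show "jcomp (s + t) d (mscale (K $ i $ j) M)" "jcomp (t + s) d (mscale (K $ i $ j) M)"
    by (simp_all add: add.commute)
qed

lemma mdl_component_vecs: "mdl_component s \<subseteq> mdl_vecs"
  by (auto simp: mdl_component_def mdl_vecs_def)

lemma mdl_component_bracket:
  assumes m: "m \<in> mdl_component s" and n: "n \<in> mdl_component t"
  shows "mdl_bracket m n \<in> mdl_component (s + t)"
proof -
  obtain K X Y P Q where m': "m = (K, X, Y, P, Q)" by (cases m) auto
  obtain K' X' Y' P' Q' where n': "n = (K', X', Y', P', Q')" by (cases n) auto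
  have c: "kcomp s K" "jcomp s 0 X" "jcomp s 0 Y" "\<And>i. jcomp s (u_degree i) (P $ i)" "\<And>i. jcomp s (- u_degree i) (Q $ i)"
    "kcomp t K'" "jcomp t 0 X'" "jcomp t 0 Y'" "\<And>i. jcomp t (u_degree i) (P' $ i)" "\<And>i. jcomp t (- u_degree i) (Q' $ i)"
    using m n by (auto simp: m' n' mdl_component_def)
  have k: "kcomp (s + t) (\<chi> i j. trace (P $ i ** Q' $ j) - trace (P' $ i ** Q $ j))"
  proof -
    have "jcomp (s + t) (u_degree i - u_degree j) (P $ i ** Q' $ j - P' $ i ** Q $ j)" for i j
      by (intro jcomp_linear jcomp_mult(1)[OF c(4) c(10)] jcomp_mult(2)[OF c(9) c(5)]) simp_all
    from kcomp_trace[OF this] show ?thesis by (simp add: trace_linear)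
  qed
  have v: "mdl_bracket m n \<in> mdl_vecs"
    using mdl_bracket_vecs m n mdl_component_vecs by blast
  note s = u_degree_sums
  have "kcomp (s + t) (K ** K' - K' ** K - tracefree (\<chi> i j. trace (P $ i ** Q' $ j) - trace (P' $ i ** Q $ j)))"
    by (intro kcomp_linear kcomp_mult(1)[OF c(1) c(6)] kcomp_mult(2)[OF c(6) c(1)] kcomp_tracefree k)
  moreover have "jcomp (s + t) 0 (X ** X' - X' ** X - tracefree (\<Sum>i\<in>UNIV. P $ i ** Q' $ i - P' $ i ** Q $ i))"
    by (intro jcomp_linear jcomp_sum jcomp_tracefree jcomp_mult(1)[OF c(2) c(7)] jcomp_mult(2)[OF c(7) c(2)]
      jcomp_mult(1)[OF c(4) c(10)] jcomp_mult(2)[OF c(9) c(5)]) simp_all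
  moreover have "jcomp (s + t) 0 (Y ** Y' - Y' ** Y + tracefree (\<Sum>i\<in>UNIV. Q' $ i ** P $ i - Q $ i ** P' $ i))"
    by (intro jcomp_linear jcomp_sum jcomp_tracefree jcomp_mult(1)[OF c(3) c(8)] jcomp_mult(2)[OF c(8) c(3)]
      jcomp_mult(2)[OF c(10) c(4)] jcomp_mult(1)[OF c(5) c(9)]) simp_all
  moreover have "jcomp (s + t) (u_degree i) ((\<Sum>l\<in>UNIV. mscale (K $ i $ l) (P' $ l) - mscale (K' $ i $ l) (P $ l))
        + (X ** P' $ i - X' ** P $ i) - (P' $ i ** Y - P $ i ** Y')
        + (mcross (Q $ (i + 1)) (Q' $ (i + 2)) - mcross (Q $ (i + 2)) (Q' $ (i + 1))))" for i
    by (intro jcomp_linear jcomp_sum jcomp_kcomp(1)[OF c(1) c(9)] jcomp_kcomp(2)[OF c(6) c(4)]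
      jcomp_mult(1)[OF c(2) c(9)] jcomp_mult(2)[OF c(7) c(4)] jcomp_mult(2)[OF c(9) c(3)] jcomp_mult(1)[OF c(4) c(8)]
      jcomp_mult(3)[OF c(5) c(10)]) (simp_all add: s)
  moreover have "jcomp (s + t) (- u_degree i) ((\<Sum>l\<in>UNIV. mscale (K' $ l $ i) (Q $ l) - mscale (K $ l $ i) (Q' $ l))
        - (Q' $ i ** X - Q $ i ** X') + (Y ** Q' $ i - Y' ** Q $ i)
        + (mcross (P $ (i + 1)) (P' $ (i + 2)) - mcross (P $ (i + 2)) (P' $ (i + 1))))" for i
    by (intro jcomp_linear jcomp_sum jcomp_kcomp(1)[OF c(1) c(10)] jcomp_kcomp(2)[OF c(6) c(5)]
      jcomp_mult(2)[OF c(10) c(2)] jcomp_mult(1)[OF c(5) c(7)] jcomp_mult(1)[OF c(3) c(10)] jcomp_mult(2)[OF c(8) c(5)]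
      jcomp_mult(3)[OF c(4) c(9)]) (simp_all add: s)
  ultimately show ?thesis
    using v unfolding m' n' mdl_bracket_def mdl_component_def mdl_vecs_def by simp
qed

lemma jor_component_tracefree_iff:
  "M \<in> J g \<longleftrightarrow> tracefree M \<in> J g \<and> (trace M \<noteq> 0 \<longrightarrow> g = 0)"
proof
  assume "M \<in> J g"
  then show "tracefree M \<in> J g \<and> (trace M \<noteq> 0 \<longrightarrow> g = 0)"
    using tracefree_jor_component[of M g] trace_jor_component[of M g] by (auto simp: jor_component_linear)
next
  assume a: "tracefree M \<in> J g \<and> (trace M \<noteq> 0 \<longrightarrow> g = 0)"
  have "mscale (trace M / 3) (mat 1) \<in> J g"
  proof (cases "trace M = 0")
    case False
    then have "g = 0" using a by simp
    then show ?thesis using jor_component_linear(4)[OF pauli_in_J[of 0]] by (simp add: pauli_0)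
  qed (simp add: jor_component_linear)
  then have "tracefree M + mscale (trace M / 3) (mat 1) \<in> J g" using a by (intro jor_component_linear(2)) auto
  then show "M \<in> J g" by (simp add: tracefree_def)
qed

lemma jcomp_tracefree_iff:
  "jcomp s c M \<longleftrightarrow> tracefree M \<in> J (fst s) \<and> (tracefree M \<noteq> 0 \<longrightarrow> c = snd s) \<and> (trace M \<noteq> 0 \<longrightarrow> fst s = 0 \<and> c = snd s)"
proof -
  have "M = 0 \<longleftrightarrow> tracefree M = 0 \<and> trace M = 0"
    by (auto simp: tracefree_def trace_linear)
  then show ?thesis
    unfolding jcomp_def jor_component_tracefree_iff[of M] by auto
qed

lemma jcomp_half_iff:
  "jcomp s 0 X \<and> jcomp s 0 Y \<longleftrightarrow> mscale (1 / 2) (X - Y) \<in> J (fst s) \<and> (mscale (1 / 2) (X - Y) \<noteq> 0 \<longrightarrow> snd s = 0) \<and>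
     (if snd s = 0 then mscale (1 / 2) (X + Y) \<in> J (fst s) else mscale (1 / 2) (X + Y) = 0)"
proof
  assume a: "mscale (1 / 2) (X - Y) \<in> J (fst s) \<and> (mscale (1 / 2) (X - Y) \<noteq> 0 \<longrightarrow> snd s = 0) \<and>
     (if snd s = 0 then mscale (1 / 2) (X + Y) \<in> J (fst s) else mscale (1 / 2) (X + Y) = 0)"
  have e: "X = mscale (1 / 2) (X + Y) + mscale (1 / 2) (X - Y)" "Y = mscale (1 / 2) (X + Y) - mscale (1 / 2) (X - Y)"
    by (simp_all add: vec_eq_iff field_simps)
  have "jcomp s 0 (mscale (1 / 2) (X - Y))" "jcomp s 0 (mscale (1 / 2) (X + Y))"
    using a by (auto simp: jcomp_def jor_component_linear split: if_splits)
  then have "jcomp s 0 (mscale (1 / 2) (X + Y) + mscale (1 / 2) (X - Y))" "jcomp s 0 (mscale (1 / 2) (X + Y) - mscale (1 / 2) (X - Y))"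
    using jcomp_linear(2,3) by blast+
  then show "jcomp s 0 X \<and> jcomp s 0 Y" using e by metis
qed (auto simp: jcomp_def jor_component_linear)

lemma oct_der_eq_0_iff: "oct_der K p q = (0 :: 'b::field oct \<Rightarrow> 'b oct) \<longleftrightarrow> K = 0 \<and> p = 0 \<and> q = 0"
proof -
  have "oct_der 0 0 0 = (0 :: 'b oct \<Rightarrow> 'b oct)"
    by (simp add: fun_eq_iff vec_eq_iff forall_octix oct_der_nth)
  then show ?thesis using oct_der_inject[of K p q 0 0 0] by simp
qed

lemma jor_ad_eq_0_iff:
  assumes "trace y = 0"
  shows "jor_ad y = 0 \<longleftrightarrow> y = (0 :: 'b::field_char_0 jor)"
proof -
  have "jor_ad (0 :: 'b jor) = 0" by (simp add: fun_eq_iff jor_ad_linear)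
  then show ?thesis using jor_ad_inject[of y 0] assms by (auto simp: trace_linear)
qed

text \<open>\<Gamma>4 looks at the traces of P and Q through the derivation factor, where the
  torsion degree must be 0, and at their tracefree parts through the tensor factor.
  \<open>jcomp_tracefree_iff\<close> joins the two conditions into one on the whole matrix,
  \<open>jcomp_half_iff\<close> does the same for X and Y.\<close>

lemma to_tits_component_iff:
  assumes "m \<in> mdl_vecs"
  shows "to_tits m \<in> \<Gamma>4 \<omega> s \<longleftrightarrow> m \<in> mdl_component s"
proof -
  obtain K X Y P Q where m: "m = (K, X, Y, P, Q)" by (cases m) auto
  obtain g h where s: "s = (g, h)" by (cases s)
  have tr: "trace K = 0" "trace X = 0" "trace Y = 0" using assms by (auto simp: m mdl_vecs_def)
  have trh: "trace (mscale (1 / 2) (X + Y)) = 0" by (simp add: trace_linear tr)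
  have d: "oct_der K (trace_vec P) (trace_vec Q) \<in> (if g = 0 then Der_oct_component h else {0}) \<longleftrightarrow>
      kcomp s K \<and> (\<forall>i. trace (P $ i) \<noteq> 0 \<longrightarrow> g = 0 \<and> u_degree i = h) \<and> (\<forall>i. trace (Q $ i) \<noteq> 0 \<longrightarrow> g = 0 \<and> - u_degree i = h)"
    by (auto simp: oct_der_component_iff[OF tr(1)] g2_component_def oct_der_eq_0_iff kcomp_def s trace_vec_def vec_eq_iff)
  have S: "tits_mid X Y P Q \<in> tensor_span (oct_traceless \<inter> oct_component h) (jor_traceless \<inter> J g) \<longleftrightarrow>
      (mscale (1 / 2) (X - Y) \<in> J g \<and> (mscale (1 / 2) (X - Y) \<noteq> 0 \<longrightarrow> h = 0)) \<and>
      (\<forall>k. tracefree (P $ k) \<in> J g \<and> (tracefree (P $ k) \<noteq> 0 \<longrightarrow> u_degree k = h)) \<and>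
      (\<forall>k. tracefree (Q $ k) \<in> J g \<and> (tracefree (Q $ k) \<noteq> 0 \<longrightarrow> - u_degree k = h))"
  proof -
    have n: "mscale (1 / 2) (Y - X) = - mscale (1 / 2) (X - Y)" by (simp add: vec_eq_iff field_simps)
    have "- mscale (1 / 2) (X - Y) \<in> J g" if "mscale (1 / 2) (X - Y) \<in> J g"
      using that by (rule jor_component_linear(5))
    moreover have "trace (mscale (1 / 2) (X - Y)) = 0" "trace (- mscale (1 / 2) (X - Y)) = 0"
      by (simp_all add: trace_linear tr)
    ultimately show ?thesis
      unfolding tensor_span_component mem_Collect_eq forall_octix tits_mid_nth n oct_degree.simps by auto
  qed
  have D: "jor_ad (mscale (1 / 2) (X + Y)) \<in> (if h = 0 then Der_jor_component \<omega> g else {0}) \<longleftrightarrow>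
      (if h = 0 then mscale (1 / 2) (X + Y) \<in> J g else mscale (1 / 2) (X + Y) = 0)"
    using jor_ad_component_iff[OF trh, of g] jor_ad_eq_0_iff[OF trh] by simp
  have "to_tits m \<in> \<Gamma>4 \<omega> s \<longleftrightarrow>
      oct_der K (trace_vec P) (trace_vec Q) \<in> (if g = 0 then Der_oct_component h else {0}) \<and>
      tits_mid X Y P Q \<in> tensor_span (oct_traceless \<inter> oct_component h) (jor_traceless \<inter> J g) \<and>
      jor_ad (mscale (1 / 2) (X + Y)) \<in> (if h = 0 then Der_jor_component \<omega> g else {0})"
    by (simp only: m s \<Gamma>4_def to_tits_def prod.case mem_Times_iff fst_conv snd_conv)
  also have "\<dots> \<longleftrightarrow> kcomp s K \<and> (jcomp s 0 X \<and> jcomp s 0 Y) \<and> (\<forall>i. jcomp s (u_degree i) (P $ i)) \<and> (\<forall>i. jcomp s (- u_degree i) (Q $ i))"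
    unfolding d S D jcomp_half_iff s fst_conv snd_conv unfolding jcomp_tracefree_iff[of "(g, h)" "u_degree _"] jcomp_tracefree_iff[of "(g, h)" "- u_degree _"] fst_conv snd_conv
    by blast
  also have "\<dots> \<longleftrightarrow> m \<in> mdl_component s" by (auto simp: m mdl_component_def tr)
  finally show ?thesis .
qed

lemma \<Gamma>4_vecs: "\<Gamma>4 \<omega> s \<subseteq> vecs tits_algebra"
proof -
  obtain g h where s: "s = (g, h)" by (cases s)
  have "0 \<in> (Der_oct :: ('a oct \<Rightarrow> 'a oct) set)" "0 \<in> (Der_jor :: ('a jor \<Rightarrow> 'a jor) set)"
    using oct_der_in_Der[of "0 :: 'a jor" 0 0] jor_ad_in_Der[of "0 :: 'a jor"] oct_der_eq_0_iff[where 'b = 'a, of 0 0 0]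
      jor_ad_eq_0_iff[of "0 :: 'a jor"] by (simp_all add: trace_linear)
  then have "(if g = 0 then Der_oct_component h else {0 :: 'a oct \<Rightarrow> 'a oct}) \<subseteq> Der_oct"
    "(if h = 0 then Der_jor_component \<omega> g else {0}) \<subseteq> Der_jor"
    by (auto simp: Der_oct_component_def Der_jor_component_def)
  moreover have "tensor_span (oct_traceless \<inter> oct_component h) (jor_traceless \<inter> J g) \<subseteq> tensor_span oct_traceless jor_traceless"
    unfolding tensor_span_component tensor_span_traceless by auto
  ultimately show ?thesis unfolding s \<Gamma>4_def tits_algebra_def by auto
qed

lemma \<Gamma>4_eq: "\<Gamma>4 \<omega> s = to_tits ` mdl_component s"
proof
  show "to_tits ` mdl_component s \<subseteq> \<Gamma>4 \<omega> s"
    using to_tits_component_iff mdl_component_vecs by blast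
  show "\<Gamma>4 \<omega> s \<subseteq> to_tits ` mdl_component s"
  proof
    fix v assume v: "v \<in> \<Gamma>4 \<omega> s"
    then have "v \<in> to_tits ` mdl_vecs" using \<Gamma>4_vecs[of s] unfolding to_tits_image by blast
    then obtain m where "m \<in> mdl_vecs" "v = to_tits m" by blast
    then show "v \<in> to_tits ` mdl_component s" using v to_tits_component_iff by blast
  qed
qed

end

section \<open>Transport of structure along the isomorphism with the model\<close>

lemma module_tits_scale: "module (tits_scale :: 'b::field \<Rightarrow> _)"
proof unfold_locales
  fix a b :: 'b and v w :: "'b tits"
  show "tits_scale a (v + w) = tits_scale a v + tits_scale a w"
    by (cases v; cases w) (simp add: tits_scale_def fun_eq_iff vec.scale_right_distrib mscale_add octjor_scale_def vec_eq_iff algebra_simps)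
  show "tits_scale (a + b) v = tits_scale a v + tits_scale b v"
    by (cases v) (simp add: tits_scale_def fun_eq_iff octjor_scale_def vec_eq_iff algebra_simps)
  show "tits_scale a (tits_scale b v) = tits_scale (a * b) v"
    by (cases v) (simp add: tits_scale_def fun_eq_iff octjor_scale_def vec_eq_iff algebra_simps)
  show "tits_scale 1 v = v"
    by (cases v) (simp add: tits_scale_def fun_eq_iff octjor_scale_def vec_eq_iff)
qed

lemma mdl_closed:
  "0 \<in> mdl_vecs" "m \<in> mdl_vecs \<Longrightarrow> n \<in> mdl_vecs \<Longrightarrow> m + n \<in> mdl_vecs" "m \<in> mdl_vecs \<Longrightarrow> mdl_scale k m \<in> mdl_vecs"
  for m :: "'b::field mdl"
  by (auto simp: mdl_vecs_def mdl_scale_def trace_linear zero_prod_def)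

lemma to_tits_0: "to_tits (0 :: 'b::field_char_0 mdl) = 0"
  using to_tits_linear(1)[of "0 :: 'b mdl" 0] by simp

lemma to_tits_eq_0_iff: "m \<in> mdl_vecs \<Longrightarrow> to_tits m = 0 \<longleftrightarrow> m = (0 :: 'b::field_char_0 mdl)"
  using inj_onD[OF to_tits_inj, of m 0] by (auto simp: to_tits_0 mdl_closed(1))

definition from_tits :: "'b::field_char_0 tits \<Rightarrow> 'b mdl" where
  "from_tits = the_inv_into mdl_vecs to_tits"

lemma from_tits [simp]: "m \<in> mdl_vecs \<Longrightarrow> from_tits (to_tits m) = m"
  by (simp add: from_tits_def the_inv_into_f_f to_tits_inj)

lemma from_tits_vecs:
  assumes "v \<in> vecs tits_algebra"
  shows "from_tits v \<in> mdl_vecs" "to_tits (from_tits v) = v"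
proof -
  obtain m where m: "m \<in> mdl_vecs" "v = to_tits m" using assms unfolding to_tits_image[symmetric] by blast
  then show "from_tits v \<in> mdl_vecs" "to_tits (from_tits v) = v" by simp_all
qed

lemma from_tits_linear:
  assumes "v \<in> vecs tits_algebra" "w \<in> vecs tits_algebra"
  shows "from_tits (v + w) = from_tits v + from_tits w" "from_tits (tits_scale k v) = mdl_scale k (from_tits v)"
proof -
  have "from_tits (to_tits (from_tits v + from_tits w)) = from_tits v + from_tits w"
    using from_tits_vecs[OF assms(1)] from_tits_vecs[OF assms(2)] mdl_closed(2) by (intro from_tits) blast
  then show "from_tits (v + w) = from_tits v + from_tits w"
    by (simp add: to_tits_linear(1) from_tits_vecs assms)
  have "from_tits (to_tits (mdl_scale k (from_tits v))) = mdl_scale k (from_tits v)"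
    using from_tits_vecs[OF assms(1)] mdl_closed(3) by (intro from_tits) blast
  then show "from_tits (tits_scale k v) = mdl_scale k (from_tits v)"
    by (simp add: to_tits_linear(2) from_tits_vecs assms)
qed

lemma tits_algebra_simps [simp]: "scl tits_algebra = tits_scale" "mul tits_algebra = tits_bracket"
  by (simp_all add: tits_algebra_def)

lemma to_tits_subspace:
  fixes V :: "'b::field_char_0 mdl set"
  assumes "0 \<in> V" "\<And>m n. m \<in> V \<Longrightarrow> n \<in> V \<Longrightarrow> m + n \<in> V" "\<And>k m. m \<in> V \<Longrightarrow> mdl_scale k m \<in> V"
  shows "module.subspace tits_scale (to_tits ` V)"
proof -
  interpret module "tits_scale :: 'b \<Rightarrow> _" by (rule module_tits_scale)
  show ?thesis
  proof (rule subspaceI)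
    show "0 \<in> to_tits ` V" using assms(1) to_tits_0 by (metis imageI)
    show "v + w \<in> to_tits ` V" if "v \<in> to_tits ` V" "w \<in> to_tits ` V" for v w
      using that assms(2) by (auto simp flip: to_tits_linear(1))
    show "tits_scale k v \<in> to_tits ` V" if "v \<in> to_tits ` V" for k v
      using that assms(3) by (auto simp flip: to_tits_linear(2))
  qed
qed

lemma mdl_eq_0_iff: "(K, X, Y, P, Q) = (0 :: 'b::field mdl) \<longleftrightarrow>
    K = 0 \<and> X = 0 \<and> Y = 0 \<and> (\<forall>i. P $ i = 0) \<and> (\<forall>i. Q $ i = 0)"
  by (auto simp: zero_prod_def vec_eq_iff[of P] vec_eq_iff[of Q])

lemma jvec_eq_iff: "P = Q \<longleftrightarrow> (\<forall>i. P $ i = Q $ i)" for P :: "'b jor ^ 3"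
  by (rule vec_eq_iff)

section \<open>Projections, one-dimensional components and nonzero products in the model\<close>

context cube_root
begin

definition kproj :: "g4 \<Rightarrow> 'a jor \<Rightarrow> 'a jor" where
  "kproj s K = (\<chi> i j. if s = (0, u_degree i - u_degree j) then K $ i $ j else 0)"

definition jproj :: "g4 \<Rightarrow> int ^ 2 \<Rightarrow> 'a jor \<Rightarrow> 'a jor" where
  "jproj s c M = (if snd s = c then mscale (coord (fst s) M) (pauli (fst s)) else 0)"

definition mdl_proj :: "g4 \<Rightarrow> 'a mdl \<Rightarrow> 'a mdl" where
  "mdl_proj s = (\<lambda>(K, X, Y, P, Q). (kproj s K, jproj s 0 X, jproj s 0 Y,
     \<chi> i. jproj s (u_degree i) (P $ i), \<chi> i. jproj s (- u_degree i) (Q $ i)))"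

lemma kproj_component: "kcomp s (kproj s K)"
  by (auto simp: kcomp_def kproj_def)

text \<open>The whole diagonal has degree 0, so a projection keeps all of it or none of it.\<close>

lemma trace_kproj: "trace K = 0 \<Longrightarrow> trace (kproj s K) = 0"
  by (cases "s = 0") (auto simp: trace_def kproj_def zero_prod_def)

lemma jproj_component: "jcomp s c (jproj s c M)"
  by (simp add: jcomp_def jproj_def jor_component_linear)

lemma trace_jproj: "trace M = 0 \<Longrightarrow> trace (jproj s c M) = 0"
  by (auto simp: jproj_def trace_eq_coord coord_linear coord_pauli)

lemma kproj_kcomp: "kcomp t K \<Longrightarrow> kproj s K = (if s = t then K else 0)"
proof -
  assume K: "kcomp t K"
  have "kproj s K $ i $ j = (if s = t then K else 0) $ i $ j" for i j
  proof (cases "K $ i $ j = 0")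
    case False
    then have "t = (0, u_degree i - u_degree j)" using K by (auto simp: kcomp_def prod_eq_iff)
    then show ?thesis by (simp add: kproj_def)
  qed (simp add: kproj_def)
  then show ?thesis by (simp add: vec_eq_iff)
qed

lemma jproj_jcomp:
  assumes "jcomp t c M"
  shows "jproj s c M = (if s = t then M else 0)"
proof -
  obtain k where k: "M = mscale k (pauli (fst t))" "snd t \<noteq> c \<Longrightarrow> k = 0"
    using assms by (auto simp: jcomp_def jor_component_eq)
  then show ?thesis by (auto simp: jproj_def coord_linear coord_pauli prod_eq_iff)
qed

lemma kproj_sum: "(\<Sum>s\<in>e6_support. kproj s K) = K"
proof -
  have "(\<Sum>s\<in>e6_support. kproj s K) $ i $ j = K $ i $ j" for i j
    by (simp add: kproj_def finite_e6_support)
  then show ?thesis by (simp add: vec_eq_iff)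
qed

lemma jproj_sum:
  assumes "\<And>g. (g, c) \<in> e6_support"
  shows "(\<Sum>s\<in>e6_support. jproj s c M) = M"
proof -
  have "(\<Sum>s\<in>e6_support. jproj s c M) = (\<Sum>s\<in>(\<lambda>g. (g, c)) ` UNIV. jproj s c M)"
    using assms by (intro sum.mono_neutral_right finite_e6_support) (auto simp: jproj_def)
  also have "\<dots> = (\<Sum>g\<in>UNIV. mscale (coord g M) (pauli g))"
    by (subst sum.reindex) (auto simp: inj_def jproj_def)
  finally show ?thesis by (simp add: pauli_expand)
qed

lemma mdl_proj_in: "m \<in> mdl_vecs \<Longrightarrow> mdl_proj s m \<in> mdl_component s"
  by (cases m) (simp add: mdl_proj_def mdl_component_def mdl_vecs_def kproj_component trace_kproj jproj_component trace_jproj)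

lemma mdl_proj_add: "mdl_proj s (m + n) = mdl_proj s m + mdl_proj s n"
proof -
  have k: "kproj s (K + K') = kproj s K + kproj s K'" for K K'
    by (simp add: kproj_def vec_eq_iff)
  have j: "jproj s c (M + N) = jproj s c M + jproj s c N" for c M N
    by (auto simp: jproj_def coord_linear vec_eq_iff algebra_simps)
  show ?thesis by (cases m; cases n) (simp add: mdl_proj_def k j jvec_eq_iff)
qed

lemma mdl_proj_component: "m \<in> mdl_component t \<Longrightarrow> mdl_proj s m = (if s = t then m else 0)"
  by (cases m) (auto simp: mdl_proj_def mdl_component_def kproj_kcomp[of t] jproj_jcomp[of t] jvec_eq_iff mdl_eq_0_iff)

lemma mdl_proj_sum: "(\<Sum>s\<in>e6_support. mdl_proj s m) = m"
proof -
  obtain K X Y P Q where m: "m = (K, X, Y, P, Q)" by (cases m) auto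
  have s: "fst (sum f S) = (\<Sum>i\<in>S. fst (f i))" "snd (sum f S) = (\<Sum>i\<in>S. snd (f i))"
    for f :: "g4 \<Rightarrow> 'x::comm_monoid_add \<times> 'y::comm_monoid_add" and S
    by (induction S rule: infinite_finite_induct) simp_all
  show ?thesis
    by (simp add: m prod_eq_iff s mdl_proj_def kproj_sum jproj_sum jvec_eq_iff sum_component)
qed

lemma mdl_component_linear:
  "0 \<in> mdl_component s" "m \<in> mdl_component s \<Longrightarrow> n \<in> mdl_component s \<Longrightarrow> m + n \<in> mdl_component s"
  "m \<in> mdl_component s \<Longrightarrow> mdl_scale k m \<in> mdl_component s"
  by (auto simp: mdl_component_def mdl_scale_def zero_prod_def trace_linear jcomp_linear kcomp_linear)

lemma mdl_P_component: "mdl_P i (mscale k (pauli g)) \<in> mdl_component (g, u_degree i)"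
  by (auto simp: mdl_P_def mdl_component_def trace_linear kcomp_linear jcomp_linear axis_nth_if jcomp_def jor_component_linear)

lemma mdl_Q_component: "mdl_Q i (mscale k (pauli g)) \<in> mdl_component (g, - u_degree i)"
  by (auto simp: mdl_Q_def mdl_component_def trace_linear kcomp_linear jcomp_linear axis_nth_if jcomp_def jor_component_linear)

lemma mdl_component_support:
  assumes "m \<in> mdl_component s" "m \<noteq> 0"
  shows "s \<in> e6_support"
proof (rule ccontr)
  assume s: "s \<notin> e6_support"
  obtain K X Y P Q where m: "m = (K, X, Y, P, Q)" by (cases m) auto
  have "snd s \<noteq> 0" "snd s \<noteq> u_degree i" "snd s \<noteq> - u_degree i" "\<not> (fst s = 0 \<and> u_degree i - u_degree j = snd s)" for i j
    using s unfolding e6_support_def by (cases s; force)+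
  moreover from this have "K $ i $ j = 0" for i j
    using assms(1) unfolding m mdl_component_def kcomp_def by blast
  then have "K = 0" by (simp add: vec_eq_iff)
  ultimately have "m = 0"
    using assms(1) by (auto simp: m mdl_component_def mdl_eq_0_iff jcomp_def)
  then show False using assms(2) by simp
qed

lemma mdl_component_nonzero:
  assumes "s \<in> e6_support"
  shows "\<exists>m\<in>mdl_component s. m \<noteq> 0"
  using assms
proof (cases rule: e6_support_cases)
  case (1 g)
  show ?thesis
  proof (cases "g = 0")
    case True
    \<comment> \<open>The Cartan element diag(0, 1, -1) for the indices 0, 1, 2. X and Y cannot help
      in degree 0, where a traceless multiple of \<open>pauli 0\<close> vanishes.\<close>
    let ?K = "(\<chi> i j. if i = j then if i = 1 then 1 else if i = 2 then -1 else 0 else 0) :: 'a jor"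
    have "(?K, 0, 0, 0, 0) \<in> mdl_component s"
      using True 1 by (auto simp: mdl_component_def trace_3 trace_linear kcomp_def jcomp_linear)
    moreover have "?K $ 1 $ 1 \<noteq> 0" by simp
    then have "?K \<noteq> 0" by (metis zero_index)
    then have "(?K, 0, 0, 0, 0) \<noteq> (0 :: 'a mdl)" by (simp add: mdl_eq_0_iff)
    ultimately show ?thesis by blast
  next
    case False
    have "(0, pauli g, 0, 0, 0) \<in> mdl_component s"
      using False 1 by (auto simp: mdl_component_def trace_linear trace_pauli kcomp_linear jcomp_linear jcomp_def jor_component_linear)
    moreover have "(0, pauli g, 0, 0, 0) \<noteq> (0 :: 'a mdl)" by (simp add: mdl_eq_0_iff)
    ultimately show ?thesis by blast
  qed
next
  case (2 g i)
  have "mdl_P i (mscale 1 (pauli g)) \<noteq> 0" by (auto simp: mdl_P_def mdl_eq_0_iff axis_nth_if)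
  then show ?thesis using mdl_P_component[of i 1 g] 2 by blast
next
  case (3 g i)
  have "mdl_Q i (mscale 1 (pauli g)) \<noteq> 0" by (auto simp: mdl_Q_def mdl_eq_0_iff axis_nth_if)
  then show ?thesis using mdl_Q_component[of i 1 g] 3 by blast
next
  case (4 i j)
  let ?K = "matrix_unit i j :: 'a jor"
  have "trace ?K = 0" unfolding trace_def using 4(1) by (intro sum.neutral) (auto simp: matrix_unit_nth)
  then have "(?K, 0, 0, 0, 0) \<in> mdl_component s"
    using 4 by (auto simp: mdl_component_def trace_linear kcomp_def jcomp_linear matrix_unit_nth split: if_splits)
  moreover have "?K $ i $ j \<noteq> 0" by (simp add: matrix_unit_nth)
  then have "?K \<noteq> 0" by (metis zero_index)
  then have "(?K, 0, 0, 0, 0) \<noteq> (0 :: 'a mdl)" by (simp add: mdl_eq_0_iff)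
  ultimately show ?thesis by blast
qed

lemma jor_component_line: "M \<in> J g \<Longrightarrow> N \<in> J g \<Longrightarrow> M \<noteq> 0 \<Longrightarrow> \<exists>k. N = mscale k M"
proof -
  assume "M \<in> J g" "N \<in> J g" "M \<noteq> 0"
  then obtain a b where ab: "M = mscale a (pauli g)" "N = mscale b (pauli g)" "a \<noteq> 0"
    by (auto simp: jor_component_eq)
  then have "N = mscale (b / a) M" by (simp add: mscale_mscale)
  then show ?thesis ..
qed

text \<open>The short roots, their negatives and the long roots are distinct weights, so off the
  torsion only one slot survives: one matrix entry of K, or one multiple of a Pauli matrix in P or
  Q.\<close>

lemma mdl_line:
  assumes s: "snd s \<noteq> 0" and m: "m \<in> mdl_component s" "m \<noteq> 0" and n: "n \<in> mdl_component s"
  shows "\<exists>k. n = mdl_scale k m"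
proof -
  obtain K X Y P Q where m': "m = (K, X, Y, P, Q)" by (cases m) auto
  obtain K' X' Y' P' Q' where n': "n = (K', X', Y', P', Q')" by (cases n) auto
  have c: "kcomp s K" "jcomp s 0 X" "jcomp s 0 Y" "\<And>i. jcomp s (u_degree i) (P $ i)" "\<And>i. jcomp s (- u_degree i) (Q $ i)"
    "kcomp s K'" "jcomp s 0 X'" "jcomp s 0 Y'" "\<And>i. jcomp s (u_degree i) (P' $ i)" "\<And>i. jcomp s (- u_degree i) (Q' $ i)"
    using m n by (auto simp: m' n' mdl_component_def)
  have X: "X = 0" "Y = 0" "X' = 0" "Y' = 0" using c s by (auto simp: jcomp_def)
  have s': "s \<in> e6_support" using mdl_component_support m by blast
  note d = u_degree_diff_short u_degree_diff_short(3)[symmetric] u_degree_inject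
  from s' show ?thesis
  proof (cases rule: e6_support_cases)
    case (1 g)
    then show ?thesis using s by simp
  next
    case (2 g i)
    have 0: "K = 0" "K' = 0" "\<And>j. Q $ j = 0" "\<And>j. Q' $ j = 0" "\<And>j. j \<noteq> i \<Longrightarrow> P $ j = 0" "\<And>j. j \<noteq> i \<Longrightarrow> P' $ j = 0"
      using c 2 by (auto simp: kcomp_def jcomp_def d vec_eq_iff[of "_ :: 'a jor"] vec_eq_iff[of "_ :: 'a ^ 3"])
    then have "P $ i \<noteq> 0" using m X by (auto simp: m' mdl_eq_0_iff) metis
    then obtain k where k: "P' $ i = mscale k (P $ i)"
      using jor_component_line[of "P $ i" g "P' $ i"] c 2 by (auto simp: jcomp_def)
    have "P' $ j = mscale k (P $ j)" for j using k 0 by (cases "j = i") auto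
    then have "n = mdl_scale k m" using 0 X by (simp add: m' n' mdl_scale_def jvec_eq_iff)
    then show ?thesis ..
  next
    case (3 g i)
    have 0: "K = 0" "K' = 0" "\<And>j. P $ j = 0" "\<And>j. P' $ j = 0" "\<And>j. j \<noteq> i \<Longrightarrow> Q $ j = 0" "\<And>j. j \<noteq> i \<Longrightarrow> Q' $ j = 0"
      using c 3 by (auto simp: kcomp_def jcomp_def d vec_eq_iff[of "_ :: 'a jor"] vec_eq_iff[of "_ :: 'a ^ 3"])
    then have "Q $ i \<noteq> 0" using m X by (auto simp: m' mdl_eq_0_iff) metis
    then obtain k where k: "Q' $ i = mscale k (Q $ i)"
      using jor_component_line[of "Q $ i" g "Q' $ i"] c 3 by (auto simp: jcomp_def)
    have "Q' $ j = mscale k (Q $ j)" for j using k 0 by (cases "j = i") auto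
    then have "n = mdl_scale k m" using 0 X by (simp add: m' n' mdl_scale_def jvec_eq_iff)
    then show ?thesis ..
  next
    case (4 i j)
    have 0: "\<And>k. P $ k = 0" "\<And>k. P' $ k = 0" "\<And>k. Q $ k = 0" "\<And>k. Q' $ k = 0"
      using c 4 by (auto simp: jcomp_def d)
    have K: "M $ k $ l = 0" if "kcomp s M" "\<not> (k = i \<and> l = j)" for k l M
    proof (rule ccontr)
      assume "M $ k $ l \<noteq> 0"
      then have "u_degree k - u_degree l = u_degree i - u_degree j" using that(1) 4 by (simp add: kcomp_def)
      then show False using that(2) u_degree_diff_inject[OF 4(1), of k l] by simp
    qed
    have "K \<noteq> 0" using m X 0 by (auto simp: m' mdl_eq_0_iff)
    then have nz: "K $ i $ j \<noteq> 0" using K[OF c(1)] by (auto simp: vec_eq_iff) metis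
    define c where "c = K' $ i $ j / K $ i $ j"
    have "K' $ k $ l = c * K $ k $ l" for k l
      using K[OF c(1), of k l] K[OF c(6), of k l] nz by (cases "k = i \<and> l = j") (auto simp: c_def)
    then have "K' = mscale c K" by (simp add: vec_eq_iff)
    then have "n = mdl_scale c m" using 0 X by (simp add: m' n' mdl_scale_def jvec_eq_iff)
    then show ?thesis ..
  qed
qed

lemma mdl_bracket_uu: "mdl_bracket (mdl_P 1 (pauli 0)) (mdl_P 2 (pauli 0)) \<noteq> 0"
proof
  assume "mdl_bracket (mdl_P 1 (pauli 0)) (mdl_P 2 (pauli 0)) = (0 :: 'a mdl)"
  then have "snd (snd (snd (snd (mdl_bracket (mdl_P 1 (pauli 0)) (mdl_P 2 (pauli 0)))))) $ 0 = (0 :: 'a jor)" by simp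
  then show False by (simp add: mdl_bracket_def mdl_P_def axis_nth_if mcross_linear mcross_pauli)
qed

text \<open>If g + h = 0 the product of the Pauli matrices is scalar, so its tracefree part is
  invisible in X; its trace is then nonzero and shows in K, at the diagonal place i + 1, where only
  the subtracted trace is left. In the other case the X-component is nonzero.\<close>

lemma mdl_bracket_uv: "mdl_bracket (mdl_P i (pauli g)) (mdl_Q i (pauli h)) \<noteq> 0"
proof
  assume 0: "mdl_bracket (mdl_P i (pauli g)) (mdl_Q i (pauli h)) = 0"
  show False
  proof (cases "g + h = 0")
    case True
    have "fst (mdl_bracket (mdl_P i (pauli g)) (mdl_Q i (pauli h))) $ (i + 1) $ (i + 1) = 0" using 0 by simp
    then show False
      using True
      by (simp add: mdl_bracket_def mdl_P_def mdl_Q_def tracefree_nth axis_nth_if trace_def[of "\<chi> i j. _ i j"]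
          if_distrib[of "\<lambda>x. x ** _"] if_distrib[of trace] pauli_mult trace_linear trace_pauli cong: if_cong)
  next
    case False
    have "fst (snd (mdl_bracket (mdl_P i (pauli g)) (mdl_Q i (pauli h)))) = 0" using 0 by simp
    then show False
      using False
      by (simp add: mdl_bracket_def mdl_P_def mdl_Q_def axis_nth_if if_distrib[of "\<lambda>x. x ** _"]
          pauli_mult tracefree_linear tracefree_eq trace_pauli cong: if_cong)
  qed
qed

lemma mdl_bracket_long:
  assumes "i \<noteq> j"
  shows "mdl_bracket (mdl_P i (pauli 0)) (mdl_Q j (pauli 0)) \<noteq> 0"
proof
  assume "mdl_bracket (mdl_P i (pauli 0)) (mdl_Q j (pauli 0)) = 0"
  then have "fst (mdl_bracket (mdl_P i (pauli 0)) (mdl_Q j (pauli 0))) $ i $ j = 0" by simp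
  then show False
    using assms by (simp add: mdl_bracket_def mdl_P_def mdl_Q_def tracefree_nth axis_nth_if pauli_mult trace_linear trace_pauli)
qed

text \<open>In degree 0 only a diagonal K remains, and a nonzero diagonal entry acts as a nonzero
  scalar on the corresponding slot of P.\<close>

lemma mdl_bracket_zero:
  assumes z: "z \<in> mdl_component 0" "z \<noteq> 0"
  shows "\<exists>i. mdl_bracket z (mdl_P i (pauli 0)) \<noteq> 0"
proof -
  obtain K X Y P Q where m: "z = (K, X, Y, P, Q)" by (cases z) auto
  have X: "X = 0" "Y = 0"
    using z tracefree_jor_component[of X 0] tracefree_jor_component[of Y 0]
    by (auto simp: m mdl_component_def jcomp_def tracefree_eq)
  have P: "P $ i = 0" "Q $ i = 0" for i
    using z u_degree_nonzero[of i] by (auto simp: m mdl_component_def jcomp_def)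
  have K: "K $ i $ j = 0" if "i \<noteq> j" for i j
    using z that by (auto simp: m mdl_component_def kcomp_def u_degree_inject)
  have "K \<noteq> 0" using z X P by (auto simp: m mdl_eq_0_iff)
  then obtain i where i: "K $ i $ i \<noteq> 0" using K by (auto simp: vec_eq_iff) metis
  have "fst (snd (snd (snd (mdl_bracket z (mdl_P i (pauli 0)))))) $ i = mscale (K $ i $ i) (pauli 0)"
    by (simp add: m mdl_bracket_def mdl_P_def X P axis_nth_if mcross_linear if_distrib[of "mscale _"] cong: if_cong)
  then have "mdl_bracket z (mdl_P i (pauli 0)) \<noteq> 0" using i by auto
  then show ?thesis ..
qed

text \<open>An element with X = a \<open>pauli g\<close> and Y = b \<open>pauli g\<close> kills the
  first slot at label h exactly if a \<omega>^(-k) = b \<omega>^k with k = \<open>sympl g h\<close>.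
  Unless a = b = 0 this holds for at most one k, so z and z' together exclude at most two of the
  three values of k.\<close>

lemma mdl_bracket_plane:
  assumes g: "g \<noteq> 0" and z: "z \<in> mdl_component (g, 0)" "z \<noteq> 0" and z': "z' \<in> mdl_component (g, 0)" "z' \<noteq> 0"
  shows "\<exists>h. mdl_bracket z (mdl_P 1 (pauli h)) \<noteq> 0 \<and> mdl_bracket z' (mdl_P 1 (pauli h)) \<noteq> 0"
proof -
  obtain h1 where h1: "sympl g h1 = 1" using sympl_nondegenerate[OF g] .
  \<comment> \<open>One label for each value of the symplectic product with g.\<close>
  define h where "h k = k *s h1" for k
  have h: "sympl g (h k) = k" for k
  proof -
    have "sympl g (k *s h1) = k * sympl g h1" by (simp add: sympl_def algebra_simps)
    then show ?thesis by (simp add: h_def h1)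
  qed
  have bad: "\<exists>k. \<forall>l. l \<noteq> k \<longrightarrow> mdl_bracket z (mdl_P 1 (pauli (h l))) \<noteq> 0" if z: "z \<in> mdl_component (g, 0)" "z \<noteq> 0" for z
  proof -
    obtain K X Y P Q where m: "z = (K, X, Y, P, Q)" by (cases z) auto
    have "K $ i $ j = 0" for i j using z g by (auto simp: m mdl_component_def kcomp_def)
    then have K: "K = 0" by (simp add: vec_eq_iff)
    have P: "P $ i = 0" "Q $ i = 0" for i
      using z u_degree_nonzero[of i] by (auto simp: m mdl_component_def jcomp_def)
    obtain a b where ab: "X = mscale a (pauli g)" "Y = mscale b (pauli g)"
      using z by (auto simp: m mdl_component_def jcomp_def jor_component_eq)
    have nz: "a \<noteq> 0 \<or> b \<noteq> 0" using z K P ab by (auto simp: m mdl_eq_0_iff)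
    have "fst (snd (snd (snd (mdl_bracket z (mdl_P 1 (pauli (h k))))))) $ 1 =
        mscale (a * root_char (- k) - b * root_char k) (pauli (g + h k))" for k
      by (simp add: m mdl_bracket_def mdl_P_def K P ab axis_nth_if mcross_linear mscale_matrix_mult pauli_mult
          sympl_sym[of "h k" g] h add.commute[of "h k" g] mscale_mscale) (simp add: vec_eq_iff algebra_simps)
    then have zero: "a * root_char (- k) = b * root_char k" if "mdl_bracket z (mdl_P 1 (pauli (h k))) = 0" for k
      using that by (metis fst_zero mscale_eq_0_iff pauli_nonzero right_minus_eq snd_zero zero_index)
    have uniq: "k = l" if "mdl_bracket z (mdl_P 1 (pauli (h k))) = 0" "mdl_bracket z (mdl_P 1 (pauli (h l))) = 0" for k l
    proof -
      have e: "a = b * root_char (k + k)" if "a * root_char (- k) = b * root_char k" for k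
      proof -
        have "a * root_char (- k) * root_char k = b * root_char k * root_char k" using that by simp
        moreover have "root_char (- k) * root_char k = 1" by (simp add: root_char_minus)
        ultimately show ?thesis unfolding root_char_add by (simp add: mult.assoc)
      qed
      have "a = b * root_char (k + k)" "a = b * root_char (l + l)" using e zero that by blast+
      then have "root_char (k + k) = root_char (l + l)" using nz by auto
      then have "k + k = l + l" by (simp add: root_char_inj)
      then have "- k = - l" by (metis mod3_triple(3))
      then show ?thesis by simp
    qed
    show ?thesis
    proof (cases "\<exists>k. mdl_bracket z (mdl_P 1 (pauli (h k))) = 0")
      case True
      then show ?thesis using uniq by metis
    qed blast
  qed
  obtain k where k: "\<And>l. l \<noteq> k \<Longrightarrow> mdl_bracket z (mdl_P 1 (pauli (h l))) \<noteq> 0" using bad[OF z] by blast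
  obtain k' where k': "\<And>l. l \<noteq> k' \<Longrightarrow> mdl_bracket z' (mdl_P 1 (pauli (h l))) \<noteq> 0" using bad[OF z'] by blast
  have "card {k, k'} < card (UNIV :: 3 set)" by (simp add: card_insert_if)
  then obtain l where "l \<notin> {k, k'}" by (metis UNIV_I subsetI card_mono finite leD)
  then show ?thesis using k k' by blast
qed

definition tits_proj :: "g4 \<Rightarrow> 'a tits \<Rightarrow> 'a tits" where
  "tits_proj s v = to_tits (mdl_proj s (from_tits v))"

lemma tits_product_nonzero:
  assumes "mdl_bracket m n \<noteq> 0" "m \<in> mdl_component s" "n \<in> mdl_component t"
  shows "tits_bracket (to_tits m) (to_tits n) \<noteq> 0"
proof -
  have v: "m \<in> mdl_vecs" "n \<in> mdl_vecs" using assms mdl_component_vecs by blast+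
  then show ?thesis
    using assms(1) to_tits_eq_0_iff[OF mdl_bracket_vecs[OF v]] by (simp add: to_tits_bracket[OF v, symmetric])
qed

lemma \<Gamma>4_e6_grading: "e6_grading tits_algebra (\<Gamma>4 \<omega>) tits_proj"
proof (rule e6_grading.intro, unfold tits_algebra_simps)
  have P1: "mdl_P i (pauli g) \<in> mdl_component (g, u_degree i)" "mdl_Q i (pauli g) \<in> mdl_component (g, - u_degree i)" for i g
    using mdl_P_component[of i 1 g] mdl_Q_component[of i 1 g] by simp_all
  have v: "m \<in> mdl_component s \<Longrightarrow> m \<in> mdl_vecs" for m s using mdl_component_vecs by blast
  show "module.subspace tits_scale (vecs (tits_algebra :: ('a, 'a tits) algebra))"
    unfolding to_tits_image[symmetric] by (intro to_tits_subspace mdl_closed)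
  show "module.subspace tits_scale (\<Gamma>4 \<omega> g)" for g
    unfolding \<Gamma>4_eq by (intro to_tits_subspace mdl_component_linear)
  show "\<Gamma>4 \<omega> g \<subseteq> vecs tits_algebra" for g by (rule \<Gamma>4_vecs)
  show "tits_bracket x y \<in> \<Gamma>4 \<omega> (g + h)" if "x \<in> \<Gamma>4 \<omega> g" "y \<in> \<Gamma>4 \<omega> h" for x y g h
    using that unfolding \<Gamma>4_eq by (auto simp: to_tits_bracket[OF v v, symmetric] mdl_component_bracket)
  show "tits_bracket x y \<in> vecs tits_algebra" if "x \<in> vecs tits_algebra" "y \<in> vecs tits_algebra" for x y :: "'a tits"
    using that unfolding to_tits_image[symmetric] by (auto simp: to_tits_bracket[symmetric] mdl_bracket_vecs)
  show "finite e6_support" by (rule finite_e6_support)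
  show "\<Gamma>4 \<omega> s \<noteq> {0} \<longleftrightarrow> s \<in> e6_support" for s
  proof
    assume "\<Gamma>4 \<omega> s \<noteq> {0}"
    moreover have "0 \<in> \<Gamma>4 \<omega> s" unfolding \<Gamma>4_eq using mdl_component_linear(1) to_tits_0 by (metis imageI)
    ultimately obtain m where "m \<in> mdl_component s" "to_tits m \<noteq> 0" unfolding \<Gamma>4_eq by blast
    then show "s \<in> e6_support" using mdl_component_support[of m s] to_tits_0 by auto
  next
    assume "s \<in> e6_support"
    then obtain m where "m \<in> mdl_component s" "m \<noteq> 0" using mdl_component_nonzero by blast
    then show "\<Gamma>4 \<omega> s \<noteq> {0}" using to_tits_eq_0_iff[OF v, of m s] unfolding \<Gamma>4_eq by blast
  qed
  show "tits_proj g x \<in> \<Gamma>4 \<omega> g" if "x \<in> vecs tits_algebra" for x g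
    unfolding \<Gamma>4_eq tits_proj_def using mdl_proj_in from_tits_vecs(1)[OF that] by blast
  show "tits_proj g (x + y) = tits_proj g x + tits_proj g y" if "x \<in> vecs tits_algebra" "y \<in> vecs tits_algebra" for x y g
    by (simp add: tits_proj_def from_tits_linear that mdl_proj_add to_tits_linear)
  show "tits_proj g x = (if g = h then x else 0)" if "x \<in> \<Gamma>4 \<omega> h" for x g h
    using that unfolding \<Gamma>4_eq by (auto simp: tits_proj_def v mdl_proj_component to_tits_0)
  show "(\<Sum>g\<in>e6_support. tits_proj g x) = x" if "x \<in> vecs tits_algebra" for x
  proof -
    have "(\<Sum>g\<in>S. to_tits (f g)) = to_tits (sum f S)" for f :: "g4 \<Rightarrow> 'a mdl" and S
      by (induction S rule: infinite_finite_induct) (simp_all add: to_tits_0 to_tits_linear)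
    then show ?thesis by (simp add: tits_proj_def mdl_proj_sum from_tits_vecs that)
  qed
  show "\<exists>k. y = tits_scale k x" if s: "snd g \<noteq> 0" and x: "x \<in> \<Gamma>4 \<omega> g" "x \<noteq> 0" and y: "y \<in> \<Gamma>4 \<omega> g" for g x y
  proof -
    obtain m n where mn: "m \<in> mdl_component g" "x = to_tits m" "n \<in> mdl_component g" "y = to_tits n"
      using x y unfolding \<Gamma>4_eq by blast
    then have "m \<noteq> 0" using x to_tits_0 by auto
    then obtain k where "n = mdl_scale k m" using mdl_line[OF s mn(1) _ mn(3)] by blast
    then show ?thesis using mn by (auto simp: to_tits_linear)
  qed
  show "\<exists>x\<in>\<Gamma>4 \<omega> (0, u_degree 1). \<exists>y\<in>\<Gamma>4 \<omega> (0, u_degree 2). tits_bracket x y \<noteq> 0"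
    unfolding \<Gamma>4_eq using tits_product_nonzero[OF mdl_bracket_uu P1(1) P1(1)] P1(1) by blast
  show "\<exists>x\<in>\<Gamma>4 \<omega> (g, u_degree i). \<exists>y\<in>\<Gamma>4 \<omega> (h, - u_degree i). tits_bracket x y \<noteq> 0" for g h i
    unfolding \<Gamma>4_eq using tits_product_nonzero[OF mdl_bracket_uv P1(1) P1(2)] P1 by blast
  show "\<exists>x\<in>\<Gamma>4 \<omega> (0, u_degree i). \<exists>y\<in>\<Gamma>4 \<omega> (0, - u_degree j). tits_bracket x y \<noteq> 0" if "i \<noteq> j" for i j
    unfolding \<Gamma>4_eq using tits_product_nonzero[OF mdl_bracket_long[OF that] P1(1) P1(2)] P1 by blast
  show "\<exists>i. \<exists>y\<in>\<Gamma>4 \<omega> (0, u_degree i). tits_bracket z y \<noteq> 0" if z: "z \<in> \<Gamma>4 \<omega> 0" "z \<noteq> 0" for z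
  proof -
    obtain m where m: "m \<in> mdl_component 0" "z = to_tits m" using z unfolding \<Gamma>4_eq by blast
    then have "m \<noteq> 0" using z to_tits_0 by auto
    then obtain i where "mdl_bracket m (mdl_P i (pauli 0)) \<noteq> 0" using mdl_bracket_zero[OF m(1)] by blast
    then have "tits_bracket z (to_tits (mdl_P i (pauli 0))) \<noteq> 0"
      unfolding m(2) by (rule tits_product_nonzero[OF _ m(1) P1(1)])
    then show ?thesis unfolding \<Gamma>4_eq using P1(1) by blast
  qed
  show "\<exists>h. \<exists>y\<in>\<Gamma>4 \<omega> (h, u_degree 1). tits_bracket z y \<noteq> 0 \<and> tits_bracket z' y \<noteq> 0"
    if z: "z \<in> \<Gamma>4 \<omega> (g, 0)" "z \<noteq> 0" and z': "z' \<in> \<Gamma>4 \<omega> (g, 0)" "z' \<noteq> 0" and g: "g \<noteq> 0" for z z' g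
  proof -
    obtain m m' where m: "m \<in> mdl_component (g, 0)" "z = to_tits m" and m': "m' \<in> mdl_component (g, 0)" "z' = to_tits m'"
      using z z' unfolding \<Gamma>4_eq by blast
    then have "m \<noteq> 0" "m' \<noteq> 0" using z z' to_tits_0 by auto
    then obtain h where "mdl_bracket m (mdl_P 1 (pauli h)) \<noteq> 0" "mdl_bracket m' (mdl_P 1 (pauli h)) \<noteq> 0"
      using mdl_bracket_plane[OF g m(1) _ m'(1)] by blast
    then have "tits_bracket z (to_tits (mdl_P 1 (pauli h))) \<noteq> 0 \<and> tits_bracket z' (to_tits (mdl_P 1 (pauli h))) \<noteq> 0"
      unfolding m(2) m'(2) by (intro conjI tits_product_nonzero[OF _ m(1) P1(1)] tits_product_nonzero[OF _ m'(1) P1(1)])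
    then show ?thesis unfolding \<Gamma>4_eq using P1(1) by blast
  qed
qed (rule module_tits_scale)

end

section \<open>Automorphisms\<close>

lemma matrix_vector_mult_2: "(A *v g) $ i = A $ i $ 1 * g $ 1 + A $ i $ 2 * g $ 2"
  for A :: "'b::semiring_1 ^ 2 ^ 2"
  by (simp add: matrix_vector_mult_def sum_2)

lemma matrix_vector_add: "A *v (g + h) = A *v g + A *v h" for A :: "'b::semiring_1 ^ 2 ^ 2"
  by (simp add: vec2_eq_iff matrix_vector_mult_2 algebra_simps)

lemma matrix_vector_zero: "A *v 0 = 0" for A :: "'b::semiring_1 ^ 2 ^ 2"
  by (simp add: vec2_eq_iff matrix_vector_mult_2)

definition mat_det :: "'b::comm_ring_1 ^ 2 ^ 2 \<Rightarrow> 'b" where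
  "mat_det A = A $ 1 $ 1 * A $ 2 $ 2 - A $ 1 $ 2 * A $ 2 $ 1"

lemma mat_det_mult: "mat_det (A ** B) = mat_det A * mat_det B"
  by (simp add: mat_det_def matrix_mult_nth sum_2 algebra_simps)

lemma sympl_map: "sympl (A *v g) (A *v h) = mat_det A * sympl g h"
  by (simp add: sympl_def mat_det_def matrix_vector_mult_2 algebra_simps)

lemma invertible_mod3_det:
  fixes A :: "3 ^ 2 ^ 2"
  assumes "invertible A"
  shows "mat_det A = 1 \<or> mat_det A = - 1"
proof -
  obtain B where "A ** B = mat 1" using assms by (auto simp: invertible_def)
  then have "mat_det A * mat_det B = mat_det (mat 1)" by (metis mat_det_mult)
  then have "mat_det A * mat_det B = 1" by (simp add: mat_det_def mat_def)
  then have "mat_det A \<noteq> 0" by auto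
  then show ?thesis using exhaust_mod3[of "mat_det A"] by (elim disjE) simp_all
qed

context cube_root
begin

sublocale e6: e6_grading tits_algebra "\<Gamma>4 \<omega>" tits_proj
  by (rule \<Gamma>4_e6_grading)

definition realized :: "(g4 \<Rightarrow> g4) set" where
  "realized = {\<alpha>. \<exists>f\<in>algebra_automorphisms tits_algebra. e6.induces f \<alpha>}"

text \<open>Transports a linear bijection of the model to the Tits algebra. The two
  \<open>comp\<close> assumptions give the two inclusions between the image of a component and the
  target component, the second one through the inverse map.\<close>

lemma realizedI:
  assumes add: "\<And>m n. F (m + n) = F m + F n" and scale: "\<And>k m. F (mdl_scale k m) = mdl_scale k (F m)"
    and vecs: "\<And>m. m \<in> mdl_vecs \<Longrightarrow> F m \<in> mdl_vecs" "\<And>m. m \<in> mdl_vecs \<Longrightarrow> F' m \<in> mdl_vecs"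
    and inv: "\<And>m. F (F' m) = m" "\<And>m. F' (F m) = m"
    and mult: "\<And>m n. m \<in> mdl_vecs \<Longrightarrow> n \<in> mdl_vecs \<Longrightarrow> F (mdl_bracket m n) = mdl_bracket (F m) (F n)"
    and comp: "\<And>s m. s \<in> e6_support \<Longrightarrow> m \<in> mdl_component s \<Longrightarrow> F m \<in> mdl_component (\<alpha> s)"
      "\<And>s m. s \<in> e6_support \<Longrightarrow> m \<in> mdl_component (\<alpha> s) \<Longrightarrow> F' m \<in> mdl_component s"
    and \<alpha>: "\<alpha> \<in> auto G4"
  shows "\<alpha> \<in> realized"
proof -
  let ?V = "vecs tits_algebra :: 'a tits set"
  define f where "f = (\<lambda>v\<in>?V. to_tits (F (from_tits v)))"
  have f: "f (to_tits m) = to_tits (F m)" if "m \<in> mdl_vecs" for m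
    using that to_tits_image by (auto simp: f_def)
  have V: "\<exists>m\<in>mdl_vecs. v = to_tits m" if "v \<in> ?V" for v
    using that unfolding to_tits_image[symmetric] by blast
  have "inj_on f ?V"
  proof (rule inj_onI)
    fix v w assume vw: "v \<in> ?V" "w \<in> ?V" "f v = f w"
    obtain m n where mn: "m \<in> mdl_vecs" "v = to_tits m" "n \<in> mdl_vecs" "w = to_tits n"
      using V[OF vw(1)] V[OF vw(2)] by blast
    then have "to_tits (F m) = to_tits (F n)" using vw f by simp
    then have "F m = F n" using inj_onD[OF to_tits_inj] vecs(1) mn by metis
    then show "v = w" using inv(2) mn by metis
  qed
  moreover have "f ` ?V = ?V"
  proof
    show "f ` ?V \<subseteq> ?V"
    proof
      fix w assume "w \<in> f ` ?V"
      then obtain v where v: "v \<in> ?V" "w = f v" by blast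
      from V[OF v(1)] obtain m where "m \<in> mdl_vecs" "v = to_tits m" by blast
      then have "m \<in> mdl_vecs" "w = to_tits (F m)" using v f by simp_all
      then show "w \<in> ?V" using vecs(1) to_tits_image by blast
    qed
    show "?V \<subseteq> f ` ?V"
    proof
      fix w assume "w \<in> ?V"
      then obtain m where m: "m \<in> mdl_vecs" "w = to_tits m" using V by blast
      then have "w = f (to_tits (F' m))" using f[of "F' m"] vecs(2) inv by simp
      moreover have "to_tits (F' m) \<in> ?V" using vecs(2) m to_tits_image by blast
      ultimately show "w \<in> f ` ?V" by blast
    qed
  qed
  ultimately have b: "f \<in> Bij ?V" by (simp add: Bij_def bij_betw_def f_def)
  have "f (v + w) = f v + f w" if vw: "v \<in> ?V" "w \<in> ?V" for v w
  proof -
    obtain m n where mn: "m \<in> mdl_vecs" "v = to_tits m" "n \<in> mdl_vecs" "w = to_tits n"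
      using V[OF vw(1)] V[OF vw(2)] by blast
    then show ?thesis using f[OF mdl_closed(2), of m n] by (simp add: f add to_tits_linear)
  qed
  moreover have "f (tits_scale k v) = tits_scale k (f v)" if v: "v \<in> ?V" for v k
  proof -
    obtain m where m: "m \<in> mdl_vecs" "v = to_tits m" using V[OF v] by blast
    then show ?thesis using f[OF mdl_closed(3), of m k] by (simp add: f scale to_tits_linear)
  qed
  moreover have "f (tits_bracket v w) = tits_bracket (f v) (f w)" if vw: "v \<in> ?V" "w \<in> ?V" for v w
  proof -
    obtain m n where mn: "m \<in> mdl_vecs" "v = to_tits m" "n \<in> mdl_vecs" "w = to_tits n"
      using V[OF vw(1)] V[OF vw(2)] by blast
    then show ?thesis
      using f[OF mdl_bracket_vecs, of m n] vecs(1) by (simp add: f mult to_tits_bracket[symmetric])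
  qed
  ultimately have "f \<in> algebra_automorphisms tits_algebra"
    using b by (simp add: algebra_automorphisms_def)
  moreover have "f ` \<Gamma>4 \<omega> s = \<Gamma>4 \<omega> (\<alpha> s)" if s: "s \<in> e6_support" for s
  proof
    show "f ` \<Gamma>4 \<omega> s \<subseteq> \<Gamma>4 \<omega> (\<alpha> s)"
    proof
      fix w assume "w \<in> f ` \<Gamma>4 \<omega> s"
      then obtain m where m: "m \<in> mdl_component s" "w = f (to_tits m)" unfolding \<Gamma>4_eq by blast
      then have "w = to_tits (F m)" using f mdl_component_vecs by blast
      then show "w \<in> \<Gamma>4 \<omega> (\<alpha> s)" using comp(1)[OF s m(1)] unfolding \<Gamma>4_eq by blast
    qed
    show "\<Gamma>4 \<omega> (\<alpha> s) \<subseteq> f ` \<Gamma>4 \<omega> s"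
    proof
      fix w assume "w \<in> \<Gamma>4 \<omega> (\<alpha> s)"
      then obtain m where m: "m \<in> mdl_component (\<alpha> s)" "w = to_tits m" unfolding \<Gamma>4_eq by blast
      then have "F' m \<in> mdl_component s" using comp(2) s by blast
      moreover from this have "F' m \<in> mdl_vecs" using mdl_component_vecs by blast
      then have "w = f (to_tits (F' m))" using f[of "F' m"] m(2) inv(1)[of m] by simp
      ultimately show "w \<in> f ` \<Gamma>4 \<omega> s" unfolding \<Gamma>4_eq by blast
    qed
  qed
  ultimately show ?thesis using \<alpha> unfolding realized_def e6.induces_def by blast
qed

lemma mdl_vecs_iff: "(K, X, Y, P, Q) \<in> mdl_vecs \<longleftrightarrow> trace K = 0 \<and> trace X = 0 \<and> trace Y = 0"
  by (simp add: mdl_vecs_def)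

definition mdl_map :: "('a jor \<Rightarrow> 'a jor) \<Rightarrow> 'a mdl \<Rightarrow> 'a mdl" where
  "mdl_map \<psi> = (\<lambda>(K, X, Y, P, Q). (K, \<psi> X, \<psi> Y, \<chi> i. \<psi> (P $ i), \<chi> i. \<psi> (Q $ i)))"

text \<open>An anti-automorphism turns left multiplication by X into right multiplication by its
  image. As Y acts from the right with a minus sign, X and Y have to be exchanged and
  negated.\<close>

definition mdl_anti_map :: "('a jor \<Rightarrow> 'a jor) \<Rightarrow> 'a mdl \<Rightarrow> 'a mdl" where
  "mdl_anti_map \<psi> = (\<lambda>(K, X, Y, P, Q). (K, - \<psi> Y, - \<psi> X, \<chi> i. \<psi> (P $ i), \<chi> i. \<psi> (Q $ i)))"

lemma mdl_map_bracket:
  assumes l: "mlin \<psi>" and m: "\<And>M N. \<psi> (M ** N) = \<psi> M ** \<psi> N" and t: "\<And>M. trace (\<psi> M) = trace M" and o: "\<psi> (mat 1) = mat 1"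
  shows "mdl_map \<psi> (mdl_bracket x y) = mdl_bracket (mdl_map \<psi> x) (mdl_map \<psi> y)"
proof -
  have c: "\<psi> (mcross M N) = mcross (\<psi> M) (\<psi> N)" for M N
    using t[of "M ** N"] by (simp add: mcross_def mlin_simps[OF l] m t o)
  have tf: "\<psi> (tracefree M) = tracefree (\<psi> M)" for M
    by (simp add: tracefree_def mlin_simps[OF l] t o)
  have tm: "trace (\<psi> M ** \<psi> N) = trace (M ** N)" for M N using t[of "M ** N"] by (simp add: m)
  show ?thesis
    by (cases x; cases y) (simp add: mdl_map_def mdl_bracket_def mlin_simps[OF l] mlin_sum[OF l] m c tf tm jvec_eq_iff)
qed

lemma mdl_anti_map_bracket:
  assumes l: "mlin \<psi>" and m: "\<And>M N. \<psi> (M ** N) = \<psi> N ** \<psi> M" and t: "\<And>M. trace (\<psi> M) = trace M" and o: "\<psi> (mat 1) = mat 1"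
  shows "mdl_anti_map \<psi> (mdl_bracket x y) = mdl_bracket (mdl_anti_map \<psi> x) (mdl_anti_map \<psi> y)"
proof -
  have tm: "trace (\<psi> M ** \<psi> N) = trace (M ** N)" for M N
    using t[of "N ** M"] trace_mul_sym[of M N] by (simp add: m)
  have c: "\<psi> (mcross M N) = mcross (\<psi> M) (\<psi> N)" for M N
    by (simp add: mcross_def mlin_simps[OF l] m t o tm add.commute)
  have tf: "\<psi> (tracefree M) = tracefree (\<psi> M)" for M
    by (simp add: tracefree_def mlin_simps[OF l] t o)
  have tn: "- tracefree M = tracefree (- M)" "- sum f I = (\<Sum>i\<in>I. - f i)" for M :: "'a jor" and f :: "3 \<Rightarrow> 'a jor" and I
    by (simp_all add: tracefree_linear sum_negf)
  show ?thesis
    by (cases x; cases y) (simp add: mdl_anti_map_def mdl_bracket_def mlin_simps[OF l] mlin_sum[OF l] m c tf tm tn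
        jvec_eq_iff matrix_mult_minus algebra_simps)
qed

definition pauli_map :: "3 ^ 2 ^ 2 \<Rightarrow> 'a jor \<Rightarrow> 'a jor" where
  "pauli_map A M = (\<Sum>g\<in>UNIV. mscale (coord g M) (pauli (A *v g)))"

lemma pauli_map_mlin: "mlin (pauli_map A)"
proof -
  interpret m: module "mscale :: 'a \<Rightarrow> _ \<Rightarrow> 'a jor" by (rule module_mscale)
  show ?thesis
    by (auto simp: mlin_def pauli_map_def coord_linear m.scale_left_distrib sum.distrib m.scale_sum_right)
qed

lemma pauli_map_pauli: "pauli_map A (pauli g) = pauli (A *v g)"
proof -
  have "pauli_map A (pauli g) = (\<Sum>h\<in>UNIV. if h = g then pauli (A *v g) else 0)"
    unfolding pauli_map_def by (rule sum.cong) (auto simp: coord_pauli)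
  then show ?thesis by simp
qed

lemma pauli_map_trace:
  assumes "invertible A"
  shows "trace (pauli_map A M) = trace M"
proof -
  have "A *v g = 0 \<longleftrightarrow> g = 0" for g
  proof
    assume 0: "A *v g = 0"
    obtain B where "B ** A = mat 1" using assms by (auto simp: invertible_def)
    then have "g = B *v (A *v g)" by (simp add: matrix_vector_mul_assoc matrix_vector_mul_lid)
    then show "g = 0" using 0 by (simp add: vec2_eq_iff matrix_vector_mult_2)
  qed (simp add: vec2_eq_iff matrix_vector_mult_2)
  note z = this
  have "trace (pauli_map A M) = (\<Sum>g\<in>(UNIV :: (3 ^ 2) set). if g = 0 then 3 * coord 0 M else 0)"
    unfolding pauli_map_def trace_sum by (rule sum.cong) (auto simp: trace_linear trace_pauli z)
  then show ?thesis by (simp add: trace_eq_coord)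
qed

text \<open>With the chosen phases the structure constants depend on the labels only through
  \<open>sympl\<close>, which A multiplies by its determinant. Determinant 1 preserves them;
  determinant -1 inverts them, which amounts to reversing the two factors.\<close>

lemma pauli_map_mult:
  shows "mat_det A = 1 \<Longrightarrow> pauli_map A (M ** N) = pauli_map A M ** pauli_map A N"
    and "mat_det A = -1 \<Longrightarrow> pauli_map A (M ** N) = pauli_map A N ** pauli_map A M"
proof -
  note l = mlin_comp[OF pauli_map_mlin] mlin_comp[OF _ pauli_map_mlin] mlin_intros
  note s = pauli_map_pauli pauli_mult mlin_simps[OF pauli_map_mlin] sympl_map matrix_vector_add
  show "pauli_map A (M ** N) = pauli_map A M ** pauli_map A N" if "mat_det A = 1"
  proof (rule mlin2_eqI[where f = "\<lambda>M N. pauli_map A (M ** N)" and h = "\<lambda>M N. pauli_map A M ** pauli_map A N"])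
    show "pauli_map A (pauli g ** pauli k) = pauli_map A (pauli g) ** pauli_map A (pauli k)" for g k
      using that by (simp add: s)
  qed (rule mlin_comp[OF pauli_map_mlin mlin_intros(2)] mlin_comp[OF pauli_map_mlin mlin_intros(3)]
      mlin_comp[OF mlin_intros(2) pauli_map_mlin] mlin_comp[OF mlin_intros(3) pauli_map_mlin])+
  show "pauli_map A (M ** N) = pauli_map A N ** pauli_map A M" if "mat_det A = -1"
  proof (rule mlin2_eqI[where f = "\<lambda>M N. pauli_map A (M ** N)" and h = "\<lambda>M N. pauli_map A N ** pauli_map A M"])
    show "pauli_map A (pauli g ** pauli k) = pauli_map A (pauli k) ** pauli_map A (pauli g)" for g k
      using that sympl_sym[of k g] by (simp add: s add.commute)
  qed (rule mlin_comp[OF pauli_map_mlin mlin_intros(2)] mlin_comp[OF pauli_map_mlin mlin_intros(3)]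
      mlin_comp[OF mlin_intros(2) pauli_map_mlin] mlin_comp[OF mlin_intros(3) pauli_map_mlin])+
qed

lemma pauli_map_comp: "pauli_map A (pauli_map B M) = pauli_map (A ** B) M"
  by (rule mlin_eqI) (simp_all add: pauli_map_pauli matrix_vector_mul_assoc pauli_map_mlin mlin_comp[OF pauli_map_mlin pauli_map_mlin])

lemma pauli_map_one: "pauli_map (mat 1) M = M"
  by (rule mlin_eqI) (simp_all add: pauli_map_pauli pauli_map_mlin mlin_intros)

lemma pauli_map_jcomp: "jcomp (g, h) c M \<Longrightarrow> jcomp (A *v g, h) c (pauli_map A M)"
  by (auto simp: jcomp_def jor_component_eq mlin_simps[OF pauli_map_mlin] pauli_map_pauli)

lemma kcomp_map: "kcomp (g, h) K \<Longrightarrow> kcomp (A *v g, h) K"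
  by (auto simp: kcomp_def matrix_vector_zero)

lemma realized_A:
  assumes A: "invertible A"
  shows "(\<lambda>(g, h). (A *v g, h)) \<in> realized"
proof -
  obtain B where B: "A ** B = mat 1" "B ** A = mat 1" using A by (auto simp: invertible_def)
  have iB: "invertible B" using B by (auto simp: invertible_def)
  have BA: "B *v (A *v g) = g" "A *v (B *v g) = g" for g
    using B by (simp_all add: matrix_vector_mul_assoc)
  have auto: "(\<lambda>(g, h). (A *v g, h)) \<in> auto G4"
  proof -
    have "bij (\<lambda>(g :: 3 ^ 2, h :: int ^ 2). (A *v g, h))"
      by (rule bij_betw_byWitness[where f' = "\<lambda>(g, h). (B *v g, h)"]) (auto simp: BA)
    then show ?thesis by (auto simp: e6.auto_G4_iff matrix_vector_add)
  qed
  note l = mlin_simps[OF pauli_map_mlin]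
  have o: "pauli_map A (mat 1) = mat 1" by (simp add: pauli_map_pauli matrix_vector_zero flip: pauli_0)
  have inv: "pauli_map A (pauli_map B M) = M" "pauli_map B (pauli_map A M) = M" for M
    by (simp_all add: pauli_map_comp B pauli_map_one)
  have k: "kcomp (g, h) K" if "kcomp (A *v g, h) K" for g h K
    using kcomp_map[OF that, of B] by (simp add: BA)
  have j: "jcomp (g, h) c (pauli_map B M)" if "jcomp (A *v g, h) c M" for g h c M
    using pauli_map_jcomp[OF that, of B] by (simp add: BA)
  show ?thesis
    using invertible_mod3_det[OF A]
  proof
    assume d: "mat_det A = 1"
    show ?thesis
    proof (rule realizedI[where F = "mdl_map (pauli_map A)" and F' = "mdl_map (pauli_map B)"])
      show "mdl_map (pauli_map A) (m + n) = mdl_map (pauli_map A) m + mdl_map (pauli_map A) n" for m n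
        by (cases m; cases n) (simp add: mdl_map_def l jvec_eq_iff)
      show "mdl_map (pauli_map A) (mdl_scale k m) = mdl_scale k (mdl_map (pauli_map A) m)" for k m
        by (cases m) (simp add: mdl_map_def mdl_scale_def l jvec_eq_iff)
      show "mdl_map (pauli_map A) m \<in> mdl_vecs" "mdl_map (pauli_map B) m \<in> mdl_vecs" if "m \<in> mdl_vecs" for m
        using that by (cases m; simp add: mdl_map_def mdl_vecs_iff trace_linear pauli_map_trace A iB)+
      show "mdl_map (pauli_map A) (mdl_map (pauli_map B) m) = m" "mdl_map (pauli_map B) (mdl_map (pauli_map A) m) = m" for m
        by (cases m; simp add: mdl_map_def l mlin_simps[OF pauli_map_mlin] inv jvec_eq_iff)+
      show "mdl_map (pauli_map A) (mdl_bracket m n) = mdl_bracket (mdl_map (pauli_map A) m) (mdl_map (pauli_map A) n)" for m n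
        by (rule mdl_map_bracket[OF pauli_map_mlin pauli_map_mult(1)[OF d] pauli_map_trace[OF A] o])
      show "mdl_map (pauli_map A) m \<in> mdl_component (case s of (g, h) \<Rightarrow> (A *v g, h))" if "m \<in> mdl_component s" for s m
        using that by (cases s; cases m)
          (simp add: mdl_map_def mdl_component_def trace_linear pauli_map_trace A kcomp_map pauli_map_jcomp jcomp_linear)
      show "mdl_map (pauli_map B) m \<in> mdl_component s" if "m \<in> mdl_component (case s of (g, h) \<Rightarrow> (A *v g, h))" for s m
        using that by (cases s; cases m)
          (simp add: mdl_map_def mdl_component_def trace_linear pauli_map_trace iB k j jcomp_linear)
    qed (rule auto)
  next
    assume d: "mat_det A = - 1"
    show ?thesis
    proof (rule realizedI[where F = "mdl_anti_map (pauli_map A)" and F' = "mdl_anti_map (pauli_map B)"])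
      show "mdl_anti_map (pauli_map A) (m + n) = mdl_anti_map (pauli_map A) m + mdl_anti_map (pauli_map A) n" for m n
        by (cases m; cases n) (simp add: mdl_anti_map_def l jvec_eq_iff)
      show "mdl_anti_map (pauli_map A) (mdl_scale k m) = mdl_scale k (mdl_anti_map (pauli_map A) m)" for k m
        by (cases m) (simp add: mdl_anti_map_def mdl_scale_def l jvec_eq_iff)
      show "mdl_anti_map (pauli_map A) m \<in> mdl_vecs" "mdl_anti_map (pauli_map B) m \<in> mdl_vecs" if "m \<in> mdl_vecs" for m
        using that by (cases m; simp add: mdl_anti_map_def mdl_vecs_iff trace_linear pauli_map_trace A iB)+
      show "mdl_anti_map (pauli_map A) (mdl_anti_map (pauli_map B) m) = m" "mdl_anti_map (pauli_map B) (mdl_anti_map (pauli_map A) m) = m" for m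
        by (cases m; simp add: mdl_anti_map_def l mlin_simps[OF pauli_map_mlin] inv jvec_eq_iff)+
      show "mdl_anti_map (pauli_map A) (mdl_bracket m n) = mdl_bracket (mdl_anti_map (pauli_map A) m) (mdl_anti_map (pauli_map A) n)" for m n
        by (rule mdl_anti_map_bracket[OF pauli_map_mlin pauli_map_mult(2)[OF d] pauli_map_trace[OF A] o])
      show "mdl_anti_map (pauli_map A) m \<in> mdl_component (case s of (g, h) \<Rightarrow> (A *v g, h))" if "m \<in> mdl_component s" for s m
        using that by (cases s; cases m)
          (simp add: mdl_anti_map_def mdl_component_def trace_linear pauli_map_trace A kcomp_map pauli_map_jcomp jcomp_linear)
      show "mdl_anti_map (pauli_map B) m \<in> mdl_component s" if "m \<in> mdl_component (case s of (g, h) \<Rightarrow> (A *v g, h))" for s m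
        using that by (cases s; cases m)
          (simp add: mdl_anti_map_def mdl_component_def trace_linear pauli_map_trace iB k j jcomp_linear)
    qed (rule auto)
  qed
qed

end

section \<open>Automorphisms for the shifts and for the generators of the dihedral group\<close>

lemma mod3_negatives: "(- 1 :: 3) = 2" "(- 2 :: 3) = 1"
  by simp_all

text \<open>The homomorphism from Z^2 to Z_3 with value 1 on all three degrees u_i; the third one,
  (-1, -1), fits because -2 = 1 modulo 3. It vanishes on the long roots, so adding a multiple of k
  by the weight is a shift compatible with the support.\<close>

definition weight :: "int ^ 2 \<Rightarrow> 3" where
  "weight h = of_int (h $ 1 + h $ 2)"

lemma weight_simps [simp]:
  "weight 0 = 0" "weight (g + h) = weight g + weight h" "weight (g - h) = weight g - weight h" "weight (- h) = - weight h"
  by (simp_all add: weight_def)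

lemma weight_u_degree [simp]: "weight (u_degree i) = 1"
  using exhaust_mod3[of i] by (elim disjE) (simp_all add: u_degree_simps weight_def)

lemma matrix_vector_diff: "A *v (g - h) = A *v g - A *v h" "A *v (- h) = - (A *v h)" for A :: "'b::ring_1 ^ 2 ^ 2"
  by (simp_all add: vec2_eq_iff matrix_vector_mult_2 algebra_simps)

text \<open>\<sigma> is minus a 3-cycle of the short degrees, hence of order 6, and exchanges the
  degrees of the u_i with those of the v_i.\<close>

lemma sigma_mat_u_degree: "sigma_mat *v u_degree i = - u_degree (i - 1)"
  using exhaust_mod3[of i]
  by (elim disjE) (simp_all add: sigma_mat_def mod3_negatives u_degree_simps vec2_eq_iff matrix_vector_mult_2)

text \<open>\<tau> fixes the degree of u_1 and exchanges those of u_2 and u_3.\<close>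

lemma tau_mat_u_degree: "tau_mat *v u_degree i = u_degree (2 - i)"
  using exhaust_mod3[of i]
  by (elim disjE) (simp_all add: tau_mat_def u_degree_simps vec2_eq_iff matrix_vector_mult_2)

context cube_root
begin

lemma pauli_inverse: "pauli k ** pauli (- k) = mat 1" "pauli (- k) ** pauli k = mat 1"
  by (simp_all add: pauli_mult pauli_0)

text \<open>The action of (1, T, 1) in SL_3 x SL_3 x SL_3 for T = \<open>pauli k\<close>. It adds k
  to the labels in P, subtracts k from those in Q, and changes a Pauli matrix in X only by a
  phase.\<close>

definition mdl_translation :: "3 ^ 2 \<Rightarrow> 'a mdl \<Rightarrow> 'a mdl" where
  "mdl_translation k = (\<lambda>(K, X, Y, P, Q). (K, pauli k ** X ** pauli (- k), Y,
     \<chi> i. pauli k ** P $ i, \<chi> i. Q $ i ** pauli (- k)))"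

text \<open>The polarized form of adj (T M) = adj M T^-1 for T of determinant 1. On the Pauli basis,
  translating both labels does not affect whether they are equal, so the coefficient in
  \<open>mcross_pauli\<close> is unchanged; the total shift is k + k = -k.\<close>

lemma mcross_translation:
  "mcross (pauli k ** M) (pauli k ** N) = mcross M N ** pauli (- k)"
  "mcross (M ** pauli (- k)) (N ** pauli (- k)) = pauli k ** mcross M N"
proof -
  have k: "k + k = - k" by (simp add: vec2_eq_iff mod3_triple(3)[of "k $ _"])
  show "mcross (pauli k ** M) (pauli k ** N) = mcross M N ** pauli (- k)"
  proof (rule mlin2_eqI[where f = "\<lambda>M N. mcross (pauli k ** M) (pauli k ** N)" and h = "\<lambda>M N. mcross M N ** pauli (- k)"])
    fix g h
    have "k + g + (k + h) = g + h + (k + k)" by (simp only: ac_simps)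
    then have e: "k + g + (k + h) = g + h + - k" unfolding k .
    have r: "root_char (- sympl k g) * root_char (- sympl k h) = root_char (- sympl (g + h) (- k))"
      by (simp add: root_char_add[symmetric] sympl_add sympl_sym[of k] add.commute)
    show "mcross (pauli k ** pauli g) (pauli k ** pauli h) = mcross (pauli g) (pauli h) ** pauli (- k)"
      unfolding pauli_mult mcross_linear mcross_pauli mscale_matrix_mult mscale_mscale e r[symmetric]
      by (rule arg_cong[where f = "\<lambda>c. mscale c _"]) simp
  qed (auto simp: mlin_def matrix_mult_add mscale_matrix_mult mcross_linear)
  show "mcross (M ** pauli (- k)) (N ** pauli (- k)) = pauli k ** mcross M N"
  proof (rule mlin2_eqI[where f = "\<lambda>M N. mcross (M ** pauli (- k)) (N ** pauli (- k))" and h = "\<lambda>M N. pauli k ** mcross M N"])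
    fix g h
    have "g + - k + (h + - k) = - (k + k) + (g + h)" by (simp only: ac_simps minus_add_distrib)
    then have e: "g + - k + (h + - k) = k + (g + h)" unfolding k by simp
    have r: "root_char (- sympl g (- k)) * root_char (- sympl h (- k)) = root_char (- sympl k (g + h))"
      by (simp add: root_char_add[symmetric] sympl_add sympl_sym[of k] add.commute)
    show "mcross (pauli g ** pauli (- k)) (pauli h ** pauli (- k)) = pauli k ** mcross (pauli g) (pauli h)"
      unfolding pauli_mult mcross_linear mcross_pauli mscale_matrix_mult mscale_mscale e r[symmetric]
      by (rule arg_cong[where f = "\<lambda>c. mscale c _"]) simp
  qed (auto simp: mlin_def matrix_mult_add mscale_matrix_mult mcross_linear)
qed

lemma mdl_translation_bracket: "mdl_translation k (mdl_bracket m n) = mdl_bracket (mdl_translation k m) (mdl_translation k n)"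
proof -
  let ?T = "pauli k" and ?S = "pauli (- k)"
  have c: "?S ** (?T ** M) = M" "?T ** (?S ** M) = M" for M :: "'a jor"
    by (simp_all add: matrix_mul_assoc pauli_inverse)
  have a: "(A ** B) ** C = A ** (B ** C)" for A B C :: "'a jor" by (simp add: matrix_mul_assoc)
  have t: "trace (?T ** (M ** ?S)) = trace M" for M :: "'a jor"
    using trace_mul_sym[of ?T "M ** ?S"] by (simp add: a pauli_inverse)
  have t2: "trace (?T ** (M ** (N ** ?S))) = trace (M ** N)" for M N :: "'a jor" using t[of "M ** N"] by (simp add: a)
  have tf: "?T ** (tracefree M ** ?S) = tracefree (?T ** (M ** ?S))" for M
    by (simp add: tracefree_def matrix_mult_diff mscale_matrix_mult t pauli_inverse)
  show ?thesis
    by (cases m; cases n) (simp add: mdl_translation_def mdl_bracket_def jvec_eq_iff a c t2 tf mcross_translation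
        matrix_mult_add matrix_mult_diff matrix_mult_sum_distrib mscale_matrix_mult)
qed

lemma realized_translation: "(\<lambda>(g, h). (g + weight h *s k, h)) \<in> realized"
proof (rule realizedI[where F = "mdl_translation k" and F' = "mdl_translation (- k)"])
  have a: "(A ** B) ** C = A ** (B ** C)" for A B C :: "'a jor" by (simp add: matrix_mul_assoc)
  have c: "pauli (- k) ** (pauli k ** M) = M" "pauli k ** (pauli (- k) ** M) = M" for M :: "'a jor" and k
    by (simp_all add: matrix_mul_assoc pauli_inverse)
  have t: "trace (pauli k ** (M ** pauli (- k))) = trace M" for M :: "'a jor" and k
    using trace_mul_sym[of "pauli k" "M ** pauli (- k)"] by (simp add: a pauli_inverse)
  show "mdl_translation k (m + n) = mdl_translation k m + mdl_translation k n" for m n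
    by (cases m; cases n) (simp add: mdl_translation_def jvec_eq_iff matrix_mult_add)
  show "mdl_translation k (mdl_scale l m) = mdl_scale l (mdl_translation k m)" for l m
    by (cases m) (simp add: mdl_translation_def mdl_scale_def jvec_eq_iff mscale_matrix_mult)
  have v: "mdl_translation k m \<in> mdl_vecs" if "m \<in> mdl_vecs" for m k
    using that by (cases m) (simp add: mdl_translation_def mdl_vecs_iff a t)
  show "mdl_translation k m \<in> mdl_vecs" "mdl_translation (- k) m \<in> mdl_vecs" if "m \<in> mdl_vecs" for m
    using v that by blast+
  have i: "mdl_translation k (mdl_translation (- k) m) = m" for m k
    by (cases m) (use c[of k] c[of "- k"] in \<open>simp add: mdl_translation_def jvec_eq_iff a pauli_inverse\<close>)
  show "mdl_translation k (mdl_translation (- k) m) = m" "mdl_translation (- k) (mdl_translation k m) = m" for m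
    using i[of k m] i[of "- k" m] by simp_all
  show "mdl_translation k (mdl_bracket m n) = mdl_bracket (mdl_translation k m) (mdl_translation k n)" for m n
    by (rule mdl_translation_bracket)
  have p: "pauli k ** M \<in> J (k + g)" "M ** pauli k \<in> J (g + k)" if "M \<in> J g" for M g k
    using that jor_component_mult(1)[OF pauli_in_J that] jor_component_mult(1)[OF that pauli_in_J] by blast+
  have j1: "jcomp (g + weight h *s k, h) (u_degree i) (pauli k ** M)" if "jcomp (g, h) (u_degree i) M" for g h i M k
    using that p(1)[of M g k] by (cases "h = u_degree i") (auto simp: jcomp_def add.commute jor_component_linear)
  have j2: "jcomp (g + weight h *s k, h) (- u_degree i) (M ** pauli (- k))" if "jcomp (g, h) (- u_degree i) M" for g h i M k
  proof (cases "h = - u_degree i")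
    case True
    then have "weight h *s k = - k" by (simp only: weight_simps weight_u_degree) (simp add: vec2_eq_iff)
    then show ?thesis using that p(2)[of M g "- k"] True by (simp add: jcomp_def)
  qed (use that in \<open>auto simp: jcomp_def jor_component_linear\<close>)
  have j3: "jcomp (g + weight h *s k, h) 0 (pauli k ** (M ** pauli (- k)))" if "jcomp (g, h) 0 M" for g h M k
  proof (cases "h = 0")
    case True
    have "k + (g - k) = g" by simp
    moreover have "weight h *s k = 0" unfolding True weight_simps by (simp add: vec2_eq_iff)
    ultimately show ?thesis using that p(1)[OF p(2)[of M g "- k"], of k] True by (simp add: jcomp_def)
  qed (use that in \<open>auto simp: jcomp_def jor_component_linear\<close>)
  have j4: "jcomp (g + weight h *s k, h) 0 M" if "jcomp (g, h) 0 M" for g h M k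
  proof (cases "h = 0")
    case True
    have "weight h *s k = 0" unfolding True weight_simps by (simp add: vec2_eq_iff)
    then show ?thesis using that by simp
  qed (use that in \<open>auto simp: jcomp_def jor_component_linear\<close>)
  have j5: "kcomp (g + weight h *s k, h) M" if "kcomp (g, h) M" for g h M k
  proof -
    have "weight h = 0" if "M $ i $ j \<noteq> 0" for i j
    proof -
      have "h = u_degree i - u_degree j" using that \<open>kcomp (g, h) M\<close> by (auto simp: kcomp_def)
      then show ?thesis by simp
    qed
    note w = this
    have "weight h *s k = 0" if "M $ i $ j \<noteq> 0" for i j
      unfolding w[OF that] by (simp add: vec2_eq_iff)
    then show ?thesis using that unfolding kcomp_def by auto
  qed
  have comp: "mdl_translation k m \<in> mdl_component (g + weight h *s k, h)" if "m \<in> mdl_component (g, h)" for m g h k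
    using that by (cases m) (simp add: mdl_translation_def mdl_component_def a t j1 j2 j3 j4 j5)
  show "mdl_translation k m \<in> mdl_component (case s of (g, h) \<Rightarrow> (g + weight h *s k, h))"
    if "m \<in> mdl_component s" for s m
    using comp that by (cases s) simp
  show "mdl_translation (- k) m \<in> mdl_component s"
    if "m \<in> mdl_component (case s of (g, h) \<Rightarrow> (g + weight h *s k, h))" for s m
  proof -
    obtain g h where s: "s = (g, h)" by (cases s)
    have "g + weight h *s k + weight h *s (- k) = g" by (simp add: vec2_eq_iff)
    then show ?thesis using comp[of m "g + weight h *s k" h "- k"] that by (simp add: s)
  qed
  have "bij (\<lambda>(g, h). (g + weight h *s k, h))"
    by (rule bij_betw_byWitness[where f' = "\<lambda>(g, h). (g - weight h *s k, h)"]) auto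
  then show "(\<lambda>(g, h). (g + weight h *s k, h)) \<in> auto G4"
    by (auto simp: e6.auto_G4_iff vec2_eq_iff algebra_simps)
qed

text \<open>Minus the transpose on K exchanges V with its dual, hence P with Q; as these are
  matrices in opposite directions, the left factor X and the right factor Y are exchanged too.
  Duality alone would induce -1 on the short degrees; the rotation of the index turns it into
  \<sigma>.\<close>

definition mdl_sigma :: "'a mdl \<Rightarrow> 'a mdl" where
  "mdl_sigma = (\<lambda>(K, X, Y, P, Q). (- (\<chi> i j. K $ (j + 1) $ (i + 1)), Y, X, \<chi> i. Q $ (i + 1), \<chi> i. P $ (i + 1)))"

definition mdl_sigma_inv :: "'a mdl \<Rightarrow> 'a mdl" where
  "mdl_sigma_inv = (\<lambda>(K, X, Y, P, Q). (- (\<chi> i j. K $ (j - 1) $ (i - 1)), Y, X, \<chi> i. Q $ (i - 1), \<chi> i. P $ (i - 1)))"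

text \<open>An odd permutation of the index reverses the sign of the cross product in the index, and
  the signs on P and Q make up for it. Put differently, minus the permutation matrix has determinant
  1.\<close>

definition mdl_tau :: "'a mdl \<Rightarrow> 'a mdl" where
  "mdl_tau = (\<lambda>(K, X, Y, P, Q). (\<chi> i j. K $ (2 - i) $ (2 - j), X, Y, \<chi> i. - P $ (2 - i), \<chi> i. - Q $ (2 - i)))"

lemma mscale_minus_left: "mscale (- k) M = - mscale k (M :: 'a jor)"
  by (simp add: vec_eq_iff)

lemma sigma_commutator:
  fixes T :: "3 \<Rightarrow> 3 \<Rightarrow> 'a" and K K' :: "'a jor"
  shows "- (\<chi> i j. (K ** K' - K' ** K - tracefree (\<chi> i j. T i j)) $ (j + 1) $ (i + 1)) =
    - (\<chi> i j. K $ (j + 1) $ (i + 1)) ** - (\<chi> i j. K' $ (j + 1) $ (i + 1))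
    - - (\<chi> i j. K' $ (j + 1) $ (i + 1)) ** - (\<chi> i j. K $ (j + 1) $ (i + 1)) - tracefree (\<chi> i j. - T (j + 1) (i + 1))"
  unfolding vec_eq_iff forall_mod3
  by (simp add: matrix_mult_nth sum_mod3 tracefree_nth trace_3 mod3_numerals) (simp add: algebra_simps)

lemma tau_commutator:
  fixes T :: "3 \<Rightarrow> 3 \<Rightarrow> 'a" and K K' :: "'a jor"
  shows "(\<chi> i j. (K ** K' - K' ** K - tracefree (\<chi> i j. T i j)) $ (2 - i) $ (2 - j)) =
    (\<chi> i j. K $ (2 - i) $ (2 - j)) ** (\<chi> i j. K' $ (2 - i) $ (2 - j))
    - (\<chi> i j. K' $ (2 - i) $ (2 - j)) ** (\<chi> i j. K $ (2 - i) $ (2 - j)) - tracefree (\<chi> i j. T (2 - i) (2 - j))"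
  unfolding vec_eq_iff forall_mod3
  by (simp add: matrix_mult_nth sum_mod3 tracefree_nth trace_3 mod3_numerals)

lemma mdl_sigma_bracket: "mdl_sigma (mdl_bracket m n) = mdl_bracket (mdl_sigma m) (mdl_sigma n)"
proof -
  obtain K X Y P Q where m: "m = (K, X, Y, P, Q)" by (cases m) auto
  obtain K' X' Y' P' Q' where n: "n = (K', X', Y', P', Q')" by (cases n) auto
  have t: "trace (Q $ i ** P' $ j) = trace (P' $ j ** Q $ i)" "trace (Q' $ i ** P $ j) = trace (P $ j ** Q' $ i)" for i j
    by (rule trace_mul_sym)+
  have tf: "- tracefree M = tracefree (- M)" for M :: "'a jor" by (simp add: tracefree_linear)
  have tfm: "x - tracefree M = x + tracefree (- M)" for x M :: "'a jor" by (simp add: tracefree_linear)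
  show ?thesis
    unfolding m n mdl_sigma_def mdl_bracket_def prod.case prod.inject
  proof (intro conjI, goal_cases)
    case 1
    show ?case
      by (rule trans[OF sigma_commutator]) (simp add: t)
  next
    case 2
    show ?case by (simp add: tfm sum_mod3 mod3_numerals algebra_simps)
  next
    case 3
    show ?case by (simp add: tfm sum_mod3 mod3_numerals algebra_simps)
  next
    case 4
    show ?case
      unfolding jvec_eq_iff forall_mod3
      by (simp add: sum_mod3 mod3_numerals mscale_minus_left)
  next
    case 5
    show ?case
      unfolding jvec_eq_iff forall_mod3
      by (simp add: sum_mod3 mod3_numerals mscale_minus_left)
  qed
qed

lemma mdl_tau_bracket: "mdl_tau (mdl_bracket m n) = mdl_bracket (mdl_tau m) (mdl_tau n)"
proof -
  obtain K X Y P Q where m: "m = (K, X, Y, P, Q)" by (cases m) auto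
  obtain K' X' Y' P' Q' where n: "n = (K', X', Y', P', Q')" by (cases n) auto
  show ?thesis
    unfolding m n mdl_tau_def mdl_bracket_def prod.case prod.inject
  proof (intro conjI, goal_cases)
    case 1
    show ?case
      by (rule trans[OF tau_commutator]) (simp add: matrix_mult_minus)
  next
    case 2
    show ?case by (simp add: sum_mod3 mod3_numerals matrix_mult_minus algebra_simps)
  next
    case 3
    show ?case by (simp add: sum_mod3 mod3_numerals matrix_mult_minus algebra_simps)
  next
    case 4
    show ?case
      unfolding jvec_eq_iff forall_mod3
      by (simp add: sum_mod3 mod3_numerals matrix_mult_minus mcross_linear)
  next
    case 5
    show ?case
      unfolding jvec_eq_iff forall_mod3
      by (simp add: sum_mod3 mod3_numerals matrix_mult_minus mcross_linear)
  qed
qed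

lemma trace_permute:
  "trace (- (\<chi> i j. K $ (j + 1) $ (i + 1))) = - trace (K :: 'a jor)"
  "trace (- (\<chi> i j. K $ (j - 1) $ (i - 1))) = - trace (K :: 'a jor)"
  "trace (\<chi> i j. K $ (2 - i) $ (2 - j)) = trace (K :: 'a jor)"
  using sum_mod3_shift(1)[of "\<lambda>i. K $ i $ i" 1] sum_mod3_shift(4)[of "\<lambda>i. K $ i $ i" 1] sum_mod3_shift(3)[of "\<lambda>i. K $ i $ i" 2]
  by (simp_all add: trace_def sum_negf)

lemma realized_sigma: "(\<lambda>(g, h). (g, sigma_mat *v h)) \<in> realized"
proof (rule realizedI[where F = mdl_sigma and F' = mdl_sigma_inv])
  have sinj: "sigma_mat *v h = sigma_mat *v h' \<longleftrightarrow> h = h'" for h h'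
    by (auto simp: sigma_mat_def vec2_eq_iff matrix_vector_mult_2)
  have sv: "sigma_mat *v (u_degree i - u_degree j) = u_degree (j - 1) - u_degree (i - 1)"
    "sigma_mat *v (- u_degree i) = u_degree (i - 1)" for i j
    by (simp_all add: matrix_vector_diff sigma_mat_u_degree)
  have s0: "sigma_mat *v h = 0 \<longleftrightarrow> h = 0" for h using sinj[of h 0] by (simp add: matrix_vector_zero)
  have jc: "jcomp (g, sigma_mat *v h) (sigma_mat *v c) M \<longleftrightarrow> jcomp (g, h) c M" for g h c M
    by (simp add: jcomp_def sinj)
  show "mdl_sigma (m + n) = mdl_sigma m + mdl_sigma n" for m n
    by (cases m; cases n) (simp add: mdl_sigma_def jvec_eq_iff, simp add: vec_eq_iff)
  show "mdl_sigma (mdl_scale k m) = mdl_scale k (mdl_sigma m)" for k m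
    by (cases m) (simp add: mdl_sigma_def mdl_scale_def jvec_eq_iff, simp add: vec_eq_iff)
  show "mdl_sigma m \<in> mdl_vecs" "mdl_sigma_inv m \<in> mdl_vecs" if "m \<in> mdl_vecs" for m
    using that by (cases m; simp add: mdl_sigma_def mdl_sigma_inv_def mdl_vecs_iff trace_permute)+
  show "mdl_sigma (mdl_sigma_inv m) = m" "mdl_sigma_inv (mdl_sigma m) = m" for m
    by (cases m; simp add: mdl_sigma_def mdl_sigma_inv_def vec_eq_iff)+
  show "mdl_sigma (mdl_bracket m n) = mdl_bracket (mdl_sigma m) (mdl_sigma n)" for m n
    by (rule mdl_sigma_bracket)
  show "mdl_sigma m \<in> mdl_component (case s of (g, h) \<Rightarrow> (g, sigma_mat *v h))" if m: "m \<in> mdl_component s" for s m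
  proof -
    obtain g h where s: "s = (g, h)" by (cases s)
    obtain K X Y P Q where m': "m = (K, X, Y, P, Q)" by (cases m) auto
    have "kcomp (g, sigma_mat *v h) (- (\<chi> i j. K $ (j + 1) $ (i + 1)))"
      unfolding kcomp_def
    proof (intro allI impI)
      fix i j assume "(- (\<chi> i j. K $ (j + 1) $ (i + 1))) $ i $ j \<noteq> 0"
      then have "g = 0" "h = u_degree (j + 1) - u_degree (i + 1)"
        using m by (auto simp: s m' mdl_component_def kcomp_def)
      then show "fst (g, sigma_mat *v h) = 0 \<and> u_degree i - u_degree j = snd (g, sigma_mat *v h)" by (simp add: sv)
    qed
    moreover have "jcomp (g, sigma_mat *v h) 0 X" "jcomp (g, sigma_mat *v h) 0 Y"
      using m jc[of g h 0] by (auto simp: s m' mdl_component_def matrix_vector_zero)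
    moreover have "jcomp (g, sigma_mat *v h) (u_degree i) (Q $ (i + 1))" for i
      using m jc[of g h "- u_degree (i + 1)" "Q $ (i + 1)"] by (simp add: s m' mdl_component_def sv)
    moreover have "jcomp (g, sigma_mat *v h) (- u_degree i) (P $ (i + 1))" for i
      using m jc[of g h "u_degree (i + 1)" "P $ (i + 1)"] by (simp add: s m' mdl_component_def sigma_mat_u_degree)
    moreover have "trace (- (\<chi> i j. K $ (j + 1) $ (i + 1))) = 0" "trace X = 0" "trace Y = 0"
      using m by (simp_all add: m' mdl_component_def trace_permute)
    ultimately show ?thesis by (simp add: s m' mdl_sigma_def mdl_component_def)
  qed
  show "mdl_sigma_inv m \<in> mdl_component s" if m: "m \<in> mdl_component (case s of (g, h) \<Rightarrow> (g, sigma_mat *v h))" for s m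
  proof -
    obtain g h where s: "s = (g, h)" by (cases s)
    obtain K X Y P Q where m': "m = (K, X, Y, P, Q)" by (cases m) auto
    have "kcomp (g, h) (- (\<chi> i j. K $ (j - 1) $ (i - 1)))"
      unfolding kcomp_def
    proof (intro allI impI)
      fix i j assume "(- (\<chi> i j. K $ (j - 1) $ (i - 1))) $ i $ j \<noteq> 0"
      then have "g = 0" "sigma_mat *v h = u_degree (j - 1) - u_degree (i - 1)"
        using m by (auto simp: s m' mdl_component_def kcomp_def)
      then have "g = 0" "sigma_mat *v h = sigma_mat *v (u_degree i - u_degree j)" by (simp_all add: sv)
      then show "fst (g, h) = 0 \<and> u_degree i - u_degree j = snd (g, h)" by (simp add: sinj)
    qed
    moreover have "jcomp (g, h) 0 X" "jcomp (g, h) 0 Y"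
      using m jc[of g h 0] by (auto simp: s m' mdl_component_def matrix_vector_zero)
    moreover have "jcomp (g, h) (u_degree i) (Q $ (i - 1))" for i
      using m jc[of g h "u_degree i" "Q $ (i - 1)"] by (simp add: s m' mdl_component_def sigma_mat_u_degree)
    moreover have "jcomp (g, h) (- u_degree i) (P $ (i - 1))" for i
      using m jc[of g h "- u_degree i" "P $ (i - 1)"] by (simp add: s m' mdl_component_def sv)
    moreover have "trace (- (\<chi> i j. K $ (j - 1) $ (i - 1))) = 0" "trace X = 0" "trace Y = 0"
      using m by (simp_all add: s m' mdl_component_def trace_permute)
    ultimately show ?thesis by (simp add: s m' mdl_sigma_inv_def mdl_component_def)
  qed
  have "bij (\<lambda>(g :: 3 ^ 2, h). (g, sigma_mat *v h))"
    by (rule bij_betw_byWitness[where f' = "\<lambda>(g, h). (g, vector [h $ 2, h $ 2 - h $ 1])"])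
      (auto simp: sigma_mat_def vec2_eq_iff matrix_vector_mult_2)
  then show "(\<lambda>(g, h). (g, sigma_mat *v h)) \<in> auto G4"
    by (simp add: e6.auto_G4_iff matrix_vector_add)
qed

lemma realized_tau: "(\<lambda>(g, h). (g, tau_mat *v h)) \<in> realized"
proof (rule realizedI[where F = mdl_tau and F' = mdl_tau])
  have tt: "tau_mat *v (tau_mat *v h) = h" for h
    by (simp add: tau_mat_def vec2_eq_iff matrix_vector_mult_2)
  show "mdl_tau (m + n) = mdl_tau m + mdl_tau n" for m n
    by (cases m; cases n) (simp add: mdl_tau_def jvec_eq_iff, simp add: vec_eq_iff)
  show "mdl_tau (mdl_scale k m) = mdl_scale k (mdl_tau m)" for k m
    by (cases m) (simp add: mdl_tau_def mdl_scale_def jvec_eq_iff, simp add: vec_eq_iff)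
  show v: "mdl_tau m \<in> mdl_vecs" if "m \<in> mdl_vecs" for m
    using that by (cases m) (simp add: mdl_tau_def mdl_vecs_iff trace_permute)
  then show "mdl_tau m \<in> mdl_vecs" if "m \<in> mdl_vecs" for m using that .
  show "mdl_tau (mdl_tau m) = m" for m
    by (cases m; simp add: mdl_tau_def vec_eq_iff)
  then show "mdl_tau (mdl_tau m) = m" for m .
  show "mdl_tau (mdl_bracket m n) = mdl_bracket (mdl_tau m) (mdl_tau n)" for m n
    by (rule mdl_tau_bracket)
  have comp: "mdl_tau m \<in> mdl_component (g, tau_mat *v h)" if m: "m \<in> mdl_component (g, h)" for g h m
  proof -
    obtain K X Y P Q where m': "m = (K, X, Y, P, Q)" by (cases m) auto
    have "kcomp (g, tau_mat *v h) (\<chi> i j. K $ (2 - i) $ (2 - j))"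
      unfolding kcomp_def
    proof (intro allI impI)
      fix i j assume "(\<chi> i j. K $ (2 - i) $ (2 - j)) $ i $ j \<noteq> 0"
      then have "g = 0" "h = u_degree (2 - i) - u_degree (2 - j)"
        using m by (auto simp: m' mdl_component_def kcomp_def)
      then show "fst (g, tau_mat *v h) = 0 \<and> u_degree i - u_degree j = snd (g, tau_mat *v h)"
        by (simp add: matrix_vector_diff tau_mat_u_degree)
    qed
    moreover have jc: "jcomp (g, tau_mat *v h) (tau_mat *v c) M" if "jcomp (g, h) c M" for c M
      using that by (auto simp: jcomp_def)
    have "jcomp (g, tau_mat *v h) 0 X" "jcomp (g, tau_mat *v h) 0 Y"
      using m jc[of 0] by (auto simp: m' mdl_component_def matrix_vector_zero)
    moreover have "jcomp (g, tau_mat *v h) (u_degree i) (- P $ (2 - i))" for i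
      using m jc[of "u_degree (2 - i)" "- P $ (2 - i)"] by (simp add: m' mdl_component_def tau_mat_u_degree jcomp_linear)
    moreover have "jcomp (g, tau_mat *v h) (- u_degree i) (- Q $ (2 - i))" for i
      using m jc[of "- u_degree (2 - i)" "- Q $ (2 - i)"]
      by (simp add: m' mdl_component_def matrix_vector_diff tau_mat_u_degree jcomp_linear)
    moreover have "trace (\<chi> i j. K $ (2 - i) $ (2 - j)) = 0" "trace X = 0" "trace Y = 0"
      using m by (simp_all add: m' mdl_component_def trace_permute)
    ultimately show ?thesis by (simp add: m' mdl_tau_def mdl_component_def)
  qed
  show "mdl_tau m \<in> mdl_component (case s of (g, h) \<Rightarrow> (g, tau_mat *v h))" if "m \<in> mdl_component s" for s m
    using comp that by (cases s) simp
  show "mdl_tau m \<in> mdl_component s" if "m \<in> mdl_component (case s of (g, h) \<Rightarrow> (g, tau_mat *v h))" for s m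
    using comp[of m "fst s" "tau_mat *v snd s"] that by (cases s) (simp add: tt)
  have "bij (\<lambda>(g :: 3 ^ 2, h). (g, tau_mat *v h))"
    by (rule bij_betw_byWitness[where f' = "\<lambda>(g, h). (g, tau_mat *v h)"]) (auto simp: tt)
  then show "(\<lambda>(g, h). (g, tau_mat *v h)) \<in> auto G4"
    by (simp add: e6.auto_G4_iff matrix_vector_add)
qed

end

section \<open>The groups in the description of the Weyl group\<close>

text \<open>Compares two groups through embeddings with a common image. It serves for the Weyl group
  and the semidirect product inside the automorphisms of G4, and for the matrix group and the
  abstract dihedral group inside \<open>GL\<close>.\<close>

lemma is_isoI_image:
  assumes f: "f \<in> mon W K" and g: "g \<in> mon S K" and im: "f ` carrier W = g ` carrier S"
    and W: "\<And>x y. x \<in> carrier W \<Longrightarrow> y \<in> carrier W \<Longrightarrow> x \<otimes>\<^bsub>W\<^esub> y \<in> carrier W"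
    and S: "\<And>x y. x \<in> carrier S \<Longrightarrow> y \<in> carrier S \<Longrightarrow> x \<otimes>\<^bsub>S\<^esub> y \<in> carrier S"
  shows "W \<cong> S"
proof -
  have fh: "f \<in> hom W K" "inj_on f (carrier W)" and gh: "g \<in> hom S K" "inj_on g (carrier S)"
    using f g by (auto simp: mon_def)
  define h where "h x = inv_into (carrier S) g (f x)" for x
  have h: "h x \<in> carrier S" "g (h x) = f x" if "x \<in> carrier W" for x
  proof -
    have "f x \<in> g ` carrier S" using that im by blast
    then show "h x \<in> carrier S" "g (h x) = f x"
      unfolding h_def by (rule inv_into_into, rule f_inv_into_f)
  qed
  have "h \<in> hom W S"
  proof (rule homI)
    fix x y assume xy: "x \<in> carrier W" "y \<in> carrier W"
    have "g (h (x \<otimes>\<^bsub>W\<^esub> y)) = g (h x \<otimes>\<^bsub>S\<^esub> h y)"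
      by (simp add: h W xy Group.hom_mult[OF fh(1)] Group.hom_mult[OF gh(1)])
    then show "h (x \<otimes>\<^bsub>W\<^esub> y) = h x \<otimes>\<^bsub>S\<^esub> h y"
      by (rule inj_onD[OF gh(2)]) (simp_all add: h W S xy)
  qed (rule h)
  moreover have "bij_betw h (carrier W) (carrier S)"
  proof (rule bij_betw_imageI)
    show "inj_on h (carrier W)"
    proof (rule inj_onI)
      fix x y assume xy: "x \<in> carrier W" "y \<in> carrier W" "h x = h y"
      then have "f x = f y" using h(2) by metis
      then show "x = y" using inj_onD[OF fh(2)] xy by blast
    qed
    show "h ` carrier W = carrier S"
    proof
      show "carrier S \<subseteq> h ` carrier W"
      proof
        fix y assume y: "y \<in> carrier S"
        then obtain x where x: "x \<in> carrier W" "g y = f x" using im by blast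
        then have "h x = y" using inj_onD[OF gh(2), of "h x" y] h y by simp
        then show "y \<in> h ` carrier W" using x by blast
      qed
    qed (use h in blast)
  qed
  ultimately show ?thesis by (auto simp: is_iso_def iso_def)
qed

lemma GL_simps [simp]: "carrier GL = {A. invertible A}" "mult GL = (**)" "one GL = mat 1"
  by (simp_all add: GL_def)

lemma group_GL: "group (GL :: ('r::comm_ring_1 ^ 'n ^ 'n) monoid)"
proof (rule groupI)
  fix A B :: "'r ^ 'n ^ 'n" assume A: "A \<in> carrier GL"
  then obtain A' where A': "A ** A' = mat 1" "A' ** A = mat 1" by (auto simp: invertible_def)
  show "\<exists>A'\<in>carrier GL. A' \<otimes>\<^bsub>GL\<^esub> A = \<one>\<^bsub>GL\<^esub>" using A' by (auto simp: invertible_def)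
  assume "B \<in> carrier GL"
  then obtain B' where B': "B ** B' = mat 1" "B' ** B = mat 1" by (auto simp: invertible_def)
  have "(A ** B) ** (B' ** A') = A ** (B ** B') ** A'" "(B' ** A') ** (A ** B) = B' ** (A' ** A) ** B"
    by (simp_all only: matrix_mul_assoc)
  then have "(A ** B) ** (B' ** A') = mat 1" "(B' ** A') ** (A ** B) = mat 1"
    using A' B' by simp_all
  then show "A \<otimes>\<^bsub>GL\<^esub> B \<in> carrier GL" by (auto simp: invertible_def)
qed (auto simp: matrix_mul_assoc invertible_def intro: exI[of _ "mat 1"])

section \<open>The dihedral group generated by \<sigma> and \<tau>\<close>

definition dihedral_map :: "('g, 'x) monoid_scheme \<Rightarrow> 'g \<Rightarrow> 'g \<Rightarrow> int \<times> int \<Rightarrow> 'g" where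
  "dihedral_map G a b = (\<lambda>(r, s). a [^]\<^bsub>G\<^esub> r \<otimes>\<^bsub>G\<^esub> b [^]\<^bsub>G\<^esub> s)"

lemma (in group) int_pow_mod:
  assumes x: "x \<in> carrier G" "x [^] n = \<one>"
  shows "x [^] (k mod n) = x [^] (k :: int)"
proof -
  have "x [^] k = x [^] (n * (k div n) + k mod n)" by simp
  also have "\<dots> = (x [^] n) [^] (k div n) \<otimes> x [^] (k mod n)"
    using x(1) by (simp only: int_pow_mult int_pow_pow)
  finally show ?thesis using x by simp
qed

text \<open>Conjugation by b turns sums of exponents of a into products, so it is determined by its
  value inv a at exponent 1; this gives b a^k = a^(-k) b for all integers k. The reductions of
  exponents modulo n and modulo 2 in the source are absorbed by \<open>int_pow_mod\<close>.\<close>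

lemma (in group) dihedral_map_hom:
  assumes a: "a \<in> carrier G" "a [^] int n = \<one>" and b: "b \<in> carrier G" "b \<otimes> b = \<one>" and ba: "b \<otimes> a = inv a \<otimes> b"
    and n: "n > 0"
  shows "dihedral_map G a b \<in> hom (dihedral_group n) G"
proof -
  have conj: "b \<otimes> a [^] k \<otimes> b = a [^] (- k)" for k :: int
  proof -
    have "b \<otimes> a [^] (i + j) \<otimes> b = (b \<otimes> a [^] i \<otimes> b) \<otimes> (b \<otimes> a [^] j \<otimes> b)" for i j :: int
    proof -
      have "(b \<otimes> a [^] i \<otimes> b) \<otimes> (b \<otimes> a [^] j \<otimes> b) = b \<otimes> a [^] i \<otimes> (b \<otimes> b) \<otimes> a [^] j \<otimes> b"
        using a(1) b(1) by (simp only: m_assoc m_closed int_pow_closed)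
      then show ?thesis using a(1) b by (simp add: int_pow_mult m_assoc)
    qed
    from int_hom_pow[of "\<lambda>k. b \<otimes> a [^] k \<otimes> b" k, OF this]
    have "b \<otimes> a [^] k \<otimes> b = (b \<otimes> a \<otimes> b) [^] k" using a b by simp
    also have "b \<otimes> a \<otimes> b = inv a" using a b by (simp add: ba m_assoc)
    finally show ?thesis using a by (simp add: int_pow_inv int_pow_neg)
  qed
  have swap: "b \<otimes> a [^] k = a [^] (- k) \<otimes> b" for k :: int
  proof -
    have "a [^] (- k) \<otimes> b = b \<otimes> a [^] k \<otimes> (b \<otimes> b)"
      unfolding conj[symmetric] using a(1) b(1) by (simp add: m_assoc)
    then show ?thesis using a(1) b by simp
  qed
  have b2: "b [^] (2 :: int) = \<one>" using int_pow_mult[OF b(1), of 1 1] b by simp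
  show ?thesis
  proof (rule homI)
    fix x y assume c: "x \<in> carrier (dihedral_group n)" "y \<in> carrier (dihedral_group n)"
    obtain r s r' s' where e: "x = (r, s)" "y = (r', s')" by (cases x; cases y)
    then have "s \<in> {0..<2}" "r' \<in> carrier (integer_mod_group n)"
      using c by (simp_all add: dihedral_group_def semidirect_def carrier_integer_mod_group)
    then have xy: "x = (r, s)" "y = (r', s')" "s = 0 \<or> s = 1" "r' \<in> carrier (integer_mod_group n)"
      using e by auto
    show "dihedral_map G a b x \<in> carrier G" using a b by (simp add: dihedral_map_def xy)
    have "a [^] (r + r') \<otimes> b [^] s' = a [^] r \<otimes> \<one> \<otimes> (a [^] r' \<otimes> b [^] s')"
      using a b by (simp add: int_pow_mult m_assoc)
    moreover have "a [^] (r + (- r')) \<otimes> b [^] (1 + s') = a [^] r \<otimes> b \<otimes> (a [^] r' \<otimes> b [^] s')"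
    proof -
      have "a [^] r \<otimes> b \<otimes> (a [^] r' \<otimes> b [^] s') = a [^] r \<otimes> (b \<otimes> a [^] r') \<otimes> b [^] s'"
        using a(1) b(1) by (simp add: m_assoc)
      also have "\<dots> = a [^] (r + (- r')) \<otimes> b [^] (1 + s')"
        unfolding swap using a(1) b(1) by (simp only: int_pow_mult m_assoc m_closed int_pow_closed int_pow_1)
      finally show ?thesis by simp
    qed
    moreover have "a [^] ((r + (- r') mod int n) mod int n) = a [^] (r + (- r'))"
      using int_pow_mod[OF a, of "r + - r'"] by (simp only: mod_add_right_eq)
    ultimately show "dihedral_map G a b (x \<otimes>\<^bsub>dihedral_group n\<^esub> y) = dihedral_map G a b x \<otimes> dihedral_map G a b y"
      using xy b int_pow_mod[OF a] int_pow_mod[OF b(1) b2]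
      by (auto simp: dihedral_map_def dihedral_group_def semidirect_def)
  qed
qed

text \<open>A normal form in which integer matrices can be multiplied and compared entry by entry
  through rewriting.\<close>

definition mat2 :: "int \<Rightarrow> int \<Rightarrow> int \<Rightarrow> int \<Rightarrow> int ^ 2 ^ 2" where
  "mat2 p q r s = vector [vector [p, q], vector [r, s]]"

lemma mat2_simps [simp]:
  "mat2 p q r s ** mat2 p' q' r' s' = mat2 (p * p' + q * r') (p * q' + q * s') (r * p' + s * r') (r * q' + s * s')"
  "mat2 p q r s = mat2 p' q' r' s' \<longleftrightarrow> p = p' \<and> q = q' \<and> r = r' \<and> s = s'"
  "mat2 p q r s $ 1 = vector [p, q]" "mat2 p q r s $ 2 = vector [r, s]"
  by (auto simp: mat2_def vec2_eq_iff matrix_mult_nth sum_2)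

lemma mat2_eqs: "sigma_mat = mat2 1 (-1) 1 0" "tau_mat = mat2 1 (-1) 0 (-1)" "mat 1 = mat2 1 0 0 1"
  by (simp_all add: mat2_def sigma_mat_def tau_mat_def vec2_eq_iff mat_def)

lemma sigma_tau_GL: "sigma_mat \<in> carrier GL" "tau_mat \<in> carrier GL"
proof -
  have "sigma_mat ** mat2 0 1 (-1) 1 = mat 1" "mat2 0 1 (-1) 1 ** sigma_mat = mat 1" "tau_mat ** tau_mat = mat 1"
    by (simp_all add: mat2_eqs)
  then show "sigma_mat \<in> carrier GL" "tau_mat \<in> carrier GL" by (auto simp: invertible_def)
qed

lemma int_interval_6: "{0..<6 :: int} = {0, 1, 2, 3, 4, 5}" "{0..<2 :: int} = {0, 1}"
  by auto

lemma sigma_pow: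
  "sigma_mat [^]\<^bsub>GL\<^esub> (2 :: int) = mat2 0 (-1) 1 (-1)" "sigma_mat [^]\<^bsub>GL\<^esub> (3 :: int) = mat2 (-1) 0 0 (-1)"
  "sigma_mat [^]\<^bsub>GL\<^esub> (4 :: int) = mat2 (-1) 1 (-1) 0" "sigma_mat [^]\<^bsub>GL\<^esub> (5 :: int) = mat2 0 1 (-1) 1"
  "sigma_mat [^]\<^bsub>GL\<^esub> (6 :: int) = mat 1"
proof -
  interpret group "GL :: (int ^ 2 ^ 2) monoid" by (rule group_GL)
  have s: "sigma_mat [^]\<^bsub>GL\<^esub> (k + 1 :: int) = sigma_mat [^]\<^bsub>GL\<^esub> k ** mat2 1 (-1) 1 0" for k
    using int_pow_mult[OF sigma_tau_GL(1), of k 1] sigma_tau_GL by (simp add: mat2_eqs)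
  show p: "sigma_mat [^]\<^bsub>GL\<^esub> (2 :: int) = mat2 0 (-1) 1 (-1)"
    using s[of 1] sigma_tau_GL by (simp add: mat2_eqs)
  show p: "sigma_mat [^]\<^bsub>GL\<^esub> (3 :: int) = mat2 (-1) 0 0 (-1)" using s[of 2] by (simp add: p)
  show p: "sigma_mat [^]\<^bsub>GL\<^esub> (4 :: int) = mat2 (-1) 1 (-1) 0" using s[of 3] by (simp add: p)
  show p: "sigma_mat [^]\<^bsub>GL\<^esub> (5 :: int) = mat2 0 1 (-1) 1" using s[of 4] by (simp add: p)
  show "sigma_mat [^]\<^bsub>GL\<^esub> (6 :: int) = mat 1" using s[of 5] by (simp add: p mat2_eqs(3))
qed

text \<open>The six rotations and the six reflections. The twelve values are different, which yields
  injectivity, and they list the group explicitly for the case analyses that follow.\<close>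

lemma dihedral_map_sigma_tau:
  "dihedral_map GL sigma_mat tau_mat (0, 0) = mat2 1 0 0 1"
  "dihedral_map GL sigma_mat tau_mat (1, 0) = mat2 1 (-1) 1 0"
  "dihedral_map GL sigma_mat tau_mat (2, 0) = mat2 0 (-1) 1 (-1)"
  "dihedral_map GL sigma_mat tau_mat (3, 0) = mat2 (-1) 0 0 (-1)"
  "dihedral_map GL sigma_mat tau_mat (4, 0) = mat2 (-1) 1 (-1) 0"
  "dihedral_map GL sigma_mat tau_mat (5, 0) = mat2 0 1 (-1) 1"
  "dihedral_map GL sigma_mat tau_mat (0, 1) = mat2 1 (-1) 0 (-1)"
  "dihedral_map GL sigma_mat tau_mat (1, 1) = mat2 1 0 1 (-1)"
  "dihedral_map GL sigma_mat tau_mat (2, 1) = mat2 0 1 1 0"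
  "dihedral_map GL sigma_mat tau_mat (3, 1) = mat2 (-1) 1 0 1"
  "dihedral_map GL sigma_mat tau_mat (4, 1) = mat2 (-1) 0 (-1) 1"
  "dihedral_map GL sigma_mat tau_mat (5, 1) = mat2 0 (-1) (-1) 0"
proof -
  interpret group "GL :: (int ^ 2 ^ 2) monoid" by (rule group_GL)
  have "sigma_mat [^]\<^bsub>GL\<^esub> (0 :: int) = mat2 1 0 0 1" "sigma_mat [^]\<^bsub>GL\<^esub> (1 :: int) = mat2 1 (-1) 1 0"
    "tau_mat [^]\<^bsub>GL\<^esub> (0 :: int) = mat2 1 0 0 1" "tau_mat [^]\<^bsub>GL\<^esub> (1 :: int) = mat2 1 (-1) 0 (-1)"
    using int_pow_1[OF sigma_tau_GL(1)] int_pow_1[OF sigma_tau_GL(2)] by (simp_all only: mat2_eqs int_pow_0 GL_simps)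
  note q = this
  show "dihedral_map GL sigma_mat tau_mat (0, 0) = mat2 1 0 0 1"
  "dihedral_map GL sigma_mat tau_mat (1, 0) = mat2 1 (-1) 1 0"
  "dihedral_map GL sigma_mat tau_mat (2, 0) = mat2 0 (-1) 1 (-1)"
  "dihedral_map GL sigma_mat tau_mat (3, 0) = mat2 (-1) 0 0 (-1)"
  "dihedral_map GL sigma_mat tau_mat (4, 0) = mat2 (-1) 1 (-1) 0"
  "dihedral_map GL sigma_mat tau_mat (5, 0) = mat2 0 1 (-1) 1"
  "dihedral_map GL sigma_mat tau_mat (0, 1) = mat2 1 (-1) 0 (-1)"
  "dihedral_map GL sigma_mat tau_mat (1, 1) = mat2 1 0 1 (-1)"
  "dihedral_map GL sigma_mat tau_mat (2, 1) = mat2 0 1 1 0"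
  "dihedral_map GL sigma_mat tau_mat (3, 1) = mat2 (-1) 1 0 1"
  "dihedral_map GL sigma_mat tau_mat (4, 1) = mat2 (-1) 0 (-1) 1"
  "dihedral_map GL sigma_mat tau_mat (5, 1) = mat2 0 (-1) (-1) 0"
    by (simp_all add: dihedral_map_def sigma_pow q del: int_pow_0 int_pow_1)
qed

lemma carrier_dihedral_6: "carrier (dihedral_group 6) = {0, 1, 2, 3, 4, 5} \<times> {0, 1}"
  by (simp add: dihedral_group_def semidirect_def carrier_integer_mod_group int_interval_6)

lemma dihedral_map_sigma_tau_mon: "dihedral_map GL sigma_mat tau_mat \<in> mon (dihedral_group 6) GL"
proof -
  interpret group "GL :: (int ^ 2 ^ 2) monoid" by (rule group_GL)
  have "inv\<^bsub>GL\<^esub> sigma_mat = mat2 0 1 (-1) 1"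
    by (rule inv_equality) (use sigma_tau_GL in \<open>auto simp: mat2_eqs invertible_def intro: exI[of _ "mat2 1 (-1) 1 0"]\<close>)
  then have "tau_mat ** sigma_mat = inv\<^bsub>GL\<^esub> sigma_mat ** tau_mat" by (simp add: mat2_eqs)
  moreover have "tau_mat ** tau_mat = mat 1" by (simp add: mat2_eqs)
  ultimately have "dihedral_map GL sigma_mat tau_mat \<in> hom (dihedral_group 6) GL"
    using sigma_tau_GL sigma_pow by (intro dihedral_map_hom) simp_all
  moreover have "inj_on (dihedral_map GL sigma_mat tau_mat) (carrier (dihedral_group 6))"
    unfolding carrier_dihedral_6 by (auto simp: inj_on_def dihedral_map_sigma_tau)
  ultimately show ?thesis by (simp add: mon_def)
qed

lemma D_simps [simp]: "mult D_sigma_tau = (**)" "one D_sigma_tau = mat 1"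
  by (simp_all add: D_sigma_tau_def)

lemma group_D: "group D_sigma_tau"
  unfolding D_sigma_tau_def by (rule group.group_subgroup_generated[OF group_GL])

lemma dihedral_group_closed:
  "x \<in> carrier (dihedral_group 6) \<Longrightarrow> y \<in> carrier (dihedral_group 6) \<Longrightarrow> x \<otimes>\<^bsub>dihedral_group 6\<^esub> y \<in> carrier (dihedral_group 6)"
  by (cases x; cases y) (simp add: dihedral_group_def semidirect_def carrier_integer_mod_group)

text \<open>The image of a homomorphism is closed under products, and it contains the generators and
  their inverses: \<tau> is an involution and the inverse of \<sigma> is its fifth power.\<close>

lemma D_carrier_image: "carrier D_sigma_tau = dihedral_map GL sigma_mat tau_mat ` carrier (dihedral_group 6)"
proof -
  interpret group "GL :: (int ^ 2 ^ 2) monoid" by (rule group_GL)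
  let ?h = "dihedral_map GL sigma_mat tau_mat" and ?D = "carrier (dihedral_group 6)"
  have h: "?h \<in> hom (dihedral_group 6) GL" using dihedral_map_sigma_tau_mon by (simp add: mon_def)
  have mem: "M \<in> ?h ` ?D" if "?h x = M" "x \<in> ?D" for x M using that by blast
  have M: "mat 1 \<in> ?h ` ?D" "sigma_mat \<in> ?h ` ?D" "tau_mat \<in> ?h ` ?D" "mat2 0 1 (-1) 1 \<in> ?h ` ?D"
    using mem[OF dihedral_map_sigma_tau(1)] mem[OF dihedral_map_sigma_tau(2)]
      mem[OF dihedral_map_sigma_tau(7)] mem[OF dihedral_map_sigma_tau(6)]
    by (simp_all add: carrier_dihedral_6 mat2_eqs)
  have "M \<in> ?h ` ?D" if "M \<in> generate GL {sigma_mat, tau_mat}" for M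
    using that
  proof (induction rule: generate.induct)
    case one
    show ?case using M by simp
  next
    case (incl M)
    then show ?case using M by blast
  next
    case (inv M)
    have i: "inv\<^bsub>GL\<^esub> M = N" if "M \<in> carrier GL" "N \<in> carrier GL" "N ** M = mat 1" for N
      by (rule inv_equality) (use that in simp_all)
    consider "M = sigma_mat" | "M = tau_mat" using inv by blast
    then show ?case
    proof cases
      case 1
      have "mat2 0 1 (-1) 1 \<in> carrier GL"
        using int_pow_closed[OF sigma_tau_GL(1), of 5] by (simp only: sigma_pow)
      moreover have "mat2 0 1 (-1) 1 ** M = mat 1" using 1 by (simp add: mat2_eqs)
      ultimately have "inv\<^bsub>GL\<^esub> M = mat2 0 1 (-1) 1" using sigma_tau_GL 1 by (intro i) simp_all
      then show ?thesis using M by simp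
    next
      case 2
      then have "tau_mat ** M = mat 1" by (simp add: mat2_eqs)
      then have "inv\<^bsub>GL\<^esub> M = tau_mat" using sigma_tau_GL 2 by (intro i) simp_all
      then show ?thesis using M by simp
    qed
  next
    case (eng M N)
    then obtain x y where xy: "x \<in> ?D" "M = ?h x" "y \<in> ?D" "N = ?h y" by blast
    then have "M \<otimes>\<^bsub>GL\<^esub> N = ?h (x \<otimes>\<^bsub>dihedral_group 6\<^esub> y)" using Group.hom_mult[OF h xy(1,3)] by simp
    then show ?case using dihedral_group_closed xy by blast
  qed
  moreover have "?h x \<in> carrier D_sigma_tau" for x
  proof -
    interpret D: group D_sigma_tau by (rule group_D)
    have "sigma_mat \<in> carrier D_sigma_tau" "tau_mat \<in> carrier D_sigma_tau"
      using sigma_tau_GL by (simp_all add: D_sigma_tau_def carrier_subgroup_generated generate.incl del: GL_simps)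
    then have "sigma_mat [^]\<^bsub>D_sigma_tau\<^esub> fst x ** tau_mat [^]\<^bsub>D_sigma_tau\<^esub> snd x \<in> carrier D_sigma_tau"
      using D.m_closed[OF D.int_pow_closed D.int_pow_closed, of sigma_mat tau_mat "fst x" "snd x"] by simp
    then show ?thesis
      using \<open>sigma_mat \<in> carrier D_sigma_tau\<close> \<open>tau_mat \<in> carrier D_sigma_tau\<close>
      by (simp add: dihedral_map_def case_prod_beta D_sigma_tau_def int_pow_subgroup_generated)
  qed
  ultimately show ?thesis
    using sigma_tau_GL by (auto simp: D_sigma_tau_def carrier_subgroup_generated simp del: GL_simps)
qed

lemma D_carrier: "carrier D_sigma_tau =
  {mat2 1 0 0 1, mat2 1 (-1) 1 0, mat2 0 (-1) 1 (-1), mat2 (-1) 0 0 (-1), mat2 (-1) 1 (-1) 0, mat2 0 1 (-1) 1,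
   mat2 1 (-1) 0 (-1), mat2 1 0 1 (-1), mat2 0 1 1 0, mat2 (-1) 1 0 1, mat2 (-1) 0 (-1) 1, mat2 0 (-1) (-1) 0}"
proof -
  have p: "{0, 1, 2, 3, 4, 5} \<times> {0, 1} = {(0, 0), (1, 0), (2, 0), (3, 0), (4, 0), (5, 0),
      (0, 1), (1, 1), (2, 1), (3, 1), (4, 1), (5, 1 :: int)}"
    by auto
  show ?thesis
    unfolding D_carrier_image carrier_dihedral_6 p by (simp only: image_insert image_empty dihedral_map_sigma_tau)
qed

lemma D_sigma_tau_dihedral: "D_sigma_tau \<cong> dihedral_group 6" "card (carrier D_sigma_tau) = 12"
proof -
  note m = dihedral_map_sigma_tau_mon
  have "(\<lambda>M. M) \<in> mon D_sigma_tau GL"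
    using group.carrier_subgroup_generated_subset[OF group_GL, of "{sigma_mat, tau_mat}"]
    by (auto simp: mon_def hom_def D_sigma_tau_def)
  then show "D_sigma_tau \<cong> dihedral_group 6"
    by (rule is_isoI_image[OF _ m])
      (auto simp: D_carrier_image[symmetric] intro: monoid.m_closed[OF group.is_monoid[OF group_D], unfolded D_simps]
        dihedral_group_closed)
  have "card (carrier D_sigma_tau) = card (carrier (dihedral_group 6))"
    unfolding D_carrier_image by (rule card_image) (use m in \<open>simp add: mon_def\<close>)
  then show "card (carrier D_sigma_tau) = 12" by (simp add: carrier_dihedral_6 card_cartesian_product)
qed

section \<open>The Weyl group\<close>

text \<open>First B, then A, then the shift by v. With the shift applied last, composition follows
  the multiplication of \<open>semidirect\<close>; in return the upper right block of the matrix
  acquires the factor \<open>sign_char B\<close>.\<close>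

definition Weyl_map :: "(3 ^ 2) \<times> (3 ^ 2 ^ 2) \<times> (int ^ 2 ^ 2) \<Rightarrow> g4 \<Rightarrow> g4" where
  "Weyl_map = (\<lambda>(v, A, B) (g, h). (A *v g + weight (B *v h) *s v, B *v h))"

text \<open>On the dihedral group this is the character with value -1 at \<sigma> and 1 at \<tau>.
  It tells whether B permutes the degrees u_i or sends them to their negatives.\<close>

definition sign_char :: "int ^ 2 ^ 2 \<Rightarrow> 3" where
  "sign_char B = of_int (B $ 1 $ 1 + B $ 2 $ 1)"

lemma D_cases:
  assumes "B \<in> carrier D_sigma_tau"
  shows "sign_char B = 1 \<and> of_int (B $ 1 $ 2 + B $ 2 $ 2) = (1 :: 3) \<or>
    sign_char B = - 1 \<and> of_int (B $ 1 $ 2 + B $ 2 $ 2) = (- 1 :: 3)"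
  using assms unfolding D_carrier sign_char_def by (elim insertE) (auto simp: mod3_negatives)

lemma weight_D:
  assumes "B \<in> carrier D_sigma_tau"
  shows "weight (B *v h) = sign_char B * weight h" "sign_char B * sign_char B = 1"
proof -
  have "weight (B *v h) = of_int (B $ 1 $ 1 + B $ 2 $ 1) * of_int (h $ 1) + of_int (B $ 1 $ 2 + B $ 2 $ 2) * of_int (h $ 2)"
    by (simp add: weight_def matrix_vector_mult_2 algebra_simps)
  then show "weight (B *v h) = sign_char B * weight h"
    using D_cases[OF assms] by (elim disjE) (simp_all add: sign_char_def weight_def)
  show "sign_char B * sign_char B = 1" using D_cases[OF assms] by (elim disjE) simp_all
qed

lemma sign_char_mult:
  assumes "B \<in> carrier D_sigma_tau"
  shows "sign_char (B ** B') = sign_char B * sign_char B'"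
proof -
  have m: "sign_char (M ** N) = weight (M *v (N *v axis 1 1))" "sign_char M = weight (M *v axis 1 1)" for M N
    by (simp_all add: sign_char_def weight_def matrix_vector_mult_2 matrix_mult_nth sum_2 axis_def)
  show ?thesis unfolding m(1) weight_D(1)[OF assms] by (simp only: m(2)[of B'])
qed

lemma smult_matrix_vector: "A *v (k *s v) = k *s (A *v v)" "(A ** A') *v v = A *v (A' *v v)"
  for A :: "'b::comm_ring_1 ^ 2 ^ 2"
  by (simp_all add: vec2_eq_iff matrix_vector_mult_2 matrix_mult_nth sum_2 algebra_simps)

lemma Weyl_action_eq: "Weyl_action (A, B) v = sign_char B *s (A *v v)"
  by (simp add: Weyl_action_def sign_char_def)

lemma D_closed: "B \<in> carrier D_sigma_tau \<Longrightarrow> B' \<in> carrier D_sigma_tau \<Longrightarrow> B ** B' \<in> carrier D_sigma_tau"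
  using monoid.m_closed[OF group.is_monoid[OF group_D]] by simp

lemma Weyl_action_auto:
  assumes "invertible A" "B \<in> carrier D_sigma_tau"
  shows "Weyl_action (A, B) \<in> auto (additive_group :: (3 ^ 2) monoid)"
proof -
  have add: "Weyl_action (A, B) (v + w) = Weyl_action (A, B) v + Weyl_action (A, B) w" for v w
    by (simp add: Weyl_action_eq matrix_vector_add vector_add_ldistrib)
  obtain A' where A': "A ** A' = mat 1" "A' ** A = mat 1" using assms(1) by (auto simp: invertible_def)
  have "bij (Weyl_action (A, B))"
  proof (rule bij_betw_byWitness[where f' = "\<lambda>v. sign_char B *s (A' *v v)"])
    have "sign_char B *s (sign_char B *s v) = v" for v :: "3 ^ 2"
      using weight_D(2)[OF assms(2)] by (simp add: vector_smult_assoc)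
    moreover have "A *v (A' *v v) = v" "A' *v (A *v v) = v" for v
      using A' by (simp_all flip: smult_matrix_vector(2))
    ultimately show "\<forall>v\<in>UNIV. sign_char B *s (A' *v Weyl_action (A, B) v) = v"
      "\<forall>v\<in>UNIV. Weyl_action (A, B) (sign_char B *s (A' *v v)) = v"
      by (simp_all add: Weyl_action_eq smult_matrix_vector)
  qed auto
  then show ?thesis using add by (simp add: auto_def hom_def Bij_def)
qed

lemma Weyl_action_hom: "Weyl_action \<in> hom (GL \<times>\<times> D_sigma_tau) (AutoGroup (additive_group :: (3 ^ 2) monoid))"
proof (rule homI)
  fix x assume "x \<in> carrier ((GL :: (3 ^ 2 ^ 2) monoid) \<times>\<times> D_sigma_tau)"
  then obtain A B where x: "x = (A, B)" "invertible A" "B \<in> carrier D_sigma_tau" by (cases x) auto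
  note a = Weyl_action_auto[OF x(2,3)]
  then show "Weyl_action x \<in> carrier (AutoGroup (additive_group :: (3 ^ 2) monoid))"
    by (simp add: AutoGroup_def x(1))
  fix y assume "y \<in> carrier ((GL :: (3 ^ 2 ^ 2) monoid) \<times>\<times> D_sigma_tau)"
  then obtain A1 B1 where y: "y = (A1, B1)" "invertible A1" "B1 \<in> carrier D_sigma_tau" by (cases y) auto
  have "Weyl_action x \<otimes>\<^bsub>AutoGroup (additive_group :: (3 ^ 2) monoid)\<^esub> Weyl_action y = Weyl_action x \<circ> Weyl_action y"
    using a Weyl_action_auto[OF y(2,3)]
    by (simp add: x(1) y(1) AutoGroup_def BijGroup_def auto_def compose_def comp_def restrict_def)
  moreover have "Weyl_action (x \<otimes>\<^bsub>GL \<times>\<times> D_sigma_tau\<^esub> y) = Weyl_action x \<circ> Weyl_action y"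
    by (simp add: fun_eq_iff x(1) y(1) Weyl_action_eq smult_matrix_vector sign_char_mult[OF x(3)]
        vector_smult_assoc mult.commute)
  ultimately show "Weyl_action (x \<otimes>\<^bsub>GL \<times>\<times> D_sigma_tau\<^esub> y) =
      Weyl_action x \<otimes>\<^bsub>AutoGroup (additive_group :: (3 ^ 2) monoid)\<^esub> Weyl_action y"
    by simp
qed

text \<open>The inner shift v' is weighted by B' h, the shift of the composite by B B' h. The two
  weights differ by \<open>sign_char B\<close>, which squares to 1 and is therefore absorbed into
  \<open>Weyl_action\<close>.\<close>

lemma Weyl_map_compose:
  assumes "B \<in> carrier D_sigma_tau" "B' \<in> carrier D_sigma_tau"
  shows "Weyl_map (v, A, B) \<circ> Weyl_map (v', A', B') = Weyl_map (v + Weyl_action (A, B) v', A ** A', B ** B')"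
proof
  fix s :: g4
  obtain g h where s: "s = (g, h)" by (cases s)
  have "weight (B *v (B' *v h)) * sign_char B = sign_char B * sign_char B * weight (B' *v h)"
    by (simp only: weight_D(1)[OF assms(1), of "B' *v h"] mult_ac)
  then have "weight (B *v (B' *v h)) * sign_char B = weight (B' *v h)" by (simp only: weight_D(2)[OF assms(1)] mult_1)
  then show "(Weyl_map (v, A, B) \<circ> Weyl_map (v', A', B')) s = Weyl_map (v + Weyl_action (A, B) v', A ** A', B ** B') s"
    by (simp add: s Weyl_map_def Weyl_action_eq smult_matrix_vector matrix_vector_add vector_add_ldistrib vector_smult_assoc add_ac)
qed

lemma g4_matrix_Weyl_map:
  assumes "B \<in> carrier D_sigma_tau"
  shows "g4_matrix (Weyl_map (v, A, B)) =
    (A, vector [vector [sign_char B * v $ 1, sign_char B * v $ 1], vector [sign_char B * v $ 2, sign_char B * v $ 2]], 0, B)"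
proof -
  have "weight (axis j 1) = 1" for j :: 2 using exhaust_2[of j] by (auto simp: weight_def axis_def)
  then have "weight (B *v axis j 1) = sign_char B" for j by (simp add: weight_D(1)[OF assms])
  moreover have "(A *v axis j 1) $ i = A $ i $ j" "(B *v axis j 1) $ i = B $ i $ j" for i j
    using exhaust_2[of j] by (auto simp: matrix_vector_mult_2 axis_def)
  ultimately show ?thesis
    by (simp add: g4_matrix_def Weyl_map_def matrix_vector_zero vec_eq_iff forall_2)
qed

lemma Weyl_map_inj:
  assumes B: "B \<in> carrier D_sigma_tau" "B' \<in> carrier D_sigma_tau" and eq: "Weyl_map (v, A, B) = Weyl_map (v', A', B')"
  shows "(v, A, B) = (v', A', B')"
proof -
  have *: "g4_matrix (Weyl_map (v, A, B)) = g4_matrix (Weyl_map (v', A', B'))" by (simp add: eq)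
  then have AB: "A = A'" "B = B'"
    unfolding g4_matrix_Weyl_map[OF B(1)] g4_matrix_Weyl_map[OF B(2)] by simp_all
  from * have v: "sign_char B *s v = sign_char B *s v'"
    unfolding g4_matrix_Weyl_map[OF B(1)] g4_matrix_Weyl_map[OF B(2)] by (simp add: vec2_eq_iff AB)
  have "v = sign_char B *s (sign_char B *s v)" for v :: "3 ^ 2"
    using weight_D(2)[OF B(1)] by (simp add: vector_smult_assoc)
  then have "v = v'" using v by metis
  then show ?thesis using AB by simp
qed

section \<open>Automorphisms of G4 that preserve the support\<close>

lemma additive_mod3_matrix:
  fixes f :: "3 ^ 2 \<Rightarrow> 3 ^ 2"
  assumes add: "\<And>g h. f (g + h) = f g + f h"
  shows "f g = (\<chi> i j. f (axis j 1) $ i) *v g"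
proof -
  have "f 0 = 0" using add[of 0 0] by simp
  moreover have "f ((1 + 1) *s x) = (1 + 1) *s f x" for x
    using add[of x x] by (simp only: vector_sadd_rdistrib vector_smult_lid)
  ultimately have sc: "f (k *s x) = k *s f x" for k x
    using exhaust_mod3[of k] by (elim disjE) simp_all
  have "g = g $ 1 *s axis 1 1 + g $ 2 *s axis 2 1" by (simp add: vec2_eq_iff axis_def)
  then have "f g = g $ 1 *s f (axis 1 1) + g $ 2 *s f (axis 2 1)" by (metis add sc)
  then show ?thesis by (simp add: vec2_eq_iff matrix_vector_mult_2 mult.commute)
qed

lemma additive_mod3_invertible:
  fixes f :: "3 ^ 2 \<Rightarrow> 3 ^ 2"
  assumes add: "\<And>g h. f (g + h) = f g + f h" and inj: "inj f"
  shows "invertible (\<chi> i j. f (axis j 1) $ i)"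
proof -
  have surj: "surj f" by (rule finite_UNIV_inj_surj[OF _ inj]) simp
  have add': "inv_into UNIV f (g + h) = inv_into UNIV f g + inv_into UNIV f h" for g h
    by (rule injD[OF inj]) (simp add: add surj surj_f_inv_f)
  let ?A = "\<chi> i j. f (axis j 1) $ i" and ?A' = "\<chi> i j. inv_into UNIV f (axis j 1) $ i"
  have "?A ** ?A' = mat 1" "?A' ** ?A = mat 1"
    unfolding matrix_eq smult_matrix_vector additive_mod3_matrix[OF add, symmetric] additive_mod3_matrix[OF add', symmetric]
    using inj surj by (simp_all add: surj_f_inv_f)
  then show ?thesis unfolding invertible_def by blast
qed

lemma short_iff: "(\<exists>i. h = u_degree i \<or> h = - u_degree i) \<longleftrightarrow>
  (h $ 1, h $ 2) \<in> {(1, 0), (0, 1), (-1, -1), (-1, 0), (0, -1), (1, 1)}"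
proof -
  have "(\<exists>i. R i) \<longleftrightarrow> R 0 \<or> R 1 \<or> R (2 :: 3)" for R by (metis exhaust_mod3)
  then show ?thesis by (auto simp: u_degree_simps vec2_eq_iff)
qed

text \<open>The short roots form a hexagon. The sum of two of them is again short exactly when they
  enclose 120 degrees, and the twelve such ordered pairs are the columns of the twelve
  matrices.\<close>

lemma short_triple_D:
  assumes "\<exists>i. b1 = u_degree i \<or> b1 = - u_degree i" "\<exists>i. b2 = u_degree i \<or> b2 = - u_degree i"
    and "\<exists>i. - (b1 + b2) = u_degree i \<or> - (b1 + b2) = - u_degree i"
  shows "mat2 (b1 $ 1) (b2 $ 1) (b1 $ 2) (b2 $ 2) \<in> carrier D_sigma_tau"
  using assms(1,2) unfolding short_iff
  by (elim insertE emptyE; use assms(3)[unfolded short_iff] in \<open>simp add: D_carrier\<close>)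

text \<open>Two vertices of the hexagon at 120 degrees differ by a long root. Used to show that the
  image of a long root has no torsion part.\<close>

lemma short_difference_D:
  assumes "mat2 (b1 $ 1) (b2 $ 1) (b1 $ 2) (b2 $ 2) \<in> carrier D_sigma_tau"
  shows "b1 - b2 \<noteq> 0" "\<not> (\<exists>i. b1 - b2 = u_degree i \<or> b1 - b2 = - u_degree i)"
proof -
  show "\<not> (\<exists>i. b1 - b2 = u_degree i \<or> b1 - b2 = - u_degree i)"
    using assms unfolding short_iff D_carrier by (elim insertE emptyE) simp_all
  show "b1 - b2 \<noteq> 0"
    using assms unfolding D_carrier vec2_eq_iff by (elim insertE emptyE) simp_all
qed

lemma support_preserving_Weyl_map:
  assumes inj: "inj \<alpha>" and add: "\<And>s t. \<alpha> (s + t) = \<alpha> s + \<alpha> t" and supp: "\<And>s. s \<in> e6_support \<Longrightarrow> \<alpha> s \<in> e6_support"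
  obtains v A B where "invertible A" "B \<in> carrier D_sigma_tau" "\<alpha> = Weyl_map (v, A, B)"
proof -
  have z: "\<alpha> 0 = 0" using add[of 0 0] by simp
  have s0: "snd (\<alpha> (g, 0)) = 0" for g
  proof -
    have "(g, 0) + (g, 0) + (g, 0) = (0 :: g4)" by (simp add: zero_prod_def vec2_eq_iff mod3_simps)
    then have "\<alpha> (g, 0) + \<alpha> (g, 0) + \<alpha> (g, 0) = 0" using add z by metis
    then have "snd (\<alpha> (g, 0)) + snd (\<alpha> (g, 0)) + snd (\<alpha> (g, 0)) = 0" by (metis snd_add snd_zero)
    then show ?thesis by (simp add: vec2_eq_iff)
  qed
  define f where "f g = fst (\<alpha> (g, 0))" for g
  have \<alpha>f: "\<alpha> (g, 0) = (f g, 0)" for g using s0[of g] by (simp add: f_def prod_eq_iff)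
  have fadd: "f (g + h) = f g + f h" for g h using add[of "(g, 0)" "(h, 0)"] by (simp add: f_def)
  have finj: "inj f"
  proof (rule injI)
    fix g h assume "f g = f h"
    then have "\<alpha> (g, 0) = \<alpha> (h, 0)" by (simp add: \<alpha>f)
    then show "g = h" using injD[OF inj] by blast
  qed
  have fsurj: "surj f" by (rule finite_UNIV_inj_surj[OF _ finj]) simp
  define A where "A = (\<chi> i j. f (axis j 1) $ i)"
  have fA: "f g = A *v g" for g unfolding A_def by (rule additive_mod3_matrix[OF fadd])
  have A: "invertible A" unfolding A_def by (rule additive_mod3_invertible[OF fadd finj])
  define c where "c i = fst (\<alpha> (0, u_degree i))" for i
  define b where "b i = snd (\<alpha> (0, u_degree i))" for i
  have \<alpha>u: "\<alpha> (g, u_degree i) = (f g + c i, b i)" for g i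
    using add[of "(g, 0)" "(0, u_degree i)"] by (simp add: \<alpha>f c_def b_def prod_eq_iff)
  \<comment> \<open>b i is nonzero, since every torsion element is already the image of a torsion
    element. To exclude a long root, first alter (0, u_i) by torsion so that the image has a nonzero
    torsion part, which the support does not allow over long roots.\<close>
  have short: "\<exists>j. b i = u_degree j \<or> b i = - u_degree j" for i
  proof -
    obtain g where "f g = c i" using fsurj by (metis surjD)
    then have "\<alpha> (g, 0) \<noteq> \<alpha> (0, u_degree i)"
      using injD[OF inj, of "(g, 0)" "(0, u_degree i)"] u_degree_nonzero[of i] by auto
    then have "b i \<noteq> 0" using \<alpha>f[of g] \<open>f g = c i\<close> by (auto simp: c_def b_def prod_eq_iff)
    obtain k where "f k = axis 1 1 - c i" using fsurj by (metis surjD)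
    then have "\<alpha> (k, u_degree i) = (axis 1 1, b i)" by (simp add: \<alpha>u)
    then have "(axis 1 1, b i) \<in> e6_support" using supp[of "(k, u_degree i)"] by simp
    moreover have "axis 1 1 \<noteq> (0 :: 3 ^ 2)" by (simp add: vec2_eq_iff axis_def)
    ultimately show ?thesis using \<open>b i \<noteq> 0\<close> by (auto simp: e6_support_def)
  qed
  have "(0, u_degree 1) + (0, u_degree 2) + (0, u_degree 0) = (0 :: g4)"
    by (simp add: zero_prod_def u_degree_simps vec2_eq_iff)
  then have "\<alpha> (0, u_degree 1) + \<alpha> (0, u_degree 2) + \<alpha> (0, u_degree 0) = 0" using add z by metis
  then have "b 1 + b 2 + b 0 = 0" unfolding b_def by (metis snd_add snd_zero)
  then have b0: "b 0 = - (b 1 + b 2)" by (metis eq_neg_iff_add_eq_0 add.commute)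
  define B where "B = mat2 (b 1 $ 1) (b 2 $ 1) (b 1 $ 2) (b 2 $ 2)"
  have B: "B \<in> carrier D_sigma_tau" unfolding B_def by (rule short_triple_D[OF short short short[of 0, unfolded b0]])
  have Bu: "B *v u_degree 1 = b 1" "B *v u_degree 2 = b 2"
    by (simp_all add: B_def vec2_eq_iff matrix_vector_mult_2 u_degree_simps)
  have "(0, u_degree 1 - u_degree 2) + (0, u_degree 2) = (0 :: 3 ^ 2, u_degree 1)" by simp
  then have "\<alpha> (0, u_degree 1 - u_degree 2) = \<alpha> (0, u_degree 1) - \<alpha> (0, u_degree 2)" by (metis add eq_diff_eq)
  then have "\<alpha> (0, u_degree 1 - u_degree 2) = (c 1 - c 2, b 1 - b 2)" by (simp add: b_def c_def prod_eq_iff)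
  then have "(c 1 - c 2, b 1 - b 2) \<in> e6_support" using supp[of "(0, u_degree 1 - u_degree 2)"] by simp
  \<comment> \<open>c 1 - c 2 is the torsion part over b 1 - b 2, which is neither zero nor short;
    only the long part of the support is left, and there the torsion part is 0.\<close>
  then have cc: "c 1 = c 2" using short_difference_D[OF B[unfolded B_def]] by (auto simp: e6_support_def)
  have w: "weight (b 1) = sign_char B" "weight (b 2) = sign_char B"
    unfolding Bu[symmetric] by (simp_all add: weight_D(1)[OF B])
  \<comment> \<open>\<open>Weyl_map\<close> multiplies v by the weight of b 1, which is
    \<open>sign_char B\<close>; the sign is its own inverse, so this choice reproduces c 1.\<close>
  define v where "v = sign_char B *s c 1"
  have "\<alpha> s = Weyl_map (v, A, B) s" for s
  proof (rule G4_hom_eqI[OF group_G4, where \<phi> = \<alpha> and \<psi> = "Weyl_map (v, A, B)"])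
    show "\<alpha> \<in> hom G4 G4" by (rule homI) (simp_all add: add)
    show "Weyl_map (v, A, B) \<in> hom G4 G4"
      by (auto simp: hom_def Weyl_map_def matrix_vector_add vector_sadd_rdistrib)
    show "\<alpha> (g, 0) = Weyl_map (v, A, B) (g, 0)" for g
      by (simp add: \<alpha>f fA Weyl_map_def matrix_vector_zero)
    show "\<alpha> (0, u_degree 1) = Weyl_map (v, A, B) (0, u_degree 1)"
      "\<alpha> (0, u_degree 2) = Weyl_map (v, A, B) (0, u_degree 2)"
      using \<alpha>u[of 0 1] \<alpha>u[of 0 2]
      by (simp_all add: Weyl_map_def Bu w v_def weight_D(2)[OF B] cc fA matrix_vector_zero)
  qed
  then show thesis using that[OF A B] by blast
qed

text \<open>Every element is a power of \<sigma> or such a power times \<tau>, so it is reached from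
  1 or from \<tau> by left multiplications with \<sigma>.\<close>

lemma D_sigma_tau_induct:
  assumes B: "B \<in> carrier D_sigma_tau" and one: "R (mat 1)"
    and sigma: "\<And>M. R M \<Longrightarrow> R (sigma_mat ** M)" and tau: "R tau_mat"
  shows "R B"
proof -
  have p: "R (mat2 1 0 0 1)" "R (mat2 1 (-1) 0 (-1))" using one tau by (simp_all add: mat2_eqs)
  have s: "R (sigma_mat ** mat2 a b c d) \<longleftrightarrow> R (mat2 (a - c) (b - d) a b)" for a b c d
    by (simp add: mat2_eqs)
  note q = sigma[of "mat2 _ _ _ _", unfolded s]
  have 1: "R (mat2 1 (-1) 1 0)" "R (mat2 1 0 1 (-1))" using q[OF p(1)] q[OF p(2)] by simp_all
  have 2: "R (mat2 0 (-1) 1 (-1))" "R (mat2 0 1 1 0)" using q[OF 1(1)] q[OF 1(2)] by simp_all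
  have 3: "R (mat2 (-1) 0 0 (-1))" "R (mat2 (-1) 1 0 1)" using q[OF 2(1)] q[OF 2(2)] by simp_all
  have 4: "R (mat2 (-1) 1 (-1) 0)" "R (mat2 (-1) 0 (-1) 1)" using q[OF 3(1)] q[OF 3(2)] by simp_all
  have 5: "R (mat2 0 1 (-1) 1)" "R (mat2 0 (-1) (-1) 0)" using q[OF 4(1)] q[OF 4(2)] by simp_all
  show ?thesis using B p 1 2 3 4 5 unfolding D_carrier by blast
qed

section \<open>The Weyl group as a group of matrices and as a semidirect product\<close>

context cube_root
begin

lemma realized_compose: "\<alpha> \<in> realized \<Longrightarrow> \<beta> \<in> realized \<Longrightarrow> \<alpha> \<circ> \<beta> \<in> realized"
  unfolding realized_def by (rule e6.realized_compose)

lemma realized_D: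
  assumes "B \<in> carrier D_sigma_tau"
  shows "(\<lambda>(g, h). (g, B *v h)) \<in> realized"
  using assms
proof (rule D_sigma_tau_induct[where R = "\<lambda>B. (\<lambda>(g, h). (g, B *v h)) \<in> realized"])
  have "(\<lambda>(g, h). (mat 1 *v g, h)) \<in> realized" by (rule realized_A) (simp add: invertible_def)
  then show "(\<lambda>(g, h). (g, mat 1 *v h)) \<in> realized" by simp
  show "(\<lambda>(g, h). (g, (sigma_mat ** M) *v h)) \<in> realized" if "(\<lambda>(g, h). (g, M *v h)) \<in> realized" for M
    using realized_compose[OF realized_sigma that] by (simp add: comp_def case_prod_unfold smult_matrix_vector)
qed (rule realized_tau)

lemma realized_eq: "realized = Weyl_map ` (UNIV \<times> {A. invertible A} \<times> carrier D_sigma_tau)"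
proof (intro equalityI subsetI)
  fix \<alpha> assume "\<alpha> \<in> realized"
  then obtain f where f: "f \<in> algebra_automorphisms tits_algebra" "e6.induces f \<alpha>" by (auto simp: realized_def)
  have "inj \<alpha>" "\<And>s t. \<alpha> (s + t) = \<alpha> s + \<alpha> t"
    using f(2) unfolding e6.induces_def e6.auto_G4_iff by (blast intro: bij_is_inj)+
  moreover have "\<alpha> s \<in> e6_support" if "s \<in> e6_support" for s using e6.induces_support[OF f] that by blast
  ultimately obtain v A B where "invertible A" "B \<in> carrier D_sigma_tau" "\<alpha> = Weyl_map (v, A, B)"
    by (rule support_preserving_Weyl_map)
  then show "\<alpha> \<in> Weyl_map ` (UNIV \<times> {A. invertible A} \<times> carrier D_sigma_tau)" by blast
next
  fix \<alpha> assume "\<alpha> \<in> Weyl_map ` (UNIV \<times> {A. invertible A} \<times> carrier D_sigma_tau)"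
  then obtain v A B where x: "invertible A" "B \<in> carrier D_sigma_tau" "\<alpha> = Weyl_map (v, A, B)" by auto
  \<comment> \<open>The order of the factors is that built into \<open>Weyl_map\<close>: the shift
    sees the weight of h after B has acted.\<close>
  have "(\<lambda>(g, h). (g + weight h *s v, h)) \<circ> ((\<lambda>(g, h). (A *v g, h)) \<circ> (\<lambda>(g, h). (g, B *v h))) \<in> realized"
    using x by (intro realized_compose realized_translation realized_A realized_D)
  moreover have "(\<lambda>(g, h). (g + weight h *s v, h)) \<circ> ((\<lambda>(g, h). (A *v g, h)) \<circ> (\<lambda>(g, h). (g, B *v h))) = \<alpha>"
    by (auto simp: x(3) Weyl_map_def fun_eq_iff)
  ultimately show "\<alpha> \<in> realized" by simp
qed

lemma Weyl_map_mon:
  "Weyl_map \<in> mon (semidirect (additive_group :: (3 ^ 2) monoid) (GL \<times>\<times> D_sigma_tau) Weyl_action) (AutoGroup G4)"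
proof -
  let ?S = "semidirect (additive_group :: (3 ^ 2) monoid) (GL \<times>\<times> D_sigma_tau) Weyl_action"
  have au: "Weyl_map (v, A, B) \<in> auto G4" if "invertible A" "B \<in> carrier D_sigma_tau" for v A B
  proof -
    have "Weyl_map (v, A, B) \<in> realized" unfolding realized_eq using that by blast
    then show ?thesis by (auto simp: realized_def e6.induces_def)
  qed
  have "Weyl_map \<in> hom ?S (AutoGroup G4)"
  proof (rule homI)
    fix x y assume "x \<in> carrier ?S" "y \<in> carrier ?S"
    then obtain v A B v' A' B' where xy: "x = (v, A, B)" "y = (v', A', B')" "invertible A" "invertible A'"
      "B \<in> carrier D_sigma_tau" "B' \<in> carrier D_sigma_tau"
      by (cases x; cases y) (auto simp: semidirect_def)
    show "Weyl_map x \<in> carrier (AutoGroup G4)" using au xy by (simp add: AutoGroup_def)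
    have "Weyl_map x \<otimes>\<^bsub>AutoGroup G4\<^esub> Weyl_map y = Weyl_map x \<circ> Weyl_map y"
      using au[OF xy(3,5), of v] au[OF xy(4,6), of v'] xy
      by (simp add: AutoGroup_def BijGroup_def auto_def compose_def comp_def restrict_def)
    then show "Weyl_map (x \<otimes>\<^bsub>?S\<^esub> y) = Weyl_map x \<otimes>\<^bsub>AutoGroup G4\<^esub> Weyl_map y"
      using xy by (simp add: semidirect_def Weyl_map_compose)
  qed
  moreover have "inj_on Weyl_map (carrier ?S)"
    by (rule inj_onI) (auto simp: semidirect_def dest!: Weyl_map_inj[rotated 2])
  ultimately show ?thesis by (simp add: mon_def)
qed

lemma Weyl_group_semidirect:
  "Weyl_group tits_algebra G4 (\<Gamma>4 \<omega>) \<cong> semidirect (additive_group :: (3 ^ 2) monoid) (GL \<times>\<times> D_sigma_tau) Weyl_action"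
proof (rule is_isoI_image[OF e6.Weyl_embedding_mon Weyl_map_mon])
  show "Weyl_embedding G4 (\<Gamma>4 \<omega>) ` carrier (Weyl_group tits_algebra G4 (\<Gamma>4 \<omega>)) =
      Weyl_map ` carrier (semidirect additive_group (GL \<times>\<times> D_sigma_tau) Weyl_action)"
    unfolding e6.Weyl_embedding_image realized_def[symmetric] realized_eq by (simp add: semidirect_def)
  interpret group_hom "Aut_grading tits_algebra G4 (\<Gamma>4 \<omega>)" "AutoGroup G4" e6.induced
    by (rule e6.induced_group_hom)
  have g: "group (Weyl_group tits_algebra G4 (\<Gamma>4 \<omega>))"
    unfolding e6.Weyl_group_eq by (rule normal.factorgroup_is_group[OF normal_kernel])
  show "x \<otimes>\<^bsub>Weyl_group tits_algebra G4 (\<Gamma>4 \<omega>)\<^esub> y \<in> carrier (Weyl_group tits_algebra G4 (\<Gamma>4 \<omega>))"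
    if "x \<in> carrier (Weyl_group tits_algebra G4 (\<Gamma>4 \<omega>))" "y \<in> carrier (Weyl_group tits_algebra G4 (\<Gamma>4 \<omega>))" for x y
    by (rule monoid.m_closed[OF group.is_monoid[OF g] that])
qed (auto simp: semidirect_def D_closed invertible_mult)

lemma Weyl_matrices:
  "g4_matrix ` Weyl_embedding G4 (\<Gamma>4 \<omega>) ` carrier (Weyl_group tits_algebra G4 (\<Gamma>4 \<omega>)) =
    {(A, vector [vector [a, a], vector [b, b]], 0, B) | A B a b. A \<in> carrier GL \<and> B \<in> carrier D_sigma_tau}"
  (is "_ = ?M")
proof -
  have "g4_matrix ` realized = ?M"
  proof (intro equalityI subsetI)
    fix m assume "m \<in> g4_matrix ` realized"
    then obtain v A B where "invertible A" "B \<in> carrier D_sigma_tau" "m = g4_matrix (Weyl_map (v, A, B))"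
      unfolding realized_eq by blast
    then show "m \<in> ?M" by (auto simp: g4_matrix_Weyl_map)
  next
    fix m assume "m \<in> ?M"
    then obtain A B a b where m: "m = (A, vector [vector [a, a], vector [b, b]], 0, B)" "invertible A" "B \<in> carrier D_sigma_tau"
      by auto
    have "sign_char B * (sign_char B * x) = x" for x
      using weight_D(2)[OF m(3)] by (simp flip: mult.assoc)
    \<comment> \<open>Multiplying by \<open>sign_char B\<close> beforehand undoes the sign that
      \<open>g4_matrix_Weyl_map\<close> puts into the upper right block.\<close>
    then have "m = g4_matrix (Weyl_map (sign_char B *s vector [a, b], A, B))"
      by (simp add: g4_matrix_Weyl_map[OF m(3)] m(1))
    then show "m \<in> g4_matrix ` realized" unfolding realized_eq using m by blast
  qed
  then show ?thesis unfolding e6.Weyl_embedding_image realized_def .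
qed

end

theorem proposition5p4:
  fixes \<omega> :: "'a::{alg_closed_field, field_char_0}"
  assumes "\<omega> ^ 3 = 1" and "\<omega> \<noteq> 1"
  shows "fine_grading TYPE('h) tits_algebra G4 (\<Gamma>4 \<omega>)
    \<and> universal_group TYPE('h) tits_algebra G4 (\<Gamma>4 \<omega>)
    \<and> Weyl_embedding G4 (\<Gamma>4 \<omega>) \<in> mon (Weyl_group tits_algebra G4 (\<Gamma>4 \<omega>)) (AutoGroup G4)
    \<and> g4_matrix ` Weyl_embedding G4 (\<Gamma>4 \<omega>) ` carrier (Weyl_group tits_algebra G4 (\<Gamma>4 \<omega>))
        = {(A, vector [vector [a, a], vector [b, b]], 0, B) | A B a b.
             A \<in> carrier GL \<and> B \<in> carrier D_sigma_tau}
    \<and> sigma_mat \<in> carrier GL \<and> tau_mat \<in> carrier GL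
    \<and> D_sigma_tau \<cong> dihedral_group 6 \<and> card (carrier D_sigma_tau) = 12
    \<and> Weyl_action \<in> hom (GL \<times>\<times> D_sigma_tau) (AutoGroup (additive_group :: (3 ^ 2) monoid))
    \<and> Weyl_group tits_algebra G4 (\<Gamma>4 \<omega>)
        \<cong> semidirect (additive_group :: (3 ^ 2) monoid) (GL \<times>\<times> D_sigma_tau) Weyl_action"
proof -
  interpret cube_root \<omega> by (rule cube_root.intro) (fact assms)+
  show ?thesis
    by (intro conjI e6.fine e6.universal e6.Weyl_embedding_mon Weyl_matrices sigma_tau_GL D_sigma_tau_dihedral
        Weyl_action_hom Weyl_group_semidirect)
qed

end
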